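(* Assume $n r_n^d\to\lambda\in(0,\infty]$ as $n\to\infty$, and in the case $\lambda=\infty$ assume moreover that $f$ is lower bounded and $\mathrm{supp}(f)$ is convex. Let $1\le k\le d$. Then there exist constants $\sigma_k^2(\lambda)$ and $\widehat\sigma_k^2(\lambda)$ (depending only on $d,k,f,\lambda$) with $\sigma_k^2(\lambda)<\widehat\sigma_k^2(\lambda)<\infty$ such that \[ \lim_{n\to\infty}n^{-1}\mathrm{Var}\{N_{k,n}\}=\sigma_k^2(\lambda),\qquad \lim_{n\to\infty}n^{-1}\mathrm{Var}\{\widehat N_{k,n}\}=\widehat\sigma_k^2(\lambda). \]
   Context: Fix $d\ge1$. Let $f$ be a bounded probability density on $\mathbb{R}^d$. $f$ is called lower bounded if it has compact support and $\inf\{f(x):x\in\mathrm{supp}(f)\}>0$. For each $n$, $\mathcal{X}_n=\{X_1,\dots,X_n\}$ where $X_1,X_2,\dots$ are i.i.d. with density $f$, and $\mathcal{P}_n$ is a Poisson point process on $\mathbb{R}^d$ with intensity function $nf$. $(r_n)_{n\ge1}$ is a sequence of positive numbers with $r_n\to0$. For a finite set $\mathcal{P}\subset\mathbb{R}^d$ let $d_{\mathcal{P}}(x)=\min_{p\in\mathcal{P}}\|x-p\|$. For a set $\mathcal{Y}$ of $k+1$ affinely independent points of $\mathbb{R}^d$, let $\mathrm{conv}^\circ(\mathcal{Y})$ be the interior of the convex hull of $\mathcal{Y}$ (an open $k$-simplex). For $1\le k\le d$, a point $c\in\mathbb{R}^d$ is a critical point of index $k$ of $d_{\mathcal{P}}$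 if there is a subset $\mathcal{Y}\subset\mathcal{P}$ of $k+1$ affinely independent points with $\|c-y\|=d_{\mathcal{P}}(c)$ for all $y\in\mathcal{Y}$, $\|c-p\|>d_{\mathcal{P}}(c)$ for all $p\in\mathcal{P}\setminus\mathcal{Y}$, and $c\in\mathrm{conv}^\circ(\mathcal{Y})$. $N_{k,n}$ is the number of critical points $c$ of index $k$ of $d_{\mathcal{X}_n}$ with $d_{\mathcal{X}_n}(c)\le r_n$, and $\widehat N_{k,n}$ the same for $d_{\mathcal{P}_n}$. *)

theory Defs
  imports "HOL-Probability.Probability"
begin

definition dist_fun :: "'a::euclidean_space set \<Rightarrow> 'a \<Rightarrow> real" where
  "dist_fun P x = Min ((\<lambda>p. dist x p) ` P)"

definition critical_point :: "nat \<Rightarrow> 'a::euclidean_space set \<Rightarrow> 'a \<Rightarrow> bool" where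
  "critical_point k P c \<longleftrightarrow>
     (\<exists>Y. Y \<subseteq> P \<and> finite Y \<and> card Y = k + 1 \<and> \<not> affine_dependent Y \<and>
          (\<forall>y\<in>Y. dist c y = dist_fun P c) \<and>
          (\<forall>p\<in>P - Y. dist c p > dist_fun P c) \<and>
          c \<in> rel_interior (convex hull Y))"

definition crit_count :: "nat \<Rightarrow> real \<Rightarrow> 'a::euclidean_space set \<Rightarrow> nat" where
  "crit_count k r P = card {c. critical_point k P c \<and> dist_fun P c \<le> r}"

definition bounded_prob_density :: "('a::euclidean_space \<Rightarrow> real) \<Rightarrow> bool" where
  "bounded_prob_density f \<longleftrightarrow>
     f \<in> borel_measurable borel \<and> (\<forall>x. 0 \<le> f x) \<and> bdd_above (range f) \<and>
     integrable lborel f \<and> integral\<^sup>L lborel f = 1"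

definition supp :: "('a::euclidean_space \<Rightarrow> real) \<Rightarrow> 'a set" where
  "supp f = closure {x. f x \<noteq> 0}"

definition lower_bounded :: "('a::euclidean_space \<Rightarrow> real) \<Rightarrow> bool" where
  "lower_bounded f \<longleftrightarrow> compact (supp f) \<and> (INF x\<in>supp f. f x) > 0"

definition sample_law :: "('a::euclidean_space \<Rightarrow> real) \<Rightarrow> nat \<Rightarrow> (nat \<Rightarrow> 'a) measure" where
  "sample_law f n = PiM {..<n} (\<lambda>_. density lborel (\<lambda>x. ennreal (f x)))"

definition binom_expect :: "('a::euclidean_space \<Rightarrow> real) \<Rightarrow> nat \<Rightarrow> ('a set \<Rightarrow> real) \<Rightarrow> real" where
  "binom_expect f n h = (\<integral>x. h (x ` {..<n}) \<partial>sample_law f n)"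

definition binom_var :: "('a::euclidean_space \<Rightarrow> real) \<Rightarrow> nat \<Rightarrow> ('a set \<Rightarrow> real) \<Rightarrow> real" where
  "binom_var f n h = binom_expect f n (\<lambda>P. (h P - binom_expect f n h)\<^sup>2)"

text \<open>Expectation of a functional h of the Poisson process P_n with intensity n f
  (finite intensity measure): a Poisson(n) number m of i.i.d. points with density f.\<close>
definition pois_expect :: "('a::euclidean_space \<Rightarrow> real) \<Rightarrow> nat \<Rightarrow> ('a set \<Rightarrow> real) \<Rightarrow> real" where
  "pois_expect f n h = (\<Sum>m. (exp (- real n) * real n ^ m / fact m) * binom_expect f m h)"

definition pois_var :: "('a::euclidean_space \<Rightarrow> real) \<Rightarrow> nat \<Rightarrow> ('a set \<Rightarrow> real) \<Rightarrow> real" where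
  "pois_var f n h = pois_expect f n (\<lambda>P. (h P - pois_expect f n h)\<^sup>2)"

end

theory Submission
  imports Defs
begin

text \<open>A critical point of index \<open>k\<close> is the circumcentre of \<open>K = k + 1\<close> sample points that lies in the relative interior of
  their convex hull and whose closed circumball contains no further sample point. Second moments are therefore sums over \<open>j\<close>
  of explicit integrals over \<open>2K - j\<close> points, \<open>j\<close> being the number of points shared by two such \<open>K\<close>-sets, in which the
  emptiness condition contributes \<open>(1 - F)\<^sup>N\<close> or \<open>exp (- n F)\<close> with \<open>F\<close> the mass of the union of the two balls.
  After division by \<open>n\<close> and rescaling to the length scale \<open>s\<^sub>n\<close> of the balls, every integral over configurations whose balls touch
  converges by dominated convergence to the same limit in both models. Disjoint balls contribute nothing to the
  variance in the Poisson model and \<open>- \<alpha>\<^sup>2\<close> in the binomial one, where \<open>\<alpha>\<close> is the mean add-one cost; a dilation argument shows \<open>\<alpha> > 0\<close>.\<close>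

section \<open>Critical points as circumcentres\<close>

text \<open>Three obstacles shape the development. The density is only bounded and measurable, so
  \<open>f (x + s n *\<^sub>R z)\<close> may fail to converge at a given \<open>x\<close>;
  continuity of translations in the mean, with almost everywhere convergent subsequences, takes the
  place of pointwise continuity. Measurability of the count is not evident, because its definition
  quantifies over centres and vertex sets; well-centredness is shown to be an open condition by
  projecting a closed relation along a compact cube of coefficients. Finally, disjoint balls are not
  confined to the scale \<open>s n\<close>: in the binomial model the two terms of their covariance
  each grow like \<open>n\<close> after normalisation, and only their difference, smaller by a
  factor \<open>1 / n\<close>, has a limit. That difference is compared with its limit uniformly, up
  to an exponentially decaying error. Domination requires large balls to have large mass: for finite
  \<open>\<lambda>\<close> the radius never exceeds the scale, while for infinite
  \<open>\<lambda>\<close> the lower bound on \<open>f\<close> and the convexity of its support make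
  the mean number of points in a ball grow at least linearly in its rescaled radius.\<close>

definition centered :: "'a::euclidean_space set \<Rightarrow> 'a \<Rightarrow> bool" where
  "centered Y c \<longleftrightarrow> c \<in> rel_interior (convex hull Y) \<and> (\<forall>y\<in>Y. \<forall>y'\<in>Y. dist c y = dist c y')"

definition well_centered :: "'a::euclidean_space set \<Rightarrow> bool" where
  "well_centered Y \<longleftrightarrow> finite Y \<and> Y \<noteq> {} \<and> \<not> affine_dependent Y \<and> (\<exists>c. centered Y c)"

definition ccenter :: "'a::euclidean_space set \<Rightarrow> 'a" where
  "ccenter Y = (THE c. centered Y c)"

definition cradius :: "'a::euclidean_space set \<Rightarrow> real" where
  "cradius Y = (THE \<rho>. \<forall>y\<in>Y. dist (ccenter Y) y = \<rho>)"

text \<open>Subtracting the two families of squared-distance equations cancels the quadratic terms,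
  so the inner product with \<open>c - c'\<close> is constant on \<open>Y\<close>, hence on its
  affine hull. Both centres lie there, which leaves
  \<open>inner (c - c') (c - c') = 0\<close>.\<close>

lemma equidistant_unique:
  fixes Y :: "'a::euclidean_space set"
  assumes "c \<in> affine hull Y" "c' \<in> affine hull Y"
    and eq: "\<And>y y'. y \<in> Y \<Longrightarrow> y' \<in> Y \<Longrightarrow> dist c y = dist c y'"
    and eq': "\<And>y y'. y \<in> Y \<Longrightarrow> y' \<in> Y \<Longrightarrow> dist c' y = dist c' y'"
  shows "c = c'"
proof -
  obtain y0 where y0: "y0 \<in> Y"
    using assms(1) by (metis affine_hull_empty empty_iff equals0I)
  define d where "d = c - c'"
  have sq: "(dist a b)\<^sup>2 = inner a a - 2 * inner a b + inner b b" for a b :: 'a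
    by (simp add: dist_norm power2_norm_eq_inner inner_diff inner_commute)
  have "inner d y = inner d y0" if y: "y \<in> Y" for y
  proof -
    have "(dist c y)\<^sup>2 = (dist c y0)\<^sup>2" "(dist c' y)\<^sup>2 = (dist c' y0)\<^sup>2"
      using eq[OF y y0] eq'[OF y y0] by simp_all
    then show ?thesis
      unfolding sq d_def inner_diff_left by linarith
  qed
  then have "affine hull Y \<subseteq> {x. inner d x = inner d y0}"
    by (intro hull_minimal affine_hyperplane) auto
  then have "\<And>x. x \<in> affine hull Y \<Longrightarrow> inner d x = inner d y0"
    by blast
  then have "inner d c = inner d c'"
    using assms(1,2) by metis
  then have "inner d d = 0"
    by (simp add: d_def inner_diff)
  then show ?thesis by (simp add: d_def)
qed

lemma centered_affine_hull: "centered Y c \<Longrightarrow> c \<in> affine hull Y"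
  unfolding centered_def
  by (meson convex_hull_subset_affine_hull rel_interior_subset subsetD)

lemma centered_unique: "centered Y c \<Longrightarrow> centered Y c' \<Longrightarrow> c = c'"
  by (rule equidistant_unique[of c Y c'], simp_all add: centered_affine_hull, unfold centered_def, blast+)

lemma ccenter_eq: "centered Y c \<Longrightarrow> ccenter Y = c"
  unfolding ccenter_def by (blast intro: the_equality centered_unique)

lemma centered_ccenter: "well_centered Y \<Longrightarrow> centered Y (ccenter Y)"
  unfolding well_centered_def using ccenter_eq by metis

lemma cradius_eq:
  assumes "well_centered Y" "y \<in> Y"
  shows "dist (ccenter Y) y = cradius Y"
proof -
  have eq: "\<forall>y'\<in>Y. dist (ccenter Y) y' = dist (ccenter Y) y"
    using centered_ccenter[OF assms(1)] assms(2) unfolding centered_def by blast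
  have "cradius Y = dist (ccenter Y) y"
    unfolding cradius_def by (rule the_equality[where P="\<lambda>\<rho>. \<forall>y\<in>Y. dist (ccenter Y) y = \<rho>", OF eq]) (use assms(2) in auto)
  then show ?thesis by simp
qed

lemma ccenter_in_hull: "well_centered Y \<Longrightarrow> ccenter Y \<in> convex hull Y"
  using centered_ccenter rel_interior_subset unfolding centered_def by blast

lemma well_centered_nonempty: "well_centered Y \<Longrightarrow> Y \<noteq> {}"
  by (simp add: well_centered_def)

lemma cradius_nonneg: "well_centered Y \<Longrightarrow> 0 \<le> cradius Y"
  using cradius_eq well_centered_nonempty zero_le_dist by (metis ex_in_conv)

text \<open>At the centre of an admissible \<open>Y\<close> the distance function equals the radius,
  so \<open>Y\<close> is exactly the part of \<open>P\<close> in the closed circumball and can be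
  read off its centre. Hence \<open>ccenter\<close> is injective on admissible subsets, and counting
  centres amounts to counting subsets.\<close>

lemma crit_count_eq_card:
  fixes P :: "'a::euclidean_space set"
  assumes fin: "finite P"
  shows "crit_count k r P = card {Y. Y \<subseteq> P \<and> card Y = k + 1 \<and> well_centered Y \<and> cradius Y \<le> r \<and>
           (\<forall>p\<in>P - Y. cradius Y < dist (ccenter Y) p)}"
    (is "_ = card ?S")
proof -
  have df: "dist_fun P (ccenter Y) = cradius Y"
    if Y: "Y \<subseteq> P" "well_centered Y" "\<forall>p\<in>P - Y. cradius Y < dist (ccenter Y) p" for Y
  proof -
    obtain y where y: "y \<in> Y" using well_centered_nonempty[OF Y(2)] by auto
    show ?thesis unfolding dist_fun_def
    proof (rule Min_eqI)
      show "finite (dist (ccenter Y) ` P)" using fin by simp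
      show "cradius Y \<le> d" if d: "d \<in> dist (ccenter Y) ` P" for d
      proof -
        obtain p where p: "p \<in> P" "d = dist (ccenter Y) p" using d by (meson imageE)
        show ?thesis using p Y(3) cradius_eq[OF Y(2), of p] by (metis DiffI less_imp_le order_refl)
      qed
      show "cradius Y \<in> dist (ccenter Y) ` P"
        using cradius_eq[OF Y(2) y] y Y(1) by (metis imageI subsetD)
    qed
  qed
  have inj: "inj_on ccenter ?S"
  proof (rule inj_onI)
    fix Y Z assume Y: "Y \<in> ?S" and Z: "Z \<in> ?S" and eq: "ccenter Y = ccenter Z"
    have "dist_fun P (ccenter Y) = cradius Y" "dist_fun P (ccenter Z) = cradius Z"
      using df[of Y] df[of Z] Y Z by blast+
    then have r: "cradius Y = cradius Z" using eq by simp
    have *: "X = {p\<in>P. dist (ccenter X) p \<le> cradius X}" if X: "X \<in> ?S" for X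
    proof (intro equalityI subsetI)
      fix p assume "p \<in> X"
      then show "p \<in> {p\<in>P. dist (ccenter X) p \<le> cradius X}" using X cradius_eq[of X p] by auto
    next
      fix p assume "p \<in> {p\<in>P. dist (ccenter X) p \<le> cradius X}"
      then have p: "p \<in> P" "\<not> cradius X < dist (ccenter X) p" by auto
      have "\<forall>p\<in>P - X. cradius X < dist (ccenter X) p" using X by blast
      then show "p \<in> X" using p by blast
    qed
    have "Y = {p\<in>P. dist (ccenter Z) p \<le> cradius Z}"
      using *[OF Y] unfolding eq r .
    also have "\<dots> = Z" by (rule *[OF Z, symmetric])
    finally show "Y = Z" .
  qed
  have img: "ccenter ` ?S = {c. critical_point k P c \<and> dist_fun P c \<le> r}"
  proof (intro equalityI subsetI)
    fix c assume "c \<in> ccenter ` ?S"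
    then obtain Y where Y: "Y \<in> ?S" and c: "c = ccenter Y" by auto
    have d: "dist_fun P c = cradius Y" using df[of Y] Y c by blast
    have "critical_point k P c"
      unfolding critical_point_def
    proof (rule exI[of _ Y], intro conjI ballI)
      have w: "well_centered Y" using Y by blast
      then show "finite Y" "\<not> affine_dependent Y" by (auto simp: well_centered_def)
      show "Y \<subseteq> P" "card Y = k + 1" using Y by blast+
      show "dist c y = dist_fun P c" if "y \<in> Y" for y using cradius_eq[OF w that] d c by simp
      show "dist_fun P c < dist c p" if "p \<in> P - Y" for p using Y that d by (simp add: c)
      show "c \<in> rel_interior (convex hull Y)" using centered_ccenter[OF w] c by (simp add: centered_def)
    qed
    then show "c \<in> {c. critical_point k P c \<and> dist_fun P c \<le> r}" using d Y by simp
  next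
    fix c assume "c \<in> {c. critical_point k P c \<and> dist_fun P c \<le> r}"
    then obtain Y where Y: "Y \<subseteq> P" "finite Y" "card Y = k + 1" "\<not> affine_dependent Y"
      "\<forall>y\<in>Y. dist c y = dist_fun P c" "\<forall>p\<in>P - Y. dist c p > dist_fun P c"
      "c \<in> rel_interior (convex hull Y)" and r: "dist_fun P c \<le> r"
      unfolding critical_point_def by auto
    have ce: "centered Y c" using Y(5,7) by (simp add: centered_def)
    have "Y \<noteq> {}" using Y(3) by auto
    then have wc: "well_centered Y" using Y(2,4) ce unfolding well_centered_def by blast
    have c: "ccenter Y = c" using ccenter_eq ce by auto
    obtain y where "y \<in> Y" using wc well_centered_nonempty by blast
    then have "cradius Y = dist_fun P c" using cradius_eq[OF wc, of y] c Y by auto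
    then show "c \<in> ccenter ` ?S" using Y r wc c by (intro image_eqI[of _ _ Y]) auto
  qed
  show ?thesis
    unfolding crit_count_def img[symmetric] by (rule card_image[OF inj])
qed

section \<open>Centres and radii under translations and dilations\<close>

context
  fixes x :: "'a::euclidean_space" and s :: real
  assumes s: "s > 0"
begin

lemma centered_affinity:
  assumes "centered Y c"
  shows "centered ((\<lambda>y. x + s *\<^sub>R y) ` Y) (x + s *\<^sub>R c)"
proof -
  have img: "(\<lambda>y. x + s *\<^sub>R y) ` S = (\<lambda>y. x + y) ` ((*\<^sub>R) s ` S)" for S :: "'a set"
    by (simp add: image_image)
  have ri: "rel_interior ((\<lambda>y. x + s *\<^sub>R y) ` S) = (\<lambda>y. x + s *\<^sub>R y) ` rel_interior S" for S :: "'a set"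
    unfolding img rel_interior_translation using s by (subst rel_interior_scaleR) simp_all
  have d: "dist (x + s *\<^sub>R u) (x + s *\<^sub>R v) = s * dist u v" for u v :: 'a
    using s by (simp add: dist_norm scaleR_diff_right[symmetric])
  show ?thesis
    unfolding centered_def convex_hull_affinity ri
  proof (intro conjI ballI)
    show "x + s *\<^sub>R c \<in> (\<lambda>y. x + s *\<^sub>R y) ` rel_interior (convex hull Y)"
      using assms unfolding centered_def by blast
    fix u v assume "u \<in> (\<lambda>y. x + s *\<^sub>R y) ` Y" "v \<in> (\<lambda>y. x + s *\<^sub>R y) ` Y"
    then obtain u' v' where uv: "u' \<in> Y" "v' \<in> Y" "u = x + s *\<^sub>R u'" "v = x + s *\<^sub>R v'" by blast
    then have "dist c u' = dist c v'" using assms unfolding centered_def by blast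
    then show "dist (x + s *\<^sub>R c) u = dist (x + s *\<^sub>R c) v"
      unfolding uv(3,4) d by simp
  qed
qed

lemma well_centered_affine_image:
  assumes "well_centered Y"
  shows "well_centered ((\<lambda>y. x + s *\<^sub>R y) ` Y)"
proof -
  have "(\<lambda>y. x + s *\<^sub>R y) ` Y = (\<lambda>y. x + y) ` ((*\<^sub>R) s ` Y)"
    by (auto simp: image_image)
  moreover have "\<not> affine_dependent ((*\<^sub>R) s ` Y)"
  proof
    assume "affine_dependent ((*\<^sub>R) s ` Y)"
    then obtain v where v: "v \<in> Y" "s *\<^sub>R v \<in> affine hull ((*\<^sub>R) s ` Y - {s *\<^sub>R v})"
      unfolding affine_dependent_def by blast
    have "(*\<^sub>R) s ` Y - {s *\<^sub>R v} = (*\<^sub>R) s ` (Y - {v})" using s by auto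
    then have "s *\<^sub>R v \<in> (*\<^sub>R) s ` (affine hull (Y - {v}))"
      using v(2) affine_hull_linear_image[OF bounded_linear_scaleR_right, of s "Y - {v}"] by simp
    then have "v \<in> affine hull (Y - {v})" using s by auto
    then show False using assms v(1) unfolding well_centered_def affine_dependent_def by blast
  qed
  ultimately have "\<not> affine_dependent ((\<lambda>y. x + s *\<^sub>R y) ` Y)"
    using affine_dependent_translation_eq[of "(*\<^sub>R) s ` Y" x] by simp
  moreover obtain c where "centered Y c" using assms unfolding well_centered_def by blast
  then have "\<exists>c. centered ((\<lambda>y. x + s *\<^sub>R y) ` Y) c" using centered_affinity by blast
  ultimately show ?thesis
    using assms unfolding well_centered_def by simp
qed

end

text \<open>The inverse map has the same form, again with a positive factor, so one direction of
  \<open>well_centered_affinity\<close> yields the other.\<close>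

lemma affinity_inverse:
  fixes x :: "'a::euclidean_space"
  assumes "s > 0"
  shows "(\<lambda>y. - (x /\<^sub>R s) + inverse s *\<^sub>R y) ` ((\<lambda>y. x + s *\<^sub>R y) ` Y) = Y"
  using assms by (simp add: image_image scaleR_add_right)

lemma well_centered_affinity:
  assumes "s > 0"
  shows "well_centered ((\<lambda>y. x + s *\<^sub>R y) ` Y) \<longleftrightarrow> well_centered Y"
proof
  assume "well_centered ((\<lambda>y. x + s *\<^sub>R y) ` Y)"
  from well_centered_affine_image[OF _ this, of "inverse s" "- (x /\<^sub>R s)"]
  show "well_centered Y"
    unfolding affinity_inverse[OF assms] using assms by simp
qed (rule well_centered_affine_image[OF assms])

lemma ccenter_affinity:
  assumes "s > 0" "well_centered Y"
  shows "ccenter ((\<lambda>y. x + s *\<^sub>R y) ` Y) = x + s *\<^sub>R ccenter Y"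
  by (rule ccenter_eq[OF centered_affinity[OF assms(1) centered_ccenter[OF assms(2)]]])

lemma cradius_affinity:
  assumes "s > 0" "well_centered Y"
  shows "cradius ((\<lambda>y. x + s *\<^sub>R y) ` Y) = s * cradius Y"
proof -
  obtain y where y: "y \<in> Y" using well_centered_nonempty assms(2) by blast
  have "cradius ((\<lambda>y. x + s *\<^sub>R y) ` Y) = dist (x + s *\<^sub>R ccenter Y) (x + s *\<^sub>R y)"
    using cradius_eq[of "(\<lambda>y. x + s *\<^sub>R y) ` Y" "x + s *\<^sub>R y"] y assms
    by (simp add: well_centered_affinity ccenter_affinity)
  also have "\<dots> = s * dist (ccenter Y) y"
    using assms(1) by (simp add: dist_norm scaleR_diff_right[symmetric])
  finally show ?thesis using cradius_eq[OF assms(2) y] by simp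
qed

text \<open>With a vertex \<open>a\<close> moved to the origin, equidistance becomes the linear
  conditions \<open>inner p v = (norm v)\<^sup>2 / 2\<close> on the independent set
  \<open>B\<close>. A linear functional with these values is represented by a vector
  \<open>w\<close>, and projecting \<open>w\<close> to \<open>span B\<close> keeps the values while
  placing the centre in the affine hull.\<close>

lemma circumcenter_exists:
  fixes Y :: "'a::euclidean_space set"
  assumes "finite Y" "Y \<noteq> {}" "\<not> affine_dependent Y"
  obtains c where "c \<in> affine hull Y" "\<And>y y'. y \<in> Y \<Longrightarrow> y' \<in> Y \<Longrightarrow> dist c y = dist c y'"
proof -
  obtain a where a: "a \<in> Y" using assms by auto
  define B where "B = (\<lambda>x. - a + x) ` (Y - {a})"
  have "independent B"
    using assms(3) affine_dependent_iff_dependent2[OF a] by (simp add: B_def)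
  then obtain g :: "'a \<Rightarrow> real" where g: "linear g" "\<And>v. v \<in> B \<Longrightarrow> g v = (norm v)\<^sup>2 / 2"
    using linear_independent_extend[of B "\<lambda>v. (norm v)\<^sup>2 / 2"] by auto
  define w where "w = adjoint g 1"
  have w: "inner w v = g v" for v
    unfolding w_def using adjoint_works[OF g(1), of v 1] by (simp add: inner_commute)
  obtain p q where pq: "p \<in> span B" "\<And>v. v \<in> span B \<Longrightarrow> orthogonal q v" "w = p + q"
    using orthogonal_subspace_decomp_exists[of B w] by metis
  have pv: "inner p v = (norm v)\<^sup>2 / 2" if "v \<in> B" for v
  proof -
    have "inner q v = 0" using pq(2) that by (auto simp: orthogonal_def span_base)
    then show ?thesis using g(2)[OF that] w[of v] pq(3) by (simp add: inner_add_left)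
  qed
  have d: "dist (a + p) y = norm p" if y: "y \<in> Y" for y
  proof (cases "y = a")
    case False
    define v where "v = - a + y"
    have v: "v \<in> B" using y False by (auto simp: B_def v_def)
    have "(norm (p - v))\<^sup>2 = (norm p)\<^sup>2"
      using pv[OF v] by (simp add: power2_norm_eq_inner inner_diff inner_commute)
    then have "norm (p - v) = norm p" by simp
    moreover have "a + p - y = p - v" unfolding v_def by (simp add: algebra_simps)
    ultimately show ?thesis unfolding dist_norm by metis
  qed (simp add: dist_norm)
  have "affine hull Y = (+) a ` span B"
    using affine_hull_span2[OF a] by (simp add: B_def)
  then have "a + p \<in> affine hull Y" using pq(1) by blast
  then show ?thesis using that d by metis
qed

text \<open>The tube lemma: projecting along a compact factor preserves closedness. The compact
  factor will hold coefficients of affine combinations, so that the existence of suitable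
  coefficients becomes a closed condition on the vertices.\<close>

lemma closed_bex_compact:
  fixes C :: "('b::topological_space \<times> 'c::topological_space) set"
  assumes K: "compact K" and C: "closed C"
  shows "closed {x. \<exists>u\<in>K. (x, u) \<in> C}"
proof -
  have "open {x. \<forall>u\<in>K. (x, u) \<notin> C}"
  proof (subst open_subopen, safe)
    fix x assume x: "\<forall>u\<in>K. (x, u) \<notin> C"
    have "\<exists>A B. open A \<and> open B \<and> x \<in> A \<and> u \<in> B \<and> A \<times> B \<subseteq> - C" if "u \<in> K" for u
      using open_prod_elim[of "- C" "(x, u)"] C x that by (metis ComplI SigmaE2 mem_Sigma_iff open_Compl)
    then obtain A B where AB: "\<And>u. u \<in> K \<Longrightarrow> open (A u) \<and> open (B u) \<and> x \<in> A u \<and> u \<in> B u \<and> A u \<times> B u \<subseteq> - C"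
      by metis
    obtain F where F: "F \<subseteq> K" "finite F" "K \<subseteq> (\<Union>u\<in>F. B u)"
      using compactE_image[OF K, of K B] AB by blast
    show "\<exists>T. open T \<and> x \<in> T \<and> T \<subseteq> {x. \<forall>u\<in>K. (x, u) \<notin> C}"
    proof (intro exI conjI)
      show "open (\<Inter>u\<in>F. A u)" using F AB by (intro open_INT) auto
      show "x \<in> (\<Inter>u\<in>F. A u)" using F(1) AB by (auto dest: subsetD)
      show "(\<Inter>u\<in>F. A u) \<subseteq> {x. \<forall>u\<in>K. (x, u) \<notin> C}"
      proof safe
        fix y u assume y: "y \<in> (\<Inter>u\<in>F. A u)" and u: "u \<in> K" "(y, u) \<in> C"
        then obtain v where "v \<in> F" "u \<in> B v" using F(3) by blast
        then show False using y u AB[of v] F(1) by blast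
      qed
    qed
  qed
  then have "closed (- {x. \<forall>u\<in>K. (x, u) \<notin> C})" by (rule closed_Compl)
  then show ?thesis by (simp add: Compl_eq)
qed

lemma closed_Collect_bex_finite:
  assumes "finite I" "\<And>i. i \<in> I \<Longrightarrow> closed {x. P i x}"
  shows "closed {x. \<exists>i\<in>I. P i x}"
proof -
  have "{x. \<exists>i\<in>I. P i x} = (\<Union>i\<in>I. {x. P i x})" by auto
  then show ?thesis using assms by auto
qed

lemma closed_Collect_ball:
  assumes "\<And>i. i \<in> I \<Longrightarrow> closed {x. P i x}"
  shows "closed {x. \<forall>i\<in>I. P i x}"
proof -
  have "{x. \<forall>i\<in>I. P i x} = (\<Inter>i\<in>I. {x. P i x})" by auto
  then show ?thesis using assms by auto
qed

text \<open>Coefficients are taken as functions on all of \<open>nat\<close>, which makes this an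
  instance of Tychonoff's theorem.\<close>

lemma compact_cube: "compact (PiE UNIV (\<lambda>_::nat. {-1..1::real}))"
  using compactin_PiE[of "\<lambda>_::nat. euclidean :: real topology" UNIV "\<lambda>_. {-1..1}"]
  by (simp add: euclidean_product_topology)

section \<open>Well-centred simplices with labelled vertices\<close>

text \<open>Vertices carry labels because the integrals run over products indexed by
  \<open>nat\<close>. Injectivity is recorded separately, since the image set forgets
  multiplicities.\<close>

definition wc :: "nat set \<Rightarrow> (nat \<Rightarrow> 'a::euclidean_space) \<Rightarrow> bool" where
  "wc I z \<longleftrightarrow> inj_on z I \<and> well_centered (z ` I)"

text \<open>Coefficients attached to labels instead of points also detect coinciding vertices:
  \<open>z i = z j\<close> gives the relation with coefficients \<open>1\<close> and
  \<open>-1\<close>. Both ways of being degenerate thus become one algebraic condition.\<close>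

lemma affine_independent_index:
  fixes z :: "nat \<Rightarrow> 'a::euclidean_space"
  assumes fin: "finite I"
  shows "(inj_on z I \<and> \<not> affine_dependent (z ` I)) \<longleftrightarrow>
    \<not> (\<exists>u. sum u I = 0 \<and> (\<exists>i\<in>I. u i \<noteq> 0) \<and> (\<Sum>i\<in>I. u i *\<^sub>R z i) = 0)" (is "?L \<longleftrightarrow> \<not> ?R")
proof
  assume L: ?L
  show "\<not> ?R"
  proof
    assume ?R
    then obtain u i where u: "sum u I = 0" "i \<in> I" "u i \<noteq> 0" "(\<Sum>i\<in>I. u i *\<^sub>R z i) = 0" by auto
    define U where "U v = u (inv_into I z v)" for v
    have U: "U (z j) = u j" if "j \<in> I" for j
      using L that by (simp add: U_def)
    have "sum U (z ` I) = 0" "(\<Sum>v\<in>z ` I. U v *\<^sub>R v) = 0"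
      using L u by (simp_all add: sum.reindex U)
    moreover have "U (z i) \<noteq> 0" using U u by simp
    ultimately have "affine_dependent (z ` I)"
      using u(2) fin by (subst affine_dependent_explicit_finite) auto
    then show False using L by simp
  qed
next
  assume R: "\<not> ?R"
  have inj: "inj_on z I"
  proof (rule inj_onI, rule ccontr)
    fix i j assume ij: "i \<in> I" "j \<in> I" "z i = z j" "i \<noteq> j"
    define u :: "nat \<Rightarrow> real" where "u l = (if l = i then 1 else 0) - (if l = j then 1 else 0)" for l
    have "sum u I = 0" using ij fin by (simp add: u_def sum_subtractf)
    moreover have "(\<Sum>l\<in>I. u l *\<^sub>R z l) = 0"
    proof -
      have "(\<Sum>l\<in>I. u l *\<^sub>R z l) = (\<Sum>l\<in>I. (if l = i then z l else 0)) - (\<Sum>l\<in>I. (if l = j then z l else 0))"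
        unfolding sum_subtractf[symmetric] by (rule sum.cong) (auto simp: u_def)
      then show ?thesis using ij fin by simp
    qed
    moreover have "u i \<noteq> 0" using ij by (simp add: u_def)
    ultimately show False using R ij(1) by blast
  qed
  moreover have "\<not> affine_dependent (z ` I)"
  proof
    assume "affine_dependent (z ` I)"
    then obtain U where U: "sum U (z ` I) = 0" "\<exists>v\<in>z ` I. U v \<noteq> 0" "(\<Sum>v\<in>z ` I. U v *\<^sub>R v) = 0"
      using fin by (subst (asm) affine_dependent_explicit_finite) auto
    have "sum (U \<circ> z) I = 0" "(\<Sum>i\<in>I. (U \<circ> z) i *\<^sub>R z i) = 0" "\<exists>i\<in>I. (U \<circ> z) i \<noteq> 0"
      using U inj by (simp_all add: sum.reindex)
    then show False using R by blast
  qed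
  ultimately show ?L by simp
qed

lemma dist_eq_iff_inner:
  fixes c :: "'a::euclidean_space"
  shows "dist c x = dist c y \<longleftrightarrow> inner c (x - y) = ((norm x)\<^sup>2 - (norm y)\<^sup>2) / 2"
proof -
  have "dist c x = dist c y \<longleftrightarrow> (dist c x)\<^sup>2 = (dist c y)\<^sup>2"
    by (simp add: power2_eq_iff_nonneg)
  also have "\<dots> \<longleftrightarrow> inner c (x - y) = ((norm x)\<^sup>2 - (norm y)\<^sup>2) / 2"
    by (simp add: dist_norm power2_norm_eq_inner inner_diff inner_commute) linarith
  finally show ?thesis .
qed

lemma wc_coefficients:
  fixes z :: "nat \<Rightarrow> 'a::euclidean_space"
  assumes wc: "wc I z" and fin: "finite I"
  obtains t where "\<And>i. i \<in> I \<Longrightarrow> t i > 0" "sum t I = 1" "(\<Sum>i\<in>I. t i *\<^sub>R z i) = ccenter (z ` I)"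
proof -
  have inj: "inj_on z I" and w: "well_centered (z ` I)" using wc by (auto simp: wc_def)
  have "ccenter (z ` I) \<in> rel_interior (convex hull (z ` I))"
    using centered_ccenter[OF w] by (simp add: centered_def)
  then obtain u where u: "\<forall>x\<in>z ` I. 0 < u x" "sum u (z ` I) = 1" "(\<Sum>x\<in>z ` I. u x *\<^sub>R x) = ccenter (z ` I)"
    using w by (subst (asm) rel_interior_convex_hull_explicit) (auto simp: well_centered_def)
  show ?thesis
    by (rule that[of "u \<circ> z"]) (use u inj in \<open>simp_all add: sum.reindex\<close>)
qed

lemma affine_combination_in_hull:
  fixes z :: "nat \<Rightarrow> 'a::euclidean_space"
  assumes "finite I" "inj_on z I" "sum t I = 1"
  shows "(\<Sum>i\<in>I. t i *\<^sub>R z i) \<in> affine hull (z ` I)"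
proof -
  define u where "u v = t (inv_into I z v)" for v
  have "u (z i) = t i" if "i \<in> I" for i using assms(2) that by (simp add: u_def)
  then have "sum u (z ` I) = 1 \<and> (\<Sum>v\<in>z ` I. u v *\<^sub>R v) = (\<Sum>i\<in>I. t i *\<^sub>R z i)"
    using assms by (simp add: sum.reindex)
  then show ?thesis using assms(1) by (subst affine_hull_finite) auto
qed

text \<open>The coefficients \<open>u\<close> are homogeneous barycentric coordinates of a candidate
  circumcentre. Positive \<open>sum u I\<close> with some \<open>u i \<le> 0\<close> describes a
  centre outside the relative interior, and \<open>sum u I = 0\<close> describes affine dependence,
  so every kind of failure satisfies one and the same closed relation. Scaling to
  \<open>\<bar>u i\<bar> = 1\<close> for some \<open>i\<close> excludes \<open>u = 0\<close> and
  makes the range of \<open>u\<close> compact.\<close>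

lemma not_wc_iff:
  fixes z :: "nat \<Rightarrow> 'a::euclidean_space"
  assumes fin: "finite I" and ne: "I \<noteq> {}"
  shows "\<not> wc I z \<longleftrightarrow> (\<exists>u\<in>PiE UNIV (\<lambda>_. {-1..1}). (\<exists>i\<in>I. \<bar>u i\<bar> = 1) \<and> 0 \<le> sum u I \<and> (\<exists>i\<in>I. u i \<le> 0) \<and>
     (\<forall>i\<in>I. \<forall>j\<in>I. inner (\<Sum>l\<in>I. u l *\<^sub>R z l) (z i - z j) = sum u I * (((norm (z i))\<^sup>2 - (norm (z j))\<^sup>2) / 2)))"
    (is "?L \<longleftrightarrow> ?R")
proof -
  define Q where "Q u \<longleftrightarrow> 0 \<le> sum u I \<and> (\<exists>i\<in>I. u i \<le> 0) \<and>
     (\<forall>i\<in>I. \<forall>j\<in>I. inner (\<Sum>l\<in>I. u l *\<^sub>R z l) (z i - z j) = sum u I * (((norm (z i))\<^sup>2 - (norm (z j))\<^sup>2) / 2))" for u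
  have R: "?R \<longleftrightarrow> (\<exists>u\<in>PiE UNIV (\<lambda>_. {-1..1}). (\<exists>i\<in>I. \<bar>u i\<bar> = 1) \<and> Q u)"
    unfolding Q_def by simp
  \<comment> \<open>\<open>Q\<close> is invariant under positive scaling, so a nonzero witness may
    be divided by its largest absolute value; setting it to 0 outside \<open>I\<close> puts it into
    the cube.\<close>
  have norm: ?R if Qu: "Q u" and i: "\<exists>i\<in>I. u i \<noteq> 0" for u
  proof -
    define m where "m = Max ((\<lambda>i. \<bar>u i\<bar>) ` I)"
    have le: "\<bar>u i\<bar> \<le> m" if "i \<in> I" for i unfolding m_def using fin that by simp
    have m: "m > 0" using i le by (metis abs_le_zero_iff linorder_not_le order.trans)
    have "m \<in> (\<lambda>i. \<bar>u i\<bar>) ` I" unfolding m_def using fin ne by (intro Max_in) auto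
    then obtain i0 where i0: "i0 \<in> I" "\<bar>u i0\<bar> = m" by auto
    define v where "v l = (if l \<in> I then u l / m else 0)" for l
    have sv: "sum v I = sum u I / m" by (simp add: v_def sum_divide_distrib)
    have sz: "(\<Sum>l\<in>I. v l *\<^sub>R z l) = (1 / m) *\<^sub>R (\<Sum>l\<in>I. u l *\<^sub>R z l)"
      by (simp add: v_def scaleR_sum_right)
    have "\<exists>i\<in>I. v i \<le> 0" using Qu m by (auto simp: Q_def v_def divide_le_0_iff)
    then have "Q v"
      using Qu m unfolding Q_def sv sz by (auto simp: field_simps)
    moreover have "v \<in> PiE UNIV (\<lambda>_. {-1..1})"
    proof -
      have "\<bar>v i\<bar> \<le> 1" for i using le[of i] m by (auto simp: v_def)
      then show ?thesis by (auto simp: abs_le_iff minus_le_iff)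
    qed
    moreover have "\<bar>v i0\<bar> = 1" using i0 m by (simp add: v_def)
    ultimately show ?R unfolding R using i0 by blast
  qed
  show ?thesis
  proof
    assume nw: ?L
    show ?R
    proof (cases "inj_on z I \<and> \<not> affine_dependent (z ` I)")
      case False
      then obtain u where u: "sum u I = 0" "\<exists>i\<in>I. u i \<noteq> 0" "(\<Sum>i\<in>I. u i *\<^sub>R z i) = 0"
        using affine_independent_index[OF fin, of z] by auto
      have "\<exists>i\<in>I. u i \<le> 0"
        using sum_pos[of I u] fin ne u(1) by force
      then have "Q u" using u by (simp add: Q_def)
      then show ?thesis using norm u(2) by blast
    next
      case True
      obtain c where c: "c \<in> affine hull (z ` I)" "\<And>y y'. y \<in> z ` I \<Longrightarrow> y' \<in> z ` I \<Longrightarrow> dist c y = dist c y'"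
        using circumcenter_exists[of "z ` I"] fin ne True by (metis finite_imageI image_is_empty)
      obtain U where U: "sum U (z ` I) = 1" "(\<Sum>v\<in>z ` I. U v *\<^sub>R v) = c"
        using c(1) fin by (subst (asm) affine_hull_finite) auto
      have "\<exists>i\<in>I. U (z i) \<le> 0"
      proof (rule ccontr)
        assume "\<not> ?thesis"
        then have "c \<in> rel_interior (convex hull (z ` I))"
          using True U by (simp add: rel_interior_convex_hull_explicit) (metis not_le)
        then have "centered (z ` I) c" using c(2) unfolding centered_def by blast
        then have "well_centered (z ` I)" using True fin ne unfolding well_centered_def by blast
        then show False using nw True by (simp add: wc_def)
      qed
      moreover have "sum (U \<circ> z) I = 1" "(\<Sum>i\<in>I. (U \<circ> z) i *\<^sub>R z i) = c"
        using U True by (simp_all add: sum.reindex)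
      moreover have "inner c (z i - z j) = ((norm (z i))\<^sup>2 - (norm (z j))\<^sup>2) / 2" if "i \<in> I" "j \<in> I" for i j
        using c(2)[of "z i" "z j"] that by (simp add: dist_eq_iff_inner)
      ultimately have "Q (U \<circ> z)" by (auto simp: Q_def)
      moreover have "\<exists>i\<in>I. (U \<circ> z) i \<noteq> 0"
        using \<open>sum (U \<circ> z) I = 1\<close> by (metis sum.neutral zero_neq_one)
      ultimately show ?thesis using norm by blast
    qed
  next
    assume ?R
    then obtain u where u: "\<exists>i\<in>I. \<bar>u i\<bar> = 1" "Q u" unfolding R by auto
    define v where "v = (\<Sum>l\<in>I. u l *\<^sub>R z l)"
    have Qv: "inner v (z i - z j) = sum u I * (((norm (z i))\<^sup>2 - (norm (z j))\<^sup>2) / 2)" if "i \<in> I" "j \<in> I" for i j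
      using u(2) that by (auto simp: Q_def v_def)
    have u0: "\<exists>i\<in>I. u i \<noteq> 0" using u(1) by force
    show ?L
    proof
      assume w: "wc I z"
      then have ind: "inj_on z I \<and> \<not> affine_dependent (z ` I)" by (auto simp: wc_def well_centered_def)
      show False
      proof (cases "sum u I = 0")
        case True
        obtain i0 where i0: "i0 \<in> I" using ne by auto
        \<comment> \<open>Since the coefficients sum to 0 and \<open>v\<close> is orthogonal to all
          differences of vertices, \<open>v\<close> is orthogonal to itself. Then \<open>u\<close>
          is a nontrivial affine relation, against independence.\<close>
        have "inner v v = (\<Sum>l\<in>I. u l * inner v (z l))"
          unfolding v_def inner_sum_right inner_scaleR_right ..
        also have "\<dots> = (\<Sum>l\<in>I. u l * inner v (z i0))"
          using Qv[OF _ i0] True by (intro sum.cong) (auto simp: inner_diff_right)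
        also have "\<dots> = 0" using True by (simp add: sum_distrib_right[symmetric])
        finally have "v = 0" by simp
        then show False using affine_independent_index[OF fin, of z] ind True u0 by (auto simp: v_def)
      next
        case False
        then have s: "sum u I > 0" using u(2) by (auto simp: Q_def)
        define c where "c = (1 / sum u I) *\<^sub>R v"
        have c: "c = (\<Sum>i\<in>I. (u i / sum u I) *\<^sub>R z i)"
          by (simp add: c_def v_def scaleR_sum_right)
        have st: "(\<Sum>i\<in>I. u i / sum u I) = 1" using s by (simp add: sum_divide_distrib[symmetric])
        have "c \<in> affine hull (z ` I)" unfolding c using ind by (intro affine_combination_in_hull[OF fin _ st]) blast
        moreover have "dist c (z i) = dist c (z j)" if "i \<in> I" "j \<in> I" for i j
          unfolding dist_eq_iff_inner c_def using Qv[OF that] s by simp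
        moreover have cw: "centered (z ` I) (ccenter (z ` I))" using centered_ccenter w by (auto simp: wc_def)
        ultimately have "c = ccenter (z ` I)"
        proof (intro equidistant_unique[of c "z ` I"])
          show "ccenter (z ` I) \<in> affine hull z ` I" by (rule centered_affine_hull[OF cw])
          show "dist (ccenter (z ` I)) y = dist (ccenter (z ` I)) y'" if "y \<in> z ` I" "y' \<in> z ` I" for y y'
            using that cw unfolding centered_def by blast
        qed blast+
        moreover obtain t where t: "\<And>i. i \<in> I \<Longrightarrow> t i > 0" "sum t I = 1" "(\<Sum>i\<in>I. t i *\<^sub>R z i) = ccenter (z ` I)"
          using wc_coefficients[OF w fin] by metis
        ultimately have "(\<Sum>i\<in>I. (u i / sum u I - t i) *\<^sub>R z i) = 0" "(\<Sum>i\<in>I. (u i / sum u I - t i)) = 0"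
          using c st by (simp_all add: scaleR_diff_left sum_subtractf)
        then have "\<forall>i\<in>I. u i / sum u I - t i = 0"
          using affine_independent_index[OF fin, of z] ind by blast
        moreover obtain i where "i \<in> I" "u i \<le> 0" using u(2) by (auto simp: Q_def)
        ultimately have "t i \<le> 0" using s by (metis divide_nonpos_pos eq_iff_diff_eq_0)
        then show False using t(1)[OF \<open>i \<in> I\<close>] by simp
      qed
    qed
  qed
qed

text \<open>By \<open>not_wc_iff\<close> the complement is the projection of a closed set along the
  compact cube. Openness gives Borel measurability here and, near the end, a neighbourhood of
  admissible shapes of positive volume.\<close>

lemma open_wc:
  assumes fin: "finite I" and ne: "I \<noteq> {}"
  shows "open {z :: nat \<Rightarrow> 'a::euclidean_space. wc I z}"
proof -
  let ?C = "{p :: (nat \<Rightarrow> 'a) \<times> (nat \<Rightarrow> real). (\<exists>i\<in>I. \<bar>snd p i\<bar> = 1) \<and> 0 \<le> sum (snd p) I \<and> (\<exists>i\<in>I. snd p i \<le> 0) \<and>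
     (\<forall>i\<in>I. \<forall>j\<in>I. inner (\<Sum>l\<in>I. snd p l *\<^sub>R fst p l) (fst p i - fst p j) =
        sum (snd p) I * (((norm (fst p i))\<^sup>2 - (norm (fst p j))\<^sup>2) / 2))}"
  have "closed ?C"
    by (intro closed_Collect_conj closed_Collect_bex_finite closed_Collect_ball closed_Collect_eq
        closed_Collect_le fin continuous_intros continuous_on_product_then_coordinatewise[OF continuous_on_snd]
        continuous_on_product_then_coordinatewise[OF continuous_on_fst]) auto
  from closed_bex_compact[OF compact_cube this]
  have "closed {z :: nat \<Rightarrow> 'a. \<not> wc I z}"
    unfolding not_wc_iff[OF fin ne] by simp
  then show ?thesis by (simp add: closed_def Compl_eq)
qed

text \<open>The junk value 0 makes centre and radius Borel functions on the whole product space.\<close>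
definition cc :: "nat set \<Rightarrow> (nat \<Rightarrow> 'a::euclidean_space) \<Rightarrow> 'a" where
  "cc I z = (if wc I z then ccenter (z ` I) else 0)"

definition cr :: "nat set \<Rightarrow> (nat \<Rightarrow> 'a::euclidean_space) \<Rightarrow> real" where
  "cr I z = (if wc I z then cradius (z ` I) else 0)"

lemma dist_cc: "wc I z \<Longrightarrow> i \<in> I \<Longrightarrow> dist (cc I z) (z i) = cr I z"
  by (simp add: cc_def cr_def cradius_eq wc_def)

lemma cr_nonneg: "0 \<le> cr I z"
  by (simp add: cr_def cradius_nonneg wc_def)

text \<open>On \<open>wc\<close> the centre is the only equidistant point of the affine hull, so it
  lies in a closed \<open>T\<close> exactly if some nonnegative coefficients in the cube produce an
  equidistant point in \<open>T\<close>. This is again a projection of a closed set along a compact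
  one.\<close>

lemma borel_measurable_cc:
  assumes fin: "finite I" and ne: "I \<noteq> {}"
  shows "cc I \<in> borel_measurable (borel :: (nat \<Rightarrow> 'a::euclidean_space) measure)"
proof -
  have wcm: "{z :: nat \<Rightarrow> 'a. wc I z} \<in> sets borel" by (rule borel_open[OF open_wc[OF assms]])
  have cl: "{z. wc I z \<and> cc I z \<in> T} \<in> sets borel" if T: "closed T" for T :: "'a set"
  proof -
    let ?C = "{p :: (nat \<Rightarrow> 'a) \<times> (nat \<Rightarrow> real). (\<forall>i\<in>I. snd p i \<ge> 0) \<and> sum (snd p) I = 1 \<and>
       (\<forall>i\<in>I. \<forall>j\<in>I. dist (\<Sum>l\<in>I. snd p l *\<^sub>R fst p l) (fst p i) = dist (\<Sum>l\<in>I. snd p l *\<^sub>R fst p l) (fst p j)) \<and>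
       (\<Sum>l\<in>I. snd p l *\<^sub>R fst p l) \<in> T}"
    have cont: "continuous_on UNIV (\<lambda>p :: (nat \<Rightarrow> 'a) \<times> (nat \<Rightarrow> real). (\<Sum>l\<in>I. snd p l *\<^sub>R fst p l))"
      by (intro continuous_intros continuous_on_product_then_coordinatewise[OF continuous_on_snd]
        continuous_on_product_then_coordinatewise[OF continuous_on_fst])
    have "closed {p :: (nat \<Rightarrow> 'a) \<times> (nat \<Rightarrow> real). (\<Sum>l\<in>I. snd p l *\<^sub>R fst p l) \<in> T}"
      using closed_vimage[OF T cont] by (simp add: vimage_def)
    then have "closed ?C"
      by (intro closed_Collect_conj closed_Collect_ball closed_Collect_eq
        closed_Collect_le fin continuous_intros continuous_on_product_then_coordinatewise[OF continuous_on_snd]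
        continuous_on_product_then_coordinatewise[OF continuous_on_fst])
    from closed_bex_compact[OF compact_cube this]
    have clo: "closed {z :: nat \<Rightarrow> 'a. \<exists>u\<in>PiE UNIV (\<lambda>_. {-1..1}). (z, u) \<in> ?C}" .
    have "cc I z \<in> T \<longleftrightarrow> (\<exists>u\<in>PiE UNIV (\<lambda>_. {-1..1}). (z, u) \<in> ?C)" if w: "wc I z" for z
    proof
      assume cT: "cc I z \<in> T"
      obtain t where t: "\<And>i. i \<in> I \<Longrightarrow> t i > 0" "sum t I = 1" "(\<Sum>i\<in>I. t i *\<^sub>R z i) = ccenter (z ` I)"
        using wc_coefficients[OF w fin] by metis
      define u where "u i = (if i \<in> I then t i else 0)" for i
      have us: "sum u I = 1" "(\<Sum>i\<in>I. u i *\<^sub>R z i) = cc I z"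
        using t w by (simp_all add: u_def cc_def)
      have "u i \<in> {-1..1}" for i
      proof (cases "i \<in> I")
        case True
        then have "t i \<le> sum t I" using fin t(1) by (intro member_le_sum) (auto intro: less_imp_le)
        then show ?thesis using t(1)[OF True] t(2) True by (auto simp: u_def)
      qed (simp add: u_def)
      then have "u \<in> PiE UNIV (\<lambda>_. {-1..1})" by auto
      moreover have "(z, u) \<in> ?C"
        using us cT t(1) dist_cc[OF w] by (auto simp: less_imp_le) (simp_all add: u_def less_imp_le)
      ultimately show "\<exists>u\<in>PiE UNIV (\<lambda>_. {-1..1}). (z, u) \<in> ?C" by blast
    next
      assume "\<exists>u\<in>PiE UNIV (\<lambda>_. {-1..1}). (z, u) \<in> ?C"
      then obtain u where "(z, u) \<in> ?C" by blast
      then have *: "(\<forall>i\<in>I. u i \<ge> 0) \<and> sum u I = 1 \<and>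
         (\<forall>i\<in>I. \<forall>j\<in>I. dist (\<Sum>l\<in>I. u l *\<^sub>R z l) (z i) = dist (\<Sum>l\<in>I. u l *\<^sub>R z l) (z j)) \<and>
         (\<Sum>l\<in>I. u l *\<^sub>R z l) \<in> T"
        unfolding mem_Collect_eq fst_conv snd_conv .
      then have u: "sum u I = 1" "(\<Sum>l\<in>I. u l *\<^sub>R z l) \<in> T" by blast+
      have eq: "dist (\<Sum>l\<in>I. u l *\<^sub>R z l) (z i) = dist (\<Sum>l\<in>I. u l *\<^sub>R z l) (z j)" if "i \<in> I" "j \<in> I" for i j
        using * that by blast
      have c: "centered (z ` I) (ccenter (z ` I))" using centered_ccenter w by (auto simp: wc_def)
      have "(\<Sum>l\<in>I. u l *\<^sub>R z l) = ccenter (z ` I)"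
      proof (rule equidistant_unique)
        show "(\<Sum>l\<in>I. u l *\<^sub>R z l) \<in> affine hull z ` I" using w by (intro affine_combination_in_hull[OF fin _ u(1)]) (simp add: wc_def)
        show "ccenter (z ` I) \<in> affine hull z ` I" by (rule centered_affine_hull[OF c])
        show "dist (\<Sum>l\<in>I. u l *\<^sub>R z l) y = dist (\<Sum>l\<in>I. u l *\<^sub>R z l) y'" if "y \<in> z ` I" "y' \<in> z ` I" for y y'
          using that eq by blast
        show "dist (ccenter (z ` I)) y = dist (ccenter (z ` I)) y'" if "y \<in> z ` I" "y' \<in> z ` I" for y y'
          using that c unfolding centered_def by blast
      qed
      then show "cc I z \<in> T" using u w by (simp add: cc_def)
    qed
    then have eq: "{z. wc I z \<and> cc I z \<in> T} = {z. wc I z} \<inter> {z. \<exists>u\<in>PiE UNIV (\<lambda>_. {-1..1}). (z, u) \<in> ?C}"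
      by blast
    show ?thesis unfolding eq by (rule sets.Int[OF wcm borel_closed[OF clo]])
  qed
  show ?thesis
  proof (rule borel_measurableI)
    fix S :: "'a set" assume S: "open S"
    \<comment> \<open>The preimage of \<open>S\<close> is the part of \<open>wc\<close> whose centre
      is not in the closed complement, together with all of the complement of \<open>wc\<close> if
      the default value 0 lies in \<open>S\<close>.\<close>
    have "cc I -` S \<inter> space borel = ({z. wc I z} - {z. wc I z \<and> cc I z \<in> - S}) \<union> (if 0 \<in> S then - {z. wc I z} else {})"
      by (auto simp: cc_def split: if_splits)
    moreover have "{z. wc I z \<and> cc I z \<in> - S} \<in> sets borel" using cl[of "- S"] S by (simp add: closed_Compl)
    ultimately show "cc I -` S \<inter> space borel \<in> sets borel" using wcm by auto
  qed
qed

lemma borel_measurable_cr: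
  assumes fin: "finite I" and ne: "I \<noteq> {}"
  shows "cr I \<in> borel_measurable (borel :: (nat \<Rightarrow> 'a::euclidean_space) measure)"
proof -
  obtain i where i: "i \<in> I" using ne by auto
  have [measurable]: "cc I \<in> borel_measurable (borel :: (nat \<Rightarrow> 'a::euclidean_space) measure)"
    by (rule borel_measurable_cc[OF assms])
  have [measurable]: "Measurable.pred borel (wc I :: (nat \<Rightarrow> 'a) \<Rightarrow> bool)"
    using borel_open[OF open_wc[OF assms]] by (simp add: pred_def)
  have [measurable]: "(\<lambda>z :: nat \<Rightarrow> 'a. z i) \<in> borel_measurable borel"
    by (intro borel_measurable_continuous_onI) simp
  have "cr I z = (if wc I z then dist (cc I z) (z i) else 0)" for z :: "nat \<Rightarrow> 'a"
    using dist_cc[OF _ i, of z] by (simp add: cr_def)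
  then have "cr I = (\<lambda>z :: nat \<Rightarrow> 'a. if wc I z then dist (cc I z) (z i) else 0)" by (intro ext)
  then show ?thesis by simp
qed

lemma wc_cong: "(\<And>i. i \<in> I \<Longrightarrow> z i = z' i) \<Longrightarrow> wc I z = wc I z'"
  unfolding wc_def by (metis image_cong inj_on_cong)

lemma cc_cong: "(\<And>i. i \<in> I \<Longrightarrow> z i = z' i) \<Longrightarrow> cc I z = cc I z'"
  unfolding cc_def using wc_cong[of I z z'] by (metis image_cong)

lemma cr_cong: "(\<And>i. i \<in> I \<Longrightarrow> z i = z' i) \<Longrightarrow> cr I z = cr I z'"
  unfolding cr_def using wc_cong[of I z z'] by (metis image_cong)

context
  fixes x :: "'a::euclidean_space" and s :: real and I :: "nat set" and w z :: "nat \<Rightarrow> 'a"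
  assumes s: "s > 0" and w: "\<And>i. i \<in> I \<Longrightarrow> w i = x + s *\<^sub>R z i"
begin

lemma image_affinity: "w ` I = (\<lambda>y. x + s *\<^sub>R y) ` (z ` I)"
  using w by (force simp: image_image)

lemma wc_affinity: "wc I w \<longleftrightarrow> wc I z"
proof -
  have "inj_on w I \<longleftrightarrow> inj_on z I" unfolding inj_on_def using s w by simp
  then show ?thesis unfolding wc_def image_affinity using well_centered_affinity[OF s] by metis
qed

lemma cc_affinity: "wc I z \<Longrightarrow> cc I w = x + s *\<^sub>R cc I z"
  using wc_affinity by (simp add: cc_def image_affinity ccenter_affinity[OF s] wc_def[of I z])

lemma cr_affinity: "cr I w = s * cr I z"
proof (cases "wc I z")
  case True
  then have "well_centered (z ` I)" by (simp add: wc_def)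
  with True show ?thesis using wc_affinity by (simp add: cr_def image_affinity cradius_affinity[OF s])
qed (simp add: cr_def wc_affinity)

end

text \<open>Vertices \<open>b\<^sub>1, \<dots>, b\<^sub>k\<close> of the standard basis and \<open>- (b\<^sub>1 + \<dots> + b\<^sub>k) / \<surd>k\<close> lie on the unit sphere
  around the origin, which is a positive combination of them.\<close>
lemma wc_exists:
  fixes k :: nat
  assumes k: "1 \<le> k" "k \<le> DIM('a::euclidean_space)"
  obtains z :: "nat \<Rightarrow> 'a::euclidean_space" where "wc {..k} z"
proof -
  obtain B where B: "B \<subseteq> (Basis :: 'a set)" "card B = k"
    using obtain_subset_with_card_n[OF k(2)] by metis
  have finB: "finite B" using B finite_Basis finite_subset by blast
  obtain e where e: "bij_betw e {1..k} B"
    using finB B(2) finite_same_card_bij[of "{1..k}" B] by auto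
  define z where "z i = (if i = 0 then - (1 / sqrt k) *\<^sub>R (\<Sum>b\<in>B. b) else e i)" for i
  have inner_e: "inner (e i) (e j) = (if i = j then 1 else 0)" if "i \<in> {1..k}" "j \<in> {1..k}" for i j
  proof -
    have "e i \<in> Basis" "e j \<in> Basis" using e B(1) that by (auto simp: bij_betw_def)
    moreover have "e i = e j \<longleftrightarrow> i = j" using e that by (metis bij_betw_imp_inj_on inj_on_eq_iff)
    ultimately show ?thesis by (simp add: inner_Basis)
  qed
  have sumB: "(\<Sum>b\<in>B. b) = (\<Sum>i\<in>{1..k}. e i)"
    using sum.reindex_bij_betw[OF e, of "\<lambda>b. b"] by simp
  have inner_s: "inner (\<Sum>b\<in>B. b) (e j) = 1" if "j \<in> {1..k}" for j
    unfolding sumB inner_sum_left using that by (simp add: inner_e sum.delta)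
  have split: "{..k} = insert 0 {1..k}" using k by auto
  have sq: "sqrt k > 0" using k by simp
  have ind: "\<not> (\<exists>u. sum u {..k} = 0 \<and> (\<exists>i\<in>{..k}. u i \<noteq> 0) \<and> (\<Sum>i\<in>{..k}. u i *\<^sub>R z i) = 0)"
  proof
    assume "\<exists>u. sum u {..k} = 0 \<and> (\<exists>i\<in>{..k}. u i \<noteq> 0) \<and> (\<Sum>i\<in>{..k}. u i *\<^sub>R z i) = 0"
    then obtain u where u: "sum u {..k} = 0" "\<exists>i\<in>{..k}. u i \<noteq> 0" "(\<Sum>i\<in>{..k}. u i *\<^sub>R z i) = 0" by auto
    have s0: "u 0 *\<^sub>R z 0 + (\<Sum>i\<in>{1..k}. u i *\<^sub>R e i) = 0"
      using u(3) unfolding split by (simp add: z_def)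
    \<comment> \<open>Pairing the relation with \<open>e j\<close> isolates \<open>u j\<close>. All
      coefficients are then multiples of \<open>u 0\<close>, and the vanishing total forces
      \<open>u 0 = 0\<close>.\<close>
    have uj: "u j = u 0 / sqrt k" if j: "j \<in> {1..k}" for j
    proof -
      have "0 = inner (u 0 *\<^sub>R z 0 + (\<Sum>i\<in>{1..k}. u i *\<^sub>R e i)) (e j)" using s0 by simp
      also have "\<dots> = u 0 * inner (z 0) (e j) + (\<Sum>i\<in>{1..k}. u i * inner (e i) (e j))"
        by (simp add: inner_add_left inner_sum_left)
      also have "(\<Sum>i\<in>{1..k}. u i * inner (e i) (e j)) = (\<Sum>i\<in>{1..k}. if i = j then u i else 0)"
        using j by (intro sum.cong) (auto simp: inner_e)
      also have "\<dots> = u j" using j by simp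
      also have "u 0 * inner (z 0) (e j) = - (u 0 / sqrt k)"
        using inner_s[OF j] by (simp add: z_def)
      finally show ?thesis by simp
    qed
    have "sum u {..k} = u 0 + (\<Sum>i\<in>{1..k}. u i)" unfolding split by simp
    also have "(\<Sum>i\<in>{1..k}. u i) = (\<Sum>i\<in>{1..k}. u 0 / sqrt k)" using uj by (intro sum.cong) auto
    also have "\<dots> = u 0 * (real k / sqrt k)" by simp
    also have "u 0 + \<dots> = u 0 * (1 + sqrt k)" by (subst real_div_sqrt) (simp_all add: algebra_simps)
    finally have "u 0 = 0" using u(1) sq by auto
    then show False using u(2) uj unfolding split by auto
  qed
  \<comment> \<open>The weight \<open>sqrt k\<close> cancels the factor \<open>1 / sqrt k\<close> of
    vertex 0, so the combination is 0; \<open>k + sqrt k\<close> normalises the total weight to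
    1.\<close>
  define t where "t i = (if i = 0 then sqrt k else 1) / (k + sqrt k)" for i :: nat
  have tp: "t i > 0" for i using k by (simp add: t_def add_pos_nonneg)
  have st: "sum t {..k} = 1"
  proof -
    have "sum t {..k} = (sqrt k + k) / (k + sqrt k)"
      unfolding split by (simp add: t_def add_divide_distrib)
    then show ?thesis using sq k by (simp add: add.commute add_pos_nonneg)
  qed
  have tz: "(\<Sum>i\<in>{..k}. t i *\<^sub>R z i) = 0"
  proof -
    have "(\<Sum>i\<in>{1..k}. t i *\<^sub>R z i) = (1 / (k + sqrt k)) *\<^sub>R (\<Sum>b\<in>B. b)"
      unfolding sumB scaleR_sum_right by (rule sum.cong) (auto simp: t_def z_def)
    moreover have "t 0 *\<^sub>R z 0 = - (1 / (k + sqrt k)) *\<^sub>R (\<Sum>b\<in>B. b)"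
      using sq by (simp add: t_def z_def)
    ultimately show ?thesis unfolding split by simp
  qed
  have nz: "norm (z i) = 1" if "i \<in> {..k}" for i
  proof (cases "i = 0")
    case True
    have "inner (\<Sum>b\<in>B. b) (\<Sum>b\<in>B. b) = k"
      by (subst (2) sumB) (simp add: inner_sum_right inner_s)
    then have "norm (\<Sum>b\<in>B. b) = sqrt k" by (simp add: norm_eq_sqrt_inner)
    then show ?thesis using True sq by (simp add: z_def)
  next
    case False
    then have "inner (e i) (e i) = 1" using inner_e[of i i] that by simp
    then show ?thesis using False by (simp add: z_def norm_eq_sqrt_inner)
  qed
  have inj: "inj_on z {..k}" and aff: "\<not> affine_dependent (z ` {..k})"
    using affine_independent_index[of "{..k}" z] ind by auto
  have "centered (z ` {..k}) 0"
    unfolding centered_def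
  proof
    define u where "u v = t (inv_into {..k} z v)" for v
    have u: "u (z i) = t i" if "i \<in> {..k}" for i using inj that by (simp add: u_def)
    have "(\<forall>x\<in>z ` {..k}. 0 < u x) \<and> sum u (z ` {..k}) = 1 \<and> (\<Sum>x\<in>z ` {..k}. u x *\<^sub>R x) = 0"
      using tp st tz u inj by (simp add: sum.reindex)
    then show "0 \<in> rel_interior (convex hull z ` {..k})"
      unfolding rel_interior_convex_hull_explicit[OF aff] by blast
  qed (simp add: nz)
  then have "well_centered (z ` {..k})"
    using aff unfolding well_centered_def by blast
  then show ?thesis using that inj by (auto simp: wc_def)
qed

section \<open>Lebesgue measure under translations and dilations\<close>

interpretation lborel_prod: product_sigma_finite "\<lambda>_::nat. lborel :: 'a::euclidean_space measure" ..

lemma nn_integral_lborel_affine: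
  fixes g :: "'a::euclidean_space \<Rightarrow> ennreal"
  assumes [measurable]: "g \<in> borel_measurable borel" and s: "s > 0"
  shows "(\<integral>\<^sup>+y. g y \<partial>lborel) = ennreal (s ^ DIM('a)) * (\<integral>\<^sup>+y. g (x + s *\<^sub>R y) \<partial>lborel)"
  using s by (subst lborel_affine[of s x])
    (simp_all add: nn_integral_density nn_integral_distr nn_integral_cmult)

text \<open>Coordinates are substituted one at a time, each contributing \<open>s ^ DIM('a)\<close>.
  They share the translation \<open>x\<close>, so whole configurations are moved by one
  similarity.\<close>

lemma nn_integral_PiM_lborel_affine:
  fixes \<Phi> :: "(nat \<Rightarrow> 'a::euclidean_space) \<Rightarrow> ennreal"
  assumes J: "finite J" and s: "s > 0" and \<Phi>: "\<Phi> \<in> borel_measurable (PiM J (\<lambda>_. lborel))"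
  shows "(\<integral>\<^sup>+z. \<Phi> z \<partial>PiM J (\<lambda>_. lborel)) =
    ennreal (s ^ (DIM('a) * card J)) * (\<integral>\<^sup>+z. \<Phi> (\<lambda>i\<in>J. x + s *\<^sub>R z i) \<partial>PiM J (\<lambda>_. lborel))"
  using J \<Phi>
proof (induction J arbitrary: \<Phi> rule: finite_induct)
  case empty
  have "(\<lambda>i\<in>{}. x + s *\<^sub>R z i) = (\<lambda>_. undefined)" for z :: "nat \<Rightarrow> 'a" by auto
  then show ?case by (simp add: lborel_prod.nn_integral_empty space_PiM)
next
  case (insert i J)
  note [measurable] = insert.prems
  let ?P = "\<lambda>z. \<integral>\<^sup>+y. \<Phi> (z(i := x + s *\<^sub>R y)) \<partial>lborel"
  have m1: "(\<lambda>(z, y). z(i := x + s *\<^sub>R y)) \<in> PiM J (\<lambda>_. lborel) \<Otimes>\<^sub>M lborel \<rightarrow>\<^sub>M PiM (insert i J) (\<lambda>_. lborel)"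
    unfolding split_beta' by (rule measurable_fun_upd[where J=J]) (auto intro!: measurable_compose[OF measurable_snd])
  have Pm[measurable]: "?P \<in> borel_measurable (PiM J (\<lambda>_. lborel))"
    using measurable_compose[OF m1 insert.prems]
    by (intro lborel.borel_measurable_nn_integral) (simp add: split_beta')
  have "(\<integral>\<^sup>+z. \<Phi> z \<partial>PiM (insert i J) (\<lambda>_. lborel)) = (\<integral>\<^sup>+z. \<integral>\<^sup>+y. \<Phi> (z(i := y)) \<partial>lborel \<partial>PiM J (\<lambda>_. lborel))"
    by (rule lborel_prod.product_nn_integral_insert) (use insert in auto)
  also have "\<dots> = (\<integral>\<^sup>+z. ennreal (s ^ DIM('a)) * ?P z \<partial>PiM J (\<lambda>_. lborel))"
  proof (rule nn_integral_cong)
    fix z assume z: "z \<in> space (PiM J (\<lambda>_. lborel :: 'a measure))"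
    have "(\<lambda>y. z(i := y)) \<in> borel \<rightarrow>\<^sub>M PiM (insert i J) (\<lambda>_. lborel)"
      using z by (intro measurable_fun_upd[where J=J]) auto
    then have "(\<lambda>y. \<Phi> (z(i := y))) \<in> borel_measurable borel" by measurable
    then show "(\<integral>\<^sup>+y. \<Phi> (z(i := y)) \<partial>lborel) = ennreal (s ^ DIM('a)) * ?P z"
      by (rule nn_integral_lborel_affine[OF _ s])
  qed
  also have "\<dots> = ennreal (s ^ DIM('a)) * (\<integral>\<^sup>+z. ?P z \<partial>PiM J (\<lambda>_. lborel))"
    by (rule nn_integral_cmult) simp
  also have "(\<integral>\<^sup>+z. ?P z \<partial>PiM J (\<lambda>_. lborel)) =
     ennreal (s ^ (DIM('a) * card J)) * (\<integral>\<^sup>+z. ?P (\<lambda>i\<in>J. x + s *\<^sub>R z i) \<partial>PiM J (\<lambda>_. lborel))"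
    by (rule insert.IH[OF Pm])
  also have "(\<integral>\<^sup>+z. ?P (\<lambda>i\<in>J. x + s *\<^sub>R z i) \<partial>PiM J (\<lambda>_. lborel)) =
      (\<integral>\<^sup>+z. \<integral>\<^sup>+y. \<Phi> (\<lambda>j\<in>insert i J. x + s *\<^sub>R (z(i := y)) j) \<partial>lborel \<partial>PiM J (\<lambda>_. lborel))"
  proof (intro nn_integral_cong)
    fix z :: "nat \<Rightarrow> 'a" and y :: 'a
    have "(\<lambda>i\<in>J. x + s *\<^sub>R z i)(i := x + s *\<^sub>R y) = (\<lambda>j\<in>insert i J. x + s *\<^sub>R (z(i := y)) j)"
      using insert.hyps by (auto simp: fun_eq_iff restrict_def)
    then show "\<Phi> ((\<lambda>i\<in>J. x + s *\<^sub>R z i)(i := x + s *\<^sub>R y)) = \<Phi> (\<lambda>j\<in>insert i J. x + s *\<^sub>R (z(i := y)) j)" by simp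
  qed
  also have "\<dots> = (\<integral>\<^sup>+z. \<Phi> (\<lambda>j\<in>insert i J. x + s *\<^sub>R z j) \<partial>PiM (insert i J) (\<lambda>_. lborel))"
    by (rule lborel_prod.product_nn_integral_insert[symmetric]) (use insert in auto)
  also have "ennreal (s ^ DIM('a)) * (ennreal (s ^ (DIM('a) * card J)) * X) =
      ennreal (s ^ (DIM('a) * card (insert i J))) * X" for X
    using insert.hyps s by (simp add: mult.assoc[symmetric] ennreal_mult[symmetric] power_add)
  finally show ?case .
qed

lemma integrable_translation:
  fixes g :: "'a::euclidean_space \<Rightarrow> real"
  assumes g: "integrable lborel g"
  shows "integrable lborel (\<lambda>x. g (x + v))" and "(\<integral>x. g (x + v) \<partial>lborel) = (\<integral>x. g x \<partial>lborel)"
proof -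
  have [measurable]: "g \<in> borel_measurable borel" using borel_measurable_integrable[OF g] by simp
  have "integrable (distr lborel borel ((+) v)) g" using g by (simp add: lborel_distr_plus)
  then show "integrable lborel (\<lambda>x. g (x + v))"
    by (subst (asm) integrable_distr_eq) (simp_all add: add.commute)
  have "(\<integral>x. g x \<partial>lborel) = integral\<^sup>L (distr lborel borel ((+) v)) g" by (simp add: lborel_distr_plus)
  also have "\<dots> = (\<integral>x. g (x + v) \<partial>lborel)" by (subst integral_distr) (simp_all add: add.commute)
  finally show "(\<integral>x. g (x + v) \<partial>lborel) = (\<integral>x. g x \<partial>lborel)" by simp
qed

lemma translation_L1_approx:
  fixes g h :: "'a::euclidean_space \<Rightarrow> real"
  assumes g: "integrable lborel g" and h: "integrable lborel h"
  shows "(\<integral>x. \<bar>g (x + v) - g x\<bar> \<partial>lborel) \<le> 2 * (\<integral>x. \<bar>g x - h x\<bar> \<partial>lborel) + (\<integral>x. \<bar>h (x + v) - h x\<bar> \<partial>lborel)"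
proof -
  have d: "integrable lborel (\<lambda>x. \<bar>g x - h x\<bar>)" using g h by auto
  note gv = integrable_translation(1)[OF g, of v] and hv = integrable_translation(1)[OF h, of v]
    and dv = integrable_translation[OF d, of v]
  have "(\<integral>x. \<bar>g (x + v) - g x\<bar> \<partial>lborel) \<le>
    (\<integral>x. \<bar>g (x + v) - h (x + v)\<bar> + \<bar>g x - h x\<bar> + \<bar>h (x + v) - h x\<bar> \<partial>lborel)"
    using g h gv hv d dv(1) by (intro integral_mono) auto
  also have "\<dots> = (\<integral>x. \<bar>g (x + v) - h (x + v)\<bar> \<partial>lborel) + (\<integral>x. \<bar>g x - h x\<bar> \<partial>lborel) + (\<integral>x. \<bar>h (x + v) - h x\<bar> \<partial>lborel)"
    using g h gv hv d dv(1) by simp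
  finally show ?thesis using dv(2) by simp
qed

text \<open>The functions whose translates converge in mean form a closed set in L1, because
  translation is an isometry there. This is the limiting step in the induction for
  \<open>translation_L1\<close>.\<close>

lemma translation_L1_closed:
  fixes g :: "'a::euclidean_space \<Rightarrow> real" and v :: "nat \<Rightarrow> 'a"
  assumes g: "integrable lborel g"
    and approx: "\<And>e. e > 0 \<Longrightarrow> \<exists>h. integrable lborel h \<and> (\<integral>x. \<bar>g x - h x\<bar> \<partial>lborel) < e \<and>
        (\<lambda>n. \<integral>x. \<bar>h (x + v n) - h x\<bar> \<partial>lborel) \<longlonglongrightarrow> 0"
  shows "(\<lambda>n. \<integral>x. \<bar>g (x + v n) - g x\<bar> \<partial>lborel) \<longlonglongrightarrow> 0"
proof (rule LIMSEQ_I)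
  fix e :: real assume e: "e > 0"
  obtain h where h: "integrable lborel h" "(\<integral>x. \<bar>g x - h x\<bar> \<partial>lborel) < e / 4"
    "(\<lambda>n. \<integral>x. \<bar>h (x + v n) - h x\<bar> \<partial>lborel) \<longlonglongrightarrow> 0"
    using approx[of "e / 4"] e by auto
  obtain N where N: "\<And>n. n \<ge> N \<Longrightarrow> norm ((\<integral>x. \<bar>h (x + v n) - h x\<bar> \<partial>lborel) - 0) < e / 2"
    using LIMSEQ_D[OF h(3), of "e / 2"] e by auto
  have "norm ((\<integral>x. \<bar>g (x + v n) - g x\<bar> \<partial>lborel) - 0) < e" if "n \<ge> N" for n
  proof -
    have "(\<integral>x. \<bar>g (x + v n) - g x\<bar> \<partial>lborel) < e"
      using translation_L1_approx[OF g h(1), of "v n"] h(2) N[OF that] by simp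
    moreover have "0 \<le> (\<integral>x. \<bar>g (x + v n) - g x\<bar> \<partial>lborel)" by simp
    ultimately show ?thesis by simp
  qed
  then show "\<exists>N. \<forall>n\<ge>N. norm ((\<integral>x. \<bar>g (x + v n) - g x\<bar> \<partial>lborel) - 0) < e" by blast
qed

text \<open>For an open set \<open>U\<close>, the indicators of \<open>U \<inter> (U - v)\<close> converge pointwise to that of \<open>U\<close>, so dominated
  convergence applies; general integrable functions are reached by outer regularity and density.\<close>
lemma translation_L1_open:
  fixes v :: "nat \<Rightarrow> 'a::euclidean_space"
  assumes U: "open U" and fin: "emeasure lborel U < \<infinity>" and v: "v \<longlonglongrightarrow> 0"
  shows "(\<lambda>n. \<integral>x. \<bar>(indicator U (x + v n) :: real) - indicator U x\<bar> \<partial>lborel) \<longlonglongrightarrow> 0"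
proof -
  have [measurable]: "U \<in> sets borel" using U by simp
  have iU: "integrable lborel (indicator U :: 'a \<Rightarrow> real)" using fin by (intro integrable_real_indicator) simp_all
  note iv = integrable_translation[OF iU]
  have ip: "integrable lborel (\<lambda>x. (indicator U (x + w) :: real) * indicator U x)" for w
    by (rule Bochner_Integration.integrable_bound[OF iU]) (auto split: split_indicator)
  have eq: "(\<integral>x. \<bar>(indicator U (x + w) :: real) - indicator U x\<bar> \<partial>lborel) =
      2 * measure lborel U - 2 * (\<integral>x. indicator U (x + w) * indicator U x \<partial>lborel)" for w
  proof -
    have "(\<integral>x. \<bar>(indicator U (x + w) :: real) - indicator U x\<bar> \<partial>lborel) =
      (\<integral>x. indicator U (x + w) + indicator U x - 2 * (indicator U (x + w) * indicator U x) \<partial>lborel)"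
      by (rule Bochner_Integration.integral_cong) (auto split: split_indicator)
    also have "\<dots> = measure lborel U + measure lborel U - 2 * (\<integral>x. indicator U (x + w) * indicator U x \<partial>lborel)"
      using iv iU ip by simp
    finally show ?thesis by simp
  qed
  have "(\<lambda>n. \<integral>x. indicator U (x + v n) * indicator U x \<partial>lborel) \<longlonglongrightarrow> (\<integral>x. (indicator U x :: real) \<partial>lborel)"
  proof (rule integral_dominated_convergence[OF _ _ iU])
    show "AE x in lborel. (\<lambda>n. (indicator U (x + v n) :: real) * indicator U x) \<longlonglongrightarrow> indicator U x"
    proof (rule AE_I2)
      fix x
      show "(\<lambda>n. (indicator U (x + v n) :: real) * indicator U x) \<longlonglongrightarrow> indicator U x"
      proof (cases "x \<in> U")
        case True
        have "(\<lambda>n. x + v n) \<longlonglongrightarrow> x" using tendsto_add[OF tendsto_const v, of x] by simp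
        then have "eventually (\<lambda>n. x + v n \<in> U) sequentially" using U True by (metis topological_tendstoD)
        then show ?thesis by (intro tendsto_eventually) (auto elim!: eventually_mono simp: True)
      qed simp
    qed
  qed (auto split: split_indicator)
  then have "(\<lambda>n. \<integral>x. indicator U (x + v n) * indicator U x \<partial>lborel) \<longlonglongrightarrow> measure lborel U" by simp
  then have "(\<lambda>n. 2 * measure lborel U - 2 * (\<integral>x. indicator U (x + v n) * indicator U x \<partial>lborel))
      \<longlonglongrightarrow> 2 * measure lborel U - 2 * measure lborel U"
    by (intro tendsto_intros)
  then show ?thesis unfolding eq by simp
qed

text \<open>Applied to the density, this supplies convergence of
  \<open>f (x + s n *\<^sub>R z)\<close> to \<open>f x\<close> on average over \<open>x\<close>,
  which is what a merely measurable density allows.\<close>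

lemma translation_L1:
  fixes g :: "'a::euclidean_space \<Rightarrow> real" and v :: "nat \<Rightarrow> 'a"
  assumes g: "integrable lborel g" and v: "v \<longlonglongrightarrow> 0"
  shows "(\<lambda>n. \<integral>x. \<bar>g (x + v n) - g x\<bar> \<partial>lborel) \<longlonglongrightarrow> 0"
  using g
proof (induction rule: integrable_induct)
  case (base A c)
  then have [measurable]: "A \<in> sets borel" by simp
  have iA: "integrable lborel (\<lambda>x. indicator A x *\<^sub>R c)" using base by simp
  show ?case
  proof (rule translation_L1_closed[OF iA])
    fix e :: real assume e: "e > 0"
    \<comment> \<open>The \<open>+ 1\<close> keeps the tolerance well defined for
      \<open>c = 0\<close>, and \<open>\<bar>c\<bar> / (\<bar>c\<bar> + 1) < 1\<close> leaves an
      error below \<open>e\<close>.\<close>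
    obtain U where U: "open U" "A \<subseteq> U" "emeasure lborel (U - A) < ennreal (e / (\<bar>c\<bar> + 1))"
      using outer_regular_lborel[of A "e / (\<bar>c\<bar> + 1)"] e by auto
    have [measurable]: "U \<in> sets borel" using U by simp
    have "emeasure lborel U = emeasure lborel (A \<union> (U - A))" using U by (simp add: Un_absorb1)
    also have "\<dots> \<le> emeasure lborel A + emeasure lborel (U - A)" by (rule emeasure_subadditive) auto
    also have "\<dots> < \<infinity>" using base(2) U(3) by (simp add: less_top[symmetric]) (metis ennreal_less_top less_trans order_less_irrefl)
    finally have Uf: "emeasure lborel U < \<infinity>" .
    have iU: "integrable lborel (\<lambda>x. indicator U x *\<^sub>R c)" using Uf by simp
    have fd: "emeasure lborel (U - A) < \<infinity>" using U(3) by (metis ennreal_less_top infinity_ennreal_def less_trans)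
    have "(\<integral>x. \<bar>indicator A x *\<^sub>R c - indicator U x *\<^sub>R c\<bar> \<partial>lborel) = (\<integral>x. \<bar>c\<bar> * indicator (U - A) x \<partial>lborel)"
      using U(2) by (intro Bochner_Integration.integral_cong) (auto split: split_indicator)
    also have "\<dots> = \<bar>c\<bar> * measure lborel (U - A)" using fd by simp
    also have "\<dots> < e"
    proof -
      have "measure lborel (U - A) < e / (\<bar>c\<bar> + 1)"
        using U(3) fd e by (simp add: measure_def enn2real_less_iff)
      then have "measure lborel (U - A) * (\<bar>c\<bar> + 1) < e" by (simp add: field_simps)
      moreover have "\<bar>c\<bar> * measure lborel (U - A) \<le> measure lborel (U - A) * (\<bar>c\<bar> + 1)" by (simp add: algebra_simps)
      ultimately show ?thesis by linarith
    qed
    finally have "(\<integral>x. \<bar>indicator A x *\<^sub>R c - indicator U x *\<^sub>R c\<bar> \<partial>lborel) < e" .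
    moreover have "(\<lambda>n. \<integral>x. \<bar>indicator U (x + v n) *\<^sub>R c - indicator U x *\<^sub>R c\<bar> \<partial>lborel) \<longlonglongrightarrow> 0"
    proof -
      have "(\<integral>x. \<bar>indicator U (x + w) *\<^sub>R c - indicator U x *\<^sub>R c\<bar> \<partial>lborel) =
          \<bar>c\<bar> * (\<integral>x. \<bar>indicator U (x + w) - indicator U x\<bar> \<partial>lborel)" for w
        unfolding integral_mult_right_zero[symmetric]
        by (rule Bochner_Integration.integral_cong) (auto split: split_indicator)
      then show ?thesis using tendsto_mult[OF tendsto_const translation_L1_open[OF U(1) Uf v], of "\<bar>c\<bar>"] by simp
    qed
    ultimately show "\<exists>h. integrable lborel h \<and> (\<integral>x. \<bar>indicator A x *\<^sub>R c - h x\<bar> \<partial>lborel) < e \<and>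
        (\<lambda>n. \<integral>x. \<bar>h (x + v n) - h x\<bar> \<partial>lborel) \<longlonglongrightarrow> 0"
      using iU by blast
  qed
next
  case (add g h)
  show ?case
  proof (rule tendsto_sandwich[OF _ _ tendsto_const tendsto_add[OF add.IH, simplified]])
    show "\<forall>\<^sub>F n in sequentially. (\<integral>x. \<bar>g (x + v n) + h (x + v n) - (g x + h x)\<bar> \<partial>lborel) \<le>
      (\<integral>x. \<bar>g (x + v n) - g x\<bar> \<partial>lborel) + (\<integral>x. \<bar>h (x + v n) - h x\<bar> \<partial>lborel)"
    proof (rule always_eventually, rule allI)
      fix n
      note gv = integrable_translation(1)[OF add.hyps(1), of "v n"] and hv = integrable_translation(1)[OF add.hyps(2), of "v n"]
      have "(\<integral>x. \<bar>g (x + v n) + h (x + v n) - (g x + h x)\<bar> \<partial>lborel) \<le>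
        (\<integral>x. \<bar>g (x + v n) - g x\<bar> + \<bar>h (x + v n) - h x\<bar> \<partial>lborel)"
        using add.hyps gv hv by (intro integral_mono) auto
      also have "\<dots> = (\<integral>x. \<bar>g (x + v n) - g x\<bar> \<partial>lborel) + (\<integral>x. \<bar>h (x + v n) - h x\<bar> \<partial>lborel)"
        using add.hyps gv hv by simp
      finally show "(\<integral>x. \<bar>g (x + v n) + h (x + v n) - (g x + h x)\<bar> \<partial>lborel) \<le>
        (\<integral>x. \<bar>g (x + v n) - g x\<bar> \<partial>lborel) + (\<integral>x. \<bar>h (x + v n) - h x\<bar> \<partial>lborel)" .
    qed
  qed simp
next
  case (lim g s)
  show ?case
  proof (rule translation_L1_closed[OF lim.hyps(4)])
    fix e :: real assume e: "e > 0"
    have [measurable]: "g \<in> borel_measurable borel" "\<And>i. s i \<in> borel_measurable borel"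
      using lim.hyps borel_measurable_integrable by (force, force)
    have "(\<lambda>i. \<integral>x. \<bar>g x - s i x\<bar> \<partial>lborel) \<longlonglongrightarrow> (\<integral>x. 0 \<partial>(lborel :: 'a measure))"
    proof (rule integral_dominated_convergence)
      \<comment> \<open>The approximating functions of the induction rule satisfy
        \<open>\<bar>s i x\<bar> \<le> 2 * \<bar>g x\<bar>\<close>, which makes the difference at
        most three times \<open>\<bar>g x\<bar>\<close>.\<close>
      show "integrable lborel (\<lambda>x. 3 * \<bar>g x\<bar>)" using lim.hyps(4) by auto
      show "AE x in lborel. (\<lambda>i. \<bar>g x - s i x\<bar>) \<longlonglongrightarrow> 0"
      proof (rule AE_I2)
        fix x assume "x \<in> space (lborel :: 'a measure)"
        from tendsto_rabs[OF tendsto_diff[OF tendsto_const lim.hyps(2)[OF this], of "g x"]]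
        show "(\<lambda>i. \<bar>g x - s i x\<bar>) \<longlonglongrightarrow> 0" by simp
      qed
      show "AE x in lborel. norm \<bar>g x - s i x\<bar> \<le> 3 * \<bar>g x\<bar>" for i
      proof (rule AE_I2)
        fix x assume "x \<in> space (lborel :: 'a measure)"
        from lim.hyps(3)[OF this, of i] show "norm \<bar>g x - s i x\<bar> \<le> 3 * \<bar>g x\<bar>" by simp
      qed
    qed simp_all
    from LIMSEQ_D[OF this e] obtain i where i: "norm ((\<integral>x. \<bar>g x - s i x\<bar> \<partial>lborel) - (\<integral>x. 0 \<partial>(lborel :: 'a measure))) < e"
      by blast
    then show "\<exists>h. integrable lborel h \<and> (\<integral>x. \<bar>g x - h x\<bar> \<partial>lborel) < e \<and>
        (\<lambda>n. \<integral>x. \<bar>h (x + v n) - h x\<bar> \<partial>lborel) \<longlonglongrightarrow> 0"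
      using lim.hyps(1) lim.IH by (intro exI[of _ "s i"]) simp
  qed
qed

text \<open>Layer-cake argument: \<open>exp (- norm z)\<close> is the integral of
  \<open>exp (- t)\<close> over \<open>t \<ge> norm z\<close>, and exchanging the integrals leaves
  the volume of balls against \<open>exp (- t)\<close>, a Gamma integral. General
  \<open>\<kappa>\<close> follows by dilation. These functions build the majorant in
  \<open>local_limit\<close>.\<close>

lemma integrable_exp_norm:
  fixes \<kappa> :: real
  assumes \<kappa>: "\<kappa> > 0"
  shows "integrable lborel (\<lambda>z :: 'a::euclidean_space. exp (- \<kappa> * norm z))"
proof -
  let ?V = "unit_ball_vol (DIM('a))"
  have 1: "ennreal (exp (- norm z)) = (\<integral>\<^sup>+t. ennreal (exp (- t)) * indicator {norm z ..} t \<partial>lborel)" for z :: 'a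
  proof -
    have "((\<lambda>t::real. - exp (- t)) \<longlongrightarrow> 0) at_top"
      using tendsto_minus[OF filterlim_compose[OF exp_at_bot filterlim_uminus_at_bot_at_top]] by simp
    then have "(\<integral>\<^sup>+t. ennreal (exp (- t)) * indicator {norm z ..} t \<partial>lborel) = 0 - (- exp (- norm z))"
      by (intro nn_integral_FTC_atLeast) (auto intro!: derivative_eq_intros)
    then show ?thesis by simp
  qed
  have "(\<integral>\<^sup>+z. ennreal (exp (- norm (z :: 'a))) \<partial>lborel) =
      (\<integral>\<^sup>+z. \<integral>\<^sup>+t. ennreal (exp (- t)) * indicator {norm (z :: 'a) ..} t \<partial>lborel \<partial>lborel)"
    unfolding 1 ..
  also have "\<dots> = (\<integral>\<^sup>+t. \<integral>\<^sup>+z. ennreal (exp (- t)) * indicator {norm (z :: 'a) ..} t \<partial>lborel \<partial>lborel)"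
    by (rule lborel_pair.Fubini'[symmetric]) (simp add: indicator_def split_beta')
  also have "\<dots> = (\<integral>\<^sup>+t. ennreal ?V * (ennreal (t ^ DIM('a) * exp (- t)) * indicator {0 ..} t) \<partial>lborel)"
  proof (rule nn_integral_cong)
    fix t :: real
    have "(\<integral>\<^sup>+z. ennreal (exp (- t)) * indicator {norm (z :: 'a) ..} t \<partial>lborel) =
       (\<integral>\<^sup>+z. ennreal (exp (- t)) * indicator (cball (0::'a) t) z \<partial>lborel)"
      by (rule nn_integral_cong) (auto split: split_indicator)
    also have "\<dots> = ennreal (exp (- t)) * emeasure lborel (cball (0::'a) t)"
      by (rule nn_integral_cmult_indicator) simp
    also have "\<dots> = ennreal ?V * (ennreal (t ^ DIM('a) * exp (- t)) * indicator {0 ..} t)"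
    proof (cases "t \<ge> 0")
      case True
      then show ?thesis
        by (simp add: emeasure_cball ennreal_mult[symmetric] ac_simps)
    next
      case False
      then have "cball (0::'a) t = {}" by auto
      then show ?thesis using False by simp
    qed
    finally show "(\<integral>\<^sup>+z. ennreal (exp (- t)) * indicator {norm (z :: 'a) ..} t \<partial>lborel) =
      ennreal ?V * (ennreal (t ^ DIM('a) * exp (- t)) * indicator {0 ..} t)" .
  qed
  also have "\<dots> = ennreal ?V * ennreal (fact (DIM('a)))"
    by (subst nn_integral_cmult) (simp_all add: nn_intergal_power_times_exp_Ici)
  also have "\<dots> < \<infinity>" by (simp add: ennreal_mult_less_top)
  finally have fin: "(\<integral>\<^sup>+z. ennreal (exp (- norm (z :: 'a))) \<partial>lborel) < \<infinity>" .
  have "(\<integral>\<^sup>+z. ennreal (exp (- \<kappa> * norm (z :: 'a))) \<partial>lborel) =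
     ennreal ((1 / \<kappa>) ^ DIM('a)) * (\<integral>\<^sup>+z. ennreal (exp (- \<kappa> * norm (0 + (1 / \<kappa>) *\<^sub>R (z :: 'a)))) \<partial>lborel)"
    by (rule nn_integral_lborel_affine) (use \<kappa> in simp_all)
  also have "\<dots> < \<infinity>" using fin \<kappa> by (simp add: ennreal_mult_less_top)
  finally show ?thesis by (intro integrableI_bounded) simp_all
qed

text \<open>Convergence in mean yields convergence almost everywhere only along a subsequence; this
  principle brings the conclusion back to the full sequence.\<close>

lemma tendsto_subsubseq:
  fixes X :: "nat \<Rightarrow> real"
  assumes "\<And>r :: nat \<Rightarrow> nat. strict_mono r \<Longrightarrow> \<exists>r' :: nat \<Rightarrow> nat. strict_mono r' \<and> (\<lambda>n. X (r (r' n))) \<longlonglongrightarrow> L"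
  shows "X \<longlonglongrightarrow> L"
proof (rule ccontr)
  assume "\<not> X \<longlonglongrightarrow> L"
  then obtain e where e: "e > 0" "\<And>N. \<exists>n\<ge>N. \<not> norm (X n - L) < e"
    unfolding LIMSEQ_iff by blast
  then have "infinite {n. \<not> norm (X n - L) < e}"
    unfolding infinite_nat_iff_unbounded_le by blast
  then obtain r :: "nat \<Rightarrow> nat" where r: "strict_mono r" "\<And>n. r n \<in> {n. \<not> norm (X n - L) < e}"
    using infinite_enumerate by blast
  obtain r' where "strict_mono r'" "(\<lambda>n. X (r (r' n))) \<longlonglongrightarrow> L" using assms[OF r(1)] by blast
  then obtain n where "norm (X (r (r' n)) - L) < e" using e(1) LIMSEQ_D by blast
  then show False using r(2)[of "r' n"] by blast
qed

section \<open>The local limit lemma\<close>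

text \<open>Kernels \<open>g\<^sub>n(a, b)\<close> are only evaluated at arguments \<open>n F \<le> n\<close>, so convergence to \<open>G\<close> is required along arguments in \<open>[0, n]\<close> only.\<close>
definition cfilt :: "real \<Rightarrow> real \<Rightarrow> (nat \<times> real \<times> real) filter" where
  "cfilt a b = inf (sequentially \<times>\<^sub>F nhds a \<times>\<^sub>F nhds b)
     (principal {(n, x, y). 0 \<le> x \<and> x \<le> real n \<and> 0 \<le> y \<and> y \<le> real n})"

definition cconv :: "(nat \<Rightarrow> real \<Rightarrow> real \<Rightarrow> real) \<Rightarrow> (real \<Rightarrow> real \<Rightarrow> real) \<Rightarrow> bool" where
  "cconv g G \<longleftrightarrow> (\<forall>a\<ge>0. \<forall>b\<ge>0. ((\<lambda>(n, x, y). g n x y) \<longlongrightarrow> G a b) (cfilt a b))"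

lemma cconv_seq:
  assumes "cconv g G" "filterlim r sequentially F" "(x \<longlongrightarrow> a) F" "(y \<longlongrightarrow> b) F" "a \<ge> 0" "b \<ge> 0"
    and ev: "eventually (\<lambda>t. 0 \<le> x t \<and> x t \<le> real (r t) \<and> 0 \<le> y t \<and> y t \<le> real (r t)) F"
  shows "((\<lambda>t. g (r t) (x t) (y t)) \<longlongrightarrow> G a b) F"
proof -
  have "filterlim (\<lambda>t. (r t, x t, y t)) (cfilt a b) F"
    unfolding cfilt_def filterlim_inf filterlim_principal
    using assms by (auto intro!: filterlim_Pair elim!: eventually_mono)
  then show ?thesis
    using filterlim_compose[of "\<lambda>(n, x, y). g n x y" "nhds (G a b)" "cfilt a b" "\<lambda>t. (r t, x t, y t)" F] assms(1,5,6)
    by (simp add: cconv_def)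
qed

text \<open>The two arguments stand for the mean numbers of points in two regions. Exponential decay
  in both turns a linear lower bound on these numbers, as in \<open>controlled\<close>, into an
  integrable majorant.\<close>

definition kern :: "(nat \<Rightarrow> real \<Rightarrow> real \<Rightarrow> real) \<Rightarrow> (real \<Rightarrow> real \<Rightarrow> real) \<Rightarrow> bool" where
  "kern g G \<longleftrightarrow> cconv g G \<and> (\<forall>n. case_prod (g n) \<in> borel_measurable (borel \<Otimes>\<^sub>M borel)) \<and>
     case_prod G \<in> borel_measurable (borel \<Otimes>\<^sub>M borel) \<and>
     (\<exists>C \<kappa> N. \<kappa> > 0 \<and> C \<ge> 0 \<and> (\<forall>n\<ge>N. \<forall>a b. 0 \<le> a \<longrightarrow> a \<le> real n \<longrightarrow> 0 \<le> b \<longrightarrow> b \<le> real n \<longrightarrow>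
        \<bar>g n a b\<bar> \<le> C * exp (- \<kappa> * (a + b))))"

section \<open>The sampling measure and coordinates centred at the first point\<close>

locale prob_density =
  fixes f :: "'a::euclidean_space \<Rightarrow> real"
  assumes dens: "bounded_prob_density f"
begin

definition pt :: "'a measure" where "pt = density lborel (\<lambda>x. ennreal (f x))"

definition f_sup :: real where "f_sup = (SUP x. f x)"

lemma f_meas [measurable]: "f \<in> borel_measurable borel"
  and f_nonneg: "0 \<le> f x"
  and f_int: "integrable lborel f" "(\<integral>x. f x \<partial>lborel) = 1"
  using dens by (auto simp: bounded_prob_density_def)

lemma f_le: "f x \<le> f_sup"
  unfolding f_sup_def using dens by (intro cSUP_upper) (auto simp: bounded_prob_density_def)

lemma f_sup_nonneg: "0 \<le> f_sup"
  using f_nonneg f_le order_trans by blast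

lemma sets_pt [simp, measurable_cong]: "sets pt = sets borel" and space_pt [simp]: "space pt = UNIV"
  by (simp_all add: pt_def)

lemma prob_space_pt: "prob_space pt"
proof
  have "emeasure pt (space pt) = (\<integral>\<^sup>+x. ennreal (f x) \<partial>lborel)"
    by (simp add: pt_def emeasure_density)
  also have "\<dots> = ennreal 1" using f_int f_nonneg by (subst nn_integral_eq_integral) auto
  finally show "emeasure pt (space pt) = 1" by simp
qed

sublocale pt: prob_space pt by (rule prob_space_pt)

sublocale pt_prod: product_prob_space "\<lambda>_::nat. pt" UNIV
  by standard

abbreviation mass :: "'a set \<Rightarrow> real" where "mass \<equiv> measure pt"

lemma sets_PiM_pt [measurable_cong]: "sets (PiM J (\<lambda>_::nat. pt)) = sets (PiM J (\<lambda>_. lborel))"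
  by (rule sets_PiM_cong) auto

lemma prob_space_PiM_pt: "prob_space (PiM J (\<lambda>_::nat. pt))"
  by (rule prob_space_PiM) (rule prob_space_pt)

lemma nn_integral_PiM_pt:
  assumes J: "finite J" and \<Phi>: "\<Phi> \<in> borel_measurable (PiM J (\<lambda>_::nat. lborel))"
  shows "(\<integral>\<^sup>+z. \<Phi> z \<partial>PiM J (\<lambda>_. pt)) = (\<integral>\<^sup>+z. (\<Prod>i\<in>J. ennreal (f (z i))) * \<Phi> z \<partial>PiM J (\<lambda>_. lborel))"
  using J \<Phi>
proof (induction J arbitrary: \<Phi> rule: finite_induct)
  case empty
  then show ?case by (simp add: lborel_prod.nn_integral_empty pt_prod.nn_integral_empty space_PiM)
next
  case (insert i J)
  have m1: "(\<lambda>(z, y). z(i := y)) \<in> PiM J (\<lambda>_. lborel) \<Otimes>\<^sub>M lborel \<rightarrow>\<^sub>M PiM (insert i J) (\<lambda>_. lborel)"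
    unfolding split_beta' by (rule measurable_fun_upd[where J=J]) auto
  have m2: "(\<lambda>(z, y). \<Phi> (z(i := y))) \<in> borel_measurable (PiM J (\<lambda>_. lborel) \<Otimes>\<^sub>M lborel)"
    using measurable_compose[OF m1 insert.prems] unfolding split_beta' .
  have Pm[measurable]: "(\<lambda>z. \<integral>\<^sup>+y. ennreal (f y) * \<Phi> (z(i := y)) \<partial>lborel) \<in> borel_measurable (PiM J (\<lambda>_. lborel))"
    using m2 unfolding split_beta' by measurable
  have slice: "(\<lambda>y. \<Phi> (z(i := y))) \<in> borel_measurable borel" if z: "z \<in> space (PiM J (\<lambda>_. lborel :: 'a measure))" for z
  proof -
    have "(\<lambda>y. z(i := y)) \<in> borel \<rightarrow>\<^sub>M PiM (insert i J) (\<lambda>_. lborel)"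
      using z by (intro measurable_fun_upd[where J=J]) auto
    then show ?thesis using insert.prems by measurable
  qed
  have sp: "space (PiM J (\<lambda>_. pt)) = space (PiM J (\<lambda>_. lborel :: 'a measure))" by (rule sets_eq_imp_space_eq[OF sets_PiM_pt])
  have "(\<integral>\<^sup>+z. \<Phi> z \<partial>PiM (insert i J) (\<lambda>_. pt)) = (\<integral>\<^sup>+z. \<integral>\<^sup>+y. \<Phi> (z(i := y)) \<partial>pt \<partial>PiM J (\<lambda>_. pt))"
    using insert by (intro pt_prod.product_nn_integral_insert) (simp_all cong: measurable_cong_sets add: sets_PiM_pt)
  also have "\<dots> = (\<integral>\<^sup>+z. \<integral>\<^sup>+y. ennreal (f y) * \<Phi> (z(i := y)) \<partial>lborel \<partial>PiM J (\<lambda>_. pt))"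
  proof (rule nn_integral_cong)
    fix z assume "z \<in> space (PiM J (\<lambda>_. pt))"
    then show "(\<integral>\<^sup>+y. \<Phi> (z(i := y)) \<partial>pt) = (\<integral>\<^sup>+y. ennreal (f y) * \<Phi> (z(i := y)) \<partial>lborel)"
      unfolding pt_def by (intro nn_integral_density) (use slice sp in \<open>auto simp: pt_def\<close>)
  qed
  also have "\<dots> = (\<integral>\<^sup>+z. (\<Prod>j\<in>J. ennreal (f (z j))) * (\<integral>\<^sup>+y. ennreal (f y) * \<Phi> (z(i := y)) \<partial>lborel) \<partial>PiM J (\<lambda>_. lborel))"
    by (rule insert.IH[OF Pm])
  also have "\<dots> = (\<integral>\<^sup>+z. \<integral>\<^sup>+y. (\<Prod>j\<in>insert i J. ennreal (f ((z(i := y)) j))) * \<Phi> (z(i := y)) \<partial>lborel \<partial>PiM J (\<lambda>_. lborel))"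
  proof (rule nn_integral_cong)
    fix z assume z: "z \<in> space (PiM J (\<lambda>_. lborel :: 'a measure))"
    note [measurable] = slice[OF z]
    have "(\<Prod>j\<in>insert i J. ennreal (f ((z(i := y)) j))) = ennreal (f y) * (\<Prod>j\<in>J. ennreal (f (z j)))" for y
    proof -
      have "(\<Prod>j\<in>J. ennreal (f ((z(i := y)) j))) = (\<Prod>j\<in>J. ennreal (f (z j)))"
        using insert.hyps by (intro prod.cong) auto
      then show ?thesis using insert.hyps by simp
    qed
    then show "(\<Prod>j\<in>J. ennreal (f (z j))) * (\<integral>\<^sup>+y. ennreal (f y) * \<Phi> (z(i := y)) \<partial>lborel) =
      (\<integral>\<^sup>+y. (\<Prod>j\<in>insert i J. ennreal (f ((z(i := y)) j))) * \<Phi> (z(i := y)) \<partial>lborel)"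
      by (simp add: nn_integral_cmult[symmetric] ac_simps)
  qed
  also have "\<dots> = (\<integral>\<^sup>+z. (\<Prod>j\<in>insert i J. ennreal (f (z j))) * \<Phi> z \<partial>PiM (insert i J) (\<lambda>_. lborel))"
  proof (rule lborel_prod.product_nn_integral_insert[symmetric])
    show "(\<lambda>z. (\<Prod>j\<in>insert i J. ennreal (f (z j))) * \<Phi> z) \<in> borel_measurable (PiM (insert i J) (\<lambda>_. lborel))"
      using insert.prems by measurable
  qed (use insert in auto)
  finally show ?case .
qed

text \<open>A configuration is encoded by its first point \<open>snd p\<close> and its shape at
  scale \<open>s\<close>. Shapes are indexed by \<open>{Suc 0..<m}\<close>, where coordinate 0 would
  be \<open>undefined\<close>; the update to 0 makes the first point the base point.\<close>

definition spread :: "nat \<Rightarrow> real \<Rightarrow> (nat \<Rightarrow> 'a) \<times> 'a \<Rightarrow> nat \<Rightarrow> 'a" where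
  "spread m s p = (\<lambda>i\<in>{..<m}. snd p + s *\<^sub>R ((fst p)(0 := 0)) i)"

lemma measurable_spread [measurable]:
  "spread m s \<in> PiM {Suc 0..<m} (\<lambda>_. lborel) \<Otimes>\<^sub>M lborel \<rightarrow>\<^sub>M PiM {..<m} (\<lambda>_. lborel)"
  unfolding spread_def
proof (rule measurable_restrict)
  fix i assume "i \<in> {..<m}"
  then show "(\<lambda>p. snd p + s *\<^sub>R ((fst p)(0 := 0)) i) \<in> PiM {Suc 0..<m} (\<lambda>_. lborel) \<Otimes>\<^sub>M lborel \<rightarrow>\<^sub>M (lborel :: 'a measure)"
    by (cases "i = 0") auto
qed

lemma nn_integral_spread:
  assumes m: "m \<ge> 1" and s: "s > 0" and [measurable]: "\<Phi> \<in> borel_measurable (PiM {..<m} (\<lambda>_. lborel))"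
  shows "(\<integral>\<^sup>+w. \<Phi> w \<partial>PiM {..<m} (\<lambda>_. pt)) =
    (\<integral>\<^sup>+p. ennreal (s ^ (DIM('a) * (m - 1))) * (\<Prod>i<m. ennreal (f (spread m s p i))) * \<Phi> (spread m s p)
      \<partial>(PiM {Suc 0..<m} (\<lambda>_. lborel) \<Otimes>\<^sub>M lborel))"
proof -
  let ?J = "{Suc 0..<m}"
  define \<Psi> where "\<Psi> w = (\<Prod>i<m. ennreal (f (w i))) * \<Phi> w" for w
  have \<Psi>m[measurable]: "\<Psi> \<in> borel_measurable (PiM {..<m} (\<lambda>_. lborel))" unfolding \<Psi>_def by measurable
  have ins: "{..<m} = insert 0 ?J" using m by auto
  have mins: "\<Psi> \<in> borel_measurable (PiM (insert 0 ?J) (\<lambda>_. lborel))" by (subst ins[symmetric]) (rule \<Psi>m)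
  interpret Jf: finite_product_sigma_finite "\<lambda>_::nat. lborel :: 'a measure" ?J by standard simp
  interpret P: pair_sigma_finite "PiM ?J (\<lambda>_. lborel :: 'a measure)" "lborel :: 'a measure" ..
  have "(\<integral>\<^sup>+w. \<Phi> w \<partial>PiM {..<m} (\<lambda>_. pt)) = (\<integral>\<^sup>+w. \<Psi> w \<partial>PiM {..<m} (\<lambda>_. lborel))"
    unfolding \<Psi>_def by (rule nn_integral_PiM_pt) simp_all
  also have "\<dots> = (\<integral>\<^sup>+y. \<integral>\<^sup>+z. \<Psi> (z(0 := y)) \<partial>PiM ?J (\<lambda>_. lborel) \<partial>lborel)"
    unfolding ins by (rule lborel_prod.product_nn_integral_insert_rev) (use mins in auto)
  also have "\<dots> = (\<integral>\<^sup>+y. ennreal (s ^ (DIM('a) * (m - 1))) * (\<integral>\<^sup>+z. \<Psi> (spread m s (z, y)) \<partial>PiM ?J (\<lambda>_. lborel)) \<partial>lborel)"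
  proof (rule nn_integral_cong)
    fix y :: 'a
    have upd: "(\<lambda>z. z(0 := y)) \<in> PiM ?J (\<lambda>_. lborel) \<rightarrow>\<^sub>M PiM {..<m} (\<lambda>_. lborel)"
      unfolding ins by (rule measurable_fun_upd[where J="?J"]) auto
    have "(\<integral>\<^sup>+z. \<Psi> (z(0 := y)) \<partial>PiM ?J (\<lambda>_. lborel)) =
      ennreal (s ^ (DIM('a) * card ?J)) * (\<integral>\<^sup>+z. \<Psi> ((\<lambda>i\<in>?J. y + s *\<^sub>R z i)(0 := y)) \<partial>PiM ?J (\<lambda>_. lborel))"
      by (rule nn_integral_PiM_lborel_affine) (use s measurable_compose[OF upd \<Psi>m] in auto)
    moreover have "(\<lambda>i\<in>?J. y + s *\<^sub>R z i)(0 := y) = spread m s (z, y)" for z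
      using m by (auto simp: spread_def fun_eq_iff restrict_def)
    ultimately show "(\<integral>\<^sup>+z. \<Psi> (z(0 := y)) \<partial>PiM ?J (\<lambda>_. lborel)) =
      ennreal (s ^ (DIM('a) * (m - 1))) * (\<integral>\<^sup>+z. \<Psi> (spread m s (z, y)) \<partial>PiM ?J (\<lambda>_. lborel))"
      by simp
  qed
  also have "\<dots> = ennreal (s ^ (DIM('a) * (m - 1))) * (\<integral>\<^sup>+y. \<integral>\<^sup>+z. \<Psi> (spread m s (z, y)) \<partial>PiM ?J (\<lambda>_. lborel) \<partial>lborel)"
    by (rule nn_integral_cmult) measurable
  also have "(\<integral>\<^sup>+y. \<integral>\<^sup>+z. \<Psi> (spread m s (z, y)) \<partial>PiM ?J (\<lambda>_. lborel) \<partial>lborel) =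
      (\<integral>\<^sup>+p. \<Psi> (spread m s p) \<partial>(PiM ?J (\<lambda>_. lborel) \<Otimes>\<^sub>M lborel))"
    by (rule P.nn_integral_snd) simp
  also have "ennreal (s ^ (DIM('a) * (m - 1))) * \<dots> =
      (\<integral>\<^sup>+p. ennreal (s ^ (DIM('a) * (m - 1))) * \<Psi> (spread m s p) \<partial>(PiM ?J (\<lambda>_. lborel) \<Otimes>\<^sub>M lborel))"
    by (rule nn_integral_cmult[symmetric]) simp
  finally show ?thesis by (simp add: \<Psi>_def mult.assoc)
qed

text \<open>Applied to indicators, \<open>nn_integral_spread\<close> says that the law of the sample
  is the image under \<open>spread\<close> of a measure with explicit density. This identity of
  measures carries over to signed bounded integrands, after which Fubini separates shape and base
  point.\<close>

lemma integral_spread: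
  assumes m: "m \<ge> 1" and s: "s > 0" and [measurable]: "\<Phi> \<in> borel_measurable (PiM {..<m} (\<lambda>_. lborel))"
    and bd: "\<And>w. \<bar>\<Phi> w\<bar> \<le> C"
  shows "(\<integral>w. \<Phi> w \<partial>PiM {..<m} (\<lambda>_. pt)) =
    (\<integral>z. \<integral>x. s ^ (DIM('a) * (m - 1)) * (\<Prod>i<m. f (spread m s (z, x) i)) * \<Phi> (spread m s (z, x)) \<partial>lborel
      \<partial>PiM {Suc 0..<m} (\<lambda>_. lborel))"
proof -
  let ?J = "{Suc 0..<m}"
  let ?N = "PiM ?J (\<lambda>_. lborel :: 'a measure) \<Otimes>\<^sub>M (lborel :: 'a measure)"
  let ?P = "PiM {..<m} (\<lambda>_. pt)"
  let ?G = "\<lambda>p. s ^ (DIM('a) * (m - 1)) * (\<Prod>i<m. f (spread m s p i))"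
  interpret Jf: finite_product_sigma_finite "\<lambda>_::nat. lborel :: 'a measure" ?J by standard simp
  interpret P: pair_sigma_finite "PiM ?J (\<lambda>_. lborel :: 'a measure)" "lborel :: 'a measure" ..
  have comp: "(\<lambda>p. spread m s p i) \<in> borel_measurable ?N" if "i < m" for i
    using measurable_compose[OF measurable_spread[of m s] measurable_component_singleton[of i "{..<m}"]] that by simp
  then have Gm[measurable]: "?G \<in> borel_measurable ?N"
    by (intro borel_measurable_times borel_measurable_const borel_measurable_prod) (auto intro: measurable_compose[OF _ f_meas])
  have exp_kernel: "0 \<le> ?G p" for p using s f_nonneg by (intro mult_nonneg_nonneg prod_nonneg) auto
  have spP[measurable]: "spread m s \<in> ?N \<rightarrow>\<^sub>M ?P"
    using measurable_spread[of m s] by (simp cong: measurable_cong_sets add: sets_PiM_pt)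
  have eq: "?P = distr (density ?N (\<lambda>p. ennreal (?G p))) ?P (spread m s)"
  proof (rule measure_eqI)
    fix A assume A: "A \<in> sets ?P"
    then have [measurable]: "A \<in> sets (PiM {..<m} (\<lambda>_. lborel :: 'a measure))" by (simp add: sets_PiM_pt)
    have "emeasure ?P A = (\<integral>\<^sup>+w. indicator A w \<partial>?P)" using A by simp
    also have "\<dots> = (\<integral>\<^sup>+p. ennreal (s ^ (DIM('a) * (m - 1))) * (\<Prod>i<m. ennreal (f (spread m s p i))) *
        indicator A (spread m s p) \<partial>?N)"
      by (rule nn_integral_spread[OF m s]) simp
    also have "\<dots> = (\<integral>\<^sup>+p. ennreal (?G p) * indicator (spread m s -` A \<inter> space ?N) p \<partial>?N)"
      using s by (intro nn_integral_cong) (simp add: ennreal_mult prod_nonneg f_nonneg prod_ennreal split: split_indicator)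
    also have "\<dots> = emeasure (density ?N (\<lambda>p. ennreal (?G p))) (spread m s -` A \<inter> space ?N)"
      by (rule emeasure_density[symmetric, OF measurable_compose[OF Gm measurable_ennreal] measurable_sets[OF spP A]])
    also have "\<dots> = emeasure (distr (density ?N (\<lambda>p. ennreal (?G p))) ?P (spread m s)) A"
      using A spP by (subst emeasure_distr) simp_all
    finally show "emeasure ?P A = emeasure (distr (density ?N (\<lambda>p. ennreal (?G p))) ?P (spread m s)) A" .
  qed simp
  interpret Pp: prob_space ?P by (rule prob_space_PiM_pt)
  have \<Phi>P: "\<Phi> \<in> borel_measurable ?P" using assms(3) by (simp cong: measurable_cong_sets add: sets_PiM_pt)
  have i1: "integrable ?P \<Phi>" by (rule Pp.integrable_const_bound[of _ C]) (use bd \<Phi>P in auto)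
  have spD: "spread m s \<in> density ?N (\<lambda>p. ennreal (?G p)) \<rightarrow>\<^sub>M ?P" using spP by simp
  have \<Phi>N: "(\<lambda>p. \<Phi> (spread m s p)) \<in> borel_measurable ?N" by (rule measurable_compose[OF spP \<Phi>P])
  have "integrable (distr (density ?N (\<lambda>p. ennreal (?G p))) ?P (spread m s)) \<Phi>"
    unfolding eq[symmetric] by (rule i1)
  then have "integrable (density ?N (\<lambda>p. ennreal (?G p))) (\<lambda>p. \<Phi> (spread m s p))"
    by (rule integrable_distr_eq[THEN iffD1, OF spD \<Phi>P])
  then have "integrable ?N (\<lambda>p. ?G p *\<^sub>R \<Phi> (spread m s p))"
    by (rule integrable_density[THEN iffD1, OF \<Phi>N Gm AE_I2[OF exp_kernel]])
  then have i2: "integrable ?N (\<lambda>p. ?G p * \<Phi> (spread m s p))" unfolding real_scaleR_def .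
  have "(\<integral>w. \<Phi> w \<partial>?P) = (\<integral>w. \<Phi> w \<partial>distr (density ?N (\<lambda>p. ennreal (?G p))) ?P (spread m s))"
    unfolding eq[symmetric] ..
  also have "\<dots> = (\<integral>p. \<Phi> (spread m s p) \<partial>density ?N (\<lambda>p. ennreal (?G p)))"
    by (rule integral_distr[OF spD \<Phi>P])
  also have "\<dots> = (\<integral>p. ?G p * \<Phi> (spread m s p) \<partial>?N)"
    by (subst integral_density[OF \<Phi>N Gm AE_I2[OF exp_kernel]]) (simp only: real_scaleR_def)
  also have "\<dots> = (\<integral>z. \<integral>x. ?G (z, x) * \<Phi> (spread m s (z, x)) \<partial>lborel \<partial>PiM ?J (\<lambda>_. lborel))"
    by (rule P.integral_fst'[OF i2, symmetric])
  finally show ?thesis .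
qed

lemma mass_affine:
  assumes [measurable]: "D \<in> sets borel" and bD: "bounded D" and s: "s > 0"
  shows "mass ((\<lambda>y. x + s *\<^sub>R y) ` D) = s ^ DIM('a) * (\<integral>y. f (x + s *\<^sub>R y) * indicator D y \<partial>lborel)"
    and "(\<lambda>y. x + s *\<^sub>R y) ` D \<in> sets borel"
    and "integrable lborel (\<lambda>y. f (x + s *\<^sub>R y) * indicator D y)"
proof -
  let ?A = "(\<lambda>y. x + s *\<^sub>R y) ` D"
  have "?A = (\<lambda>y. (1 / s) *\<^sub>R (y - x)) -` D"
  proof (intro equalityI subsetI)
    fix y assume "y \<in> (\<lambda>y. (1 / s) *\<^sub>R (y - x)) -` D"
    then have "(1 / s) *\<^sub>R (y - x) \<in> D" by simp
    moreover have "y = x + s *\<^sub>R ((1 / s) *\<^sub>R (y - x))" using s by simp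
    ultimately show "y \<in> ?A" by (rule image_eqI[rotated])
  qed (use s in auto)
  also have "\<dots> \<in> sets borel" using measurable_sets_borel[of "\<lambda>y. (1 / s) *\<^sub>R (y - x)" borel D] by simp
  finally show A[measurable]: "?A \<in> sets borel" .
  have fD: "emeasure lborel D < \<infinity>" by (rule emeasure_bounded_finite[OF bD])
  have iD: "integrable lborel (\<lambda>y. f_sup * indicator D y :: real)" using fD by simp
  show int: "integrable lborel (\<lambda>y. f (x + s *\<^sub>R y) * indicator D y)"
    by (rule Bochner_Integration.integrable_bound[OF iD]) (auto simp: f_nonneg f_sup_nonneg f_le split: split_indicator)
  have "emeasure pt ?A = (\<integral>\<^sup>+y. ennreal (f y) * indicator ?A y \<partial>lborel)"
    unfolding pt_def by (rule emeasure_density) auto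
  also have "\<dots> = ennreal (s ^ DIM('a)) * (\<integral>\<^sup>+y. ennreal (f (x + s *\<^sub>R y)) * indicator ?A (x + s *\<^sub>R y) \<partial>lborel)"
    by (rule nn_integral_lborel_affine[OF _ s]) simp
  also have "(\<integral>\<^sup>+y. ennreal (f (x + s *\<^sub>R y)) * indicator ?A (x + s *\<^sub>R y) \<partial>lborel) =
      (\<integral>\<^sup>+y. ennreal (f (x + s *\<^sub>R y) * indicator D y) \<partial>lborel)"
    using s by (intro nn_integral_cong) (auto split: split_indicator)
  also have "\<dots> = ennreal (\<integral>y. f (x + s *\<^sub>R y) * indicator D y \<partial>lborel)"
    by (rule nn_integral_eq_integral[OF int]) (simp add: f_nonneg)
  finally have "emeasure pt ?A = ennreal (s ^ DIM('a) * (\<integral>y. f (x + s *\<^sub>R y) * indicator D y \<partial>lborel))"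
    using s by (simp add: ennreal_mult f_nonneg)
  then show "mass ?A = s ^ DIM('a) * (\<integral>y. f (x + s *\<^sub>R y) * indicator D y \<partial>lborel)"
    using s by (simp add: measure_def f_nonneg)
qed

lemma mass_affine_measurable [measurable]:
  assumes [measurable]: "D \<in> sets borel" and bD: "bounded D" and s: "s > 0"
  shows "(\<lambda>x. mass ((\<lambda>y. x + s *\<^sub>R y) ` D)) \<in> borel_measurable borel"
  unfolding mass_affine(1)[OF assms] by measurable

end

text \<open>On the product over \<open>J\<close> every coordinate outside \<open>J\<close> is the
  constant \<open>undefined\<close>, so the inclusion into all functions is measurable. Borel
  measurability on \<open>nat \<Rightarrow> 'a\<close> therefore serves every index set at
  once.\<close>

lemma borel_measurable_PiM_id:
  "(\<lambda>w. w) \<in> PiM J (\<lambda>_::nat. lborel :: 'a::euclidean_space measure) \<rightarrow>\<^sub>M (borel :: (nat \<Rightarrow> 'a) measure)"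
proof (rule measurable_coordinatewise_then_product)
  fix i :: nat
  show "(\<lambda>w. w i) \<in> borel_measurable (PiM J (\<lambda>_. lborel :: 'a measure))"
  proof (cases "i \<in> J")
    case True
    then show ?thesis using measurable_component_singleton[OF True, of "\<lambda>_. lborel :: 'a measure"] by simp
  next
    case False
    have "(\<lambda>w. undefined :: 'a) \<in> borel_measurable (PiM J (\<lambda>_. lborel :: 'a measure))" by simp
    moreover have "w i = undefined" if "w \<in> space (PiM J (\<lambda>_. lborel :: 'a measure))" for w
      using that False by (auto simp: space_PiM PiE_def extensional_def)
    ultimately show ?thesis by (subst measurable_cong[where g="\<lambda>_. undefined"]) auto
  qed
qed

text \<open>The interface of the local limit lemma: an event, a radius and two regions that follow
  the configuration under similarities. Two regions are provided because products of two emptiness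
  probabilities occur besides those of a union, for which the second region is empty.\<close>

definition config :: "nat \<Rightarrow> ((nat \<Rightarrow> 'a::euclidean_space) \<Rightarrow> bool) \<Rightarrow> ((nat \<Rightarrow> 'a) \<Rightarrow> real) \<Rightarrow>
    ((nat \<Rightarrow> 'a) \<Rightarrow> 'a set) \<Rightarrow> ((nat \<Rightarrow> 'a) \<Rightarrow> 'a set) \<Rightarrow> bool" where
  "config m U \<rho> D1 D2 \<longleftrightarrow> Measurable.pred borel U \<and> \<rho> \<in> borel_measurable borel \<and>
     {p. snd p \<in> D1 (fst p)} \<in> sets (borel \<Otimes>\<^sub>M borel) \<and> {p. snd p \<in> D2 (fst p)} \<in> sets (borel \<Otimes>\<^sub>M borel) \<and>
     (\<forall>w. bounded (D1 w)) \<and> (\<forall>w. bounded (D2 w)) \<and>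
     (\<forall>x t w z. t > 0 \<longrightarrow> (\<forall>i<m. w i = x + t *\<^sub>R z i) \<longrightarrow>
        (U w \<longleftrightarrow> U z) \<and> \<rho> w = t * \<rho> z \<and> D1 w = (\<lambda>y. x + t *\<^sub>R y) ` D1 z \<and> D2 w = (\<lambda>y. x + t *\<^sub>R y) ` D2 z)"

context prob_density
begin

lemma mass_measurable:
  assumes "{p. snd p \<in> D (fst p)} \<in> sets ((borel :: 'b measure) \<Otimes>\<^sub>M (borel :: 'a measure))"
  shows "(\<lambda>w. mass (D w)) \<in> borel_measurable (borel :: 'b::topological_space measure)"
proof -
  have "sets ((borel :: 'b measure) \<Otimes>\<^sub>M pt) = sets (borel \<Otimes>\<^sub>M borel)" by (intro sets_pair_measure_cong) auto
  then have "(\<lambda>w. emeasure pt (Pair w -` {p. snd p \<in> D (fst p)})) \<in> borel_measurable (borel :: 'b measure)"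
    using assms by (intro pt.measurable_emeasure_Pair) simp
  then show ?thesis by (simp add: measure_def vimage_def)
qed

lemma slice_borel:
  assumes "{p. snd p \<in> D (fst p)} \<in> sets ((borel :: 'b::topological_space measure) \<Otimes>\<^sub>M (borel :: 'a measure))"
  shows "D w \<in> sets borel"
  using sets_Pair1[OF assms, of w] by (simp add: vimage_def)

end

text \<open>The length scale \<open>s\<close> is \<open>r\<close> itself if \<open>\<lambda> < \<infinity>\<close> and \<open>n\<^sup>-\<^sup>1\<^sup>/\<^sup>d\<close> if \<open>\<lambda> = \<infinity>\<close>; \<open>W\<close> is the limit of the constraint
  \<open>\<rho> \<le> r\<close> on the rescaled radius, namely \<open>\<rho> \<le> 1\<close> and no constraint, respectively.\<close>
locale scaling = prob_density f for f :: "'a::euclidean_space \<Rightarrow> real" +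
  fixes s r :: "nat \<Rightarrow> real" and \<beta> :: real and W :: "real \<Rightarrow> bool"
  assumes s_pos: "\<And>n. s n > 0" and s_lim: "s \<longlonglongrightarrow> 0" and \<beta>_pos: "\<beta> > 0"
    and \<beta>_lim: "(\<lambda>n. real n * s n ^ DIM('a)) \<longlonglongrightarrow> \<beta>"
    and W_lim: "\<And>t. eventually (\<lambda>n. (t \<le> r n / s n) = W t) sequentially"
begin

abbreviation blow :: "nat \<Rightarrow> 'a \<Rightarrow> 'a set \<Rightarrow> 'a set" where
  "blow n x D \<equiv> (\<lambda>y. x + s n *\<^sub>R y) ` D"

text \<open>After substitution the scaled mass is \<open>real n * s n ^ DIM('a)\<close> times the
  integral of \<open>f (x + s n *\<^sub>R y)\<close> over \<open>D\<close>. The error splits into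
  the deviation of the prefactor from \<open>\<beta>\<close> and an average over \<open>y\<close> in
  \<open>D\<close> of translation errors, each tending to 0 by \<open>translation_L1\<close> and
  bounded by 2.\<close>

lemma mass_L1:
  assumes D[measurable]: "D \<in> sets borel" and bD: "bounded D"
  shows "integrable lborel (\<lambda>x. \<bar>real n * mass (blow n x D) - \<beta> * f x * measure lborel D\<bar>)"
    and "(\<lambda>n. \<integral>x. \<bar>real n * mass (blow n x D) - \<beta> * f x * measure lborel D\<bar> \<partial>lborel) \<longlonglongrightarrow> 0"
proof -
  let ?L = "measure lborel D"
  have fD: "emeasure lborel D < \<infinity>" by (rule emeasure_bounded_finite[OF bD])
  have iD: "integrable lborel (\<lambda>y. c * indicator D y :: real)" for c using fD by simp
  define \<delta> where "\<delta> v = (\<integral>x. \<bar>f (x + v) - f x\<bar> \<partial>lborel)" for v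
  note fv = integrable_translation[OF f_int(1)]
  have \<delta>0: "0 \<le> \<delta> v" for v by (simp add: \<delta>_def)
  have \<delta>2: "\<delta> v \<le> 2" for v
  proof -
    have "\<delta> v \<le> (\<integral>x. f (x + v) + f x \<partial>lborel)"
      unfolding \<delta>_def using fv(1) f_int(1) f_nonneg by (intro integral_mono) (auto simp: abs_le_iff add_increasing add_increasing2)
    also have "\<dots> = 2" using fv f_int by simp
    finally show ?thesis .
  qed
  define K where "K n y x = indicator D y * \<bar>f (x + s n *\<^sub>R y) - f x\<bar>" for n y x
  define H where "H n y x = indicator D y * f (x + s n *\<^sub>R y)" for n y x
  have Km[measurable]: "(\<lambda>(y, x). K n y x) \<in> borel_measurable (lborel \<Otimes>\<^sub>M lborel)" for n
    unfolding K_def split_beta' by measurable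
  have Hm[measurable]: "(\<lambda>(y, x). H n y x) \<in> borel_measurable (lborel \<Otimes>\<^sub>M lborel)" for n
    unfolding H_def split_beta' by measurable
  have \<delta>m: "(\<lambda>y. \<delta> (s n *\<^sub>R y)) \<in> borel_measurable lborel" for n
    unfolding \<delta>_def by measurable
  have \<delta>i: "integrable lborel (\<lambda>y. indicator D y * \<delta> (s n *\<^sub>R y))" for n
    by (rule Bochner_Integration.integrable_bound[OF iD[of 2]])
      (use \<delta>m \<delta>0 \<delta>2 in \<open>auto split: split_indicator\<close>)
  have Ky: "(\<integral>x. K n y x \<partial>lborel) = indicator D y * \<delta> (s n *\<^sub>R y)" for n y
    by (simp add: K_def \<delta>_def)
  have Hy: "(\<integral>x. H n y x \<partial>lborel) = indicator D y" for n y
    using fv f_int by (simp add: H_def)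
  have Kint: "integrable (lborel \<Otimes>\<^sub>M lborel) (\<lambda>(y, x). K n y x)" for n
  proof (rule lborel_pair.Fubini_integrable)
    have "norm (K n y x) = K n y x" for y x by (simp add: K_def)
    then show "integrable lborel (\<lambda>y. \<integral>x. norm (case (y, x) of (y, x) \<Rightarrow> K n y x) \<partial>lborel)"
      using \<delta>i by (simp add: Ky)
    show "AE y in lborel. integrable lborel (\<lambda>x. case (y, x) of (y, x) \<Rightarrow> K n y x)"
      using fv f_int by (simp add: K_def)
  qed (rule Km)
  have Hint: "integrable (lborel \<Otimes>\<^sub>M lborel) (\<lambda>(y, x). H n y x)" for n
  proof (rule lborel_pair.Fubini_integrable)
    have "norm (H n y x) = H n y x" for y x by (simp add: H_def f_nonneg)
    then show "integrable lborel (\<lambda>y. \<integral>x. norm (case (y, x) of (y, x) \<Rightarrow> H n y x) \<partial>lborel)"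
      using iD[of 1] by (simp add: Hy)
    show "AE y in lborel. integrable lborel (\<lambda>x. case (y, x) of (y, x) \<Rightarrow> H n y x)"
      using fv f_int by (simp add: H_def)
  qed (rule Hm)
  have Kx: "integrable lborel (\<lambda>x. \<integral>y. K n y x \<partial>lborel)"
      "(\<integral>x. \<integral>y. K n y x \<partial>lborel \<partial>lborel) = (\<integral>y. indicator D y * \<delta> (s n *\<^sub>R y) \<partial>lborel)" for n
    using lborel_pair.integrable_snd[OF Kint] lborel_pair.Fubini_integral[OF Kint] by (simp_all add: Ky)
  have Hx: "integrable lborel (\<lambda>x. \<integral>y. H n y x \<partial>lborel)"
      "(\<integral>x. \<integral>y. H n y x \<partial>lborel \<partial>lborel) = ?L" for n
    using lborel_pair.integrable_snd[OF Hint] lborel_pair.Fubini_integral[OF Hint] by (simp_all add: Hy)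
  let ?b = "\<lambda>n. real n * s n ^ DIM('a)"
  have pw: "\<bar>real n * mass (blow n x D) - \<beta> * f x * ?L\<bar> \<le> \<bar>?b n - \<beta>\<bar> * (\<integral>y. H n y x \<partial>lborel) + \<beta> * (\<integral>y. K n y x \<partial>lborel)" for n x
  proof -
    note iH = mass_affine(3)[OF D bD s_pos, of x n]
    have m: "real n * mass (blow n x D) = ?b n * (\<integral>y. H n y x \<partial>lborel)"
      unfolding mass_affine(1)[OF D bD s_pos] by (simp add: H_def mult.commute)
    have i1: "integrable lborel (\<lambda>y. H n y x)" using iH by (simp add: H_def mult.commute)
    have i2: "integrable lborel (\<lambda>y. f x * indicator D y)" by (rule iD)
    have "(\<integral>y. H n y x \<partial>lborel) - f x * ?L = (\<integral>y. H n y x - f x * indicator D y \<partial>lborel)"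
      using i1 i2 fD by simp
    also have "\<bar>\<dots>\<bar> \<le> (\<integral>y. \<bar>H n y x - f x * indicator D y\<bar> \<partial>lborel)" by (rule integral_abs_bound)
    also have "\<dots> = (\<integral>y. K n y x \<partial>lborel)"
      by (rule Bochner_Integration.integral_cong) (auto simp: H_def K_def split: split_indicator)
    finally have 1: "\<bar>(\<integral>y. H n y x \<partial>lborel) - f x * ?L\<bar> \<le> (\<integral>y. K n y x \<partial>lborel)" .
    have H0: "0 \<le> (\<integral>y. H n y x \<partial>lborel)" by (simp add: H_def f_nonneg)
    have "real n * mass (blow n x D) - \<beta> * f x * ?L =
        (?b n - \<beta>) * (\<integral>y. H n y x \<partial>lborel) + \<beta> * ((\<integral>y. H n y x \<partial>lborel) - f x * ?L)"
      unfolding m by (simp add: algebra_simps)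
    also have "\<bar>\<dots>\<bar> \<le> \<bar>?b n - \<beta>\<bar> * (\<integral>y. H n y x \<partial>lborel) + \<beta> * \<bar>(\<integral>y. H n y x \<partial>lborel) - f x * ?L\<bar>"
      using abs_triangle_ineq[of "(?b n - \<beta>) * (\<integral>y. H n y x \<partial>lborel)" "\<beta> * ((\<integral>y. H n y x \<partial>lborel) - f x * ?L)"] H0 \<beta>_pos
      by (simp add: abs_mult)
    also have "\<dots> \<le> \<bar>?b n - \<beta>\<bar> * (\<integral>y. H n y x \<partial>lborel) + \<beta> * (\<integral>y. K n y x \<partial>lborel)"
      using 1 \<beta>_pos by simp
    finally show ?thesis .
  qed
  have ib: "integrable lborel (\<lambda>x. \<bar>?b n - \<beta>\<bar> * (\<integral>y. H n y x \<partial>lborel) + \<beta> * (\<integral>y. K n y x \<partial>lborel))" for n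
    using Hx(1) Kx(1) by simp
  have [measurable]: "(\<lambda>x. mass (blow n x D)) \<in> borel_measurable borel" for n
    by (rule mass_affine_measurable[OF D bD s_pos])
  show int: "integrable lborel (\<lambda>x. \<bar>real n * mass (blow n x D) - \<beta> * f x * ?L\<bar>)" for n
  proof (rule Bochner_Integration.integrable_bound[OF ib[of n]])
    show "AE x in lborel. norm \<bar>real n * mass (blow n x D) - \<beta> * f x * ?L\<bar> \<le>
        norm (\<bar>?b n - \<beta>\<bar> * (\<integral>y. H n y x \<partial>lborel) + \<beta> * (\<integral>y. K n y x \<partial>lborel))"
      using pw by (auto intro: order_trans[OF _ abs_ge_self])
  qed simp
  have ub: "(\<integral>x. \<bar>real n * mass (blow n x D) - \<beta> * f x * ?L\<bar> \<partial>lborel) \<le>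
     \<bar>?b n - \<beta>\<bar> * ?L + \<beta> * (\<integral>y. indicator D y * \<delta> (s n *\<^sub>R y) \<partial>lborel)" for n
  proof -
    have "(\<integral>x. \<bar>real n * mass (blow n x D) - \<beta> * f x * ?L\<bar> \<partial>lborel) \<le>
      (\<integral>x. \<bar>?b n - \<beta>\<bar> * (\<integral>y. H n y x \<partial>lborel) + \<beta> * (\<integral>y. K n y x \<partial>lborel) \<partial>lborel)"
      using int ib pw by (intro integral_mono) auto
    also have "\<dots> = \<bar>?b n - \<beta>\<bar> * ?L + \<beta> * (\<integral>y. indicator D y * \<delta> (s n *\<^sub>R y) \<partial>lborel)"
      using Hx Kx by simp
    finally show ?thesis .
  qed
  have "(\<lambda>n. \<integral>y. indicator D y * \<delta> (s n *\<^sub>R y) \<partial>lborel) \<longlonglongrightarrow> (\<integral>y. 0 \<partial>(lborel :: 'a measure))"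
  proof (rule integral_dominated_convergence[OF _ _ iD[of 2]])
    show "AE y in lborel. (\<lambda>n. indicator D y * \<delta> (s n *\<^sub>R y)) \<longlonglongrightarrow> 0"
    proof (rule AE_I2)
      fix y :: 'a
      have "(\<lambda>n. s n *\<^sub>R y) \<longlonglongrightarrow> 0" using tendsto_scaleR[OF s_lim tendsto_const, of y] by simp
      from tendsto_mult[OF tendsto_const translation_L1[OF f_int(1) this]]
      show "(\<lambda>n. indicator D y * \<delta> (s n *\<^sub>R y)) \<longlonglongrightarrow> 0" by (simp add: \<delta>_def)
    qed
    show "(\<lambda>y. indicator D y * \<delta> (s n *\<^sub>R y)) \<in> borel_measurable lborel" for n using \<delta>i by blast
    show "AE y in lborel. norm (indicator D y * \<delta> (s n *\<^sub>R y)) \<le> 2 * indicator D y" for n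
      using \<delta>0 \<delta>2 by (auto split: split_indicator)
  qed simp
  moreover have "(\<lambda>n. \<bar>?b n - \<beta>\<bar>) \<longlonglongrightarrow> \<bar>\<beta> - \<beta>\<bar>" by (intro tendsto_rabs tendsto_diff tendsto_const \<beta>_lim)
  ultimately have "(\<lambda>n. \<bar>?b n - \<beta>\<bar> * ?L + \<beta> * (\<integral>y. indicator D y * \<delta> (s n *\<^sub>R y) \<partial>lborel)) \<longlonglongrightarrow> \<bar>\<beta> - \<beta>\<bar> * ?L + \<beta> * (\<integral>y. 0 \<partial>(lborel :: 'a measure))"
    by (intro tendsto_add tendsto_mult tendsto_const)
  then have lim: "(\<lambda>n. \<bar>?b n - \<beta>\<bar> * ?L + \<beta> * (\<integral>y. indicator D y * \<delta> (s n *\<^sub>R y) \<partial>lborel)) \<longlonglongrightarrow> 0" by simp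
  show "(\<lambda>n. \<integral>x. \<bar>real n * mass (blow n x D) - \<beta> * f x * ?L\<bar> \<partial>lborel) \<longlonglongrightarrow> 0"
    by (rule tendsto_sandwich[OF _ _ tendsto_const lim]) (use ub in auto)
qed

lemma mass_le: "real n * mass D \<le> real n"
  using pt.prob_le_1[of D] by (simp add: mult_left_le)

text \<open>The function \<open>u n\<close> collects all errors at the base point and tends to 0 in
  mean. Along a subsequence it tends to 0 almost everywhere, and there the integrand converges by
  \<open>cconv\<close>. Because \<open>z 0 = 0\<close>, one density factor is \<open>f x\<close>
  itself, which supplies the integrable majorant.\<close>

lemma inner_limit:
  assumes m: "m \<ge> 1" and z0: "z 0 = 0"
    and D1: "D1 \<in> sets borel" "bounded D1" and D2: "D2 \<in> sets borel" "bounded D2"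
    and g: "cconv g G" and gm: "\<And>n. case_prod (g n) \<in> borel_measurable (borel \<Otimes>\<^sub>M borel)"
    and Gm: "case_prod G \<in> borel_measurable (borel \<Otimes>\<^sub>M borel)"
    and bd: "\<And>n a b. n \<ge> N \<Longrightarrow> 0 \<le> a \<Longrightarrow> a \<le> real n \<Longrightarrow> 0 \<le> b \<Longrightarrow> b \<le> real n \<Longrightarrow> \<bar>g n a b\<bar> \<le> C"
  shows "(\<lambda>n. \<integral>x. (\<Prod>i<m. f (x + s n *\<^sub>R z i)) * g n (real n * mass (blow n x D1)) (real n * mass (blow n x D2)) \<partial>lborel)
    \<longlonglongrightarrow> (\<integral>x. f x ^ m * G (\<beta> * f x * measure lborel D1) (\<beta> * f x * measure lborel D2) \<partial>lborel)"
proof -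
  define u where "u n x = (\<Sum>i<m. \<bar>f (x + s n *\<^sub>R z i) - f x\<bar>) +
     \<bar>real n * mass (blow n x D1) - \<beta> * f x * measure lborel D1\<bar> +
     \<bar>real n * mass (blow n x D2) - \<beta> * f x * measure lborel D2\<bar>" for n x
  have fi: "integrable lborel (\<lambda>x. \<bar>f (x + s n *\<^sub>R z i) - f x\<bar>)" for n i
    using integrable_translation(1)[OF f_int(1)] f_int(1) by auto
  have ui: "integrable lborel (u n)" for n
    unfolding u_def using fi mass_L1(1)[OF D1] mass_L1(1)[OF D2] by auto
  have u0: "0 \<le> u n x" for n x by (simp add: u_def sum_nonneg)
  have "(\<lambda>n. (\<Sum>i<m. \<integral>x. \<bar>f (x + s n *\<^sub>R z i) - f x\<bar> \<partial>lborel) +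
     (\<integral>x. \<bar>real n * mass (blow n x D1) - \<beta> * f x * measure lborel D1\<bar> \<partial>lborel) +
     (\<integral>x. \<bar>real n * mass (blow n x D2) - \<beta> * f x * measure lborel D2\<bar> \<partial>lborel)) \<longlonglongrightarrow> (\<Sum>i<m. 0) + 0 + 0"
  proof (intro tendsto_add tendsto_sum mass_L1(2)[OF D1] mass_L1(2)[OF D2])
    fix i
    have "(\<lambda>n. s n *\<^sub>R z i) \<longlonglongrightarrow> 0" using tendsto_scaleR[OF s_lim tendsto_const, of "z i"] by simp
    then show "(\<lambda>n. \<integral>x. \<bar>f (x + s n *\<^sub>R z i) - f x\<bar> \<partial>lborel) \<longlonglongrightarrow> 0" by (rule translation_L1[OF f_int(1)])
  qed
  moreover have "(\<integral>x. u n x \<partial>lborel) = (\<Sum>i<m. \<integral>x. \<bar>f (x + s n *\<^sub>R z i) - f x\<bar> \<partial>lborel) +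
     (\<integral>x. \<bar>real n * mass (blow n x D1) - \<beta> * f x * measure lborel D1\<bar> \<partial>lborel) +
     (\<integral>x. \<bar>real n * mass (blow n x D2) - \<beta> * f x * measure lborel D2\<bar> \<partial>lborel)" for n
    unfolding u_def using fi mass_L1(1)[OF D1, of n] mass_L1(1)[OF D2, of n]
    by (simp add: Bochner_Integration.integral_add Bochner_Integration.integral_sum)
  ultimately have ulim: "(\<lambda>n. \<integral>x. u n x \<partial>lborel) \<longlonglongrightarrow> 0" by simp
  have [measurable]: "(\<lambda>x. mass (blow n x D1)) \<in> borel_measurable borel" "(\<lambda>x. mass (blow n x D2)) \<in> borel_measurable borel" for n
    using mass_affine_measurable D1 D2 s_pos by blast+
  note [measurable] = measurable_compose[OF measurable_Pair gm, unfolded split_conv prod.case]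
     measurable_compose[OF measurable_Pair Gm, unfolded split_conv prod.case]
  show ?thesis
  proof (rule tendsto_subsubseq)
    fix q :: "nat \<Rightarrow> nat" assume q: "strict_mono q"
    have "(\<lambda>n. \<integral>x. norm (u (q n) x) \<partial>lborel) \<longlonglongrightarrow> 0"
      using LIMSEQ_subseq_LIMSEQ[OF ulim q] u0 by (simp add: comp_def)
    then obtain q' where q': "strict_mono q'" and ae: "AE x in lborel. (\<lambda>n. u (q (q' n)) x) \<longlonglongrightarrow> 0"
      using tendsto_L1_AE_subseq[of lborel "\<lambda>n. u (q n)"] ui by blast
    define p where "p n = q (q' n)" for n
    have p: "strict_mono p" using q q' by (simp add: p_def strict_mono_def)
    have pinf: "filterlim p sequentially sequentially" by (rule filterlim_subseq[OF p])
    define X where "X n x = (\<Prod>i<m. f (x + s n *\<^sub>R z i)) * g n (real n * mass (blow n x D1)) (real n * mass (blow n x D2))" for n x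
    have Xm: "X n \<in> borel_measurable borel" for n unfolding X_def by measurable
    obtain n0 where n0: "\<And>n. n \<ge> n0 \<Longrightarrow> p n \<ge> N"
      using pinf unfolding filterlim_at_top eventually_sequentially by blast
    have "(\<lambda>n. \<integral>x. X (p (n + n0)) x \<partial>lborel) \<longlonglongrightarrow>
       (\<integral>x. f x ^ m * G (\<beta> * f x * measure lborel D1) (\<beta> * f x * measure lborel D2) \<partial>lborel)"
    proof (rule integral_dominated_convergence)
      show "integrable lborel (\<lambda>x. f x * (f_sup ^ (m - 1) * \<bar>C\<bar>))" using f_int(1) by simp
      show "AE x in lborel. (\<lambda>n. X (p (n + n0)) x) \<longlonglongrightarrow> f x ^ m * G (\<beta> * f x * measure lborel D1) (\<beta> * f x * measure lborel D2)"
        using ae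
      proof eventually_elim
        case (elim x)
        then have ux: "(\<lambda>n. u (p n) x) \<longlonglongrightarrow> 0" by (simp add: p_def)
        have sq: "h \<longlonglongrightarrow> l" if "\<And>n. \<bar>h n - l\<bar> \<le> u (p n) x" for h :: "nat \<Rightarrow> real" and l
        proof -
          have "(\<lambda>n. h n - l) \<longlonglongrightarrow> 0"
            by (rule Lim_null_comparison[OF _ ux]) (use that in auto)
          then show ?thesis by (simp add: LIM_zero_iff)
        qed
        have 1: "(\<lambda>n. f (x + s (p n) *\<^sub>R z i)) \<longlonglongrightarrow> f x" if "i < m" for i
        proof (rule sq)
          fix n
          have "\<bar>f (x + s (p n) *\<^sub>R z i) - f x\<bar> \<le> (\<Sum>i<m. \<bar>f (x + s (p n) *\<^sub>R z i) - f x\<bar>)"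
            using that by (intro member_le_sum) auto
          then show "\<bar>f (x + s (p n) *\<^sub>R z i) - f x\<bar> \<le> u (p n) x" by (simp add: u_def)
        qed
        have 2: "(\<lambda>n. real (p n) * mass (blow (p n) x D1)) \<longlonglongrightarrow> \<beta> * f x * measure lborel D1"
          by (rule sq) (simp add: u_def sum_nonneg)
        have 3: "(\<lambda>n. real (p n) * mass (blow (p n) x D2)) \<longlonglongrightarrow> \<beta> * f x * measure lborel D2"
          by (rule sq) (simp add: u_def sum_nonneg)
        have "(\<lambda>n. X (p n) x) \<longlonglongrightarrow> (\<Prod>i<m. f x) * G (\<beta> * f x * measure lborel D1) (\<beta> * f x * measure lborel D2)"
          unfolding X_def
        proof (intro tendsto_mult tendsto_prod)
          show "(\<lambda>n. g (p n) (real (p n) * mass (blow (p n) x D1)) (real (p n) * mass (blow (p n) x D2)))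
              \<longlonglongrightarrow> G (\<beta> * f x * measure lborel D1) (\<beta> * f x * measure lborel D2)"
            by (rule cconv_seq[OF g pinf 2 3]) (use \<beta>_pos f_nonneg mass_le in auto)
        qed (use 1 in auto)
        then show ?case using LIMSEQ_ignore_initial_segment[of "\<lambda>n. X (p n) x" _ n0] by simp
      qed
      show "AE x in lborel. norm (X (p (n + n0)) x) \<le> f x * (f_sup ^ (m - 1) * \<bar>C\<bar>)" for n
      proof (rule AE_I2)
        fix x
        have "{..<m} = insert 0 {Suc 0..<m}" using m by auto
        then have "(\<Prod>i<m. f (x + s k *\<^sub>R z i)) = f x * (\<Prod>i\<in>{Suc 0..<m}. f (x + s k *\<^sub>R z i))" for k using z0 by simp
        moreover have "(\<Prod>i\<in>{Suc 0..<m}. f (x + s k *\<^sub>R z i)) \<le> (\<Prod>i\<in>{Suc 0..<m}. f_sup)" for k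
          by (intro prod_mono) (auto simp: f_nonneg f_le)
        ultimately have "(\<Prod>i<m. f (x + s k *\<^sub>R z i)) \<le> f x * f_sup ^ (m - 1)" for k
          by (simp add: mult_left_mono f_nonneg)
        moreover have "\<bar>g k (real k * mass (blow k x D1)) (real k * mass (blow k x D2))\<bar> \<le> \<bar>C\<bar>" if "k \<ge> N" for k
          using bd[OF that, of "real k * mass (blow k x D1)" "real k * mass (blow k x D2)"] mass_le by force
        ultimately have "(\<Prod>i<m. f (x + s k *\<^sub>R z i)) * \<bar>g k (real k * mass (blow k x D1)) (real k * mass (blow k x D2))\<bar>
            \<le> (f x * f_sup ^ (m - 1)) * \<bar>C\<bar>" if "k \<ge> N" for k
          using that f_nonneg f_sup_nonneg by (intro mult_mono) (auto simp: prod_nonneg)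
        then show "norm (X (p (n + n0)) x) \<le> f x * (f_sup ^ (m - 1) * \<bar>C\<bar>)"
          using n0[of "n + n0"] by (simp add: X_def abs_mult prod_nonneg f_nonneg mult.assoc)
      qed
    qed (use Xm in simp_all)
    then have "(\<lambda>n. \<integral>x. X (p n) x \<partial>lborel) \<longlonglongrightarrow>
       (\<integral>x. f x ^ m * G (\<beta> * f x * measure lborel D1) (\<beta> * f x * measure lborel D2) \<partial>lborel)"
      by (rule LIMSEQ_offset)
    then show "\<exists>q'. strict_mono q' \<and> (\<lambda>n. \<integral>x. (\<Prod>i<m. f (x + s (q (q' n)) *\<^sub>R z i)) *
        g (q (q' n)) (real (q (q' n)) * mass (blow (q (q' n)) x D1)) (real (q (q' n)) * mass (blow (q (q' n)) x D2)) \<partial>lborel)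
       \<longlonglongrightarrow> (\<integral>x. f x ^ m * G (\<beta> * f x * measure lborel D1) (\<beta> * f x * measure lborel D2) \<partial>lborel)"
      using q' unfolding X_def p_def by blast
  qed
qed

text \<open>A coercivity condition: extended shapes must catch many points in their two regions. It
  is asked only where all points have positive density, since other configurations carry no weight
  in the integral.\<close>

definition controlled :: "nat \<Rightarrow> ((nat \<Rightarrow> 'a) \<Rightarrow> bool) \<Rightarrow> ((nat \<Rightarrow> 'a) \<Rightarrow> real) \<Rightarrow>
    ((nat \<Rightarrow> 'a) \<Rightarrow> 'a set) \<Rightarrow> ((nat \<Rightarrow> 'a) \<Rightarrow> 'a set) \<Rightarrow> bool" where
  "controlled m U \<rho> D1 D2 \<longleftrightarrow> (\<exists>c C. c > 0 \<and> eventually (\<lambda>n. \<forall>x z. z 0 = 0 \<longrightarrow> (\<forall>i<m. f (x + s n *\<^sub>R z i) > 0) \<longrightarrow> U z \<longrightarrow> \<rho> z \<le> r n / s n \<longrightarrow>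
      c * (\<Sum>i<m. norm (z i)) - C \<le> real n * mass (blow n x (D1 z)) + real n * mass (blow n x (D2 z))) sequentially)"

definition limint :: "nat \<Rightarrow> ((nat \<Rightarrow> 'a) \<Rightarrow> bool) \<Rightarrow> ((nat \<Rightarrow> 'a) \<Rightarrow> real) \<Rightarrow>
    ((nat \<Rightarrow> 'a) \<Rightarrow> 'a set) \<Rightarrow> ((nat \<Rightarrow> 'a) \<Rightarrow> 'a set) \<Rightarrow> (real \<Rightarrow> real \<Rightarrow> real) \<Rightarrow> (nat \<Rightarrow> 'a) \<Rightarrow> real" where
  "limint m U \<rho> D1 D2 G z = (if U z \<and> W (\<rho> z) then
     (\<integral>x. f x ^ m * G (\<beta> * f x * measure lborel (D1 z)) (\<beta> * f x * measure lborel (D2 z)) \<partial>lborel) else 0)"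

text \<open>For a fixed shape the base point is handled by \<open>inner_limit\<close>; over shapes,
  the decay in \<open>kern\<close> combined with \<open>controlled\<close> gives a majorant that is
  a product of exponentials in the norms. The factor \<open>n ^ (m - 1)\<close> pairs with the
  Jacobian of the \<open>m - 1\<close> free points to give \<open>\<beta> ^ (m - 1)\<close>.\<close>

lemma local_limit:
  assumes m: "m \<ge> 1" and cfg: "config m U \<rho> D1 D2" and kern: "kern g G" and ctrl: "controlled m U \<rho> D1 D2"
  shows "(\<lambda>n. real n ^ (m - 1) * (\<integral>w. (if U w \<and> \<rho> w \<le> r n then g n (real n * mass (D1 w)) (real n * mass (D2 w)) else 0)
      \<partial>PiM {..<m} (\<lambda>_. pt))) \<longlonglongrightarrow> \<beta> ^ (m - 1) * (\<integral>z. limint m U \<rho> D1 D2 G (z(0 := 0)) \<partial>PiM {Suc 0..<m} (\<lambda>_. lborel))"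
    and "integrable (PiM {Suc 0..<m} (\<lambda>_. lborel)) (\<lambda>z. limint m U \<rho> D1 D2 G (z(0 := 0)))"
proof -
  let ?J = "{Suc 0..<m}"
  let ?N = "PiM ?J (\<lambda>_. lborel :: 'a measure)"
  have Um[measurable]: "Measurable.pred borel U" and \<rho>m[measurable]: "\<rho> \<in> borel_measurable borel"
    and D1m: "{p. snd p \<in> D1 (fst p)} \<in> sets (borel \<Otimes>\<^sub>M borel)" and D2m: "{p. snd p \<in> D2 (fst p)} \<in> sets (borel \<Otimes>\<^sub>M borel)"
    and bD: "\<And>w. bounded (D1 w)" "\<And>w. bounded (D2 w)"
    and eqv: "\<And>x t w z. t > 0 \<Longrightarrow> (\<And>i. i < m \<Longrightarrow> w i = x + t *\<^sub>R z i) \<Longrightarrow>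
        (U w \<longleftrightarrow> U z) \<and> \<rho> w = t * \<rho> z \<and> D1 w = (\<lambda>y. x + t *\<^sub>R y) ` D1 z \<and> D2 w = (\<lambda>y. x + t *\<^sub>R y) ` D2 z"
    using cfg unfolding config_def by blast+
  have g: "cconv g G" and gm: "\<And>n. case_prod (g n) \<in> borel_measurable (borel \<Otimes>\<^sub>M borel)"
    and Gm: "case_prod G \<in> borel_measurable (borel \<Otimes>\<^sub>M borel)"
    using kern unfolding kern_def by blast+
  obtain C \<kappa> N where \<kappa>: "\<kappa> > 0" "C \<ge> 0" and bd: "\<And>n a b. n \<ge> N \<Longrightarrow> 0 \<le> a \<Longrightarrow> a \<le> real n \<Longrightarrow> 0 \<le> b \<Longrightarrow> b \<le> real n \<Longrightarrow>
        \<bar>g n a b\<bar> \<le> C * exp (- \<kappa> * (a + b))"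
    using kern unfolding kern_def by blast
  obtain c C1 N1 where c: "c > 0" and ct: "\<And>n x z. n \<ge> N1 \<Longrightarrow> z 0 = 0 \<Longrightarrow> (\<And>i. i < m \<Longrightarrow> f (x + s n *\<^sub>R z i) > 0) \<Longrightarrow> U z \<Longrightarrow> \<rho> z \<le> r n / s n \<Longrightarrow>
      c * (\<Sum>i<m. norm (z i)) - C1 \<le> real n * mass (blow n x (D1 z)) + real n * mass (blow n x (D2 z))"
    using ctrl unfolding controlled_def eventually_sequentially by blast
  obtain N2 where N2: "\<And>n. n \<ge> N2 \<Longrightarrow> real n * s n ^ DIM('a) \<le> \<beta> + 1"
    using order_tendstoD(2)[OF \<beta>_lim, of "\<beta> + 1"] unfolding eventually_sequentially by (auto intro: less_imp_le)
  define N0 where "N0 = Max {N, N1, N2}"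
  have bdC: "\<bar>g n a b\<bar> \<le> C" if "n \<ge> N" "0 \<le> a" "a \<le> real n" "0 \<le> b" "b \<le> real n" for n a b
  proof -
    have "C * exp (- \<kappa> * (a + b)) \<le> C * 1" using \<kappa> that by (intro mult_left_mono) auto
    then show ?thesis using bd[OF that] by simp
  qed
  define \<Phi> where "\<Phi> n w = (if U w \<and> \<rho> w \<le> r n then g n (real n * mass (D1 w)) (real n * mass (D2 w)) else 0)" for n w
  note [measurable] = measurable_compose[OF measurable_Pair gm, unfolded split_conv prod.case]
  note [measurable] = mass_measurable[OF D1m] mass_measurable[OF D2m]
  have \<Phi>b: "\<Phi> n \<in> borel_measurable borel" for n unfolding \<Phi>_def by measurable
  have \<Phi>m[measurable]: "\<Phi> n \<in> borel_measurable (PiM {..<m} (\<lambda>_. lborel))" for n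
    by (rule measurable_compose[OF borel_measurable_PiM_id \<Phi>b])
  have \<Phi>bd: "\<bar>\<Phi> n w\<bar> \<le> C" if "n \<ge> N" for n w
    using bdC[OF that, of "real n * mass (D1 w)" "real n * mass (D2 w)"] mass_le \<kappa> by (auto simp: \<Phi>_def)
  define I where "I n z = (\<integral>x. s n ^ (DIM('a) * (m - 1)) * (\<Prod>i<m. f (spread m (s n) (z, x) i)) * \<Phi> n (spread m (s n) (z, x)) \<partial>lborel)" for n z
  have sp: "spread m (s n) (z, x) i = x + s n *\<^sub>R (z(0 := 0)) i" if "i < m" for n z x i
    using that by (simp add: spread_def)
  have \<Phi>sp: "\<Phi> n (spread m (s n) (z, x)) = (if U (z(0 := 0)) \<and> \<rho> (z(0 := 0)) \<le> r n / s n then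
       g n (real n * mass (blow n x (D1 (z(0 := 0))))) (real n * mass (blow n x (D2 (z(0 := 0))))) else 0)" for n z x
  proof -
    have e: "(U (spread m (s n) (z, x)) \<longleftrightarrow> U (z(0 := 0))) \<and> \<rho> (spread m (s n) (z, x)) = s n * \<rho> (z(0 := 0)) \<and>
       D1 (spread m (s n) (z, x)) = blow n x (D1 (z(0 := 0))) \<and> D2 (spread m (s n) (z, x)) = blow n x (D2 (z(0 := 0)))"
      by (rule eqv[OF s_pos]) (rule sp)
    moreover have "s n * \<rho> (z(0 := 0)) \<le> r n \<longleftrightarrow> \<rho> (z(0 := 0)) \<le> r n / s n"
      using s_pos[of n] by (simp add: pos_le_divide_eq mult.commute)
    ultimately show ?thesis unfolding \<Phi>_def by simp
  qed
  have prsp: "(\<Prod>i<m. f (spread m (s n) (z, x) i)) = (\<Prod>i<m. f (x + s n *\<^sub>R (z(0 := 0)) i))" for n z x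
    by (intro prod.cong) (auto simp: sp)
  have comp: "(\<lambda>p. spread m (s n) p i) \<in> borel_measurable (?N \<Otimes>\<^sub>M lborel)" if "i < m" for i n
    using measurable_compose[OF measurable_spread[of m "s n"] measurable_component_singleton[of i "{..<m}"]] that by simp
  have [measurable]: "(\<lambda>p. \<Prod>i<m. f (spread m (s n) p i)) \<in> borel_measurable (?N \<Otimes>\<^sub>M lborel)" for n
    using comp by (intro borel_measurable_prod) (auto intro: measurable_compose[OF _ f_meas])
  have Im: "I n \<in> borel_measurable ?N" for n
    unfolding I_def by (intro lborel.borel_measurable_lebesgue_integral) (simp add: split_beta')
  have cv: "(\<integral>w. \<Phi> n w \<partial>PiM {..<m} (\<lambda>_. pt)) = (\<integral>z. I n z \<partial>?N)" if "n \<ge> N" for n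
    unfolding I_def by (rule integral_spread[OF m s_pos \<Phi>m \<Phi>bd[OF that]])
  have pow: "real n ^ (m - 1) * s n ^ (DIM('a) * (m - 1)) = (real n * s n ^ DIM('a)) ^ (m - 1)" for n
    by (simp add: power_mult_distrib power_mult)
  have ptw: "(\<lambda>n. real n ^ (m - 1) * I n z) \<longlonglongrightarrow> \<beta> ^ (m - 1) * limint m U \<rho> D1 D2 G (z(0 := 0))" for z
  proof -
    let ?z = "z(0 := 0)"
    have In: "real n ^ (m - 1) * I n z = (real n * s n ^ DIM('a)) ^ (m - 1) * (\<integral>x. (\<Prod>i<m. f (x + s n *\<^sub>R ?z i)) * \<Phi> n (spread m (s n) (z, x)) \<partial>lborel)" for n
      unfolding I_def prsp pow[symmetric] by (simp add: mult.assoc)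
    show ?thesis
    proof (cases "U ?z \<and> W (\<rho> ?z)")
      case True
      have "(\<lambda>n. (real n * s n ^ DIM('a)) ^ (m - 1) * (\<integral>x. (\<Prod>i<m. f (x + s n *\<^sub>R ?z i)) * g n (real n * mass (blow n x (D1 ?z))) (real n * mass (blow n x (D2 ?z))) \<partial>lborel))
         \<longlonglongrightarrow> \<beta> ^ (m - 1) * (\<integral>x. f x ^ m * G (\<beta> * f x * measure lborel (D1 ?z)) (\<beta> * f x * measure lborel (D2 ?z)) \<partial>lborel)"
        by (intro tendsto_mult tendsto_power \<beta>_lim inner_limit[OF m _ _ _ _ _ g gm Gm bdC])
          (auto simp: slice_borel[OF D1m] slice_borel[OF D2m] bD)
      moreover have "\<forall>\<^sub>F n in sequentially. (real n * s n ^ DIM('a)) ^ (m - 1) * (\<integral>x. (\<Prod>i<m. f (x + s n *\<^sub>R ?z i)) * g n (real n * mass (blow n x (D1 ?z))) (real n * mass (blow n x (D2 ?z))) \<partial>lborel)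
          = real n ^ (m - 1) * I n z"
        using W_lim[of "\<rho> ?z"] 
      proof eventually_elim
        case (elim n)
        then show ?case unfolding In \<Phi>sp using True by simp
      qed
      ultimately show ?thesis using True by (simp add: limint_def Lim_transform_eventually)
    next
      case False
      have "\<forall>\<^sub>F n in sequentially. 0 = real n ^ (m - 1) * I n z"
        using W_lim[of "\<rho> ?z"] 
      proof eventually_elim
        case (elim n)
        then have "\<not> (U ?z \<and> \<rho> ?z \<le> r n / s n)" using False by blast
        then have "\<Phi> n (spread m (s n) (z, x)) = 0" for x unfolding \<Phi>sp by (rule if_not_P)
        then show ?case unfolding In by simp
      qed
      then have "(\<lambda>n. real n ^ (m - 1) * I n z) \<longlonglongrightarrow> 0" by (rule Lim_transform_eventually[OF tendsto_const])
      moreover have "limint m U \<rho> D1 D2 G ?z = 0" unfolding limint_def using False by (rule if_not_P)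
      ultimately show ?thesis by simp
    qed
  qed
  \<comment> \<open>The factors bound, in this order, the prefactor beyond \<open>N2\<close>, the
    densities at the \<open>m - 1\<close> further points, the kernel constant with the loss
    \<open>C1\<close> of \<open>controlled\<close>, and the decay over the shape. The density at the
    base point integrates to 1.\<close>
  define B where "B z = (\<beta> + 1) ^ (m - 1) * (f_sup ^ (m - 1) * (C * exp (\<kappa> * C1))) * (\<Prod>i\<in>?J. exp (- (\<kappa> * c) * norm (z i)))" for z :: "nat \<Rightarrow> 'a"
  have Bi: "integrable ?N B"
    unfolding B_def using \<kappa> c by (intro integrable_mult_right lborel_prod.product_integrable_prod integrable_exp_norm) auto
  have dom: "\<bar>real n ^ (m - 1) * I n z\<bar> \<le> B z" if "n \<ge> N0" for n z
  proof -
    let ?z = "z(0 := 0)"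
    have n: "n \<ge> N" "n \<ge> N1" "n \<ge> N2" using that by (auto simp: N0_def)
    have ins: "{..<m} = insert 0 ?J" using m by auto
    have Q: "\<bar>(\<Prod>i<m. f (x + s n *\<^sub>R ?z i)) * \<Phi> n (spread m (s n) (z, x))\<bar> \<le>
        f x * (f_sup ^ (m - 1) * (C * exp (\<kappa> * C1)) * (\<Prod>i\<in>?J. exp (- (\<kappa> * c) * norm (z i))))" (is "_ \<le> ?R") for x
    proof (cases "(\<forall>i<m. f (x + s n *\<^sub>R ?z i) > 0) \<and> U ?z \<and> \<rho> ?z \<le> r n / s n")
      case False
      then have "(\<Prod>i<m. f (x + s n *\<^sub>R ?z i)) * \<Phi> n (spread m (s n) (z, x)) = 0"
      proof (cases "\<forall>i<m. f (x + s n *\<^sub>R ?z i) > 0")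
        case False
        then obtain i where "i < m" "f (x + s n *\<^sub>R ?z i) = 0" using f_nonneg by (metis less_eq_real_def)
        then have "(\<Prod>i<m. f (x + s n *\<^sub>R ?z i)) = 0" by (intro prod_zero bexI[of _ i]) simp_all
        then show ?thesis by simp
      qed (auto simp: \<Phi>sp)
      moreover have "0 \<le> ?R" using \<kappa> f_sup_nonneg f_nonneg by (intro mult_nonneg_nonneg prod_nonneg) auto
      ultimately show ?thesis by (simp only: abs_zero)
    next
      case True
      let ?a = "real n * mass (blow n x (D1 ?z))" and ?b = "real n * mass (blow n x (D2 ?z))"
      have "c * (\<Sum>i<m. norm (?z i)) - C1 \<le> ?a + ?b" using True by (intro ct[OF n(2), of ?z x]) auto
      moreover have "(\<Sum>i<m. norm (?z i)) = (\<Sum>i\<in>?J. norm (z i))" unfolding ins by simp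
      ultimately have "- \<kappa> * (?a + ?b) \<le> \<kappa> * C1 + (\<Sum>i\<in>?J. - (\<kappa> * c) * norm (z i))"
        using \<kappa>(1) mult_left_mono[of "c * (\<Sum>i\<in>?J. norm (z i)) - C1" "?a + ?b" \<kappa>]
        by (simp add: sum_negf sum_distrib_left[symmetric] algebra_simps)
      then have "exp (- \<kappa> * (?a + ?b)) \<le> exp (\<kappa> * C1) * (\<Prod>i\<in>?J. exp (- (\<kappa> * c) * norm (z i)))"
        by (simp add: exp_sum[symmetric] exp_add[symmetric])
      then have "C * exp (- \<kappa> * (?a + ?b)) \<le> C * (exp (\<kappa> * C1) * (\<Prod>i\<in>?J. exp (- (\<kappa> * c) * norm (z i))))"
        using \<kappa>(2) by (rule mult_left_mono)
      then have 1: "\<bar>\<Phi> n (spread m (s n) (z, x))\<bar> \<le> C * (exp (\<kappa> * C1) * (\<Prod>i\<in>?J. exp (- (\<kappa> * c) * norm (z i))))"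
        using bd[OF n(1), of ?a ?b] mass_le True by (simp add: \<Phi>sp)
      have "(\<Prod>i\<in>?J. f (x + s n *\<^sub>R z i)) \<le> (\<Prod>i\<in>?J. f_sup)"
        by (intro prod_mono) (auto simp: f_nonneg f_le)
      then have 2: "(\<Prod>i<m. f (x + s n *\<^sub>R ?z i)) \<le> f x * f_sup ^ (m - 1)"
        unfolding ins by (simp add: mult_left_mono f_nonneg)
      have "(\<Prod>i<m. f (x + s n *\<^sub>R ?z i)) * \<bar>\<Phi> n (spread m (s n) (z, x))\<bar> \<le>
         (f x * f_sup ^ (m - 1)) * (C * (exp (\<kappa> * C1) * (\<Prod>i\<in>?J. exp (- (\<kappa> * c) * norm (z i)))))"
        using 1 2 f_nonneg f_sup_nonneg by (intro mult_mono) (auto simp: prod_nonneg)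
      then show ?thesis by (simp add: abs_mult prod_nonneg f_nonneg mult.assoc)
    qed
    let ?R = "f_sup ^ (m - 1) * (C * exp (\<kappa> * C1)) * (\<Prod>i\<in>?J. exp (- (\<kappa> * c) * norm (z i)))"
    have R0: "0 \<le> ?R" using \<kappa> f_sup_nonneg by (intro mult_nonneg_nonneg prod_nonneg) auto
    have "\<bar>\<integral>x. (\<Prod>i<m. f (x + s n *\<^sub>R ?z i)) * \<Phi> n (spread m (s n) (z, x)) \<partial>lborel\<bar> \<le> (\<integral>x. f x * ?R \<partial>lborel)"
    proof -
      have "\<bar>\<integral>x. (\<Prod>i<m. f (x + s n *\<^sub>R ?z i)) * \<Phi> n (spread m (s n) (z, x)) \<partial>lborel\<bar> \<le>
        (\<integral>x. \<bar>(\<Prod>i<m. f (x + s n *\<^sub>R ?z i)) * \<Phi> n (spread m (s n) (z, x))\<bar> \<partial>lborel)" by (rule integral_abs_bound)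
      also have "\<dots> \<le> (\<integral>x. f x * ?R \<partial>lborel)"
        by (rule integral_mono') (use f_int(1) Q R0 f_nonneg in auto)
      finally show ?thesis .
    qed
    also have "\<dots> = ?R" using f_int by simp
    finally have 3: "\<bar>\<integral>x. (\<Prod>i<m. f (x + s n *\<^sub>R ?z i)) * \<Phi> n (spread m (s n) (z, x)) \<partial>lborel\<bar> \<le> ?R" .
    have 4: "0 \<le> (real n * s n ^ DIM('a)) ^ (m - 1)" "(real n * s n ^ DIM('a)) ^ (m - 1) \<le> (\<beta> + 1) ^ (m - 1)"
      using N2[OF n(3)] s_pos[of n] by (auto intro!: power_mono)
    have "real n ^ (m - 1) * I n z = (real n * s n ^ DIM('a)) ^ (m - 1) * (\<integral>x. (\<Prod>i<m. f (x + s n *\<^sub>R ?z i)) * \<Phi> n (spread m (s n) (z, x)) \<partial>lborel)"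
      unfolding I_def prsp pow[symmetric] by (simp add: mult.assoc)
    then have "\<bar>real n ^ (m - 1) * I n z\<bar> \<le> (\<beta> + 1) ^ (m - 1) * ?R"
      using 3 4 \<beta>_pos by (simp only: abs_mult) (intro mult_mono, auto)
    then show ?thesis by (simp add: B_def mult.assoc)
  qed
  have limm: "(\<lambda>z. \<beta> ^ (m - 1) * limint m U \<rho> D1 D2 G (z(0 := 0))) \<in> borel_measurable ?N"
    by (rule borel_measurable_LIMSEQ_real[OF ptw]) (use Im in measurable)
  have meas: "(\<lambda>z. real (n + N0) ^ (m - 1) * I (n + N0) z) \<in> borel_measurable ?N" for n using Im by measurable
  have ptw': "AE z in ?N. (\<lambda>n. real (n + N0) ^ (m - 1) * I (n + N0) z) \<longlonglongrightarrow> \<beta> ^ (m - 1) * limint m U \<rho> D1 D2 G (z(0 := 0))"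
    using LIMSEQ_ignore_initial_segment[OF ptw, where k = N0] by (intro AE_I2)
  have dom': "AE z in ?N. norm (real (n + N0) ^ (m - 1) * I (n + N0) z) \<le> B z" for n
    using dom[of "n + N0"] by auto
  have "integrable ?N (\<lambda>z. \<beta> ^ (m - 1) * limint m U \<rho> D1 D2 G (z(0 := 0)))"
    by (rule integrable_dominated_convergence[OF limm meas Bi ptw' dom'])
  then show "integrable ?N (\<lambda>z. limint m U \<rho> D1 D2 G (z(0 := 0)))"
    using \<beta>_pos by simp
  have "(\<lambda>n. \<integral>z. real (n + N0) ^ (m - 1) * I (n + N0) z \<partial>?N) \<longlonglongrightarrow> (\<integral>z. \<beta> ^ (m - 1) * limint m U \<rho> D1 D2 G (z(0 := 0)) \<partial>?N)"
    by (rule integral_dominated_convergence[OF limm meas Bi ptw' dom'])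
  then have "(\<lambda>n. \<integral>z. real n ^ (m - 1) * I n z \<partial>?N) \<longlonglongrightarrow> (\<integral>z. \<beta> ^ (m - 1) * limint m U \<rho> D1 D2 G (z(0 := 0)) \<partial>?N)"
    by (rule LIMSEQ_offset)
  then have "(\<lambda>n. real n ^ (m - 1) * (\<integral>z. I n z \<partial>?N)) \<longlonglongrightarrow> \<beta> ^ (m - 1) * (\<integral>z. limint m U \<rho> D1 D2 G (z(0 := 0)) \<partial>?N)"
    by simp
  moreover have "\<forall>\<^sub>F n in sequentially. real n ^ (m - 1) * (\<integral>z. I n z \<partial>?N) = real n ^ (m - 1) * (\<integral>w. \<Phi> n w \<partial>PiM {..<m} (\<lambda>_. pt))"
    using eventually_ge_at_top[of N] by eventually_elim (simp add: cv)
  ultimately have "(\<lambda>n. real n ^ (m - 1) * (\<integral>w. \<Phi> n w \<partial>PiM {..<m} (\<lambda>_. pt))) \<longlonglongrightarrow> \<beta> ^ (m - 1) * (\<integral>z. limint m U \<rho> D1 D2 G (z(0 := 0)) \<partial>?N)"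
    by (rule Lim_transform_eventually)
  then show "(\<lambda>n. real n ^ (m - 1) * (\<integral>w. (if U w \<and> \<rho> w \<le> r n then g n (real n * mass (D1 w)) (real n * mass (D2 w)) else 0)
      \<partial>PiM {..<m} (\<lambda>_. pt))) \<longlonglongrightarrow> \<beta> ^ (m - 1) * (\<integral>z. limint m U \<rho> D1 D2 G (z(0 := 0)) \<partial>PiM {Suc 0..<m} (\<lambda>_. lborel))"
    unfolding \<Phi>_def .
qed

end

text \<open>Empty off \<open>wc\<close>, where centre and radius are only default values.\<close>

definition cb :: "nat set \<Rightarrow> (nat \<Rightarrow> 'a::euclidean_space) \<Rightarrow> 'a set" where
  "cb I w = {y. wc I w \<and> dist (cc I w) y \<le> cr I w}"

section \<open>Moments of the number of critical points\<close>

text \<open>The falling factorial as a real number. It vanishes for \<open>n < m\<close>, so subset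
  counts need no case distinction and Poisson series may start at 0.\<close>

definition ffact :: "nat \<Rightarrow> nat \<Rightarrow> real" where
  "ffact n m = (\<Prod>i<m. real n - real i)"

lemma ffact_eq_0: "n < m \<Longrightarrow> ffact n m = 0"
  unfolding ffact_def by (rule prod_zero) (auto intro!: bexI[of _ n])

lemma ffact_binomial: "ffact n m = real (n choose m) * fact m"
  by (simp add: binomial_gbinomial gbinomial_prod_rev ffact_def atLeast0LessThan)

lemma ffact_split: "ffact n (a + b) = ffact n a * ffact (n - a) b"
proof (cases "a \<le> n")
  case True
  have "ffact n (a + b) = (\<Prod>i<a. real n - real i) * (\<Prod>i<b. real n - real (a + i))"
    unfolding ffact_def by (induction b) (simp_all add: algebra_simps)
  also have "(\<Prod>i<b. real n - real (a + i)) = ffact (n - a) b"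
    unfolding ffact_def using True by (intro prod.cong) (auto simp: of_nat_diff)
  finally show ?thesis by (simp add: ffact_def)
qed (simp add: ffact_eq_0)

lemma ffact_fact: "ffact (M + l) M = fact (M + l) / fact l"
  unfolding ffact_binomial by (simp add: binomial_fact)

lemma card_subsets_intersection:
  assumes I: "I \<subseteq> {..<n}" "card I = K" and j: "j \<le> K"
  shows "card {I'. I' \<subseteq> {..<n} \<and> card I' = K \<and> card (I \<inter> I') = j} = (K choose j) * ((n - K) choose (K - j))"
proof -
  have finI: "finite I" using I(1) finite_subset by blast
  let ?S = "{I'. I' \<subseteq> {..<n} \<and> card I' = K \<and> card (I \<inter> I') = j}"
  let ?T = "{B. B \<subseteq> I \<and> card B = j} \<times> {B. B \<subseteq> {..<n} - I \<and> card B = K - j}"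
  have "bij_betw (\<lambda>I'. (I \<inter> I', I' - I)) ?S ?T"
  proof (rule bij_betw_byWitness[where f' = "\<lambda>(B, C). B \<union> C"])
    show "(\<lambda>I'. (I \<inter> I', I' - I)) ` ?S \<subseteq> ?T"
    proof (rule image_subsetI)
      fix I' assume I': "I' \<in> ?S"
      then have "finite I'" using finite_subset by blast
      then have "card I' = card (I \<inter> I') + card (I' - I)"
        by (metis Int_commute card_Int_Diff)
      then show "(I \<inter> I', I' - I) \<in> ?T" using I' by auto
    qed
    show "(\<lambda>(B, C). B \<union> C) ` ?T \<subseteq> ?S"
    proof (rule image_subsetI)
      fix p assume p: "p \<in> ?T"
      obtain B C where BC: "p = (B, C)" by (cases p)
      with p have B: "B \<subseteq> I" "card B = j" and C: "C \<subseteq> {..<n} - I" "card C = K - j" by auto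
      have f: "finite B" "finite C"
        using finite_subset[OF B(1) finI] finite_subset[OF C(1)] by auto
      have "B \<inter> C = {}" using B C by blast
      then have "card (B \<union> C) = card B + card C" using f by (simp add: card_Un_disjoint)
      then have "card (B \<union> C) = K" using C(2) B(2) j by simp
      moreover have "I \<inter> (B \<union> C) = B" using B C by blast
      ultimately show "(case p of (B, C) \<Rightarrow> B \<union> C) \<in> ?S" using B C I(1) BC by auto
    qed
  qed auto
  then have "card ?S = card ?T" by (rule bij_betw_same_card)
  also have "\<dots> = card {B. B \<subseteq> I \<and> card B = j} * card {B. B \<subseteq> {..<n} - I \<and> card B = K - j}"
    by (rule card_cartesian_product)
  also have "\<dots> = (K choose j) * ((n - K) choose (K - j))"
    using I finI by (simp add: n_subsets card_Diff_subset)
  finally show ?thesis .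
qed

text \<open>The indices are cut into consecutive blocks of sizes \<open>K - j\<close>,
  \<open>j\<close>, \<open>K - j\<close> and the rest, which are mapped onto \<open>I - I'\<close>,
  \<open>I \<inter> I'\<close>, \<open>I' - I\<close> and the remaining indices. The first two
  blocks form \<open>{..<K}\<close>, the middle two \<open>{K - j..<2 * K - j}\<close>.\<close>

lemma matching_permutation:
  assumes I: "I \<subseteq> {..<n}" "card I = K" and I': "I' \<subseteq> {..<n}" "card I' = K" and j: "card (I \<inter> I') = j"
  obtains \<tau> where "bij_betw \<tau> {..<n} {..<n}" "\<tau> ` {..<K} = I" "\<tau> ` {K - j..<2 * K - j} = I'" "2 * K - j \<le> n" "j \<le> K"
proof -
  have fin: "finite I" "finite I'" using I(1) I'(1) finite_subset by blast+
  have jK: "j \<le> K" using card_mono[of I "I \<inter> I'"] fin I(2) j by auto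
  have cI: "card (I - I') = K - j" using fin I(2) j by (metis card_Diff_subset_Int finite_Int)
  have cI': "card (I' - I) = K - j" using fin I'(2) j by (metis Int_commute card_Diff_subset_Int finite_Int)
  have cU: "card (I \<union> I') = 2 * K - j"
    using card_Un_Int[OF fin] I(2) I'(2) j by simp
  have le: "2 * K - j \<le> n"
    using card_mono[of "{..<n}" "I \<union> I'"] I(1) I'(1) cU by simp
  have cR: "card ({..<n} - (I \<union> I')) = n - (2 * K - j)"
    using I(1) I'(1) cU fin by (subst card_Diff_subset) auto
  obtain e1 where e1: "bij_betw e1 {..<K - j} (I - I')"
    using finite_same_card_bij[of "{..<K - j}" "I - I'"] fin cI by auto
  obtain e2 where e2: "bij_betw e2 {K - j..<K} (I \<inter> I')"
    using finite_same_card_bij[of "{K - j..<K}" "I \<inter> I'"] fin j jK by auto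
  obtain e3 where e3: "bij_betw e3 {K..<2 * K - j} (I' - I)"
    using finite_same_card_bij[of "{K..<2 * K - j}" "I' - I"] fin cI' jK by auto
  obtain e4 where e4: "bij_betw e4 {2 * K - j..<n} ({..<n} - (I \<union> I'))"
    using finite_same_card_bij[of "{2 * K - j..<n}" "{..<n} - (I \<union> I')"] cR by auto
  define \<tau> where "\<tau> i = (if i < K - j then e1 i else if i < K then e2 i else if i < 2 * K - j then e3 i else e4 i)" for i
  have t1: "bij_betw \<tau> {..<K - j} (I - I')" using e1 by (subst bij_betw_cong[of _ _ e1]) (auto simp: \<tau>_def)
  have t2: "bij_betw \<tau> {K - j..<K} (I \<inter> I')" using e2 by (subst bij_betw_cong[of _ _ e2]) (auto simp: \<tau>_def)
  have t3: "bij_betw \<tau> {K..<2 * K - j} (I' - I)" using e3 by (subst bij_betw_cong[of _ _ e3]) (auto simp: \<tau>_def)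
  have t4: "bij_betw \<tau> {2 * K - j..<n} ({..<n} - (I \<union> I'))" using e4 jK by (subst bij_betw_cong[of _ _ e4]) (auto simp: \<tau>_def)
  have s1: "{..<K} = {..<K - j} \<union> {K - j..<K}" using jK by auto
  have s2: "{K - j..<2 * K - j} = {K - j..<K} \<union> {K..<2 * K - j}" using jK by auto
  have b1: "bij_betw \<tau> {..<K} I"
  proof -
    have "bij_betw \<tau> ({..<K - j} \<union> {K - j..<K}) ((I - I') \<union> (I \<inter> I'))" by (rule bij_betw_combine[OF t1 t2]) blast
    moreover have "(I - I') \<union> (I \<inter> I') = I" by blast
    ultimately show ?thesis unfolding s1 by simp
  qed
  have b2: "\<tau> ` {K - j..<2 * K - j} = I'"
    unfolding s2 image_Un using t2 t3 by (auto simp: bij_betw_def)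
  have "bij_betw \<tau> ({..<K} \<union> {K..<2 * K - j}) (I \<union> (I' - I))" by (rule bij_betw_combine[OF b1 t3]) auto
  then have "bij_betw \<tau> (({..<K} \<union> {K..<2 * K - j}) \<union> {2 * K - j..<n}) ((I \<union> (I' - I)) \<union> ({..<n} - (I \<union> I')))"
    by (rule bij_betw_combine[OF _ t4]) auto
  moreover have "({..<K} \<union> {K..<2 * K - j}) \<union> {2 * K - j..<n} = {..<n}" using le jK by auto
  moreover have "(I \<union> (I' - I)) \<union> ({..<n} - (I \<union> I')) = {..<n}" using I(1) I'(1) by auto
  ultimately have "bij_betw \<tau> {..<n} {..<n}" by simp
  then show ?thesis using that b1 b2 le jK by (auto simp: bij_betw_def)
qed

lemma borel_measurable_wc:
  assumes "finite I" "I \<noteq> {}"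
  shows "Measurable.pred borel (wc I :: (nat \<Rightarrow> 'a::euclidean_space) \<Rightarrow> bool)"
  using borel_open[OF open_wc[OF assms]] by (simp add: pred_def)

lemma of_bool_measurable:
  "Measurable.pred M P \<Longrightarrow> (\<lambda>x. of_bool (P x) :: real) \<in> borel_measurable M"
  by (simp add: of_bool_def)

lemma borel_measurable_coord:
  "(\<lambda>z :: nat \<Rightarrow> 'a::euclidean_space. z i) \<in> borel_measurable borel"
  by (intro borel_measurable_continuous_onI) simp

lemma wc_image:
  assumes "inj_on \<tau> A"
  shows "wc (\<tau> ` A) x \<longleftrightarrow> wc A (x \<circ> \<tau>)" and "cc (\<tau> ` A) x = cc A (x \<circ> \<tau>)" and "cr (\<tau> ` A) x = cr A (x \<circ> \<tau>)"
proof -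
  have im: "x ` \<tau> ` A = (x \<circ> \<tau>) ` A" by (simp add: image_comp)
  show w: "wc (\<tau> ` A) x \<longleftrightarrow> wc A (x \<circ> \<tau>)"
    using assms unfolding wc_def im by (metis comp_inj_on inj_on_imageI2 inj_on_imageI)
  show "cc (\<tau> ` A) x = cc A (x \<circ> \<tau>)" "cr (\<tau> ` A) x = cr A (x \<circ> \<tau>)"
    unfolding cc_def cr_def w im by (rule refl)+
qed

lemma pred_coord_eq: "Measurable.pred borel (\<lambda>x :: nat \<Rightarrow> 'a::euclidean_space. x j = x i)"
proof -
  have "closed {x :: nat \<Rightarrow> 'a. x j = x i}" by (intro closed_Collect_eq) simp_all
  from borel_closed[OF this] show ?thesis by (simp add: pred_def)
qed

definition good :: "nat set \<Rightarrow> real \<Rightarrow> nat set \<Rightarrow> (nat \<Rightarrow> 'a::euclidean_space) \<Rightarrow> bool" where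
  "good S r I x \<longleftrightarrow> wc I x \<and> cr I x \<le> r \<and> (\<forall>i\<in>S - I. x i \<notin> cb I x)"

text \<open>First occurrences give canonical labels for the distinct sample values. They make the
  count an explicit finite sum even for samples with ties.\<close>

definition firsts :: "nat \<Rightarrow> (nat \<Rightarrow> 'a) \<Rightarrow> nat set" where
  "firsts n x = {i. i < n \<and> (\<forall>j<i. x j \<noteq> x i)}"

lemma firsts_inj: "inj_on x (firsts n x)"
  by (rule inj_onI) (auto simp: firsts_def, metis linorder_neqE_nat)

lemma firsts_image: "x ` firsts n x = x ` {..<n}"
proof
  show "x ` {..<n} \<subseteq> x ` firsts n x"
  proof
    fix y assume "y \<in> x ` {..<n}"
    then obtain i where i: "i < n" "x i = y" by auto
    define k where "k = (LEAST i. x i = y)"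
    have k: "x k = y" "k \<le> i" unfolding k_def using i(2) by (rule LeastI, rule Least_le)
    have "x j \<noteq> y" if "j < k" for j using not_less_Least[of j "\<lambda>i. x i = y"] that by (simp add: k_def)
    then have "k \<in> firsts n x" using k i by (auto simp: firsts_def)
    then show "y \<in> x ` firsts n x" using k by auto
  qed
qed (auto simp: firsts_def)

text \<open>Since \<open>x\<close> is injective on \<open>S\<close>, subsets of the sample
  correspond to index sets. The sum then runs over a family that does not depend on
  \<open>x\<close>, so it can be exchanged with expectation.\<close>

lemma crit_count_sum:
  fixes x :: "nat \<Rightarrow> 'a::euclidean_space"
  assumes inj: "inj_on x S" and fin: "finite S"
  shows "real (crit_count k r (x ` S)) = (\<Sum>I | I \<subseteq> S \<and> card I = k + 1. of_bool (good S r I x))"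
proof -
  have "crit_count k r (x ` S) = card {Y. Y \<subseteq> x ` S \<and> card Y = k + 1 \<and> well_centered Y \<and> cradius Y \<le> r \<and>
           (\<forall>p\<in>x ` S - Y. cradius Y < dist (ccenter Y) p)}" (is "_ = card ?A")
    by (rule crit_count_eq_card) (use fin in simp)
  also have "?A = (`) x ` {I. I \<subseteq> S \<and> card I = k + 1 \<and> good S r I x}" (is "_ = _ ` ?B")
  proof -
    have key: "(card (x ` I) = k + 1 \<and> well_centered (x ` I) \<and> cradius (x ` I) \<le> r \<and>
        (\<forall>p\<in>x ` S - x ` I. cradius (x ` I) < dist (ccenter (x ` I)) p)) \<longleftrightarrow> (card I = k + 1 \<and> good S r I x)"
      if I: "I \<subseteq> S" for I
    proof -
      have injI: "inj_on x I" using inj I inj_on_subset by blast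
      have "x ` S - x ` I = x ` (S - I)" using inj I by (simp add: inj_on_image_set_diff)
      then show ?thesis
        using injI by (auto simp: good_def cb_def wc_def cr_def cc_def card_image not_le)
    qed
    show ?thesis
    proof (intro equalityI subsetI)
      fix Y assume Y: "Y \<in> ?A"
      then obtain I where "I \<subseteq> S" "Y = x ` I" by (auto simp: subset_image_iff)
      then show "Y \<in> (`) x ` ?B" using key[of I] Y by auto
    next
      fix Y assume "Y \<in> (`) x ` ?B"
      then obtain I where I: "I \<subseteq> S" "Y = x ` I" "card I = k + 1 \<and> good S r I x" by blast
      have "Y \<subseteq> x ` S" using I by blast
      then show "Y \<in> ?A" using key[OF I(1)] I(2,3) by simp
    qed
  qed
  also have "card \<dots> = card ?B"
  proof (rule card_image)
    show "inj_on ((`) x) ?B"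
      using inj by (intro inj_onI) (metis (no_types, lifting) inj_on_image_eq_iff mem_Collect_eq)
  qed
  finally have c: "crit_count k r (x ` S) = card ?B" .
  have "(\<Sum>I | I \<subseteq> S \<and> card I = k + 1. of_bool (good S r I x)) = real (card ({I. I \<subseteq> S \<and> card I = k + 1} \<inter> {I. good S r I x}))"
    using fin by simp
  also have "{I. I \<subseteq> S \<and> card I = k + 1} \<inter> {I. good S r I x} = ?B" by auto
  finally show ?thesis using c by simp
qed

lemma pred_cb:
  assumes "finite I" "I \<noteq> {}"
  shows "Measurable.pred borel (\<lambda>x :: nat \<Rightarrow> 'a::euclidean_space. x i \<notin> cb I x)"
proof -
  have "{x \<in> space borel. dist (cc I x) (x i) \<le> cr I x} \<in> sets (borel :: (nat \<Rightarrow> 'a) measure)"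
    by (intro borel_measurable_le borel_measurable_dist borel_measurable_cc[OF assms] borel_measurable_cr[OF assms] borel_measurable_coord)
  then have "Measurable.pred borel (\<lambda>x :: nat \<Rightarrow> 'a. dist (cc I x) (x i) \<le> cr I x)" by (simp add: pred_def)
  then show ?thesis unfolding cb_def mem_Collect_eq
    by (intro pred_intros_logic borel_measurable_wc[OF assms])
qed

lemma pred_good:
  assumes "finite I" "I \<noteq> {}" "finite S"
  shows "Measurable.pred borel (\<lambda>x :: nat \<Rightarrow> 'a::euclidean_space. good S r I x)"
proof -
  have "Measurable.pred borel (\<lambda>x :: nat \<Rightarrow> 'a. cr I x \<le> r)"
    using borel_measurable_cr[OF assms(1,2)] by measurable
  moreover have "Measurable.pred borel (\<lambda>x :: nat \<Rightarrow> 'a. \<forall>i\<in>S - I. x i \<notin> cb I x)"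
    using assms(3) by (intro pred_intros_finite pred_cb[OF assms(1,2)]) auto
  ultimately show ?thesis unfolding good_def
    by (intro pred_intros_logic borel_measurable_wc[OF assms(1,2)])
qed

lemma pred_good_firsts:
  assumes "finite I" "I \<noteq> {}" "finite S"
  shows "Measurable.pred borel (\<lambda>x :: nat \<Rightarrow> 'a::euclidean_space. firsts n x = S \<and> good S r I x)"
proof -
  have f: "firsts n x = S \<longleftrightarrow> (\<forall>i\<in>S. i < n) \<and> (\<forall>i\<in>{..<n}. (\<forall>j\<in>{..<i}. x j \<noteq> x i) = (i \<in> S))" for x :: "nat \<Rightarrow> 'a"
    unfolding firsts_def by blast
  have 1: "Measurable.pred borel (\<lambda>x :: nat \<Rightarrow> 'a. \<forall>j\<in>{..<i}. x j \<noteq> x i)" for i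
    by (intro pred_intros_finite pred_intros_logic pred_coord_eq) simp
  then have "Measurable.pred borel (\<lambda>x :: nat \<Rightarrow> 'a. (\<forall>j\<in>{..<i}. x j \<noteq> x i) = (i \<in> S))" for i
  proof (cases "i \<in> S")
    case False
    have "Measurable.pred borel (\<lambda>x :: nat \<Rightarrow> 'a. \<not> (\<forall>j\<in>{..<i}. x j \<noteq> x i))" by (intro pred_intros_logic 1)
    then show ?thesis using False by simp
  qed (use 1[of i] in simp)
  then have "Measurable.pred borel (\<lambda>x :: nat \<Rightarrow> 'a. \<forall>i\<in>{..<n}. (\<forall>j\<in>{..<i}. x j \<noteq> x i) = (i \<in> S))"
    by (intro pred_intros_finite) simp_all
  moreover have "Measurable.pred borel (\<lambda>x :: nat \<Rightarrow> 'a. \<forall>i\<in>S. i < n)" by simp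
  ultimately show ?thesis unfolding f
    by (intro pred_intros_logic pred_good[OF assms])
qed

section \<open>Reduction of moments to integrals over few points\<close>

context prob_density
begin

lemma emeasure_pt_singleton: "emeasure pt {a} = 0"
proof -
  have "emeasure pt {a} = (\<integral>\<^sup>+x. ennreal (f x) * indicator {a} x \<partial>lborel)"
    unfolding pt_def by (rule emeasure_density) auto
  also have "\<dots> = ennreal (f a) * emeasure lborel {a}" by (rule nn_integral_indicator_singleton) auto
  finally show ?thesis by simp
qed

lemma borel_PiM_pt:
  fixes h :: "(nat \<Rightarrow> 'a) \<Rightarrow> 'c::topological_space"
  assumes "h \<in> borel_measurable borel"
  shows "h \<in> borel_measurable (PiM J (\<lambda>_::nat. pt))"
  unfolding measurable_cong_sets[OF sets_PiM_pt refl]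
  by (rule measurable_compose[OF borel_measurable_PiM_id assms])

lemma integrable_PiM_pt:
  fixes h :: "(nat \<Rightarrow> 'a) \<Rightarrow> real"
  assumes "h \<in> borel_measurable (PiM J (\<lambda>_::nat. pt))" "\<And>x. \<bar>h x\<bar> \<le> C"
  shows "integrable (PiM J (\<lambda>_::nat. pt)) h"
proof -
  interpret P: prob_space "PiM J (\<lambda>_. pt)" by (rule prob_space_PiM_pt)
  show ?thesis by (rule P.integrable_const_bound[of _ C], rule AE_I2) (use assms in simp_all)
qed

lemma AE_distinct_coords:
  fixes n :: nat
  assumes "i < n" "l < n" "i \<noteq> l"
  shows "AE x in PiM {..<n} (\<lambda>_. pt). x i \<noteq> x l"
proof -
  let ?J = "{..<n} - {i}"
  have ins: "{..<n} = insert i ?J" using assms by auto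
  have m: "(\<lambda>x. indicator {x. x i = x l} x :: ennreal) \<in> borel_measurable (PiM {..<n} (\<lambda>_. pt))"
    using pred_coord_eq[of i l] by (intro borel_PiM_pt borel_measurable_indicator) (simp add: pred_def)
  have m': "(\<lambda>x. indicator {x. x i = x l} x :: ennreal) \<in> borel_measurable (PiM (insert i ?J) (\<lambda>_. pt))"
    using m by (subst ins[symmetric])
  have "(\<integral>\<^sup>+x. indicator {x. x i = x l} x \<partial>PiM {..<n} (\<lambda>_. pt)) =
      (\<integral>\<^sup>+x. \<integral>\<^sup>+y. indicator {x. x i = x l} (x(i := y)) \<partial>pt \<partial>PiM ?J (\<lambda>_. pt))"
    using pt_prod.product_nn_integral_insert[OF _ _ m'] unfolding ins[symmetric] by simp
  also have "\<dots> = (\<integral>\<^sup>+x. \<integral>\<^sup>+y. indicator {x l} y \<partial>pt \<partial>PiM ?J (\<lambda>_. pt))"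
    using assms by (intro nn_integral_cong) (auto split: split_indicator)
  also have "\<dots> = 0" by (simp add: emeasure_pt_singleton)
  finally have "AE x in PiM {..<n} (\<lambda>_. pt). indicator {x. x i = x l} x = (0 :: ennreal)"
    by (subst (asm) nn_integral_0_iff_AE) (use m in auto)
  then show ?thesis by (rule eventually_mono) (auto split: split_indicator_asm)
qed

lemma AE_inj:
  fixes n :: nat
  shows "AE x in PiM {..<n} (\<lambda>_. pt). inj_on x {..<n}"
proof -
  have "AE x in PiM {..<n} (\<lambda>_. pt). \<forall>p\<in>{p. fst p < n \<and> snd p < n \<and> fst p \<noteq> snd p}. x (fst p) \<noteq> x (snd p)"
  proof (rule AE_finite_allI)
    show "finite {p. fst p < n \<and> snd p < n \<and> fst p \<noteq> snd p}"
      by (rule finite_subset[of _ "{..<n} \<times> {..<n}"]) (auto simp: finite_cartesian_product)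
  qed (use AE_distinct_coords in auto)
  then show ?thesis by (rule eventually_mono) (auto simp: inj_on_def)
qed

text \<open>Ties have probability 0, but the product measure is not complete, so almost sure
  equality with a measurable sum does not suffice. The space is therefore split according to the
  finitely many possible sets of first occurrences, on each of which the count is a sum of Borel
  indicators.\<close>

lemma crit_count_measurable:
  fixes n :: nat
  shows
  "(\<lambda>x. real (crit_count k r (x ` {..<n}))) \<in> borel_measurable (PiM {..<n} (\<lambda>_. pt))"
proof (rule borel_PiM_pt)
  have "real (crit_count k r (x ` {..<n})) =
     (\<Sum>S\<in>Pow {..<n}. \<Sum>I | I \<subseteq> S \<and> card I = k + 1. of_bool (firsts n x = S \<and> good S r I x))" for x :: "nat \<Rightarrow> 'a"
  proof -
    have sub: "firsts n x \<subseteq> {..<n}" by (auto simp: firsts_def)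
    then have fin: "finite (firsts n x)" using finite_subset by blast
    have "real (crit_count k r (x ` {..<n})) = (\<Sum>I | I \<subseteq> firsts n x \<and> card I = k + 1. of_bool (good (firsts n x) r I x))"
      using crit_count_sum[OF firsts_inj fin, of k r] by (simp add: firsts_image)
    also have "\<dots> = (\<Sum>S\<in>Pow {..<n}. if S = firsts n x then (\<Sum>I | I \<subseteq> S \<and> card I = k + 1. of_bool (good S r I x)) else 0)"
      using sub by simp
    also have "\<dots> = (\<Sum>S\<in>Pow {..<n}. \<Sum>I | I \<subseteq> S \<and> card I = k + 1. of_bool (firsts n x = S \<and> good S r I x))"
      by (intro sum.cong) auto
    finally show ?thesis .
  qed
  moreover have "(\<lambda>x :: nat \<Rightarrow> 'a. of_bool (firsts n x = S \<and> good S r I x) :: real) \<in> borel_measurable borel"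
    if "S \<in> Pow {..<n}" "I \<subseteq> S" "card I = k + 1" for S I
  proof -
    have "finite S" using that finite_subset by auto
    moreover have "I \<noteq> {}" using that(3) by auto
    ultimately show ?thesis
      using pred_good_firsts[of I S n r] that finite_subset[of I S] by (intro of_bool_measurable) auto
  qed
  ultimately show "(\<lambda>x :: nat \<Rightarrow> 'a. real (crit_count k r (x ` {..<n}))) \<in> borel_measurable borel"
    by (simp only:) (intro borel_measurable_sum, auto)
qed

lemma crit_count_AE:
  "AE x in PiM {..<n} (\<lambda>_. pt). real (crit_count k r (x ` {..<n})) =
     (\<Sum>I | I \<subseteq> {..<n} \<and> card I = k + 1. of_bool (good {..<n} r I x))"
  using AE_inj by (rule eventually_mono) (simp add: crit_count_sum)

text \<open>A crude bound whose only purpose is integrability for fixed \<open>n\<close>.\<close>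

lemma crit_count_le:
  fixes n :: nat
  shows "real (crit_count k r (x ` {..<n})) \<le> 2 ^ n"
proof -
  have sub: "firsts n x \<subseteq> {..<n}" by (auto simp: firsts_def)
  then have fin: "finite (firsts n x)" using finite_subset by blast
  have "real (crit_count k r (x ` {..<n})) = (\<Sum>I | I \<subseteq> firsts n x \<and> card I = k + 1. of_bool (good (firsts n x) r I x))"
    using crit_count_sum[OF firsts_inj fin, of k r] by (simp add: firsts_image)
  also have "\<dots> \<le> (\<Sum>I | I \<subseteq> firsts n x \<and> card I = k + 1. 1)" by (intro sum_mono) auto
  also have "\<dots> \<le> (\<Sum>I\<in>Pow {..<n}. 1)" using sub by (intro sum_mono2) auto
  also have "\<dots> = 2 ^ n" by (simp add: card_Pow)
  finally show ?thesis .
qed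

lemma sample_law_eq: "sample_law f n = PiM {..<n} (\<lambda>_. pt)"
  by (simp add: sample_law_def pt_def)

abbreviation "crit_num k r \<equiv> \<lambda>P. real (crit_count k r P)"

lemma binom_expect_square:
  "binom_expect f n (\<lambda>P. (crit_num k r P - c)\<^sup>2) =
     binom_expect f n (\<lambda>P. (crit_num k r P)\<^sup>2) - 2 * c * binom_expect f n (crit_num k r) + c\<^sup>2"
proof -
  interpret P: prob_space "PiM {..<n} (\<lambda>_. pt)" by (rule prob_space_PiM_pt)
  note [measurable] = crit_count_measurable[of k r n]
  have i1: "integrable (PiM {..<n} (\<lambda>_. pt)) (\<lambda>x. crit_num k r (x ` {..<n}))"
    by (rule integrable_PiM_pt[OF crit_count_measurable, of _ _ _ "2 ^ n"]) (use crit_count_le in simp)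
  have i2: "integrable (PiM {..<n} (\<lambda>_. pt)) (\<lambda>x. (crit_num k r (x ` {..<n}))\<^sup>2)"
    by (rule integrable_PiM_pt[OF borel_measurable_power[OF crit_count_measurable], of _ _ _ _ "(2 ^ n)\<^sup>2"])
      (use power_mono[OF crit_count_le, of _ _ _ _ 2] in simp)
  have "(\<integral>x. (crit_num k r (x ` {..<n}) - c)\<^sup>2 \<partial>PiM {..<n} (\<lambda>_. pt)) =
     (\<integral>x. (crit_num k r (x ` {..<n}))\<^sup>2 - 2 * c * crit_num k r (x ` {..<n}) + c\<^sup>2 \<partial>PiM {..<n} (\<lambda>_. pt))"
    by (simp add: power2_diff algebra_simps)
  also have "\<dots> = (\<integral>x. (crit_num k r (x ` {..<n}))\<^sup>2 \<partial>PiM {..<n} (\<lambda>_. pt)) - 2 * c * (\<integral>x. crit_num k r (x ` {..<n}) \<partial>PiM {..<n} (\<lambda>_. pt)) + c\<^sup>2"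
    using i1 i2 by (simp add: P.prob_space)
  finally show ?thesis by (simp add: binom_expect_def sample_law_eq)
qed

lemma binom_var_eq:
  "binom_var f n (crit_num k r) = binom_expect f n (\<lambda>P. (crit_num k r P)\<^sup>2) - (binom_expect f n (crit_num k r))\<^sup>2"
  unfolding binom_var_def binom_expect_square by (simp add: power2_eq_square)

lemma integral_permute:
  assumes \<tau>: "bij_betw \<tau> {..<n} {..<n}" and h: "h \<in> borel_measurable (PiM {..<n} (\<lambda>_. pt))"
  shows "(\<integral>x. h (\<lambda>i\<in>{..<n}. x (\<tau> i)) \<partial>PiM {..<n} (\<lambda>_. pt)) = (\<integral>x. h x \<partial>PiM {..<n} (\<lambda>_. pt) :: real)"
proof -
  have im: "\<tau> ` {..<n} = {..<n}" "inj_on \<tau> {..<n}" using \<tau> by (auto simp: bij_betw_def)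
  have d: "distr (PiM {..<n} (\<lambda>_. pt)) (PiM {..<n} (\<lambda>_. pt)) (\<lambda>x. \<lambda>i\<in>{..<n}. x (\<tau> i)) = PiM {..<n} (\<lambda>_. pt)"
    using im by (intro distr_PiM_reindex[where M = "\<lambda>_. pt"]) (auto intro: prob_space_pt)
  have m: "(\<lambda>x. \<lambda>i\<in>{..<n}. x (\<tau> i)) \<in> PiM {..<n} (\<lambda>_. pt) \<rightarrow>\<^sub>M PiM {..<n} (\<lambda>_. pt)"
    using im by (intro measurable_restrict measurable_component_singleton) auto
  have "(\<integral>x. h x \<partial>PiM {..<n} (\<lambda>_. pt)) = (\<integral>x. h x \<partial>distr (PiM {..<n} (\<lambda>_. pt)) (PiM {..<n} (\<lambda>_. pt)) (\<lambda>x. \<lambda>i\<in>{..<n}. x (\<tau> i)))"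
    unfolding d ..
  also have "\<dots> = (\<integral>x. h (\<lambda>i\<in>{..<n}. x (\<tau> i)) \<partial>PiM {..<n} (\<lambda>_. pt))"
    by (rule integral_distr[OF m h])
  finally show ?thesis ..
qed

text \<open>Given the first \<open>m\<close> points, the other \<open>n - m\<close> are independent
  and each avoids the region with probability \<open>1 - mass (D w)\<close>. The congruence
  hypotheses express that event and region depend on the first \<open>m\<close> coordinates
  only.\<close>

lemma integrate_out:
  fixes V :: "(nat \<Rightarrow> 'a) \<Rightarrow> bool" and D :: "(nat \<Rightarrow> 'a) \<Rightarrow> 'a set"
  assumes m: "m \<le> n" and V: "Measurable.pred borel V"
    and D: "{p. snd p \<in> D (fst p)} \<in> sets (borel \<Otimes>\<^sub>M borel)"
    and Vc: "\<And>w w'. (\<And>i. i < m \<Longrightarrow> w i = w' i) \<Longrightarrow> V w = V w'"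
    and Dc: "\<And>w w'. (\<And>i. i < m \<Longrightarrow> w i = w' i) \<Longrightarrow> D w = D w'"
  shows "(\<integral>x. of_bool (V x \<and> (\<forall>i\<in>{m..<n}. x i \<notin> D x)) \<partial>PiM {..<n} (\<lambda>_. pt)) =
     (\<integral>w. of_bool (V w) * (1 - mass (D w)) ^ (n - m) \<partial>PiM {..<m} (\<lambda>_. pt))"
proof -
  let ?I = "{..<m}" and ?J = "{m..<n}"
  have un: "?I \<union> ?J = {..<n}" and dj: "?I \<inter> ?J = {}" using m by auto
  interpret P: prob_space "PiM {..<n} (\<lambda>_. pt)" by (rule prob_space_PiM_pt)
  have Dm: "Measurable.pred borel (\<lambda>x. x i \<in> D x)" for i
  proof -
    have "(\<lambda>x :: nat \<Rightarrow> 'a. (x, x i)) \<in> borel \<rightarrow>\<^sub>M borel \<Otimes>\<^sub>M borel"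
      by (intro measurable_Pair borel_measurable_coord) simp
    from measurable_sets[OF this D] show ?thesis by (simp add: pred_def vimage_def)
  qed
  have "Measurable.pred borel (\<lambda>x. V x \<and> (\<forall>i\<in>?J. x i \<notin> D x))"
    by (intro pred_intros_logic pred_intros_finite V Dm) simp
  from of_bool_measurable[OF this]
  have "(\<lambda>x. of_bool (V x \<and> (\<forall>i\<in>?J. x i \<notin> D x)) :: real) \<in> borel_measurable borel" .
  from borel_PiM_pt[OF this, of "{..<n}"]
  have int: "integrable (PiM (?I \<union> ?J) (\<lambda>_. pt)) (\<lambda>x. of_bool (V x \<and> (\<forall>i\<in>?J. x i \<notin> D x)) :: real)"
    unfolding un by (rule integrable_PiM_pt[where C = 1]) auto
  have "(\<integral>x. of_bool (V x \<and> (\<forall>i\<in>?J. x i \<notin> D x)) \<partial>PiM {..<n} (\<lambda>_. pt)) =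
      (\<integral>w. \<integral>y. of_bool (V (merge ?I ?J (w, y)) \<and> (\<forall>i\<in>?J. merge ?I ?J (w, y) i \<notin> D (merge ?I ?J (w, y)))) \<partial>PiM ?J (\<lambda>_. pt) \<partial>PiM ?I (\<lambda>_. pt) :: real)"
    by (rule pt_prod.product_integral_fold[OF dj finite_lessThan finite_atLeastLessThan int, unfolded un])
  also have "\<dots> = (\<integral>w. of_bool (V w) * (\<integral>y. (\<Prod>i\<in>?J. indicator (- D w) (y i)) \<partial>PiM ?J (\<lambda>_. pt)) \<partial>PiM ?I (\<lambda>_. pt))"
  proof (intro Bochner_Integration.integral_cong refl)
    fix w :: "nat \<Rightarrow> 'a"
    have e: "V (merge ?I ?J (w, y)) = V w" "D (merge ?I ?J (w, y)) = D w" for y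
      by (rule Vc, simp add: merge_def) (rule Dc, simp add: merge_def)
    have e2: "of_bool (V (merge ?I ?J (w, y)) \<and> (\<forall>i\<in>?J. merge ?I ?J (w, y) i \<notin> D (merge ?I ?J (w, y)))) =
        of_bool (V w) * (\<Prod>i\<in>?J. indicator (- D w) (y i) :: real)" for y
    proof (cases "\<forall>i\<in>?J. y i \<notin> D w")
      case True
      then have "(\<Prod>i\<in>?J. indicator (- D w) (y i) :: real) = 1" by (intro prod.neutral) auto
      then show ?thesis unfolding e using True by (auto simp: merge_def)
    next
      case False
      then obtain i where "i \<in> ?J" "y i \<in> D w" by blast
      then have "(\<Prod>i\<in>?J. indicator (- D w) (y i) :: real) = 0" by (intro prod_zero bexI[of _ i]) auto
      then show ?thesis unfolding e using False by (auto simp: merge_def)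
    qed
    show "(\<integral>y. of_bool (V (merge ?I ?J (w, y)) \<and> (\<forall>i\<in>?J. merge ?I ?J (w, y) i \<notin> D (merge ?I ?J (w, y)))) \<partial>PiM ?J (\<lambda>_. pt)) =
       of_bool (V w) * (\<integral>y. (\<Prod>i\<in>?J. indicator (- D w) (y i)) \<partial>PiM ?J (\<lambda>_. pt) :: real)"
      unfolding e2 by (rule integral_mult_right_zero)
  qed
  also have "\<dots> = (\<integral>w. of_bool (V w) * (1 - mass (D w)) ^ (n - m) \<partial>PiM ?I (\<lambda>_. pt))"
  proof (intro Bochner_Integration.integral_cong refl)
    fix w
    have [measurable]: "D w \<in> sets borel" by (rule slice_borel[OF D])
    have "(\<integral>y. (\<Prod>i\<in>?J. indicator (- D w) (y i)) \<partial>PiM ?J (\<lambda>_. pt)) = (\<Prod>i\<in>?J. \<integral>y. indicator (- D w) y \<partial>pt :: real)"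
      by (rule pt_prod.product_integral_prod) (auto simp: less_top[symmetric] pt.emeasure_finite)
    also have "(\<integral>y. indicator (- D w) y \<partial>pt :: real) = 1 - mass (D w)"
      using pt.prob_compl[of "D w"] by (simp add: Compl_eq_Diff_UNIV)
    finally show "of_bool (V w) * (\<integral>y. (\<Prod>i\<in>?J. indicator (- D w) (y i)) \<partial>PiM ?J (\<lambda>_. pt)) = of_bool (V w) * (1 - mass (D w)) ^ (n - m)"
      by simp
  qed
  finally show ?thesis .
qed

end

text \<open>By exchangeability, two \<open>K\<close>-subsets with \<open>j\<close> common points may be taken to be \<open>{..<K}\<close> and \<open>{K - j..<2 * K - j}\<close>.\<close>
definition second_block :: "nat \<Rightarrow> nat \<Rightarrow> nat set" where
  "second_block K j = {K - j..<2 * K - j}"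

text \<open>Only the emptiness conditions among the \<open>2 * K - j\<close> points themselves are
  included; all other points of the sample must avoid \<open>pair_union\<close>.\<close>

definition pair_event :: "nat \<Rightarrow> nat \<Rightarrow> (nat \<Rightarrow> 'a::euclidean_space) \<Rightarrow> bool" where
  "pair_event K j w \<longleftrightarrow> wc {..<K} w \<and> wc (second_block K j) w \<and>
     (\<forall>i\<in>second_block K j - {..<K}. w i \<notin> cb {..<K} w) \<and> (\<forall>i\<in>{..<K} - second_block K j. w i \<notin> cb (second_block K j) w)"

definition pair_radius :: "nat \<Rightarrow> nat \<Rightarrow> (nat \<Rightarrow> 'a::euclidean_space) \<Rightarrow> real" where
  "pair_radius K j w = max (cr {..<K} w) (cr (second_block K j) w)"

definition pair_union :: "nat \<Rightarrow> nat \<Rightarrow> (nat \<Rightarrow> 'a::euclidean_space) \<Rightarrow> 'a set" where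
  "pair_union K j w = cb {..<K} w \<union> cb (second_block K j) w"

lemma cb_cong: "(\<And>i. i \<in> I \<Longrightarrow> z i = z' i) \<Longrightarrow> cb I z = cb I z'"
  unfolding cb_def using wc_cong[of I z z'] cc_cong[of I z z'] cr_cong[of I z z'] by simp

lemma cb_image: "inj_on \<tau> A \<Longrightarrow> cb (\<tau> ` A) x = cb A (x \<circ> \<tau>)"
  unfolding cb_def by (simp add: wc_image)

lemma second_block_props:
  assumes "K \<ge> 1" "j \<le> K"
  shows "finite (second_block K j)" "second_block K j \<noteq> {}" "second_block K j \<subseteq> {..<2 * K - j}" "{..<K} \<subseteq> {..<2 * K - j}"
  using assms by (auto simp: second_block_def)

lemma sets_cb:
  assumes "finite I" "I \<noteq> {}"
  shows "{p :: (nat \<Rightarrow> 'a::euclidean_space) \<times> 'a. snd p \<in> cb I (fst p)} \<in> sets (borel \<Otimes>\<^sub>M borel)"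
proof -
  have [measurable]: "Measurable.pred borel (wc I :: (nat \<Rightarrow> 'a) \<Rightarrow> bool)" "cc I \<in> borel_measurable (borel :: (nat \<Rightarrow> 'a) measure)"
    "cr I \<in> borel_measurable (borel :: (nat \<Rightarrow> 'a) measure)"
    using borel_measurable_wc[OF assms] borel_measurable_cc[OF assms] borel_measurable_cr[OF assms] by blast+
  have "Measurable.pred (borel \<Otimes>\<^sub>M borel) (\<lambda>p :: (nat \<Rightarrow> 'a) \<times> 'a. wc I (fst p) \<and> dist (cc I (fst p)) (snd p) \<le> cr I (fst p))"
    by measurable
  then show ?thesis by (simp add: cb_def pred_def space_pair_measure)
qed

context
  fixes K j :: nat
  assumes K: "K \<ge> 1" and j: "j \<le> K"
begin

lemma lessThan_ne: "finite {..<K}" "{..<K} \<noteq> {}"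
  using K by (simp_all add: lessThan_empty_iff)

lemma pair_event_measurable: "Measurable.pred borel (pair_event K j :: (nat \<Rightarrow> 'a::euclidean_space) \<Rightarrow> bool)"
proof -
  note [measurable] = borel_measurable_wc[OF lessThan_ne] borel_measurable_wc[OF second_block_props(1,2)[OF K j]]
  have 1: "Measurable.pred borel (\<lambda>w :: nat \<Rightarrow> 'a. w i \<notin> cb {..<K} w)" for i
    by (rule pred_cb[OF lessThan_ne])
  have 2: "Measurable.pred borel (\<lambda>w :: nat \<Rightarrow> 'a. w i \<notin> cb (second_block K j) w)" for i
    by (rule pred_cb[OF second_block_props(1,2)[OF K j]])
  have "Measurable.pred borel (\<lambda>w :: nat \<Rightarrow> 'a. \<forall>i\<in>second_block K j - {..<K}. w i \<notin> cb {..<K} w)"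
    using 1 second_block_props(1)[OF K j] by (intro pred_intros_finite) auto
  moreover have "Measurable.pred borel (\<lambda>w :: nat \<Rightarrow> 'a. \<forall>i\<in>{..<K} - second_block K j. w i \<notin> cb (second_block K j) w)"
    using 2 by (intro pred_intros_finite) auto
  ultimately show ?thesis
    unfolding pair_event_def by (intro pred_intros_logic borel_measurable_wc lessThan_ne second_block_props(1,2)[OF K j])
qed

lemma pair_radius_measurable: "pair_radius K j \<in> borel_measurable (borel :: (nat \<Rightarrow> 'a::euclidean_space) measure)"
  unfolding pair_radius_def[abs_def]
  by (intro borel_measurable_max borel_measurable_cr lessThan_ne second_block_props(1,2)[OF K j])

lemma pair_union_sets: "{p :: (nat \<Rightarrow> 'a::euclidean_space) \<times> 'a. snd p \<in> pair_union K j (fst p)} \<in> sets (borel \<Otimes>\<^sub>M borel)"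
proof -
  have "{p :: (nat \<Rightarrow> 'a) \<times> 'a. snd p \<in> pair_union K j (fst p)} = {p. snd p \<in> cb {..<K} (fst p)} \<union> {p. snd p \<in> cb (second_block K j) (fst p)}"
    by (auto simp: pair_union_def)
  then show ?thesis by (simp only:) (intro sets.Un sets_cb lessThan_ne second_block_props(1,2)[OF K j])
qed

lemma pair_cong:
  assumes "\<And>i. i < 2 * K - j \<Longrightarrow> w i = w' i"
  shows "pair_event K j w = pair_event K j w'" "pair_radius K j w = pair_radius K j w'" "pair_union K j w = pair_union K j w'"
proof -
  have 1: "\<And>i. i \<in> {..<K} \<Longrightarrow> w i = w' i" and 2: "\<And>i. i \<in> second_block K j \<Longrightarrow> w i = w' i"
    using assms second_block_props(3,4)[OF K j] by auto
  have e: "wc {..<K} w = wc {..<K} w'" "wc (second_block K j) w = wc (second_block K j) w'"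
    "cb {..<K} w = cb {..<K} w'" "cb (second_block K j) w = cb (second_block K j) w'"
    "cr {..<K} w = cr {..<K} w'" "cr (second_block K j) w = cr (second_block K j) w'"
    by (rule wc_cong cb_cong cr_cong; simp add: 1 2)+
  show "pair_event K j w = pair_event K j w'" unfolding pair_event_def e using 1 2 by auto
  show "pair_radius K j w = pair_radius K j w'" "pair_union K j w = pair_union K j w'" by (simp_all add: pair_radius_def pair_union_def e)
qed

end

lemma good_reindex:
  assumes \<tau>: "bij_betw \<tau> {..<n} {..<n}" and A: "A \<subseteq> {..<n}"
  shows "good {..<n} r (\<tau> ` A) x \<longleftrightarrow> good {..<n} r A (\<lambda>i\<in>{..<n}. x (\<tau> i))"
proof -
  let ?x = "\<lambda>i\<in>{..<n}. x (\<tau> i)"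
  have inj: "inj_on \<tau> {..<n}" "\<tau> ` {..<n} = {..<n}" using \<tau> by (auto simp: bij_betw_def)
  have injA: "inj_on \<tau> A" using inj(1) A inj_on_subset by blast
  have c: "\<And>i. i \<in> A \<Longrightarrow> (x \<circ> \<tau>) i = ?x i" using A by auto
  have e: "wc (\<tau> ` A) x = wc A ?x" "cr (\<tau> ` A) x = cr A ?x" "cb (\<tau> ` A) x = cb A ?x"
    unfolding wc_image[OF injA, of x] cb_image[OF injA, of x]
    by (rule wc_cong cb_cong cr_cong, rule c, assumption)+
  have d: "{..<n} - \<tau> ` A = \<tau> ` ({..<n} - A)"
    using inj A by (metis inj_on_image_set_diff Diff_subset)
  have "(\<forall>i\<in>{..<n} - \<tau> ` A. x i \<notin> cb A ?x) \<longleftrightarrow> (\<forall>i\<in>{..<n} - A. ?x i \<notin> cb A ?x)"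
    unfolding d by (auto simp del: restrict_apply simp: restrict_apply')
  then show ?thesis unfolding good_def e by simp
qed

context prob_density
begin

text \<open>The probability that two given index sets with \<open>j\<close> common elements both
  yield critical points. For \<open>n < 2 * K - j\<close> the truncated exponent is harmless,
  because the coefficient \<open>ffact n (2 * K - j)\<close> is then 0.\<close>

definition binom_pair :: "nat \<Rightarrow> nat \<Rightarrow> real \<Rightarrow> nat \<Rightarrow> real" where
  "binom_pair K j r n = (\<integral>w. of_bool (pair_event K j w \<and> pair_radius K j w \<le> r) * (1 - mass (pair_union K j w)) ^ (n - (2 * K - j)) \<partial>PiM {..<2 * K - j} (\<lambda>_. pt))"

definition pois_pair :: "nat \<Rightarrow> nat \<Rightarrow> real \<Rightarrow> real \<Rightarrow> real" where
  "pois_pair K j r t = (\<integral>w. of_bool (pair_event K j w \<and> pair_radius K j w \<le> r) * exp (- t * mass (pair_union K j w)) \<partial>PiM {..<2 * K - j} (\<lambda>_. pt))"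

lemma expect_pair:
  assumes K: "K \<ge> 1" and I: "I \<subseteq> {..<n}" "card I = K" and I': "I' \<subseteq> {..<n}" "card I' = K"
  shows "(\<integral>x. of_bool (good {..<n} r I x \<and> good {..<n} r I' x) \<partial>PiM {..<n} (\<lambda>_. pt)) = binom_pair K (card (I \<inter> I')) r n"
proof -
  define j where "j = card (I \<inter> I')"
  obtain \<tau> where \<tau>: "bij_betw \<tau> {..<n} {..<n}" "\<tau> ` {..<K} = I" "\<tau> ` {K - j..<2 * K - j} = I'" "2 * K - j \<le> n" "j \<le> K"
    using matching_permutation[OF I I' j_def[symmetric]] by metis
  let ?m = "2 * K - j"
  have sub: "{..<K} \<subseteq> {..<n}" "second_block K j \<subseteq> {..<n}" using \<tau>(4,5) by (auto simp: second_block_def)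
  have tI': "\<tau> ` second_block K j = I'" using \<tau>(3) by (simp add: second_block_def)
  define h :: "(nat \<Rightarrow> 'a) \<Rightarrow> real" where "h x = of_bool (good {..<n} r {..<K} x \<and> good {..<n} r (second_block K j) x)" for x
  have gm: "Measurable.pred borel (\<lambda>x :: nat \<Rightarrow> 'a. good {..<n} r {..<K} x)"
     "Measurable.pred borel (\<lambda>x :: nat \<Rightarrow> 'a. good {..<n} r (second_block K j) x)"
    using pred_good[OF lessThan_ne[OF K \<tau>(5)]] pred_good[OF second_block_props(1,2)[OF K \<tau>(5)]] by auto
  then have hm: "h \<in> borel_measurable borel" unfolding h_def by (intro of_bool_measurable pred_intros_logic)
  have "(\<integral>x. of_bool (good {..<n} r I x \<and> good {..<n} r I' x) \<partial>PiM {..<n} (\<lambda>_. pt)) =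
      (\<integral>x. h (\<lambda>i\<in>{..<n}. x (\<tau> i)) \<partial>PiM {..<n} (\<lambda>_. pt))"
    unfolding h_def good_reindex[OF \<tau>(1) sub(1), symmetric] good_reindex[OF \<tau>(1) sub(2), symmetric] \<tau>(2) tI' ..
  also have "\<dots> = (\<integral>x. h x \<partial>PiM {..<n} (\<lambda>_. pt))"
    by (rule integral_permute[OF \<tau>(1) borel_PiM_pt[OF hm]])
  also have "\<dots> = (\<integral>x. of_bool ((pair_event K j x \<and> pair_radius K j x \<le> r) \<and> (\<forall>i\<in>{?m..<n}. x i \<notin> pair_union K j x)) \<partial>PiM {..<n} (\<lambda>_. pt))"
  proof -
    \<comment> \<open>The points to be avoided by one ball are the private points of the other
      block, covered by \<open>pair_event\<close>, and the indices from \<open>?m\<close> on,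
      covered by \<open>pair_union\<close>.\<close>
    have s1: "{..<n} - {..<K} = (second_block K j - {..<K}) \<union> {?m..<n}" and s2: "{..<n} - second_block K j = ({..<K} - second_block K j) \<union> {?m..<n}"
      using \<tau>(4,5) by (auto simp: second_block_def)
    have "good {..<n} r {..<K} x \<and> good {..<n} r (second_block K j) x \<longleftrightarrow>
      (pair_event K j x \<and> pair_radius K j x \<le> r) \<and> (\<forall>i\<in>{?m..<n}. x i \<notin> pair_union K j x)" for x :: "nat \<Rightarrow> 'a"
      unfolding good_def pair_event_def pair_radius_def pair_union_def s1 s2 by auto
    then show ?thesis unfolding h_def by simp
  qed
  also have "\<dots> = binom_pair K j r n"
    unfolding binom_pair_def
  proof (rule integrate_out[OF \<tau>(4)])
    show "Measurable.pred borel (\<lambda>w. pair_event K j w \<and> pair_radius K j w \<le> r)"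
      using pair_event_measurable[OF K \<tau>(5)] pair_radius_measurable[OF K \<tau>(5)] by measurable
    show "{p. snd p \<in> pair_union K j (fst p)} \<in> sets (borel \<Otimes>\<^sub>M borel)" by (rule pair_union_sets[OF K \<tau>(5)])
    show "(pair_event K j w \<and> pair_radius K j w \<le> r) = (pair_event K j w' \<and> pair_radius K j w' \<le> r)" "pair_union K j w = pair_union K j w'"
      if "\<And>i. i < ?m \<Longrightarrow> w i = w' i" for w w'
      using pair_cong[OF K \<tau>(5) that] by simp_all
  qed
  finally show ?thesis by (simp add: j_def)
qed

text \<open>One subset is viewed as a pair meeting in all \<open>K\<close> indices, so a single
  family of integrals serves both moments.\<close>

lemma binom_mean:
  assumes K: "K = k + 1"
  shows "binom_expect f n (crit_num k r) = ffact n K / fact K * binom_pair K K r n"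
proof -
  let ?P = "PiM {..<n} (\<lambda>_. pt)"
  let ?S = "{I. I \<subseteq> {..<n} \<and> card I = K}"
  interpret P: prob_space ?P by (rule prob_space_PiM_pt)
  have gm: "(\<lambda>x. of_bool (good {..<n} r I x) :: real) \<in> borel_measurable ?P" if "I \<in> ?S" for I
  proof -
    have "finite I" "I \<noteq> {}" using that K finite_subset[of I "{..<n}"] by auto
    from pred_good[OF this, of "{..<n}" r] show ?thesis by (intro borel_PiM_pt of_bool_measurable) simp
  qed
  have "binom_expect f n (crit_num k r) = (\<integral>x. (\<Sum>I\<in>?S. of_bool (good {..<n} r I x)) \<partial>?P)"
    unfolding binom_expect_def sample_law_eq
  proof (rule integral_cong_AE)
    show "AE x in ?P. crit_num k r (x ` {..<n}) = (\<Sum>I\<in>?S. of_bool (good {..<n} r I x))"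
      using crit_count_AE[where n = n and k = k and r = r] by (simp add: K)
    show "(\<lambda>x. \<Sum>I\<in>?S. of_bool (good {..<n} r I x) :: real) \<in> borel_measurable ?P"
      by (intro borel_measurable_sum gm)
  qed (rule crit_count_measurable)
  also have "\<dots> = (\<Sum>I\<in>?S. \<integral>x. of_bool (good {..<n} r I x) \<partial>?P)"
    by (rule Bochner_Integration.integral_sum, rule integrable_PiM_pt[where C = 1]) (use gm in auto)
  also have "\<dots> = (\<Sum>I\<in>?S. binom_pair K K r n)"
  proof (rule sum.cong)
    fix I assume "I \<in> ?S"
    then show "(\<integral>x. of_bool (good {..<n} r I x) \<partial>?P) = binom_pair K K r n"
      using expect_pair[of K I n I r] K by simp
  qed simp
  also have "\<dots> = ffact n K / fact K * binom_pair K K r n"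
    by (simp add: n_subsets ffact_binomial)
  finally show ?thesis .
qed

text \<open>The square expands into ordered pairs of \<open>K\<close>-subsets, grouped by the size
  \<open>j\<close> of their intersection. The number of such pairs is the multinomial count with
  parts \<open>j\<close>, \<open>K - j\<close>, \<open>K - j\<close>, which is the stated
  coefficient.\<close>

lemma binom_second_moment:
  assumes K: "K = k + 1"
  shows "binom_expect f n (\<lambda>P. (crit_num k r P)\<^sup>2) = (\<Sum>j\<le>K. ffact n (2 * K - j) / (fact j * (fact (K - j))\<^sup>2) * binom_pair K j r n)"
proof -
  let ?P = "PiM {..<n} (\<lambda>_. pt)"
  let ?S = "{I. I \<subseteq> {..<n} \<and> card I = K}"
  interpret P: prob_space ?P by (rule prob_space_PiM_pt)
  have finS: "finite ?S" by (rule finite_subset[of _ "Pow {..<n}"]) auto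
  have gp: "Measurable.pred borel (\<lambda>x :: nat \<Rightarrow> 'a. good {..<n} r I x)" if "I \<in> ?S" for I
  proof -
    have "finite I" "I \<noteq> {}" using that K finite_subset[of I "{..<n}"] by auto
    then show ?thesis using pred_good[of I "{..<n}" r] by simp
  qed
  have gm: "(\<lambda>x. of_bool (good {..<n} r I x) :: real) \<in> borel_measurable ?P" if "I \<in> ?S" for I
    using gp[OF that] by (intro borel_PiM_pt of_bool_measurable)
  have gm2: "(\<lambda>x. of_bool (good {..<n} r I x \<and> good {..<n} r I' x) :: real) \<in> borel_measurable ?P" if "I \<in> ?S" "I' \<in> ?S" for I I'
    using gp[OF that(1)] gp[OF that(2)] by (intro borel_PiM_pt of_bool_measurable pred_intros_logic)
  have sq: "(\<Sum>I\<in>?S. of_bool (good {..<n} r I x))\<^sup>2 = (\<Sum>I\<in>?S. \<Sum>I'\<in>?S. of_bool (good {..<n} r I x \<and> good {..<n} r I' x) :: real)" for x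
    unfolding power2_eq_square sum_product by (intro sum.cong refl) auto
  have "binom_expect f n (\<lambda>P. (crit_num k r P)\<^sup>2) = (\<integral>x. (\<Sum>I\<in>?S. \<Sum>I'\<in>?S. of_bool (good {..<n} r I x \<and> good {..<n} r I' x)) \<partial>?P)"
    unfolding binom_expect_def sample_law_eq
  proof (rule integral_cong_AE)
    have "AE x in ?P. crit_num k r (x ` {..<n}) = (\<Sum>I\<in>?S. of_bool (good {..<n} r I x))"
      using crit_count_AE[where n = n and k = k and r = r] by (simp add: K)
    then show "AE x in ?P. (crit_num k r (x ` {..<n}))\<^sup>2 = (\<Sum>I\<in>?S. \<Sum>I'\<in>?S. of_bool (good {..<n} r I x \<and> good {..<n} r I' x))"
      by (rule eventually_mono) (simp only: sq)
    show "(\<lambda>x. (\<Sum>I\<in>?S. \<Sum>I'\<in>?S. of_bool (good {..<n} r I x \<and> good {..<n} r I' x)) :: real) \<in> borel_measurable ?P"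
      using gm2 by (intro borel_measurable_sum) auto
  qed (intro borel_measurable_power crit_count_measurable)
  also have "\<dots> = (\<Sum>I\<in>?S. \<integral>x. (\<Sum>I'\<in>?S. of_bool (good {..<n} r I x \<and> good {..<n} r I' x)) \<partial>?P)"
    using gm2 by (intro Bochner_Integration.integral_sum Bochner_Integration.integrable_sum integrable_PiM_pt[where C = 1]) auto
  also have "\<dots> = (\<Sum>I\<in>?S. \<Sum>I'\<in>?S. \<integral>x. of_bool (good {..<n} r I x \<and> good {..<n} r I' x) \<partial>?P)"
    using gm2 by (intro sum.cong refl Bochner_Integration.integral_sum integrable_PiM_pt[where C = 1]) auto
  also have "\<dots> = (\<Sum>I\<in>?S. \<Sum>I'\<in>?S. binom_pair K (card (I \<inter> I')) r n)"
    using K by (intro sum.cong refl expect_pair) auto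
  also have "\<dots> = (\<Sum>I\<in>?S. \<Sum>j\<le>K. real ((K choose j) * ((n - K) choose (K - j))) * binom_pair K j r n)"
  proof (rule sum.cong[OF refl])
    fix I assume I: "I \<in> ?S"
    then have finI: "finite I" using finite_subset by auto
    have "(\<Sum>I'\<in>?S. binom_pair K (card (I \<inter> I')) r n) = (\<Sum>j\<le>K. \<Sum>I' | I' \<in> ?S \<and> card (I \<inter> I') = j. binom_pair K (card (I \<inter> I')) r n)"
    proof (rule sum.group[symmetric, OF finS])
      show "(\<lambda>I'. card (I \<inter> I')) ` ?S \<subseteq> {..K}"
        using I card_mono[OF finI, of "I \<inter> _"] by auto
    qed simp
    also have "\<dots> = (\<Sum>j\<le>K. \<Sum>I' | I' \<subseteq> {..<n} \<and> card I' = K \<and> card (I \<inter> I') = j. binom_pair K j r n)"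
      by (intro sum.cong) auto
    also have "\<dots> = (\<Sum>j\<le>K. real ((K choose j) * ((n - K) choose (K - j))) * binom_pair K j r n)"
      using I card_subsets_intersection[of I n K] by (intro sum.cong) auto
    finally show "(\<Sum>I'\<in>?S. binom_pair K (card (I \<inter> I')) r n) = (\<Sum>j\<le>K. real ((K choose j) * ((n - K) choose (K - j))) * binom_pair K j r n)" .
  qed
  also have "\<dots> = (\<Sum>j\<le>K. real (n choose K) * (real ((K choose j) * ((n - K) choose (K - j))) * binom_pair K j r n))"
    by (simp add: n_subsets sum_distrib_left)
  also have "\<dots> = (\<Sum>j\<le>K. ffact n (2 * K - j) / (fact j * (fact (K - j))\<^sup>2) * binom_pair K j r n)"
  proof (rule sum.cong[OF refl])
    fix j assume "j \<in> {..K}"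
    then have j: "j \<le> K" by simp
    have "ffact n (2 * K - j) = ffact n K * ffact (n - K) (K - j)"
      using ffact_split[of n K "K - j"] j by (simp add: mult_2)
    also have "\<dots> = real (n choose K) * fact K * (real ((n - K) choose (K - j)) * fact (K - j))"
      by (simp add: ffact_binomial)
    also have "(fact K :: real) = real (K choose j) * (fact j * fact (K - j))"
      using binomial_fact[OF j, where 'a = real] by (simp add: field_simps)
    finally show "real (n choose K) * (real ((K choose j) * ((n - K) choose (K - j))) * binom_pair K j r n) =
        ffact n (2 * K - j) / (fact j * (fact (K - j))\<^sup>2) * binom_pair K j r n"
      by (simp add: power2_eq_square)
  qed
  finally show ?thesis .
qed

text \<open>A Mecke-type formula. The quotient of \<open>ffact m M\<close> by \<open>fact m\<close>
  is \<open>1 / fact (m - M)\<close>, where \<open>M = 2 * K - j\<close>; shifting the index by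
  \<open>M\<close> leaves \<open>t ^ M\<close> and, under the integral, the exponential series of
  \<open>t\<close> times the avoidance probability. With \<open>exp (- t)\<close> this sums to the
  Poisson avoidance probability.\<close>

lemma poisson_sums:
  assumes K: "K \<ge> 1" and j: "j \<le> K" and t: "t \<ge> 0"
  shows "(\<lambda>m. (exp (- t) * t ^ m / fact m) * (ffact m (2 * K - j) * binom_pair K j r m)) sums (t ^ (2 * K - j) * pois_pair K j r t)"
proof -
  let ?M = "2 * K - j"
  let ?P = "PiM {..<?M} (\<lambda>_. pt)"
  interpret P: prob_space ?P by (rule prob_space_PiM_pt)
  define V :: "(nat \<Rightarrow> 'a) \<Rightarrow> real" where "V w = of_bool (pair_event K j w \<and> pair_radius K j w \<le> r)" for w
  define q :: "(nat \<Rightarrow> 'a) \<Rightarrow> real" where "q w = 1 - mass (pair_union K j w)" for w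
  have q01: "0 \<le> q w" "q w \<le> 1" for w by (simp_all add: q_def)
  have V01: "0 \<le> V w" "V w \<le> 1" for w by (simp_all add: V_def)
  have "Measurable.pred borel (\<lambda>w :: nat \<Rightarrow> 'a. pair_event K j w \<and> pair_radius K j w \<le> r)"
    using pair_event_measurable[OF K j] pair_radius_measurable[OF K j] by measurable
  then have "V \<in> borel_measurable borel" unfolding V_def by (rule of_bool_measurable)
  from borel_PiM_pt[OF this, of "{..<?M}"] have Vm[measurable]: "V \<in> borel_measurable ?P" .
  have "q \<in> borel_measurable borel" unfolding q_def using mass_measurable[OF pair_union_sets[OF K j]] by measurable
  from borel_PiM_pt[OF this, of "{..<?M}"] have qm[measurable]: "q \<in> borel_measurable ?P" .
  define F where "F l w = exp (- t) * (t ^ l / fact l) * (V w * q w ^ l)" for l w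
  have e0: "0 \<le> exp (- t) * (t ^ l / fact l)" for l using t by simp
  have Fb: "0 \<le> F l w" "F l w \<le> exp (- t) * (t ^ l / fact l)" for l w
  proof -
    have a: "0 \<le> V w * q w ^ l" "V w * q w ^ l \<le> 1"
      using q01 V01 by (auto intro!: mult_le_one power_le_one)
    show "0 \<le> F l w" unfolding F_def by (rule mult_nonneg_nonneg[OF e0 a(1)])
    show "F l w \<le> exp (- t) * (t ^ l / fact l)" unfolding F_def using mult_left_mono[OF a(2) e0[of l]] by simp
  qed
  have Fm[measurable]: "F l \<in> borel_measurable ?P" for l unfolding F_def by measurable
  have Fi: "integrable ?P (F l)" for l
    by (rule integrable_PiM_pt[OF Fm, of _ "exp (- t) * (t ^ l / fact l)"]) (use Fb in simp)
  have sm: "summable (\<lambda>l. exp (- t) * (t ^ l / fact l))"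
    using summable_exp[of t] by (intro summable_mult) (simp add: field_simps)
  have sF: "summable (\<lambda>l. norm (F l w))" for w
    by (rule summable_comparison_test'[OF sm, of 0]) (use Fb in auto)
  have sI: "summable (\<lambda>l. \<integral>w. norm (F l w) \<partial>?P)"
  proof (rule summable_comparison_test'[OF sm, of 0])
    fix l
    have "(\<integral>w. norm (F l w) \<partial>?P) \<le> (\<integral>w. exp (- t) * (t ^ l / fact l) \<partial>?P)"
      using Fi Fb by (intro integral_mono) auto
    then show "norm (\<integral>w. norm (F l w) \<partial>?P) \<le> exp (- t) * (t ^ l / fact l)"
      by (simp add: P.prob_space)
  qed
  have Fsum: "(\<Sum>l. F l w) = V w * exp (- t * mass (pair_union K j w))" for w
  proof -
    have "(\<lambda>l. (t * q w) ^ l /\<^sub>R fact l) sums exp (t * q w)" by (rule exp_converges)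
    from sums_mult[OF this, of "exp (- t) * V w"]
    have "(\<lambda>l. exp (- t) * V w * ((t * q w) ^ l /\<^sub>R fact l)) sums (exp (- t) * V w * exp (t * q w))" .
    moreover have "exp (- t) * V w * ((t * q w) ^ l /\<^sub>R fact l) = F l w" for l
      by (simp add: F_def power_mult_distrib field_simps)
    moreover have "exp (- t) * V w * exp (t * q w) = V w * exp (- t * mass (pair_union K j w))"
    proof -
      have "exp (- t) * exp (t * q w) = exp (- t * mass (pair_union K j w))"
        unfolding exp_add[symmetric] by (simp add: q_def algebra_simps)
      then show ?thesis by (metis mult.assoc mult.commute)
    qed
    ultimately show ?thesis by (simp add: sums_iff)
  qed
  have "(\<lambda>l. \<integral>w. F l w \<partial>?P) sums (\<integral>w. (\<Sum>l. F l w) \<partial>?P)"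
    by (rule sums_integral) (use Fi sF sI in auto)
  then have "(\<lambda>l. t ^ ?M * (\<integral>w. F l w \<partial>?P)) sums (t ^ ?M * pois_pair K j r t)"
    unfolding Fsum pois_pair_def V_def by (rule sums_mult)
  moreover have "t ^ ?M * (\<integral>w. F l w \<partial>?P) = (exp (- t) * t ^ (l + ?M) / fact (l + ?M)) * (ffact (l + ?M) ?M * binom_pair K j r (l + ?M))" for l
  proof -
    have "(\<integral>w. F l w \<partial>?P) = exp (- t) * (t ^ l / fact l) * binom_pair K j r (l + ?M)"
      unfolding F_def binom_pair_def V_def q_def by simp
    moreover have "ffact (l + ?M) ?M = fact (l + ?M) / fact l" using ffact_fact[of ?M l] by (simp add: add.commute)
    ultimately show ?thesis by (simp add: power_add)
  qed
  ultimately have "(\<lambda>l. (exp (- t) * t ^ (l + ?M) / fact (l + ?M)) * (ffact (l + ?M) ?M * binom_pair K j r (l + ?M))) sums (t ^ ?M * pois_pair K j r t)"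
    by simp
  \<comment> \<open>The shift is undone by adding the first \<open>?M\<close> terms, all of which
    vanish because \<open>ffact\<close> does.\<close>
  then have "(\<lambda>m. (exp (- t) * t ^ m / fact m) * (ffact m ?M * binom_pair K j r m)) sums
      (t ^ ?M * pois_pair K j r t + (\<Sum>m<?M. (exp (- t) * t ^ m / fact m) * (ffact m ?M * binom_pair K j r m)))"
    unfolding sums_iff_shift[where n = ?M, symmetric] .
  moreover have "(\<Sum>m<?M. (exp (- t) * t ^ m / fact m) * (ffact m ?M * binom_pair K j r m)) = 0"
    by (intro sum.neutral) (auto simp: ffact_eq_0)
  ultimately show ?thesis by simp
qed

lemma poisson_mean_sums:
  assumes K: "K = k + 1"
  shows "(\<lambda>m. (exp (- real n) * real n ^ m / fact m) * binom_expect f m (crit_num k r)) sums (real n ^ K / fact K * pois_pair K K r (real n))"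
proof -
  have "(\<lambda>m. (exp (- real n) * real n ^ m / fact m) * (ffact m (2 * K - K) * binom_pair K K r m)) sums (real n ^ (2 * K - K) * pois_pair K K r (real n))"
    by (rule poisson_sums) (use K in auto)
  from sums_mult[OF this, of "1 / fact K"]
  show ?thesis unfolding binom_mean[OF K] by (simp add: mult.commute mult.left_commute)
qed

lemma poisson_second_sums:
  assumes K: "K = k + 1"
  shows "(\<lambda>m. (exp (- real n) * real n ^ m / fact m) * binom_expect f m (\<lambda>P. (crit_num k r P)\<^sup>2)) sums
    (\<Sum>j\<le>K. real n ^ (2 * K - j) / (fact j * (fact (K - j))\<^sup>2) * pois_pair K j r (real n))"
proof -
  have "(\<lambda>m. \<Sum>j\<le>K. 1 / (fact j * (fact (K - j))\<^sup>2) * ((exp (- real n) * real n ^ m / fact m) * (ffact m (2 * K - j) * binom_pair K j r m))) sums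
    (\<Sum>j\<le>K. 1 / (fact j * (fact (K - j))\<^sup>2) * (real n ^ (2 * K - j) * pois_pair K j r (real n)))"
    by (intro sums_sum sums_mult poisson_sums) (use K in auto)
  then show ?thesis
    unfolding binom_second_moment[OF K] sum_distrib_left by (simp add: mult_ac)
qed

text \<open>\<open>pois_expect\<close> is a \<open>suminf\<close>, whose linearity depends on
  convergence. The square is therefore expanded at the level of \<open>sums\<close>, using that the
  Poisson weights sum to 1.\<close>

lemma pois_var_eq:
  assumes K: "K = k + 1"
  shows "pois_var f n (crit_num k r) = (\<Sum>j\<le>K. real n ^ (2 * K - j) / (fact j * (fact (K - j))\<^sup>2) * pois_pair K j r (real n))
     - (real n ^ K / fact K * pois_pair K K r (real n))\<^sup>2"
proof -
  let ?p = "\<lambda>m. exp (- real n) * real n ^ m / fact m"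
  define E1 where "E1 = real n ^ K / fact K * pois_pair K K r (real n)"
  define E2 where "E2 = (\<Sum>j\<le>K. real n ^ (2 * K - j) / (fact j * (fact (K - j))\<^sup>2) * pois_pair K j r (real n))"
  have s1: "(\<lambda>m. ?p m * binom_expect f m (crit_num k r)) sums E1" unfolding E1_def by (rule poisson_mean_sums[OF K])
  have s2: "(\<lambda>m. ?p m * binom_expect f m (\<lambda>P. (crit_num k r P)\<^sup>2)) sums E2" unfolding E2_def by (rule poisson_second_sums[OF K])
  have s0: "?p sums 1"
  proof -
    have "(\<lambda>m. exp (- real n) * (real n ^ m /\<^sub>R fact m)) sums (exp (- real n) * exp (real n))"
      by (intro sums_mult exp_converges)
    then show ?thesis by (simp add: exp_minus field_simps)
  qed
  have pe: "pois_expect f n (crit_num k r) = E1" unfolding pois_expect_def using s1 by (simp add: sums_iff)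
  have "(\<lambda>m. ?p m * binom_expect f m (\<lambda>P. (crit_num k r P)\<^sup>2) - 2 * E1 * (?p m * binom_expect f m (crit_num k r)) + E1\<^sup>2 * ?p m) sums
      (E2 - 2 * E1 * E1 + E1\<^sup>2 * 1)"
    by (intro sums_add sums_diff sums_mult s0 s1 s2)
  then have "(\<lambda>m. ?p m * binom_expect f m (\<lambda>P. (crit_num k r P - E1)\<^sup>2)) sums (E2 - E1\<^sup>2)"
    unfolding binom_expect_square by (simp add: algebra_simps power2_eq_square)
  then show ?thesis
    unfolding pois_var_def pe unfolding pois_expect_def E1_def E2_def by (simp add: sums_iff)
qed

end

section \<open>Binomial and Poisson kernels\<close>

lemma one_minus_power_le:
  assumes "0 \<le> x" "x \<le> real n"
  shows "(1 - x / real n) ^ N \<le> exp (- (x * (real N / real n)))"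
proof (cases "n = 0")
  case False
  have "1 - x / real n \<le> exp (- (x / real n))" using exp_ge_add_one_self[of "- (x / real n)"] by simp
  moreover have "0 \<le> 1 - x / real n" using assms False by simp
  ultimately have "(1 - x / real n) ^ N \<le> exp (- (x / real n)) ^ N" by (rule power_mono)
  also have "\<dots> = exp (- (x * (real N / real n)))" by (simp add: exp_of_nat_mult[symmetric] mult.commute)
  finally show ?thesis .
qed (use assms in simp)

text \<open>The power is squeezed between two exponentials: \<open>1 - y \<le> exp (- y)\<close>
  bounds it above, and \<open>ln (1 - y) \<ge> - y - 2 * y\<^sup>2\<close>, valid for
  \<open>y \<le> 1 / 2\<close>, bounds it below.\<close>

lemma one_minus_power_tendsto:
  assumes r: "filterlim r sequentially F" and x: "(x \<longlongrightarrow> a) F"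
    and ev: "eventually (\<lambda>t. 0 \<le> x t \<and> x t \<le> real (r t)) F"
  shows "((\<lambda>t. (1 - x t / real (r t)) ^ (r t - q)) \<longlongrightarrow> exp (- a)) F"
proof (rule tendsto_sandwich)
  have rr: "filterlim (\<lambda>t. real (r t)) at_top F" by (rule filterlim_compose[OF filterlim_real_sequentially r])
  have big: "eventually (\<lambda>t. r t \<ge> q + 1) F" using r unfolding filterlim_at_top by blast
  have inv: "((\<lambda>t. c / real (r t)) \<longlongrightarrow> 0) F" for c by (rule tendsto_divide_0[OF tendsto_const]) (rule filterlim_at_top_imp_at_infinity[OF rr])
  have half: "eventually (\<lambda>t. x t / real (r t) \<le> 1 / 2) F"
  proof -
    have "((\<lambda>t. x t / real (r t)) \<longlongrightarrow> 0) F" by (rule tendsto_divide_0[OF x]) (rule filterlim_at_top_imp_at_infinity[OF rr])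
    then have "eventually (\<lambda>t. x t / real (r t) < 1 / 2) F" by (rule order_tendstoD) simp
    then show ?thesis by (rule eventually_mono) simp
  qed
  show "eventually (\<lambda>t. (1 - x t / real (r t)) ^ (r t - q) \<le> exp (- (x t * (1 - real q / real (r t))))) F"
    using ev big
  proof eventually_elim
    case (elim t)
    have "(1 - x t / real (r t)) ^ (r t - q) \<le> exp (- (x t * (real (r t - q) / real (r t))))"
      using elim by (intro one_minus_power_le) auto
    also have "real (r t - q) / real (r t) = 1 - real q / real (r t)" using elim by (simp add: of_nat_diff field_simps)
    finally show ?case .
  qed
  show "eventually (\<lambda>t. exp (- x t - 2 * (x t)\<^sup>2 / real (r t)) \<le> (1 - x t / real (r t)) ^ (r t - q)) F"
    using ev big half
  proof eventually_elim
    case (elim t)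
    let ?n = "real (r t)" and ?y = "x t / real (r t)"
    have n: "?n > 0" using elim by simp
    have y: "0 \<le> ?y" "?y \<le> 1 / 2" using elim by auto
    have "- ?y - 2 * ?y\<^sup>2 \<le> ln (1 - ?y)" by (rule ln_one_minus_pos_lower_bound[OF y])
    then have "?n * (- ?y - 2 * ?y\<^sup>2) \<le> ?n * ln (1 - ?y)" using n by (intro mult_left_mono) auto
    moreover have "?n * (- ?y - 2 * ?y\<^sup>2) = - x t - 2 * (x t)\<^sup>2 / ?n" using n by (simp add: field_simps power2_eq_square)
    ultimately have "exp (- x t - 2 * (x t)\<^sup>2 / ?n) \<le> exp (?n * ln (1 - ?y))" by simp
    also have "exp (?n * ln (1 - ?y)) = (1 - ?y) ^ r t"
      unfolding exp_of_nat_mult using y by (subst exp_ln) linarith+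
    finally have "exp (- x t - 2 * (x t)\<^sup>2 / ?n) \<le> (1 - ?y) ^ r t" .
    moreover have "(1 - ?y) ^ r t \<le> (1 - ?y) ^ (r t - q)" using y by (intro power_decreasing) linarith+
    ultimately show ?case by linarith
  qed
  have "((\<lambda>t. exp (- (x t * (1 - real q / real (r t))))) \<longlongrightarrow> exp (- (a * (1 - 0)))) F"
    by (intro tendsto_exp tendsto_minus tendsto_mult tendsto_diff tendsto_const x inv)
  then show "((\<lambda>t. exp (- (x t * (1 - real q / real (r t))))) \<longlongrightarrow> exp (- a)) F" by simp
  have "((\<lambda>t. 2 * (x t)\<^sup>2 / real (r t)) \<longlongrightarrow> 0) F"
    by (rule tendsto_divide_0[OF tendsto_mult[OF tendsto_const tendsto_power[OF x]]]) (rule filterlim_at_top_imp_at_infinity[OF rr])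
  then have "((\<lambda>t. exp (- x t - 2 * (x t)\<^sup>2 / real (r t))) \<longlongrightarrow> exp (- a - 0)) F"
    by (intro tendsto_exp tendsto_minus tendsto_diff x)
  then show "((\<lambda>t. exp (- x t - 2 * (x t)\<^sup>2 / real (r t))) \<longlongrightarrow> exp (- a)) F" by simp
qed

lemma cfilt_proj:
  "filterlim fst sequentially (cfilt a b)" "((\<lambda>p. fst (snd p)) \<longlongrightarrow> a) (cfilt a b)" "((\<lambda>p. snd (snd p)) \<longlongrightarrow> b) (cfilt a b)"
  "eventually (\<lambda>p. 0 \<le> fst (snd p) \<and> fst (snd p) \<le> real (fst p) \<and> 0 \<le> snd (snd p) \<and> snd (snd p) \<le> real (fst p)) (cfilt a b)"
proof -
  have le: "cfilt a b \<le> sequentially \<times>\<^sub>F nhds a \<times>\<^sub>F nhds b" by (simp add: cfilt_def)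
  show "filterlim fst sequentially (cfilt a b)" by (rule filterlim_mono[OF filterlim_fst order_refl le])
  have 1: "filterlim snd (nhds a \<times>\<^sub>F nhds b) (cfilt a b)" by (rule filterlim_mono[OF filterlim_snd order_refl le])
  show "((\<lambda>p. fst (snd p)) \<longlongrightarrow> a) (cfilt a b)" by (rule filterlim_compose[OF filterlim_fst 1])
  show "((\<lambda>p. snd (snd p)) \<longlongrightarrow> b) (cfilt a b)" by (rule filterlim_compose[OF filterlim_snd 1])
  show "eventually (\<lambda>p. 0 \<le> fst (snd p) \<and> fst (snd p) \<le> real (fst p) \<and> 0 \<le> snd (snd p) \<and> snd (snd p) \<le> real (fst p)) (cfilt a b)"
    unfolding cfilt_def eventually_inf_principal by (rule always_eventually) auto
qed

lemma kern_const:
  assumes cont: "continuous_on UNIV (\<lambda>p. G (fst p) (snd p))" and \<kappa>: "\<kappa> > 0" "C \<ge> 0"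
    and bd: "\<And>a b. 0 \<le> a \<Longrightarrow> 0 \<le> b \<Longrightarrow> \<bar>G a b\<bar> \<le> C * exp (- \<kappa> * (a + b))"
  shows "kern (\<lambda>_. G) G"
  unfolding kern_def
proof (intro conjI allI)
  show "cconv (\<lambda>_. G) G"
    unfolding cconv_def
  proof (intro allI impI)
    fix a b :: real
    have "isCont (\<lambda>p. G (fst p) (snd p)) (a, b)" using cont by (simp add: continuous_on_eq_continuous_at)
    moreover have "((\<lambda>p. (fst (snd p), snd (snd p))) \<longlongrightarrow> (a, b)) (cfilt a b)"
      by (intro tendsto_Pair cfilt_proj)
    ultimately have "((\<lambda>p. G (fst (fst (snd p), snd (snd p))) (snd (fst (snd p), snd (snd p)))) \<longlongrightarrow> G (fst (a, b)) (snd (a, b))) (cfilt a b)"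
      by (rule isCont_tendsto_compose)
    then show "((\<lambda>(n, x, y). G x y) \<longlongrightarrow> G a b) (cfilt a b)" by (simp add: split_beta')
  qed
  have "(\<lambda>p. G (fst p) (snd p)) \<in> borel_measurable borel" by (rule borel_measurable_continuous_onI[OF cont])
  then have m: "case_prod G \<in> borel_measurable (borel \<Otimes>\<^sub>M borel)" by (simp add: borel_prod split_beta')
  show "case_prod G \<in> borel_measurable (borel \<Otimes>\<^sub>M borel)" "case_prod G \<in> borel_measurable (borel \<Otimes>\<^sub>M borel)" by (rule m)+
  show "\<exists>C \<kappa> N. \<kappa> > 0 \<and> C \<ge> 0 \<and> (\<forall>n\<ge>N. \<forall>a b. 0 \<le> a \<longrightarrow> a \<le> real n \<longrightarrow> 0 \<le> b \<longrightarrow> b \<le> real n \<longrightarrow>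
        \<bar>G a b\<bar> \<le> C * exp (- \<kappa> * (a + b)))"
    using \<kappa> bd by blast
qed

text \<open>Here \<open>q\<close> is the number of points already placed, and \<open>a\<close>,
  \<open>b\<close> are \<open>n\<close> times the masses of two regions. With \<open>b = 0\<close>
  it is the avoidance probability of a single region; with both arguments it is the product arising
  from the squared mean.\<close>

definition binom_kernel :: "nat \<Rightarrow> nat \<Rightarrow> real \<Rightarrow> real \<Rightarrow> real" where
  "binom_kernel q n a b = (1 - a / real n) ^ (n - q) * (1 - b / real n) ^ (n - q)"

text \<open>Dropping at most half of the factors costs at most half of the exponent, which gives
  decay uniform in \<open>n\<close>.\<close>

lemma one_minus_power_half:
  assumes "0 \<le> x" "x \<le> real n" "N \<le> n" "n \<le> 2 * N"
  shows "(1 - x / real n) ^ N \<le> exp (- (x / 2))"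
proof (cases "n = 0")
  case False
  have "(1 - x / real n) ^ N \<le> exp (- (x * (real N / real n)))" by (rule one_minus_power_le[OF assms(1,2)])
  also have "x * (1 / 2) \<le> x * (real N / real n)"
    using assms False by (intro mult_left_mono) (auto simp: field_simps)
  then have "exp (- (x * (real N / real n))) \<le> exp (- (x / 2))" by simp
  finally show ?thesis .
qed (use assms in simp)

lemma kern_binom: "kern (binom_kernel q) (\<lambda>a b. exp (- a) * exp (- b))"
  unfolding kern_def
proof (intro conjI allI)
  show "cconv (binom_kernel q) (\<lambda>a b. exp (- a) * exp (- b))"
    unfolding cconv_def
  proof (intro allI impI)
    fix a b :: real
    note p = cfilt_proj[where a = a and b = b]
    have "((\<lambda>p. (1 - fst (snd p) / real (fst p)) ^ (fst p - q) * (1 - snd (snd p) / real (fst p)) ^ (fst p - q)) \<longlongrightarrow> exp (- a) * exp (- b)) (cfilt a b)"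
      by (intro tendsto_mult one_minus_power_tendsto[OF p(1) p(2)] one_minus_power_tendsto[OF p(1) p(3)]) (use p(4) in \<open>auto elim: eventually_mono\<close>)
    then show "((\<lambda>(n, x, y). binom_kernel q n x y) \<longlongrightarrow> exp (- a) * exp (- b)) (cfilt a b)" by (simp add: split_beta' binom_kernel_def)
  qed
  show "case_prod (binom_kernel q n) \<in> borel_measurable (borel \<Otimes>\<^sub>M borel)" for n
    unfolding binom_kernel_def split_beta' by measurable
  show "(\<lambda>(a, b). exp (- a) * exp (- b :: real) :: real) \<in> borel_measurable (borel \<Otimes>\<^sub>M borel)"
    unfolding split_beta' by measurable
  show "\<exists>C \<kappa> N. \<kappa> > 0 \<and> C \<ge> 0 \<and> (\<forall>n\<ge>N. \<forall>a b. 0 \<le> a \<longrightarrow> a \<le> real n \<longrightarrow> 0 \<le> b \<longrightarrow> b \<le> real n \<longrightarrow>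
        \<bar>binom_kernel q n a b\<bar> \<le> C * exp (- \<kappa> * (a + b)))"
  \<comment> \<open>From \<open>n \<ge> 2 * q\<close> one has \<open>n \<le> 2 * (n - q)\<close>, as
    \<open>one_minus_power_half\<close> requires; the \<open>+ 1\<close> excludes
    \<open>n = 0\<close>.\<close>
  proof (rule exI[of _ 1], rule exI[of _ "1 / 2"], rule exI[of _ "2 * q + 1"], intro conjI allI impI)
    fix n :: nat and a b :: real
    assume n: "2 * q + 1 \<le> n" and a: "0 \<le> a" "a \<le> real n" and b: "0 \<le> b" "b \<le> real n"
    have "(1 - a / real n) ^ (n - q) * (1 - b / real n) ^ (n - q) \<le> exp (- (a / 2)) * exp (- (b / 2))"
      using n a b by (intro mult_mono one_minus_power_half zero_le_power) auto
    moreover have "0 \<le> binom_kernel q n a b" unfolding binom_kernel_def using n a b by (intro mult_nonneg_nonneg zero_le_power) auto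
    ultimately show "\<bar>binom_kernel q n a b\<bar> \<le> 1 * exp (- (1 / 2) * (a + b))"
      by (simp add: binom_kernel_def exp_add[symmetric] add_divide_distrib algebra_simps)
  qed auto
qed

definition ffact_ratio :: "nat \<Rightarrow> nat \<Rightarrow> real" where "ffact_ratio m n = ffact n m / real n ^ m"

lemma ffact_ratio_prod: "n > 0 \<Longrightarrow> ffact_ratio m n = (\<Prod>i<m. 1 - real i / real n)"
proof -
  assume n: "n > 0"
  have "ffact_ratio m n = (\<Prod>i<m. (real n - real i) / real n)"
    unfolding ffact_ratio_def ffact_def by (simp add: prod_dividef)
  also have "\<dots> = (\<Prod>i<m. 1 - real i / real n)" using n by (intro prod.cong) (auto simp: field_simps)
  finally show ?thesis .
qed

lemma ffact_ratio_lim: "ffact_ratio m \<longlonglongrightarrow> 1"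
proof -
  have "(\<lambda>n. \<Prod>i<m. 1 - real i / real n) \<longlonglongrightarrow> (\<Prod>i<m. 1 - 0)"
    by (intro tendsto_prod tendsto_diff tendsto_const lim_const_over_n)
  moreover have "\<forall>\<^sub>F n in sequentially. (\<Prod>i<m. 1 - real i / real n) = ffact_ratio m n"
    using eventually_gt_at_top[of 0] by eventually_elim (simp add: ffact_ratio_prod)
  ultimately show ?thesis by (auto intro: Lim_transform_eventually)
qed

text \<open>Passing from \<open>m\<close> to \<open>Suc m\<close> multiplies the ratio by
  \<open>1 - m / n\<close>, so each step adds \<open>m\<close> to the coefficient of
  \<open>1 / n\<close>.\<close>

lemma ffact_ratio_expansion: "(\<lambda>n. real n * (1 - ffact_ratio m n)) \<longlonglongrightarrow> (\<Sum>i<m. real i)"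
proof (induction m)
  case 0
  then show ?case by (simp add: ffact_ratio_def ffact_def)
next
  case (Suc m)
  have "(\<lambda>n. real n * (1 - ffact_ratio m n) + ffact_ratio m n * real m) \<longlonglongrightarrow> (\<Sum>i<m. real i) + 1 * real m"
    by (intro tendsto_intros Suc ffact_ratio_lim)
  moreover have "\<forall>\<^sub>F n in sequentially. real n * (1 - ffact_ratio m n) + ffact_ratio m n * real m = real n * (1 - ffact_ratio (Suc m) n)"
    using eventually_gt_at_top[of 0] by eventually_elim (simp add: ffact_ratio_prod field_simps)
  ultimately show ?case by (auto intro: Lim_transform_eventually)
qed

text \<open>The first-order coefficients count pairs among \<open>2 * K\<close> points and, twice,
  pairs among \<open>K\<close> points. Their difference counts the \<open>K * K\<close> cross
  pairs.\<close>

lemma ffact_ratio_diff: "(\<lambda>n. real n * (ffact_ratio (2 * K) n - (ffact_ratio K n)\<^sup>2)) \<longlonglongrightarrow> - (real K)\<^sup>2"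
proof -
  have s: "(\<Sum>i<m. real i) = real m * (real m - 1) / 2" for m
    by (induction m) (simp_all add: field_simps)
  have "(\<lambda>n. real n * (1 - ffact_ratio K n) * (1 + ffact_ratio K n) - real n * (1 - ffact_ratio (2 * K) n)) \<longlonglongrightarrow>
      (\<Sum>i<K. real i) * (1 + 1) - (\<Sum>i<2 * K. real i)"
    by (intro tendsto_intros ffact_ratio_expansion ffact_ratio_lim)
  moreover have "(\<Sum>i<K. real i) * (1 + 1) - (\<Sum>i<2 * K. real i) = - (real K)\<^sup>2"
    unfolding s by (simp add: field_simps power2_eq_square)
  moreover have "real n * (1 - ffact_ratio K n) * (1 + ffact_ratio K n) - real n * (1 - ffact_ratio (2 * K) n) = real n * (ffact_ratio (2 * K) n - (ffact_ratio K n)\<^sup>2)" for n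
    by (simp add: algebra_simps power2_eq_square)
  ultimately show ?thesis by simp
qed

lemma ffact_ratio_bounds: assumes "m \<le> n" "n > 0" shows "0 \<le> ffact_ratio m n" "ffact_ratio m n \<le> 1"
  using assms by (auto simp: ffact_ratio_prod intro!: prod_nonneg prod_le_1)

text \<open>Mean value estimates for \<open>t ^ N\<close>, obtained from the factorisation of the
  difference: every summand lies between \<open>p ^ (N - 1)\<close> and
  \<open>q ^ (N - 1)\<close>.\<close>

lemma power_diff_bounds:
  fixes p q :: real
  assumes "0 \<le> p" "p \<le> q"
  shows "real N * p ^ (N - 1) * (q - p) \<le> q ^ N - p ^ N" "q ^ N - p ^ N \<le> real N * q ^ (N - 1) * (q - p)"
proof -
  have e: "q ^ N - p ^ N = (q - p) * (\<Sum>i<N. p ^ (N - Suc i) * q ^ i)" by (rule power_diff_sumr2)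
  have i: "p ^ (N - 1) \<le> p ^ (N - Suc i) * q ^ i" "p ^ (N - Suc i) * q ^ i \<le> q ^ (N - 1)" if "i < N" for i
  proof -
    have N: "N - 1 = (N - Suc i) + i" using that by simp
    show "p ^ (N - 1) \<le> p ^ (N - Suc i) * q ^ i" unfolding N power_add
      using assms by (intro mult_left_mono power_mono) auto
    show "p ^ (N - Suc i) * q ^ i \<le> q ^ (N - 1)" unfolding N power_add
      using assms by (intro mult_right_mono power_mono) auto
  qed
  have "(\<Sum>i<N. p ^ (N - 1)) \<le> (\<Sum>i<N. p ^ (N - Suc i) * q ^ i)" using i by (intro sum_mono) auto
  then have "(q - p) * (real N * p ^ (N - 1)) \<le> q ^ N - p ^ N" unfolding e using assms by (intro mult_left_mono) auto
  then show "real N * p ^ (N - 1) * (q - p) \<le> q ^ N - p ^ N" by (simp add: mult_ac)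
  have "(\<Sum>i<N. p ^ (N - Suc i) * q ^ i) \<le> (\<Sum>i<N. q ^ (N - 1))" using i by (intro sum_mono) auto
  then have "q ^ N - p ^ N \<le> (q - p) * (real N * q ^ (N - 1))" unfolding e using assms by (intro mult_left_mono) auto
  then show "q ^ N - p ^ N \<le> real N * q ^ (N - 1) * (q - p)" by (simp add: mult_ac)
qed

text \<open>The factor \<open>n\<close> times the normalised covariance of two disjoint balls with
  \<open>n\<close>-fold masses \<open>a\<close> and \<open>b\<close>: the joint emptiness
  probability with the count of disjoint pairs, minus the product of the single ones with the
  squared count.\<close>

definition discrepancy :: "nat \<Rightarrow> nat \<Rightarrow> real \<Rightarrow> real \<Rightarrow> real" where
  "discrepancy K n a b = real n * (ffact_ratio (2 * K) n * (1 - (a + b) / real n) ^ (n - 2 * K) - (ffact_ratio K n)\<^sup>2 * binom_kernel K n a b)"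

text \<open>The factor \<open>(K - a) * exp (- a)\<close> is the derivative at \<open>h = 0\<close>
  of \<open>(1 + h) ^ K * exp (- ((1 + h) * a))\<close>, the effect of raising the intensity. The
  product form is what later produces a square.\<close>

definition limit_discrepancy :: "nat \<Rightarrow> real \<Rightarrow> real \<Rightarrow> real" where
  "limit_discrepancy K a b = - ((real K - a) * exp (- a) * ((real K - b) * exp (- b)))"

text \<open>Three effects of order \<open>1 / n\<close> are separated: the falling factorials
  contribute \<open>- K\<^sup>2\<close>, the gap \<open>q - p = a * b / n\<^sup>2\<close>
  contributes \<open>- a * b\<close>, and the exponent \<open>n - K\<close> in place of
  \<open>n - 2 * K\<close> contributes \<open>(a + b) * K\<close>. Together they give
  \<open>- (K - a) * (K - b)\<close>.\<close>

lemma discrepancy_split: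
  assumes n: "n \<ge> 2 * K" "n > 0"
  defines "p \<equiv> \<lambda>a b. 1 - (a + b) / real n" and "q \<equiv> \<lambda>a b. (1 - a / real n) * (1 - b / real n)"
  shows "discrepancy K n a b = real n * (ffact_ratio (2 * K) n - (ffact_ratio K n)\<^sup>2) * p a b ^ (n - 2 * K)
     - (ffact_ratio K n)\<^sup>2 * (real n * (q a b ^ (n - 2 * K) - p a b ^ (n - 2 * K)))
     + (ffact_ratio K n)\<^sup>2 * (q a b ^ (n - 2 * K) * (real n * (1 - q a b ^ K)))"
proof -
  have "binom_kernel K n a b = q a b ^ (n - K)" by (simp add: binom_kernel_def q_def power_mult_distrib)
  also have "n - K = (n - 2 * K) + K" using n by simp
  finally have "binom_kernel K n a b = q a b ^ (n - 2 * K) * q a b ^ K" by (simp only: power_add)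
  then show ?thesis unfolding discrepancy_def p_def by (simp add: algebra_simps)
qed

lemma discrepancy_tendsto:
  assumes r: "filterlim r sequentially F" and x: "(x \<longlongrightarrow> a) F" and y: "(y \<longlongrightarrow> b) F"
    and ev: "eventually (\<lambda>t. 0 \<le> x t \<and> 0 \<le> y t \<and> x t + y t \<le> real (r t)) F"
  shows "((\<lambda>t. discrepancy K (r t) (x t) (y t)) \<longlongrightarrow> limit_discrepancy K a b) F"
proof -
  define p where "p t = 1 - (x t + y t) / real (r t)" for t
  define q where "q t = (1 - x t / real (r t)) * (1 - y t / real (r t))" for t
  have rr: "filterlim (\<lambda>t. real (r t)) at_top F" by (rule filterlim_compose[OF filterlim_real_sequentially r])
  have inf: "filterlim (\<lambda>t. real (r t)) at_infinity F" by (rule filterlim_at_top_imp_at_infinity[OF rr])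
  have big: "eventually (\<lambda>t. r t \<ge> 2 * K + 2) F" using r unfolding filterlim_at_top by blast
  have inv: "((\<lambda>t. c t / real (r t)) \<longlongrightarrow> 0) F" if "(c \<longlongrightarrow> d) F" for c d by (rule tendsto_divide_0[OF that inf])
  have evx: "eventually (\<lambda>t. 0 \<le> x t \<and> x t \<le> real (r t)) F" "eventually (\<lambda>t. 0 \<le> y t \<and> y t \<le> real (r t)) F"
     "eventually (\<lambda>t. 0 \<le> x t + y t \<and> x t + y t \<le> real (r t)) F"
    using ev by (auto elim!: eventually_mono)
  have pN: "((\<lambda>t. p t ^ (r t - l)) \<longlongrightarrow> exp (- (a + b))) F" for l
    unfolding p_def by (rule one_minus_power_tendsto[OF r tendsto_add[OF x y] evx(3)])
  have qN: "((\<lambda>t. q t ^ (r t - l)) \<longlongrightarrow> exp (- (a + b))) F" for l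
    unfolding q_def power_mult_distrib minus_add_distrib exp_add
    by (intro tendsto_mult one_minus_power_tendsto[OF r x evx(1)] one_minus_power_tendsto[OF r y evx(2)])
  have qp: "q t - p t = x t * y t / (real (r t))\<^sup>2" if "r t > 0" for t
    using that by (simp add: q_def p_def field_simps power2_eq_square)
  have pos: "eventually (\<lambda>t. 0 \<le> p t \<and> p t \<le> q t \<and> r t \<ge> 2 * K + 2) F"
    using ev big
  proof eventually_elim
    case (elim t)
    have "0 \<le> q t - p t" unfolding qp[of t, OF less_le_trans[OF _ conjunct2[OF conjI[OF elim(1) elim(2)]]], simplified]
      using elim by (simp add: qp)
    then show ?case using elim by (auto simp: p_def divide_le_eq)
  qed
  have frac: "((\<lambda>t. real (r t - 2 * K) / real (r t)) \<longlongrightarrow> 1) F"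
  proof -
    have "((\<lambda>t. 1 - real (2 * K) / real (r t)) \<longlongrightarrow> 1 - 0) F" by (intro tendsto_diff tendsto_const inv[OF tendsto_const])
    then have "((\<lambda>t. 1 - real (2 * K) / real (r t)) \<longlongrightarrow> 1) F" by simp
    moreover have "eventually (\<lambda>t. 1 - real (2 * K) / real (r t) = real (r t - 2 * K) / real (r t)) F"
      using big by eventually_elim (simp add: of_nat_diff field_simps)
    ultimately show ?thesis by (rule Lim_transform_eventually)
  qed
  \<comment> \<open>Both mean value bounds contain the same product of \<open>real (r t)\<close>,
    the exponent and \<open>q t - p t\<close>, which tends to \<open>a * b\<close>; the remaining
    powers have the common limit \<open>exp (- (a + b))\<close>.\<close>
  have mid: "((\<lambda>t. real (r t) * (q t ^ (r t - 2 * K) - p t ^ (r t - 2 * K))) \<longlongrightarrow> a * b * exp (- (a + b))) F"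
  proof (rule tendsto_sandwich)
    have e: "real (r t) * (real (r t - 2 * K) * c * (q t - p t)) = x t * y t * (real (r t - 2 * K) / real (r t)) * c"
      if "r t > 0" for t c
      using that by (simp add: qp field_simps power2_eq_square)
    show "eventually (\<lambda>t. x t * y t * (real (r t - 2 * K) / real (r t)) * p t ^ (r t - 2 * K - 1) \<le> real (r t) * (q t ^ (r t - 2 * K) - p t ^ (r t - 2 * K))) F"
      using pos
    proof eventually_elim
      case (elim t)
      then have "real (r t) * (real (r t - 2 * K) * p t ^ (r t - 2 * K - 1) * (q t - p t)) \<le> real (r t) * (q t ^ (r t - 2 * K) - p t ^ (r t - 2 * K))"
        by (intro mult_left_mono power_diff_bounds) auto
      moreover have rt: "r t > 0" using elim by simp
      ultimately show ?case unfolding e[OF rt] by blast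
    qed
    show "eventually (\<lambda>t. real (r t) * (q t ^ (r t - 2 * K) - p t ^ (r t - 2 * K)) \<le> x t * y t * (real (r t - 2 * K) / real (r t)) * q t ^ (r t - 2 * K - 1)) F"
      using pos
    proof eventually_elim
      case (elim t)
      then have "real (r t) * (q t ^ (r t - 2 * K) - p t ^ (r t - 2 * K)) \<le> real (r t) * (real (r t - 2 * K) * q t ^ (r t - 2 * K - 1) * (q t - p t))"
        by (intro mult_left_mono power_diff_bounds) auto
      moreover have rt: "r t > 0" using elim by simp
      ultimately show ?case unfolding e[OF rt] by blast
    qed
    have "((\<lambda>t. x t * y t * (real (r t - 2 * K) / real (r t)) * p t ^ (r t - (2 * K + 1))) \<longlongrightarrow> a * b * 1 * exp (- (a + b))) F"
      by (intro tendsto_mult x y frac pN)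
    then show "((\<lambda>t. x t * y t * (real (r t - 2 * K) / real (r t)) * p t ^ (r t - 2 * K - 1)) \<longlongrightarrow> a * b * exp (- (a + b))) F" by simp
    have "((\<lambda>t. x t * y t * (real (r t - 2 * K) / real (r t)) * q t ^ (r t - (2 * K + 1))) \<longlongrightarrow> a * b * 1 * exp (- (a + b))) F"
      by (intro tendsto_mult x y frac qN)
    then show "((\<lambda>t. x t * y t * (real (r t - 2 * K) / real (r t)) * q t ^ (r t - 2 * K - 1)) \<longlongrightarrow> a * b * exp (- (a + b))) F" by simp
  qed
  have q1: "(q \<longlongrightarrow> 1) F"
  proof -
    have "(q \<longlongrightarrow> (1 - 0) * (1 - 0)) F" unfolding q_def by (intro tendsto_mult tendsto_diff tendsto_const inv[OF x] inv[OF y])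
    then show ?thesis by simp
  qed
  have last: "((\<lambda>t. real (r t) * (1 - q t ^ K)) \<longlongrightarrow> (a + b) * real K) F"
  proof -
    have "((\<lambda>t. (x t + y t - x t * y t / real (r t)) * (\<Sum>i<K. q t ^ i)) \<longlongrightarrow> (a + b - 0) * (\<Sum>i<K. 1 ^ i)) F"
      by (intro tendsto_mult tendsto_diff tendsto_add tendsto_sum tendsto_power x y q1 inv[OF tendsto_mult[OF x y]])
    moreover have "eventually (\<lambda>t. (x t + y t - x t * y t / real (r t)) * (\<Sum>i<K. q t ^ i) = real (r t) * (1 - q t ^ K)) F"
      using big
    proof eventually_elim
      case (elim t)
      have "real (r t) * (1 - q t) = x t + y t - x t * y t / real (r t)" using elim by (simp add: q_def field_simps)
      moreover have "1 - q t ^ K = (1 - q t) * (\<Sum>i<K. q t ^ i)" by (rule one_diff_power_eq)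
      ultimately show ?case by (metis mult.assoc)
    qed
    ultimately show ?thesis by (auto intro: Lim_transform_eventually)
  qed
  have c1: "((\<lambda>t. real (r t) * (ffact_ratio (2 * K) (r t) - (ffact_ratio K (r t))\<^sup>2)) \<longlongrightarrow> - (real K)\<^sup>2) F"
    by (rule filterlim_compose[OF ffact_ratio_diff r])
  have c2: "((\<lambda>t. ffact_ratio K (r t)) \<longlongrightarrow> 1) F" by (rule filterlim_compose[OF ffact_ratio_lim r])
  have "((\<lambda>t. real (r t) * (ffact_ratio (2 * K) (r t) - (ffact_ratio K (r t))\<^sup>2) * p t ^ (r t - 2 * K)
     - (ffact_ratio K (r t))\<^sup>2 * (real (r t) * (q t ^ (r t - 2 * K) - p t ^ (r t - 2 * K)))
     + (ffact_ratio K (r t))\<^sup>2 * (q t ^ (r t - 2 * K) * (real (r t) * (1 - q t ^ K)))) \<longlongrightarrow>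
     - (real K)\<^sup>2 * exp (- (a + b)) - 1\<^sup>2 * (a * b * exp (- (a + b))) + 1\<^sup>2 * (exp (- (a + b)) * ((a + b) * real K))) F"
    by (intro tendsto_add tendsto_diff tendsto_mult tendsto_power c1 c2 pN qN mid last)
  moreover have "- (real K)\<^sup>2 * exp (- (a + b)) - 1\<^sup>2 * (a * b * exp (- (a + b))) + 1\<^sup>2 * (exp (- (a + b)) * ((a + b) * real K)) = limit_discrepancy K a b"
    unfolding limit_discrepancy_def minus_add_distrib exp_add power_one by algebra
  moreover have "eventually (\<lambda>t. real (r t) * (ffact_ratio (2 * K) (r t) - (ffact_ratio K (r t))\<^sup>2) * p t ^ (r t - 2 * K)
     - (ffact_ratio K (r t))\<^sup>2 * (real (r t) * (q t ^ (r t - 2 * K) - p t ^ (r t - 2 * K)))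
     + (ffact_ratio K (r t))\<^sup>2 * (q t ^ (r t - 2 * K) * (real (r t) * (1 - q t ^ K))) = discrepancy K (r t) (x t) (y t)) F"
    using big by eventually_elim (subst discrepancy_split, auto simp: p_def q_def)
  ultimately show ?thesis by (auto intro: Lim_transform_eventually)
qed

lemma poly_exp_bounds:
  fixes u :: real assumes "u \<ge> 0"
  shows "u \<le> 4 * exp (u / 4)" "u\<^sup>2 \<le> 32 * exp (u / 4)"
proof -
  show "u \<le> 4 * exp (u / 4)" using exp_ge_add_one_self[of "u / 4"] by linarith
  have "(u / 4)\<^sup>2 / 2 \<le> exp (u / 4)" using exp_lower_Taylor_quadratic[of "u / 4"] assms by (simp add: field_simps)
  then show "u\<^sup>2 \<le> 32 * exp (u / 4)" by (simp add: power_divide)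
qed

text \<open>With \<open>u = a + b\<close> the polynomial factor is at most
  \<open>2 * K\<^sup>2 + 2 * u\<^sup>2\<close>, which is absorbed by \<open>exp (u / 4)\<close>; the
  remaining decay \<open>exp (- 3 * u / 4)\<close> is then weakened to
  \<open>exp (- u / 4)\<close>.\<close>

lemma limit_discrepancy_bound:
  assumes "0 \<le> a" "0 \<le> b"
  shows "\<bar>limit_discrepancy K a b\<bar> \<le> (2 * (real K)\<^sup>2 + 64) * exp (- ((a + b) / 4))"
proof -
  let ?u = "a + b"
  have "\<bar>real K - a\<bar> \<le> real K + ?u" "\<bar>real K - b\<bar> \<le> real K + ?u" using assms by auto
  then have "\<bar>real K - a\<bar> * \<bar>real K - b\<bar> \<le> (real K + ?u) * (real K + ?u)" using assms by (intro mult_mono) auto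
  also have "\<dots> \<le> 2 * (real K)\<^sup>2 + 2 * ?u\<^sup>2"
    using sum_squares_bound[of "real K" ?u] by (simp add: power2_eq_square algebra_simps)
  also have "\<dots> \<le> 2 * (real K)\<^sup>2 * exp (?u / 4) + 64 * exp (?u / 4)"
    using poly_exp_bounds(2)[of ?u] assms mult_left_mono[of 1 "exp (?u / 4)" "2 * (real K)\<^sup>2"] by (intro add_mono) auto
  finally have 1: "\<bar>real K - a\<bar> * \<bar>real K - b\<bar> \<le> (2 * (real K)\<^sup>2 + 64) * exp (?u / 4)" by (simp add: algebra_simps)
  have "limit_discrepancy K a b = - ((real K - a) * (real K - b) * exp (- ?u))"
    unfolding limit_discrepancy_def minus_add_distrib exp_add by algebra
  then have "\<bar>limit_discrepancy K a b\<bar> = (\<bar>real K - a\<bar> * \<bar>real K - b\<bar>) * exp (- ?u)"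
    by (simp only: abs_minus_cancel abs_mult abs_exp_cancel)
  also have "\<dots> \<le> ((2 * (real K)\<^sup>2 + 64) * exp (?u / 4)) * exp (- ?u)" using 1 by (intro mult_right_mono) auto
  also have "\<dots> = (2 * (real K)\<^sup>2 + 64) * exp (?u / 4 - ?u)" by (simp only: mult.assoc exp_add[symmetric] add_uminus_conv_diff)
  also have "\<dots> \<le> (2 * (real K)\<^sup>2 + 64) * exp (- (?u / 4))"
  proof (rule mult_left_mono)
    show "exp (?u / 4 - ?u) \<le> exp (- (?u / 4))" unfolding exp_le_cancel_iff using assms by (simp add: field_simps)
  qed simp
  finally show ?thesis .
qed

text \<open>Each of the three terms of \<open>discrepancy_split\<close> is at most quadratic in
  \<open>a + b\<close> times \<open>exp (- (a + b) / 2)\<close>; half of that exponent pays for the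
  polynomial.\<close>

lemma discrepancy_bound:
  obtains C where "C \<ge> 0" "eventually (\<lambda>n. \<forall>a b. 0 \<le> a \<longrightarrow> 0 \<le> b \<longrightarrow> a + b \<le> real n \<longrightarrow>
     \<bar>discrepancy K n a b\<bar> \<le> C * exp (- ((a + b) / 4))) sequentially"
proof -
  have "Bseq (\<lambda>n. real n * (ffact_ratio (2 * K) n - (ffact_ratio K n)\<^sup>2))" using ffact_ratio_diff by (intro convergent_imp_Bseq) (auto simp: convergent_def)
  then obtain C0 where C0: "C0 > 0" "\<And>n. \<bar>real n * (ffact_ratio (2 * K) n - (ffact_ratio K n)\<^sup>2)\<bar> \<le> C0"
    unfolding Bseq_def by auto
  show ?thesis
  \<comment> \<open>\<open>C0\<close> bounds the falling factorial term, 32 comes from the quadratic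
    term and \<open>4 * K\<close> from the linear one, by \<open>poly_exp_bounds\<close>.\<close>
  proof (rule that[of "C0 + 32 + 4 * real K"])
    show "eventually (\<lambda>n. \<forall>a b. 0 \<le> a \<longrightarrow> 0 \<le> b \<longrightarrow> a + b \<le> real n \<longrightarrow>
       \<bar>discrepancy K n a b\<bar> \<le> (C0 + 32 + 4 * real K) * exp (- ((a + b) / 4))) sequentially"
      \<comment> \<open>The smallest exponent that occurs is \<open>n - 2 * K - 1\<close>, and
        \<open>n \<le> 2 * (n - 2 * K - 1)\<close> amounts to
        \<open>n \<ge> 4 * K + 2\<close>.\<close>
      using eventually_ge_at_top[of "4 * K + 2"]
    proof eventually_elim
      case (elim n)
      show ?case
      proof (intro allI impI)
        fix a b :: real assume ab: "0 \<le> a" "0 \<le> b" "a + b \<le> real n"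
        let ?N = "n - 2 * K" and ?u = "a + b"
        define p where "p = 1 - (a + b) / real n"
        define q where "q = (1 - a / real n) * (1 - b / real n)"
        have n: "real n > 0" using elim by simp
        have p: "0 \<le> p" using ab n by (simp add: p_def divide_le_eq)
        have qp: "q - p = a * b / (real n)\<^sup>2" using n by (simp add: q_def p_def field_simps power2_eq_square)
        then have pq: "p \<le> q" using ab n by (metis diff_ge_0_iff_ge divide_nonneg_nonneg mult_nonneg_nonneg zero_le_power2)
        have q1: "q \<le> 1" unfolding q_def using ab n by (intro mult_le_one) auto
        have q0: "0 \<le> q" using p pq by simp
        have pN: "p ^ l \<le> exp (- (?u / 2))" if "l \<le> n" "n \<le> 2 * l" for l
          unfolding p_def using ab that by (intro one_minus_power_half) auto
        have qN: "q ^ l \<le> exp (- (?u / 2))" if "l \<le> n" "n \<le> 2 * l" for l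
        proof -
          have "q ^ l \<le> exp (- (a / 2)) * exp (- (b / 2))"
            unfolding q_def power_mult_distrib using ab that n
            by (intro mult_mono one_minus_power_half zero_le_power) auto
          also have "\<dots> = exp (- (?u / 2))" by (simp add: exp_add[symmetric] add_divide_distrib)
          finally show ?thesis .
        qed
        have v: "0 \<le> (ffact_ratio K n)\<^sup>2" "(ffact_ratio K n)\<^sup>2 \<le> 1" using ffact_ratio_bounds[of K n] elim by (auto intro!: power_le_one)
        have t1: "\<bar>real n * (ffact_ratio (2 * K) n - (ffact_ratio K n)\<^sup>2) * p ^ ?N\<bar> \<le> C0 * exp (- (?u / 2))"
          unfolding abs_mult[of _ "p ^ ?N"] using C0 pN[of ?N] p elim by (intro mult_mono) auto
        have "real n * (q ^ ?N - p ^ ?N) \<le> real n * (real ?N * q ^ (?N - 1) * (q - p))"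
          by (intro mult_left_mono power_diff_bounds(2)[OF p pq]) simp
        also have "\<dots> = (a * b) * ((real ?N / real n) * q ^ (?N - 1))" unfolding qp using n by (simp add: field_simps power2_eq_square)
        also have "\<dots> \<le> ?u\<^sup>2 * (1 * exp (- (?u / 2)))"
        proof (intro mult_mono)
          show "a * b \<le> ?u\<^sup>2" using ab by (simp add: power2_eq_square algebra_simps)
          show "q ^ (?N - 1) \<le> exp (- (?u / 2))" using elim by (intro qN) auto
        qed (use n q0 in \<open>auto simp: divide_le_eq\<close>)
        finally have t2: "real n * (q ^ ?N - p ^ ?N) \<le> ?u\<^sup>2 * exp (- (?u / 2))" by simp
        have t2': "0 \<le> real n * (q ^ ?N - p ^ ?N)" using p pq n by (simp add: power_mono)
        have "real n * (1 - q ^ K) \<le> real n * (real K * (1 - q))"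
          using power_diff_bounds(2)[OF q0 q1, of K] n by (intro mult_left_mono) auto
        also have "\<dots> = real K * (?u - a * b / real n)" using n by (simp add: q_def field_simps)
        also have "\<dots> \<le> real K * ?u" using ab by (intro mult_left_mono) auto
        finally have h2: "real n * (1 - q ^ K) \<le> real K * ?u" .
        have h1: "q ^ ?N \<le> exp (- (?u / 2))" using elim by (intro qN) auto
        have "q ^ ?N * (real n * (1 - q ^ K)) \<le> exp (- (?u / 2)) * (real K * ?u)"
          by (rule mult_mono[OF h1 h2]) (use q0 q1 n in \<open>auto simp: power_le_one\<close>)
        moreover have "0 \<le> q ^ ?N * (real n * (1 - q ^ K))" using q0 q1 by (simp add: power_le_one)
        ultimately have t3: "\<bar>q ^ ?N * (real n * (1 - q ^ K))\<bar> \<le> real K * ?u * exp (- (?u / 2))" by (simp add: mult.commute)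
        have "discrepancy K n a b = real n * (ffact_ratio (2 * K) n - (ffact_ratio K n)\<^sup>2) * p ^ ?N - (ffact_ratio K n)\<^sup>2 * (real n * (q ^ ?N - p ^ ?N))
           + (ffact_ratio K n)\<^sup>2 * (q ^ ?N * (real n * (1 - q ^ K)))"
          unfolding p_def q_def by (rule discrepancy_split) (use elim in auto)
        moreover have "\<bar>(ffact_ratio K n)\<^sup>2 * (real n * (q ^ ?N - p ^ ?N))\<bar> \<le> 1 * (?u\<^sup>2 * exp (- (?u / 2)))"
          unfolding abs_mult[of "(ffact_ratio K n)\<^sup>2"] using v t2 t2' by (intro mult_mono) auto
        moreover have "\<bar>(ffact_ratio K n)\<^sup>2 * (q ^ ?N * (real n * (1 - q ^ K)))\<bar> \<le> 1 * (real K * ?u * exp (- (?u / 2)))"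
          unfolding abs_mult[of "(ffact_ratio K n)\<^sup>2"] using v t3 by (intro mult_mono) auto
        ultimately have "\<bar>discrepancy K n a b\<bar> \<le> C0 * exp (- (?u / 2)) + ?u\<^sup>2 * exp (- (?u / 2)) + real K * ?u * exp (- (?u / 2))"
          using t1 by linarith
        also have "\<dots> = (C0 + ?u\<^sup>2 + real K * ?u) * exp (- (?u / 2))" by (simp add: algebra_simps)
        also have "\<dots> \<le> ((C0 + 32 + 4 * real K) * exp (?u / 4)) * exp (- (?u / 2))"
        proof (rule mult_right_mono)
          have "C0 * 1 \<le> C0 * exp (?u / 4)" using C0 ab by (intro mult_left_mono) auto
          moreover have "real K * ?u \<le> real K * (4 * exp (?u / 4))" using poly_exp_bounds(1)[of ?u] ab by (intro mult_left_mono) auto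
          moreover have "?u\<^sup>2 \<le> 32 * exp (?u / 4)" using poly_exp_bounds(2)[of ?u] ab by auto
          ultimately show "C0 + ?u\<^sup>2 + real K * ?u \<le> (C0 + 32 + 4 * real K) * exp (?u / 4)" by (simp add: algebra_simps)
        qed simp
        also have "\<dots> = (C0 + 32 + 4 * real K) * exp (?u / 4 - ?u / 2)" by (simp only: mult.assoc exp_add[symmetric] add_uminus_conv_diff)
        also have "?u / 4 - ?u / 2 = - (?u / 4)" by simp
        finally show "\<bar>discrepancy K n a b\<bar> \<le> (C0 + 32 + 4 * real K) * exp (- ((a + b) / 4))" .
      qed
    qed
  qed (use C0 in simp)
qed

text \<open>Far pairs are not tied to one scale, so the local limit lemma does not apply to them
  directly and a uniform comparison is made instead. The decay rate \<open>1 / 4\<close> of both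
  functions beats the permitted error rate \<open>1 / 8\<close> outside a bounded square, so
  counterexamples would have bounded arguments, and a convergent subsequence of them would
  contradict \<open>discrepancy_tendsto\<close>.\<close>

lemma discrepancy_uniform:
  assumes e: "e > 0"
  shows "eventually (\<lambda>n. \<forall>a b. 0 \<le> a \<longrightarrow> 0 \<le> b \<longrightarrow> a + b \<le> real n \<longrightarrow>
     \<bar>discrepancy K n a b - limit_discrepancy K a b\<bar> \<le> e * exp (- ((a + b) / 8))) sequentially"
proof (rule ccontr)
  assume neg: "\<not> ?thesis"
  obtain C1 where C1: "C1 \<ge> 0" "eventually (\<lambda>n. \<forall>a b. 0 \<le> a \<longrightarrow> 0 \<le> b \<longrightarrow> a + b \<le> real n \<longrightarrow>
     \<bar>discrepancy K n a b\<bar> \<le> C1 * exp (- ((a + b) / 4))) sequentially" by (rule discrepancy_bound)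
  then obtain N where N: "\<And>n a b. n \<ge> N \<Longrightarrow> 0 \<le> a \<Longrightarrow> 0 \<le> b \<Longrightarrow> a + b \<le> real n \<Longrightarrow> \<bar>discrepancy K n a b\<bar> \<le> C1 * exp (- ((a + b) / 4))"
    unfolding eventually_sequentially by blast
  define C where "C = C1 + (2 * (real K)\<^sup>2 + 64)"
  have C: "C > 0" using C1 by (simp add: C_def add_nonneg_pos)
  have "\<forall>i. \<exists>n a b. n \<ge> i + N \<and> 0 \<le> a \<and> 0 \<le> b \<and> a + b \<le> real n \<and> e * exp (- ((a + b) / 8)) < \<bar>discrepancy K n a b - limit_discrepancy K a b\<bar>"
    using neg unfolding eventually_sequentially by (metis not_le)
  then obtain r x y where rxy: "\<And>i. r i \<ge> i + N \<and> 0 \<le> x i \<and> 0 \<le> y i \<and> x i + y i \<le> real (r i) \<and>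
      e * exp (- ((x i + y i) / 8)) < \<bar>discrepancy K (r i) (x i) (y i) - limit_discrepancy K (x i) (y i)\<bar>" by metis
  \<comment> \<open>Beyond this value of \<open>a + b\<close> the bound
    \<open>C * exp (- (a + b) / 4)\<close> drops below the permitted error.\<close>
  define A where "A = 8 * ln (C / e)"
  have xyA: "x i + y i \<le> A" for i
  proof -
    let ?u = "x i + y i"
    have "\<bar>discrepancy K (r i) (x i) (y i) - limit_discrepancy K (x i) (y i)\<bar> \<le> C * exp (- (?u / 4))"
      using N[of "r i" "x i" "y i"] limit_discrepancy_bound[of "x i" "y i" K] rxy[of i] by (simp add: C_def algebra_simps)
    then have "e * exp (- (?u / 8)) < C * exp (- (?u / 4))" using rxy[of i] by linarith
    also have "exp (- (?u / 4)) = exp (- (?u / 8)) * exp (- (?u / 8))" by (simp add: exp_add[symmetric])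
    finally have "e < C * exp (- (?u / 8))" by (simp add: mult.assoc[symmetric])
    then have "exp (?u / 8) < C / e" using e by (simp add: exp_minus field_simps)
    then have "?u / 8 < ln (C / e)" using C e by (metis divide_pos_pos exp_less_cancel_iff exp_ln)
    then show ?thesis by (simp add: A_def)
  qed
  have "seq_compact ({0..A} \<times> {0..A})" by (intro compact_imp_seq_compact compact_Times compact_Icc)
  moreover have "\<forall>i. (x i, y i) \<in> {0..A} \<times> {0..A}"
  proof
    fix i show "(x i, y i) \<in> {0..A} \<times> {0..A}" using rxy[of i] xyA[of i] by auto
  qed
  ultimately have "\<exists>l\<in>{0..A} \<times> {0..A}. \<exists>s. strict_mono s \<and> ((\<lambda>i. (x i, y i)) \<circ> s) \<longlonglongrightarrow> l"
    unfolding seq_compact_def by (elim allE[of _ "\<lambda>i. (x i, y i)"]) simp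
  then obtain l s where l: "strict_mono s" "((\<lambda>i. (x i, y i)) \<circ> s) \<longlonglongrightarrow> l" "l \<in> {0..A} \<times> {0..A}"
    by blast
  have xs: "(\<lambda>i. x (s i)) \<longlonglongrightarrow> fst l" and ys: "(\<lambda>i. y (s i)) \<longlonglongrightarrow> snd l"
    using tendsto_fst[OF l(2)] tendsto_snd[OF l(2)] by (simp_all add: comp_def)
  have rs: "filterlim (\<lambda>i. r (s i)) sequentially sequentially"
  proof (rule filterlim_at_top_mono[OF filterlim_ident])
    show "\<forall>\<^sub>F i in sequentially. i \<le> r (s i)"
    proof (rule always_eventually, rule allI)
      fix i show "i \<le> r (s i)" using rxy[of "s i"] seq_suble[OF l(1), of i] by linarith
    qed
  qed
  have "(\<lambda>i. discrepancy K (r (s i)) (x (s i)) (y (s i))) \<longlonglongrightarrow> limit_discrepancy K (fst l) (snd l)"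
    by (rule discrepancy_tendsto[OF rs xs ys]) (use rxy in auto)
  moreover have "(\<lambda>i. limit_discrepancy K (x (s i)) (y (s i))) \<longlonglongrightarrow> limit_discrepancy K (fst l) (snd l)"
    unfolding limit_discrepancy_def by (intro tendsto_intros xs ys)
  ultimately have "(\<lambda>i. \<bar>discrepancy K (r (s i)) (x (s i)) (y (s i)) - limit_discrepancy K (x (s i)) (y (s i))\<bar>) \<longlonglongrightarrow> \<bar>limit_discrepancy K (fst l) (snd l) - limit_discrepancy K (fst l) (snd l)\<bar>"
    by (intro tendsto_intros)
  then have "(\<lambda>i. \<bar>discrepancy K (r (s i)) (x (s i)) (y (s i)) - limit_discrepancy K (x (s i)) (y (s i))\<bar>) \<longlonglongrightarrow> 0" by simp
  moreover have "e * exp (- (A / 8)) \<le> \<bar>discrepancy K (r (s i)) (x (s i)) (y (s i)) - limit_discrepancy K (x (s i)) (y (s i))\<bar>" for i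
  proof -
    have "e * exp (- (A / 8)) \<le> e * exp (- ((x (s i) + y (s i)) / 8))" using xyA[of "s i"] e by simp
    then show ?thesis using rxy[of "s i"] by linarith
  qed
  ultimately have "e * exp (- (A / 8)) \<le> 0" by (intro LIMSEQ_le_const) auto
  then show False using e by (simp add: mult_le_0_iff)
qed

section \<open>Pairs of circumballs\<close>

text \<open>Contact of the two circumballs, expressed through centres and radii so that it is
  visibly Borel and invariant under similarities.\<close>

definition near :: "nat \<Rightarrow> nat \<Rightarrow> (nat \<Rightarrow> 'a::euclidean_space) \<Rightarrow> bool" where
  "near K j w \<longleftrightarrow> wc {..<K} w \<and> wc (second_block K j) w \<and>
     dist (cc {..<K} w) (cc (second_block K j) w) \<le> cr {..<K} w + cr (second_block K j) w"

lemma cb_eq: "cb I w = (if wc I w then cball (cc I w) (cr I w) else {})"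
  by (auto simp: cb_def)

lemma bounded_cb: "bounded (cb I w)"
  by (simp add: cb_eq)

lemma not_near_disjoint:
  assumes "wc {..<K} w" "wc (second_block K j) w" "\<not> near K j w"
  shows "cb {..<K} w \<inter> cb (second_block K j) w = {}"
proof (rule ccontr)
  assume "cb {..<K} w \<inter> cb (second_block K j) w \<noteq> {}"
  then obtain y where "dist (cc {..<K} w) y \<le> cr {..<K} w" "dist (cc (second_block K j) w) y \<le> cr (second_block K j) w"
    by (auto simp: cb_def)
  then have "near K j w"
    using assms(1,2) dist_triangle2[of "cc {..<K} w" "cc (second_block K j) w" y] by (auto simp: near_def)
  then show False using assms(3) by simp
qed

lemma coord_in_cb: "wc I w \<Longrightarrow> i \<in> I \<Longrightarrow> w i \<in> cb I w"
  by (simp add: cb_def dist_cc)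

text \<open>Every vertex lies in its own ball, so for disjoint balls the mutual emptiness conditions
  hold automatically. On far pairs the event thus splits into two conditions on separate
  blocks.\<close>

lemma not_near_pair_event:
  assumes "\<not> near K j w" "wc {..<K} w" "wc (second_block K j) w"
  shows "pair_event K j w"
proof -
  note dj = not_near_disjoint[OF assms(2,3,1)]
  have "w i \<notin> cb {..<K} w" if "i \<in> second_block K j" for i
    using coord_in_cb[OF assms(3) that] dj by blast
  moreover have "w i \<notin> cb (second_block K j) w" if "i \<in> {..<K}" for i
    using coord_in_cb[OF assms(2) that] dj by blast
  ultimately show ?thesis using assms(2,3) by (auto simp: pair_event_def)
qed

text \<open>The index \<open>K - j\<close> belongs to both blocks once \<open>j \<ge> 1\<close>, and
  its point lies on both spheres.\<close>

lemma near_of_shared_point: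
  assumes "wc {..<K} w" "wc (second_block K j) w" "1 \<le> j" "j \<le> K"
  shows "near K j w"
proof -
  have i: "K - j \<in> {..<K}" "K - j \<in> second_block K j" using assms(3,4) by (auto simp: second_block_def)
  have "dist (cc {..<K} w) (cc (second_block K j) w) \<le> dist (cc {..<K} w) (w (K - j)) + dist (cc (second_block K j) w) (w (K - j))"
    by (rule dist_triangle2)
  then show ?thesis using assms i by (simp add: near_def dist_cc)
qed

text \<open>Starting from the first point at the origin, one reaches any other point through the two
  centres. Hence the two radii control the extent of the whole configuration, which links ball
  masses to the norms in \<open>controlled\<close>.\<close>

lemma near_norm_le:
  assumes near: "near K j z" and K: "K \<ge> 1" and z0: "z 0 = 0" and i: "i < 2 * K - j" and j: "j \<le> K"
  shows "norm (z i) \<le> 2 * (cr {..<K} z + cr (second_block K j) z)"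
proof -
  let ?c0 = "cc {..<K} z" and ?c1 = "cc (second_block K j) z"
  have w: "wc {..<K} z" "wc (second_block K j) z" "dist ?c0 ?c1 \<le> cr {..<K} z + cr (second_block K j) z"
    using near by (auto simp: near_def)
  have d0: "dist ?c0 0 = cr {..<K} z" using dist_cc[OF w(1), of 0] K z0 by simp
  have r: "0 \<le> cr {..<K} z" "0 \<le> cr (second_block K j) z" by (rule cr_nonneg)+
  have n: "norm (z i) \<le> dist (z i) c + dist c ?c0 + dist ?c0 0" for c
    using dist_triangle[of "z i" 0 c] dist_triangle[of c 0 ?c0] by simp
  show ?thesis
  proof (cases "i < K")
    case True
    then have "dist ?c0 (z i) = cr {..<K} z" using dist_cc[OF w(1)] by simp
    then show ?thesis using n[of ?c0] d0 r by (simp add: dist_commute)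
  next
    case False
    then have "i \<in> second_block K j" using i j by (simp add: second_block_def)
    then have "dist ?c1 (z i) = cr (second_block K j) z" using dist_cc[OF w(2)] by simp
    then show ?thesis using n[of ?c1] d0 r w(3) by (simp add: dist_commute)
  qed
qed

lemma near_measurable:
  assumes "K \<ge> 1" "j \<le> K"
  shows "Measurable.pred borel (near K j :: (nat \<Rightarrow> 'a::euclidean_space) \<Rightarrow> bool)"
proof -
  note ne = lessThan_ne[OF assms] second_block_props(1,2)[OF assms]
  have "{w \<in> space borel. dist (cc {..<K} w) (cc (second_block K j) w) \<le> cr {..<K} w + cr (second_block K j) w} \<in> sets (borel :: (nat \<Rightarrow> 'a) measure)"
    by (intro borel_measurable_le borel_measurable_dist borel_measurable_add borel_measurable_cc borel_measurable_cr ne)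
  then have "Measurable.pred borel (\<lambda>w :: nat \<Rightarrow> 'a. dist (cc {..<K} w) (cc (second_block K j) w) \<le> cr {..<K} w + cr (second_block K j) w)"
    by (simp add: pred_def)
  then show ?thesis unfolding near_def
    by (intro pred_intros_logic borel_measurable_wc ne)
qed

context
  fixes K j :: nat and x :: "'a::euclidean_space" and t :: real and w z :: "nat \<Rightarrow> 'a"
  assumes K: "K \<ge> 1" and j: "j \<le> K" and t: "t > 0" and w: "\<And>i. i < 2 * K - j \<Longrightarrow> w i = x + t *\<^sub>R z i"
begin

lemma cb_affinity:
  assumes "I \<subseteq> {..<2 * K - j}"
  shows "cb I w = (\<lambda>y. x + t *\<^sub>R y) ` cb I z"
proof -
  have wI: "\<And>i. i \<in> I \<Longrightarrow> w i = x + t *\<^sub>R z i" using w assms by auto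
  show ?thesis
  proof (cases "wc I z")
    case True
    have "(\<lambda>y. x + t *\<^sub>R y) ` cball (cc I z) (cr I z) = cball (x + t *\<^sub>R cc I z) (t * cr I z)"
    proof (intro equalityI subsetI)
      fix y assume a: "y \<in> cball (x + t *\<^sub>R cc I z) (t * cr I z)"
      define u where "u = (1 / t) *\<^sub>R (y - x)"
      have y: "y = x + t *\<^sub>R u" using t by (simp add: u_def)
      have "dist (x + t *\<^sub>R cc I z) (x + t *\<^sub>R u) = t * dist (cc I z) u"
        using t by (simp add: dist_norm scaleR_diff_right[symmetric])
      moreover have "dist (x + t *\<^sub>R cc I z) (x + t *\<^sub>R u) \<le> t * cr I z"
        using a unfolding mem_cball y[symmetric] .
      ultimately have "dist (cc I z) u \<le> cr I z" using t by simp
      then show "y \<in> (\<lambda>y. x + t *\<^sub>R y) ` cball (cc I z) (cr I z)" using y by auto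
    qed (use t in \<open>auto simp: dist_norm scaleR_diff_right[symmetric]\<close>)
    then show ?thesis
      using True by (simp add: cb_eq wc_affinity[OF t wI] cc_affinity[OF t wI] cr_affinity[OF t wI])
  qed (simp add: cb_eq wc_affinity[OF t wI])
qed

lemma pair_affinity:
  shows "pair_event K j w \<longleftrightarrow> pair_event K j z" "pair_radius K j w = t * pair_radius K j z" "near K j w \<longleftrightarrow> near K j z"
    "pair_union K j w = (\<lambda>y. x + t *\<^sub>R y) ` pair_union K j z"
    "cb {..<K} w = (\<lambda>y. x + t *\<^sub>R y) ` cb {..<K} z" "cb (second_block K j) w = (\<lambda>y. x + t *\<^sub>R y) ` cb (second_block K j) z"
proof -
  note sub = second_block_props(3,4)[OF K j]
  have w0: "\<And>i. i \<in> {..<K} \<Longrightarrow> w i = x + t *\<^sub>R z i" and w1: "\<And>i. i \<in> second_block K j \<Longrightarrow> w i = x + t *\<^sub>R z i"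
    using w sub by auto
  show c0: "cb {..<K} w = (\<lambda>y. x + t *\<^sub>R y) ` cb {..<K} z" and c1: "cb (second_block K j) w = (\<lambda>y. x + t *\<^sub>R y) ` cb (second_block K j) z"
    using cb_affinity sub by blast+
  show "pair_union K j w = (\<lambda>y. x + t *\<^sub>R y) ` pair_union K j z" by (simp add: pair_union_def c0 c1 image_Un)
  have e0: "wc {..<K} w = wc {..<K} z" "cr {..<K} w = t * cr {..<K} z" by (rule wc_affinity cr_affinity; use t w0 in blast)+
  have e1: "wc (second_block K j) w = wc (second_block K j) z" "cr (second_block K j) w = t * cr (second_block K j) z" by (rule wc_affinity cr_affinity; use t w1 in blast)+
  show "pair_radius K j w = t * pair_radius K j z" using t by (simp add: pair_radius_def e0 e1 max_mult_distrib_left)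
  have mem: "x + t *\<^sub>R y \<in> (\<lambda>y. x + t *\<^sub>R y) ` S \<longleftrightarrow> y \<in> S" for y and S :: "'a set" using t by auto
  have "(\<forall>i\<in>second_block K j - {..<K}. w i \<notin> cb {..<K} w) \<longleftrightarrow> (\<forall>i\<in>second_block K j - {..<K}. z i \<notin> cb {..<K} z)"
    unfolding c0 using w1 mem by (metis DiffD1)
  moreover have "(\<forall>i\<in>{..<K} - second_block K j. w i \<notin> cb (second_block K j) w) \<longleftrightarrow> (\<forall>i\<in>{..<K} - second_block K j. z i \<notin> cb (second_block K j) z)"
    unfolding c1 using w0 mem by (metis DiffD1)
  ultimately show "pair_event K j w \<longleftrightarrow> pair_event K j z" unfolding pair_event_def e0 e1 by blast
  show "near K j w \<longleftrightarrow> near K j z"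
  proof (cases "wc {..<K} z \<and> wc (second_block K j) z")
    case True
    have a: "cc {..<K} w = x + t *\<^sub>R cc {..<K} z" by (rule cc_affinity[OF t w0]) (use True in auto)
    have b: "cc (second_block K j) w = x + t *\<^sub>R cc (second_block K j) z" by (rule cc_affinity[OF t w1]) (use True in auto)
    have "dist (x + t *\<^sub>R u) (x + t *\<^sub>R v) = t * dist u v" for u v :: 'a
      using t by (simp add: dist_norm scaleR_diff_right[symmetric])
    then have "near K j w \<longleftrightarrow> t * dist (cc {..<K} z) (cc (second_block K j) z) \<le> t * (cr {..<K} z + cr (second_block K j) z)"
      using True by (simp add: near_def e0 e1 a b distrib_left)
    then show ?thesis using True t by (simp add: near_def)
  qed (auto simp: near_def e0 e1)
qed

end

text \<open>Three inputs for \<open>local_limit\<close>: pairs sharing points, touching pairs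
  weighted by the mass of the union, and touching pairs weighted by both masses separately.\<close>

lemma config_pair:
  assumes K: "K \<ge> 1" and j: "j \<le> K"
  shows "config (2 * K - j) (pair_event K j :: (nat \<Rightarrow> 'a::euclidean_space) \<Rightarrow> bool) (pair_radius K j) (pair_union K j) (\<lambda>_. {})"
    and "config (2 * K - j) (\<lambda>w :: nat \<Rightarrow> 'a. pair_event K j w \<and> near K j w) (pair_radius K j) (pair_union K j) (\<lambda>_. {})"
    and "config (2 * K - j) (near K j :: (nat \<Rightarrow> 'a) \<Rightarrow> bool) (pair_radius K j) (cb {..<K}) (cb (second_block K j))"
proof -
  have e: "{p :: (nat \<Rightarrow> 'a) \<times> 'a. snd p \<in> {}} \<in> sets (borel \<Otimes>\<^sub>M borel)" by simp
  have b: "bounded (pair_union K j w)" for w :: "nat \<Rightarrow> 'a" by (simp add: pair_union_def bounded_cb)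
  note m = pair_event_measurable[OF K j] pair_radius_measurable[OF K j] pair_union_sets[OF K j] near_measurable[OF K j]
    sets_cb[OF lessThan_ne[OF K j]] sets_cb[OF second_block_props(1,2)[OF K j]]
  have m2: "Measurable.pred borel (\<lambda>w :: nat \<Rightarrow> 'a. pair_event K j w \<and> near K j w)"
    by (intro pred_intros_logic m)
  have eq: "(pair_event K j w \<longleftrightarrow> pair_event K j z) \<and> pair_radius K j w = t * pair_radius K j z \<and> (near K j w \<longleftrightarrow> near K j z) \<and>
    pair_union K j w = (\<lambda>y. x + t *\<^sub>R y) ` pair_union K j z \<and> cb {..<K} w = (\<lambda>y. x + t *\<^sub>R y) ` cb {..<K} z \<and>
    cb (second_block K j) w = (\<lambda>y. x + t *\<^sub>R y) ` cb (second_block K j) z"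
    if "t > 0" "\<forall>i<2 * K - j. w i = x + t *\<^sub>R z i" for x :: 'a and t w z
    using pair_affinity[OF K j that(1), of w x z] that(2) by blast
  show "config (2 * K - j) (pair_event K j :: (nat \<Rightarrow> 'a) \<Rightarrow> bool) (pair_radius K j) (pair_union K j) (\<lambda>_. {})"
    unfolding config_def by (intro conjI allI impI m e b bounded_empty; blast dest: eq)
  show "config (2 * K - j) (\<lambda>w :: nat \<Rightarrow> 'a. pair_event K j w \<and> near K j w) (pair_radius K j) (pair_union K j) (\<lambda>_. {})"
    unfolding config_def by (intro conjI allI impI m m2 e b bounded_empty; blast dest: eq)
  show "config (2 * K - j) (near K j :: (nat \<Rightarrow> 'a) \<Rightarrow> bool) (pair_radius K j) (cb {..<K}) (cb (second_block K j))"
    unfolding config_def by (intro conjI allI impI m bounded_cb; blast dest: eq)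
qed

text \<open>\<open>ball_mass\<close> is the source of domination, a lower bound on ball masses
  linear in the rescaled radius. \<open>W_mono\<close> and \<open>W_small\<close> serve the
  positivity of \<open>alpha\<close>: shrinking a simplex keeps it admissible, and small ones are
  admissible.\<close>

locale crit_scaling = scaling f s r \<beta> W for f :: "'a::euclidean_space \<Rightarrow> real" and s r \<beta> W +
  assumes ball_mass: "\<exists>c C. c > 0 \<and> eventually (\<lambda>n. \<forall>I w. finite I \<longrightarrow> I \<noteq> {} \<longrightarrow> wc I w \<longrightarrow> (\<forall>i\<in>I. f (w i) > 0) \<longrightarrow>
      cr I w \<le> r n \<longrightarrow> c * (cr I w / s n) - C \<le> real n * mass (cb I w)) sequentially"
    and W_mono: "\<And>t t'. W t \<Longrightarrow> t' \<le> t \<Longrightarrow> W t'"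
    and W_small: "\<exists>\<eta>>0. W \<eta>"
begin

lemma pair_ball_mass:
  assumes K: "K \<ge> 1" and j: "j \<le> K" and near: "\<And>z. U z \<Longrightarrow> near K j z"
  obtains c C where "c > 0" "eventually (\<lambda>n. \<forall>x z. z 0 = 0 \<longrightarrow> (\<forall>i<2 * K - j. f (x + s n *\<^sub>R z i) > 0) \<longrightarrow> U z \<longrightarrow>
      pair_radius K j z \<le> r n / s n \<longrightarrow>
      c * (\<Sum>i<2 * K - j. norm (z i)) - C \<le> real n * mass (blow n x (cb {..<K} z)) + real n * mass (blow n x (cb (second_block K j) z))) sequentially"
proof -
  let ?m = "2 * K - j"
  obtain c C where c: "c > 0" "eventually (\<lambda>n. \<forall>I w. finite I \<longrightarrow> I \<noteq> {} \<longrightarrow> wc I w \<longrightarrow> (\<forall>i\<in>I. f (w i) > 0) \<longrightarrow>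
      cr I w \<le> r n \<longrightarrow> c * (cr I w / s n) - C \<le> real n * mass (cb I w)) sequentially"
    using ball_mass by blast
  have m: "real ?m > 0" using K j by auto
  show ?thesis
  \<comment> \<open>By \<open>near_norm_le\<close> the sum of norms is at most \<open>2 * ?m\<close>
    times the sum of the radii; the loss \<open>C\<close> occurs once for each ball.\<close>
  proof (rule that[of "c / (2 * real ?m)" "2 * C"])
    show "c / (2 * real ?m) > 0" using c(1) m by simp
    show "eventually (\<lambda>n. \<forall>x z. z 0 = 0 \<longrightarrow> (\<forall>i<?m. f (x + s n *\<^sub>R z i) > 0) \<longrightarrow> U z \<longrightarrow> pair_radius K j z \<le> r n / s n \<longrightarrow>
      c / (2 * real ?m) * (\<Sum>i<?m. norm (z i)) - 2 * C \<le> real n * mass (blow n x (cb {..<K} z)) + real n * mass (blow n x (cb (second_block K j) z))) sequentially"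
      using c(2)
    proof eventually_elim
      case (elim n)
      show ?case
      proof (intro allI impI)
        fix x :: 'a and z
        assume z0: "z 0 = 0" and fz: "\<forall>i<?m. f (x + s n *\<^sub>R z i) > 0" and U: "U z" and rho: "pair_radius K j z \<le> r n / s n"
        define w where "w i = x + s n *\<^sub>R z i" for i
        have nz: "near K j z" using near[OF U] .
        have one: "c * cr I z - C \<le> real n * mass (blow n x (cb I z))"
          if I: "finite I" "I \<noteq> {}" "I \<subseteq> {..<?m}" "wc I z" "cr I z \<le> pair_radius K j z" for I
        proof -
          have e: "wc I w" "cr I w = s n * cr I z"
            using wc_affinity[OF s_pos, of I w x n z] cr_affinity[OF s_pos, of I w x n z] I(4) by (auto simp: w_def)
          have "cb I w = blow n x (cb I z)" by (rule cb_affinity[OF K j s_pos _ I(3)]) (simp add: w_def)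
          moreover have "cr I w \<le> r n"
            using order_trans[OF I(5) rho] s_pos[of n] unfolding e by (simp add: pos_le_divide_eq mult.commute)
          moreover have "\<forall>i\<in>I. f (w i) > 0" using fz I(3) by (auto simp: w_def)
          ultimately have "c * (cr I w / s n) - C \<le> real n * mass (blow n x (cb I z))"
            using elim I(1,2) e(1) by metis
          then show ?thesis using s_pos[of n] by (simp add: e)
        qed
        have 1: "c * cr {..<K} z - C \<le> real n * mass (blow n x (cb {..<K} z))"
          using nz lessThan_ne[OF K j] second_block_props[OF K j] by (intro one) (auto simp: near_def pair_radius_def)
        have 2: "c * cr (second_block K j) z - C \<le> real n * mass (blow n x (cb (second_block K j) z))"
          using nz lessThan_ne[OF K j] second_block_props[OF K j] by (intro one) (auto simp: near_def pair_radius_def)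
        have "(\<Sum>i<?m. norm (z i)) \<le> (\<Sum>i<?m. 2 * (cr {..<K} z + cr (second_block K j) z))"
          by (intro sum_mono near_norm_le[OF nz K z0 _ j]) auto
        also have "\<dots> = real ?m * (2 * (cr {..<K} z + cr (second_block K j) z))" by simp
        finally have "c / (2 * real ?m) * (\<Sum>i<?m. norm (z i)) \<le> c / (2 * real ?m) * (real ?m * (2 * (cr {..<K} z + cr (second_block K j) z)))"
          using c(1) m by (intro mult_left_mono) auto
        also have "\<dots> = c * (cr {..<K} z + cr (second_block K j) z)" using m by (simp add: field_simps)
        finally show "c / (2 * real ?m) * (\<Sum>i<?m. norm (z i)) - 2 * C \<le>
            real n * mass (blow n x (cb {..<K} z)) + real n * mass (blow n x (cb (second_block K j) z))"
          using 1 2 by (simp add: algebra_simps)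
      qed
    qed
  qed
qed

lemma controlled_two:
  assumes K: "K \<ge> 1" and j: "j \<le> K" and near: "\<And>z. U z \<Longrightarrow> near K j z"
  shows "controlled (2 * K - j) U (pair_radius K j) (cb {..<K}) (cb (second_block K j))"
  unfolding controlled_def by (rule pair_ball_mass[OF assms]) blast+

lemma controlled_union:
  assumes K: "K \<ge> 1" and j: "j \<le> K" and near: "\<And>z. U z \<Longrightarrow> near K j z"
  shows "controlled (2 * K - j) U (pair_radius K j) (pair_union K j) (\<lambda>_. {})"
proof -
  let ?m = "2 * K - j"
  obtain c C where c: "c > 0" "eventually (\<lambda>n. \<forall>x z. z 0 = 0 \<longrightarrow> (\<forall>i<?m. f (x + s n *\<^sub>R z i) > 0) \<longrightarrow> U z \<longrightarrow>
      pair_radius K j z \<le> r n / s n \<longrightarrow>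
      c * (\<Sum>i<?m. norm (z i)) - C \<le> real n * mass (blow n x (cb {..<K} z)) + real n * mass (blow n x (cb (second_block K j) z))) sequentially"
    by (rule pair_ball_mass[OF assms])
  show ?thesis
    unfolding controlled_def
  \<comment> \<open>The mass of the union dominates each of the two ball masses, hence half of their
    sum.\<close>
  proof (rule exI[of _ "c / 2"], rule exI[of _ "C / 2"], intro conjI)
    show "c / 2 > 0" using c by simp
    show "eventually (\<lambda>n. \<forall>x z. z 0 = 0 \<longrightarrow> (\<forall>i<?m. f (x + s n *\<^sub>R z i) > 0) \<longrightarrow> U z \<longrightarrow>
      pair_radius K j z \<le> r n / s n \<longrightarrow>
      c / 2 * (\<Sum>i<?m. norm (z i)) - C / 2 \<le> real n * mass (blow n x (pair_union K j z)) + real n * mass (blow n x {})) sequentially"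
      using c(2)
    proof eventually_elim
      case (elim n)
      show ?case
      proof (intro allI impI)
        fix x :: 'a and z
        assume *: "z 0 = 0" "\<forall>i<?m. f (x + s n *\<^sub>R z i) > 0" "U z" "pair_radius K j z \<le> r n / s n"
        have "c * (\<Sum>i<?m. norm (z i)) - C \<le> real n * mass (blow n x (cb {..<K} z)) + real n * mass (blow n x (cb (second_block K j) z))"
          using elim * by blast
        moreover have "mass (blow n x (cb I z)) \<le> mass (blow n x (pair_union K j z))" if "I = {..<K} \<or> I = second_block K j" for I
        proof (rule pt.finite_measure_mono)
          show "blow n x (cb I z) \<subseteq> blow n x (pair_union K j z)" using that by (auto simp: pair_union_def)
          have "pair_union K j z \<in> sets borel" by (rule slice_borel[OF pair_union_sets[OF K j]])
          moreover have "bounded (pair_union K j z)" by (simp add: pair_union_def bounded_cb)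
          ultimately show "blow n x (pair_union K j z) \<in> sets pt" by (simp add: mass_affine(2) s_pos)
        qed
        then have "mass (blow n x (cb {..<K} z)) \<le> mass (blow n x (pair_union K j z))" "mass (blow n x (cb (second_block K j) z)) \<le> mass (blow n x (pair_union K j z))"
          by auto
        then have "real n * mass (blow n x (cb {..<K} z)) \<le> real n * mass (blow n x (pair_union K j z))"
          "real n * mass (blow n x (cb (second_block K j) z)) \<le> real n * mass (blow n x (pair_union K j z))"
          by (auto intro: mult_left_mono)
        ultimately show "c / 2 * (\<Sum>i<?m. norm (z i)) - C / 2 \<le> real n * mass (blow n x (pair_union K j z)) + real n * mass (blow n x {})"
          by (simp add: field_simps)
      qed
    qed
  qed
qed

end

context prob_density
begin

text \<open>The function \<open>h\<close> stays arbitrary so that the emptiness probabilities of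
  both models, the add-one kernel and the weight of the error term are treated alike.\<close>

definition ball_weight :: "(real \<Rightarrow> real) \<Rightarrow> nat set \<Rightarrow> real \<Rightarrow> (nat \<Rightarrow> 'a) \<Rightarrow> real" where
  "ball_weight h I r w = of_bool (wc I w \<and> cr I w \<le> r) * h (mass (cb I w))"

lemma ball_weight_measurable:
  assumes "finite I" "I \<noteq> {}" and [measurable]: "h \<in> borel_measurable borel"
  shows "ball_weight h I r \<in> borel_measurable borel"
proof -
  have [measurable]: "Measurable.pred borel (\<lambda>w :: nat \<Rightarrow> 'a. wc I w)" by (rule borel_measurable_wc[OF assms(1,2)])
  have [measurable]: "cr I \<in> borel_measurable (borel :: (nat \<Rightarrow> 'a) measure)" by (rule borel_measurable_cr[OF assms(1,2)])
  have [measurable]: "(\<lambda>w. mass (cb I w)) \<in> borel_measurable (borel :: (nat \<Rightarrow> 'a) measure)"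
    by (rule mass_measurable[OF sets_cb[OF assms(1,2)]])
  show ?thesis unfolding ball_weight_def[abs_def] by measurable
qed

lemma second_block_0: "second_block K 0 = {K..<2 * K}"
  by (simp add: second_block_def)

lemma second_block_self: "second_block K K = {..<K}"
  by (auto simp: second_block_def)

lemma pair_event_self: "pair_event K K w \<longleftrightarrow> wc {..<K} w"
  by (simp add: pair_event_def second_block_self)

lemma pair_radius_self: "pair_radius K K w = cr {..<K} w"
  by (simp add: pair_radius_def second_block_self)

lemma pair_union_self: "pair_union K K w = cb {..<K} w"
  by (simp add: pair_union_def second_block_self)

text \<open>Blocks without common index are independent, and shifting indices by \<open>K\<close>
  identifies their laws. This rewrites squared means as integrals over pairs, the form needed for
  comparison with second moments.\<close>

lemma pair_product:
  assumes K: "K \<ge> 1" and h: "h \<in> borel_measurable borel" "\<And>x. 0 \<le> x \<Longrightarrow> x \<le> 1 \<Longrightarrow> \<bar>h x\<bar> \<le> C"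
  shows "(\<integral>w. ball_weight h {..<K} r w * ball_weight h (second_block K 0) r w \<partial>PiM {..<2 * K} (\<lambda>_. pt)) = (\<integral>w. ball_weight h {..<K} r w \<partial>PiM {..<K} (\<lambda>_. pt))\<^sup>2"
proof -
  let ?I = "{..<K}" and ?J = "{K..<2 * K}"
  have un: "?I \<union> ?J = {..<2 * K}" and dj: "?I \<inter> ?J = {}" by auto
  have ne: "finite ?I" "?I \<noteq> {}" "finite (second_block K 0)" "second_block K 0 \<noteq> {}" using lessThan_ne[OF K, of 0] second_block_props[OF K, of 0] by auto
  have hm: "ball_weight h {..<K} r \<in> borel_measurable borel" "ball_weight h (second_block K 0) r \<in> borel_measurable borel"
    using ball_weight_measurable ne h(1) by blast+
  have bd: "\<bar>ball_weight h I r w\<bar> \<le> C" for I w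
  proof -
    have "0 \<le> C" using h(2)[of 0] by simp
    then show ?thesis using h(2)[of "mass (cb I w)"] by (simp add: ball_weight_def)
  qed
  have C0: "0 \<le> C" using bd[of undefined undefined] by simp
  have int: "integrable (PiM (?I \<union> ?J) (\<lambda>_. pt)) (\<lambda>w. ball_weight h {..<K} r w * ball_weight h (second_block K 0) r w)"
  proof (rule integrable_PiM_pt[where C = "C * C"])
    show "(\<lambda>w. ball_weight h {..<K} r w * ball_weight h (second_block K 0) r w) \<in> borel_measurable (PiM (?I \<union> ?J) (\<lambda>_. pt))"
      by (intro borel_measurable_times borel_PiM_pt hm)
    show "\<bar>ball_weight h {..<K} r w * ball_weight h (second_block K 0) r w\<bar> \<le> C * C" for w
      unfolding abs_mult using bd C0 by (intro mult_mono) auto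
  qed
  have "(\<integral>w. ball_weight h {..<K} r w * ball_weight h (second_block K 0) r w \<partial>PiM {..<2 * K} (\<lambda>_. pt)) =
     (\<integral>x. \<integral>y. ball_weight h {..<K} r (merge ?I ?J (x, y)) * ball_weight h (second_block K 0) r (merge ?I ?J (x, y)) \<partial>PiM ?J (\<lambda>_. pt) \<partial>PiM ?I (\<lambda>_. pt))"
    by (rule pt_prod.product_integral_fold[OF dj finite_lessThan finite_atLeastLessThan int, unfolded un])
  also have "\<dots> = (\<integral>x. \<integral>y. ball_weight h {..<K} r x * ball_weight h (second_block K 0) r y \<partial>PiM ?J (\<lambda>_. pt) \<partial>PiM ?I (\<lambda>_. pt))"
  proof (intro Bochner_Integration.integral_cong refl)
    fix x y :: "nat \<Rightarrow> 'a"
    have c0: "\<And>i. i \<in> ?I \<Longrightarrow> merge ?I ?J (x, y) i = x i" and c1: "\<And>i. i \<in> second_block K 0 \<Longrightarrow> merge ?I ?J (x, y) i = y i"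
      by (auto simp: merge_def second_block_0)
    have "ball_weight h {..<K} r (merge ?I ?J (x, y)) = ball_weight h {..<K} r x"
      unfolding ball_weight_def using wc_cong[of ?I, OF c0] cr_cong[of ?I, OF c0] cb_cong[of ?I, OF c0] by simp
    moreover have "ball_weight h (second_block K 0) r (merge ?I ?J (x, y)) = ball_weight h (second_block K 0) r y"
      unfolding ball_weight_def using wc_cong[of "second_block K 0", OF c1] cr_cong[of "second_block K 0", OF c1] cb_cong[of "second_block K 0", OF c1] by simp
    ultimately show "ball_weight h {..<K} r (merge ?I ?J (x, y)) * ball_weight h (second_block K 0) r (merge ?I ?J (x, y)) = ball_weight h {..<K} r x * ball_weight h (second_block K 0) r y"
      by simp
  qed
  also have "\<dots> = (\<integral>x. ball_weight h {..<K} r x \<partial>PiM ?I (\<lambda>_. pt)) * (\<integral>y. ball_weight h (second_block K 0) r y \<partial>PiM ?J (\<lambda>_. pt))"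
    by simp
  also have "(\<integral>y. ball_weight h (second_block K 0) r y \<partial>PiM ?J (\<lambda>_. pt)) = (\<integral>y. ball_weight h {..<K} r y \<partial>PiM ?I (\<lambda>_. pt))"
  proof -
    let ?sh = "\<lambda>y. \<lambda>i\<in>?I. y (K + i)"
    have d: "distr (PiM ?J (\<lambda>_. pt)) (PiM ?I (\<lambda>_. pt)) ?sh = PiM ?I (\<lambda>_. pt)"
      by (rule distr_PiM_reindex[where M = "\<lambda>_. pt"]) (auto intro: prob_space_pt)
    have m: "?sh \<in> PiM ?J (\<lambda>_. pt) \<rightarrow>\<^sub>M PiM ?I (\<lambda>_. pt)"
      by (intro measurable_restrict measurable_component_singleton) auto
    have "(\<integral>y. ball_weight h {..<K} r y \<partial>PiM ?I (\<lambda>_. pt)) = (\<integral>y. ball_weight h {..<K} r y \<partial>distr (PiM ?J (\<lambda>_. pt)) (PiM ?I (\<lambda>_. pt)) ?sh)"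
      unfolding d ..
    also have "\<dots> = (\<integral>y. ball_weight h {..<K} r (?sh y) \<partial>PiM ?J (\<lambda>_. pt))"
      by (rule integral_distr[OF m borel_PiM_pt[OF hm(1)]])
    also have "\<dots> = (\<integral>y. ball_weight h (second_block K 0) r y \<partial>PiM ?J (\<lambda>_. pt))"
    proof (intro Bochner_Integration.integral_cong refl)
      fix y :: "nat \<Rightarrow> 'a"
      have A: "second_block K 0 = (\<lambda>i. K + i) ` ?I" by (simp add: second_block_0 lessThan_atLeast0 mult_2)
      have inj: "inj_on (\<lambda>i. K + i) ?I" by simp
      have c: "\<And>i. i \<in> ?I \<Longrightarrow> (y \<circ> (\<lambda>i. K + i)) i = ?sh y i" by simp
      have "wc (second_block K 0) y = wc ?I (?sh y)" "cr (second_block K 0) y = cr ?I (?sh y)" "cb (second_block K 0) y = cb ?I (?sh y)"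
        unfolding A wc_image[OF inj] cb_image[OF inj]
        by (rule wc_cong cr_cong cb_cong, rule c, assumption)+
      then show "ball_weight h {..<K} r (?sh y) = ball_weight h (second_block K 0) r y" by (simp add: ball_weight_def)
    qed
    finally show ?thesis ..
  qed
  finally show ?thesis by (simp add: power2_eq_square)
qed

end

lemma exp_pair_bound: "exp (- a) * exp (- b) = exp (- (a + b) :: real)"
  by (simp add: exp_add[symmetric])

lemma kern_exp: "kern (\<lambda>_ a b. exp (- a) * exp (- b)) (\<lambda>a b. exp (- a) * exp (- b))"
  by (rule kern_const[of _ 1 1]) (auto intro!: continuous_intros simp: exp_pair_bound)

lemma kern_limit_discrepancy: "kern (\<lambda>_. limit_discrepancy K) (limit_discrepancy K)"
proof (rule kern_const[of _ "1 / 4" "2 * (real K)\<^sup>2 + 64"])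
  show "continuous_on UNIV (\<lambda>p. limit_discrepancy K (fst p) (snd p))" unfolding limit_discrepancy_def by (intro continuous_intros)
  show "\<bar>limit_discrepancy K a b\<bar> \<le> (2 * (real K)\<^sup>2 + 64) * exp (- (1 / 4) * (a + b))" if "0 \<le> a" "0 \<le> b" for a b
    using limit_discrepancy_bound[OF that, of K] by simp
qed auto

text \<open>The factor \<open>exp (- b)\<close> equals 1 in the applications, where the second
  region is empty; it is carried along because \<open>kern\<close> asks for decay in both
  arguments.\<close>

lemma kern_poly:
  fixes q :: "real \<Rightarrow> real"
  assumes cont: "continuous_on UNIV q" and bd: "\<And>a. 0 \<le> a \<Longrightarrow> \<bar>q a\<bar> \<le> C * exp (a / 4)" and C: "C \<ge> 0"
  shows "kern (\<lambda>_ a b. q a * exp (- a) * exp (- b)) (\<lambda>a b. q a * exp (- a) * exp (- b))"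
proof (rule kern_const[of _ "1 / 4" C])
  have "continuous_on UNIV (\<lambda>p :: real \<times> real. q (fst p))"
    by (rule continuous_on_compose2[OF cont continuous_on_fst]) (auto intro: continuous_intros)
  then show "continuous_on UNIV (\<lambda>p. q (fst p) * exp (- fst p) * exp (- snd p :: real))"
    by (intro continuous_intros)
  fix a b :: real assume ab: "0 \<le> a" "0 \<le> b"
  have "\<bar>q a * exp (- a) * exp (- b)\<bar> = \<bar>q a\<bar> * (exp (- a) * exp (- b))" by (simp add: abs_mult)
  also have "\<dots> \<le> (C * exp (a / 4)) * (exp (- a) * exp (- b))" using bd[OF ab(1)] by (intro mult_right_mono) auto
  also have "\<dots> = C * exp (a / 4 + (- a + - b))" by (simp only: exp_add mult.assoc)
  also have "\<dots> \<le> C * exp (- (1 / 4) * (a + b))"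
    using ab C by (intro mult_left_mono) (auto simp: field_simps)
  finally show "\<bar>q a * exp (- a) * exp (- b)\<bar> \<le> C * exp (- (1 / 4) * (a + b))" .
qed (use C in auto)

lemma add_one_bounds:
  fixes a :: real assumes "0 \<le> a"
  shows "\<bar>real K - a\<bar> \<le> (real K + 4) * exp (a / 4)" "\<bar>(real K - a)\<^sup>2\<bar> \<le> (2 * (real K)\<^sup>2 + 64) * exp (a / 4)"
proof -
  have e: "1 \<le> exp (a / 4)" using assms by simp
  have 1: "real K * 1 \<le> real K * exp (a / 4)" using e by (intro mult_left_mono) auto
  have 2: "2 * (real K)\<^sup>2 * 1 \<le> 2 * (real K)\<^sup>2 * exp (a / 4)" using e by (intro mult_left_mono) auto
  show "\<bar>real K - a\<bar> \<le> (real K + 4) * exp (a / 4)"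
    using poly_exp_bounds(1)[OF assms] 1 assms by (simp add: distrib_right)
  have "(real K - a)\<^sup>2 \<le> 2 * (real K)\<^sup>2 + 2 * a\<^sup>2"
    using sum_squares_bound[of "real K" "- a"] by (simp add: power2_eq_square algebra_simps)
  also have "\<dots> \<le> (2 * (real K)\<^sup>2 + 64) * exp (a / 4)"
    using 2 poly_exp_bounds(2)[OF assms] by (simp add: distrib_right)
  finally show "\<bar>(real K - a)\<^sup>2\<bar> \<le> (2 * (real K)\<^sup>2 + 64) * exp (a / 4)" by simp
qed

lemma kern_add_one: "kern (\<lambda>_ a b. (real K - a) * exp (- a) * exp (- b)) (\<lambda>a b. (real K - a) * exp (- a) * exp (- b))"
  by (rule kern_poly[of _ "real K + 4"]) (auto intro!: continuous_intros add_one_bounds)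

lemma kern_add_one_sq: "kern (\<lambda>_ a b. (real K - a)\<^sup>2 * exp (- a) * exp (- b)) (\<lambda>a b. (real K - a)\<^sup>2 * exp (- a) * exp (- b))"
  by (rule kern_poly[of _ "2 * (real K)\<^sup>2 + 64"]) (use add_one_bounds(2) in \<open>auto intro!: continuous_intros\<close>)

lemma kern_dilated:
  assumes h: "h \<ge> 0"
  shows "kern (\<lambda>_ a b. (1 + h) ^ K * exp (- ((1 + h) * a)) * exp (- b)) (\<lambda>a b. (1 + h) ^ K * exp (- ((1 + h) * a)) * exp (- b))"
proof (rule kern_const[of _ 1 "(1 + h) ^ K"])
  fix a b :: real assume ab: "0 \<le> a" "0 \<le> b"
  have "(1 + h) ^ K * exp (- ((1 + h) * a)) * exp (- b) \<le> (1 + h) ^ K * exp (- a) * exp (- b)"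
    using ab h by (intro mult_right_mono mult_left_mono) (auto simp: algebra_simps)
  then show "\<bar>(1 + h) ^ K * exp (- ((1 + h) * a)) * exp (- b)\<bar> \<le> (1 + h) ^ K * exp (- 1 * (a + b))"
    using h by (simp add: abs_mult mult.assoc exp_pair_bound)
qed (use h in \<open>auto intro!: continuous_intros\<close>)

section \<open>Variance limits\<close>

context scaling
begin

definition limit_moment :: "nat \<Rightarrow> ((nat \<Rightarrow> 'a) \<Rightarrow> bool) \<Rightarrow> ((nat \<Rightarrow> 'a) \<Rightarrow> real) \<Rightarrow>
    ((nat \<Rightarrow> 'a) \<Rightarrow> 'a set) \<Rightarrow> ((nat \<Rightarrow> 'a) \<Rightarrow> 'a set) \<Rightarrow> (real \<Rightarrow> real \<Rightarrow> real) \<Rightarrow> real" where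
  "limit_moment m U \<rho> D1 D2 G = \<beta> ^ (m - 1) * (\<integral>z. limint m U \<rho> D1 D2 G (z(0 := 0)) \<partial>PiM {Suc 0..<m} (\<lambda>_. lborel))"

definition exp_kernel :: "real \<Rightarrow> real \<Rightarrow> real" where "exp_kernel a b = exp (- a) * exp (- b)"

definition pair_limit :: "nat \<Rightarrow> nat \<Rightarrow> real" where
  "pair_limit K j = limit_moment (2 * K - j) (pair_event K j) (pair_radius K j) (pair_union K j) (\<lambda>_. {}) exp_kernel"

definition near_union_limit :: "nat \<Rightarrow> real" where
  "near_union_limit K = limit_moment (2 * K - 0) (\<lambda>w. pair_event K 0 w \<and> near K 0 w) (pair_radius K 0) (pair_union K 0) (\<lambda>_. {}) exp_kernel"

definition near_product_limit :: "nat \<Rightarrow> real" where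
  "near_product_limit K = limit_moment (2 * K - 0) (near K 0) (pair_radius K 0) (cb {..<K}) (cb (second_block K 0)) exp_kernel"

definition single_limit :: "nat \<Rightarrow> (real \<Rightarrow> real \<Rightarrow> real) \<Rightarrow> real" where
  "single_limit K G = limit_moment (2 * K - K) (pair_event K K) (pair_radius K K) (pair_union K K) (\<lambda>_. {}) G"

text \<open>Pairs with shared points contribute their second moment limits. Of the pairs without
  shared points, only touching ones remain after subtracting the squared mean, as union term minus
  product term.\<close>

definition sig2_hat :: "nat \<Rightarrow> real" where
  "sig2_hat K = (\<Sum>j\<in>{1..K}. pair_limit K j / (fact j * (fact (K - j))\<^sup>2)) + (near_union_limit K - near_product_limit K) / (fact K)\<^sup>2"

text \<open>In \<open>(K - a) * exp (- a)\<close> the term \<open>K\<close> accounts for simplices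
  having the additional point as one of their \<open>K\<close> vertices, and \<open>- a\<close> for
  simplices destroyed because it falls into their ball.\<close>

definition alpha :: "nat \<Rightarrow> real" where
  "alpha K = single_limit K (\<lambda>a b. (real K - a) * exp (- a) * exp (- b)) / fact K"

definition sig2 :: "nat \<Rightarrow> real" where
  "sig2 K = sig2_hat K - (alpha K)\<^sup>2"

end

context crit_scaling
begin

lemma pair_event_near: "pair_event K j z \<Longrightarrow> 1 \<le> j \<Longrightarrow> j \<le> K \<Longrightarrow> near K j z"
  by (rule near_of_shared_point) (auto simp: pair_event_def)

lemma limit_union:
  assumes K: "K \<ge> 1" and j: "1 \<le> j" "j \<le> K" and g: "kern g G"
  shows "(\<lambda>n. real n ^ (2 * K - j - 1) * (\<integral>w. (if pair_event K j w \<and> pair_radius K j w \<le> r n then g n (real n * mass (pair_union K j w)) (real n * mass {}) else 0)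
      \<partial>PiM {..<2 * K - j} (\<lambda>_. pt))) \<longlonglongrightarrow> limit_moment (2 * K - j) (pair_event K j) (pair_radius K j) (pair_union K j) (\<lambda>_. {}) G"
    and "integrable (PiM {Suc 0..<2 * K - j} (\<lambda>_. lborel)) (\<lambda>z. limint (2 * K - j) (pair_event K j) (pair_radius K j) (pair_union K j) (\<lambda>_. {}) G (z(0 := 0)))"
proof -
  have m: "2 * K - j \<ge> 1" using K j by auto
  have c: "controlled (2 * K - j) (pair_event K j) (pair_radius K j) (pair_union K j) (\<lambda>_. {})"
    by (rule controlled_union[OF K j(2)]) (rule pair_event_near[OF _ j])
  show "(\<lambda>n. real n ^ (2 * K - j - 1) * (\<integral>w. (if pair_event K j w \<and> pair_radius K j w \<le> r n then g n (real n * mass (pair_union K j w)) (real n * mass {}) else 0)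
      \<partial>PiM {..<2 * K - j} (\<lambda>_. pt))) \<longlonglongrightarrow> limit_moment (2 * K - j) (pair_event K j) (pair_radius K j) (pair_union K j) (\<lambda>_. {}) G"
    unfolding limit_moment_def by (rule local_limit(1)[OF m config_pair(1)[OF K j(2)] g c])
  show "integrable (PiM {Suc 0..<2 * K - j} (\<lambda>_. lborel)) (\<lambda>z. limint (2 * K - j) (pair_event K j) (pair_radius K j) (pair_union K j) (\<lambda>_. {}) G (z(0 := 0)))"
    by (rule local_limit(2)[OF m config_pair(1)[OF K j(2)] g c])
qed

text \<open>Contact ties all \<open>2 * K\<close> points to one scale, so these pairs are rarer by a
  factor of order \<open>n\<close> than arbitrary pairs of small simplices and contribute at the
  order of the variance.\<close>

lemma limit_near1:
  assumes K: "K \<ge> 1" and g: "kern g G"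
  shows "(\<lambda>n. real n ^ (2 * K - 1) * (\<integral>w. (if (pair_event K 0 w \<and> near K 0 w) \<and> pair_radius K 0 w \<le> r n then g n (real n * mass (pair_union K 0 w)) (real n * mass {}) else 0)
      \<partial>PiM {..<2 * K} (\<lambda>_. pt))) \<longlonglongrightarrow> limit_moment (2 * K - 0) (\<lambda>w. pair_event K 0 w \<and> near K 0 w) (pair_radius K 0) (pair_union K 0) (\<lambda>_. {}) G"
proof -
  have m: "2 * K - 0 \<ge> 1" using K by auto
  have c: "controlled (2 * K - 0) (\<lambda>w. pair_event K 0 w \<and> near K 0 w) (pair_radius K 0) (pair_union K 0) (\<lambda>_. {})"
    by (rule controlled_union[OF K]) auto
  from local_limit(1)[OF m config_pair(2)[OF K le0] g c]
  show ?thesis unfolding limit_moment_def by simp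
qed

lemma limit_near2:
  assumes K: "K \<ge> 1" and g: "kern g G"
  shows "(\<lambda>n. real n ^ (2 * K - 1) * (\<integral>w. (if near K 0 w \<and> pair_radius K 0 w \<le> r n then g n (real n * mass (cb {..<K} w)) (real n * mass (cb (second_block K 0) w)) else 0)
      \<partial>PiM {..<2 * K} (\<lambda>_. pt))) \<longlonglongrightarrow> limit_moment (2 * K - 0) (near K 0) (pair_radius K 0) (cb {..<K}) (cb (second_block K 0)) G"
proof -
  have m: "2 * K - 0 \<ge> 1" using K by auto
  have c: "controlled (2 * K - 0) (near K 0) (pair_radius K 0) (cb {..<K}) (cb (second_block K 0))"
    by (rule controlled_two[OF K]) auto
  from local_limit(1)[OF m config_pair(3)[OF K le0] g c]
  show ?thesis unfolding limit_moment_def by simp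
qed

lemma of_bool_mult_if: "of_bool P * (x :: real) = (if P then x else 0)"
  by simp

lemma pois_pair_limit:
  assumes K: "K \<ge> 1" and j: "1 \<le> j" "j \<le> K"
  shows "(\<lambda>n. real n ^ (2 * K - j - 1) * pois_pair K j (r n) (real n)) \<longlonglongrightarrow> pair_limit K j"
  using limit_union(1)[OF K j kern_exp] unfolding pois_pair_def of_bool_mult_if pair_limit_def exp_kernel_def[abs_def] by (simp cong: if_cong)

lemma binom_pair_limit:
  assumes K: "K \<ge> 1" and j: "1 \<le> j" "j \<le> K"
  shows "(\<lambda>n. real n ^ (2 * K - j - 1) * binom_pair K j (r n) n) \<longlonglongrightarrow> pair_limit K j"
proof -
  have "\<forall>\<^sub>F n in sequentially. real n ^ (2 * K - j - 1) * (\<integral>w. (if pair_event K j w \<and> pair_radius K j w \<le> r n then binom_kernel (2 * K - j) n (real n * mass (pair_union K j w)) (real n * mass {}) else 0)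
      \<partial>PiM {..<2 * K - j} (\<lambda>_. pt)) = real n ^ (2 * K - j - 1) * binom_pair K j (r n) n"
    using eventually_gt_at_top[of 0] by eventually_elim (simp add: binom_pair_def binom_kernel_def of_bool_mult_if cong: if_cong)
  from Lim_transform_eventually[OF limit_union(1)[OF K j kern_binom] this]
  show ?thesis unfolding pair_limit_def exp_kernel_def[abs_def] .
qed

lemma mean_limit:
  assumes K: "K \<ge> 1" and g: "kern (\<lambda>n a b. g a * exp (- b)) (\<lambda>a b. g a * exp (- b))"
  shows "(\<lambda>n. real n ^ (K - 1) * (\<integral>w. ball_weight (\<lambda>x. g (real n * x)) {..<K} (r n) w \<partial>PiM {..<K} (\<lambda>_. pt))) \<longlonglongrightarrow> single_limit K (\<lambda>a b. g a * exp (- b))"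
proof -
  have e: "2 * K - K = K" by simp
  have "(if pair_event K K w \<and> pair_radius K K w \<le> t then g (real n * mass (pair_union K K w)) * exp (- (real n * mass {})) else 0) = ball_weight (\<lambda>x. g (real n * x)) {..<K} t w" for w n t
    by (simp add: ball_weight_def pair_event_self pair_radius_self pair_union_self)
  with limit_union(1)[OF K K order_refl g] show ?thesis
    unfolding single_limit_def e by simp
qed

lemma near_split:
  fixes P :: "(nat \<Rightarrow> 'a) \<Rightarrow> bool" and h :: "(nat \<Rightarrow> 'a) \<Rightarrow> real"
  assumes "Measurable.pred borel P" "h \<in> borel_measurable (borel :: (nat \<Rightarrow> 'a) measure)" "\<And>w. \<bar>h w\<bar> \<le> C" and K: "K \<ge> 1"
  shows "(\<integral>w. (if P w then h w else 0) \<partial>PiM J (\<lambda>_. pt)) =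
    (\<integral>w. (if P w \<and> near K 0 w then h w else 0) \<partial>PiM J (\<lambda>_. pt)) + (\<integral>w. (if P w \<and> \<not> near K 0 w then h w else 0) \<partial>PiM J (\<lambda>_. pt))"
    and "integrable (PiM J (\<lambda>_. pt)) (\<lambda>w. if P w \<and> near K 0 w then h w else 0)"
    and "integrable (PiM J (\<lambda>_. pt)) (\<lambda>w. if P w \<and> \<not> near K 0 w then h w else 0)"
proof -
  have C: "0 \<le> C" using assms(3)[of undefined] by linarith
  note [measurable] = assms(1,2)
  have [measurable]: "Measurable.pred borel (near K 0 :: (nat \<Rightarrow> 'a) \<Rightarrow> bool)" by (rule near_measurable[OF K le0])
  have m1: "(\<lambda>w. if P w \<and> near K 0 w then h w else 0) \<in> borel_measurable borel" by measurable
  have m2: "(\<lambda>w. if P w \<and> \<not> near K 0 w then h w else 0) \<in> borel_measurable borel" by measurable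
  show i1: "integrable (PiM J (\<lambda>_. pt)) (\<lambda>w. if P w \<and> near K 0 w then h w else 0)"
    by (rule integrable_PiM_pt[where C = C, OF borel_PiM_pt[OF m1]]) (use assms(3) C in auto)
  show i2: "integrable (PiM J (\<lambda>_. pt)) (\<lambda>w. if P w \<and> \<not> near K 0 w then h w else 0)"
    by (rule integrable_PiM_pt[where C = C, OF borel_PiM_pt[OF m2]]) (use assms(3) C in auto)
  show "(\<integral>w. (if P w then h w else 0) \<partial>PiM J (\<lambda>_. pt)) =
    (\<integral>w. (if P w \<and> near K 0 w then h w else 0) \<partial>PiM J (\<lambda>_. pt)) + (\<integral>w. (if P w \<and> \<not> near K 0 w then h w else 0) \<partial>PiM J (\<lambda>_. pt))"
    unfolding Bochner_Integration.integral_add[OF i1 i2, symmetric]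
    by (intro Bochner_Integration.integral_cong) auto
qed

definition far :: "nat \<Rightarrow> real \<Rightarrow> (nat \<Rightarrow> 'a) \<Rightarrow> bool" where
  "far K t w \<longleftrightarrow> ((wc {..<K} w \<and> wc (second_block K 0) w) \<and> pair_radius K 0 w \<le> t) \<and> \<not> near K 0 w"

lemma ball_weight_pair: "ball_weight h {..<K} t w * ball_weight h (second_block K 0) t w =
    (if (wc {..<K} w \<and> wc (second_block K 0) w) \<and> pair_radius K 0 w \<le> t then h (mass (cb {..<K} w)) * h (mass (cb (second_block K 0) w)) else 0)"
  by (auto simp: ball_weight_def pair_radius_def)

text \<open>The masses of disjoint balls add up, and their total is at most 1. After multiplication
  by \<open>n\<close> this is the domain \<open>a + b \<le> n\<close> of
  \<open>discrepancy_uniform\<close>.\<close>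

lemma far_mass:
  assumes "far K t w" and K: "K \<ge> 1"
  shows "mass (pair_union K 0 w) = mass (cb {..<K} w) + mass (cb (second_block K 0) w)"
    and "mass (cb {..<K} w) + mass (cb (second_block K 0) w) \<le> 1"
proof -
  have s: "cb {..<K} w \<in> sets pt" "cb (second_block K 0) w \<in> sets pt" by (simp_all add: cb_eq)
  have "cb {..<K} w \<inter> cb (second_block K 0) w = {}" using assms by (intro not_near_disjoint) (auto simp: far_def)
  then show e: "mass (pair_union K 0 w) = mass (cb {..<K} w) + mass (cb (second_block K 0) w)"
    unfolding pair_union_def by (intro pt.finite_measure_Union s)
  show "mass (cb {..<K} w) + mass (cb (second_block K 0) w) \<le> 1" unfolding e[symmetric] by (rule pt.prob_le_1)
qed

lemma pair_pred:
  assumes K: "K \<ge> 1"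
  shows "Measurable.pred borel (\<lambda>w :: nat \<Rightarrow> 'a. (wc {..<K} w \<and> wc (second_block K 0) w) \<and> pair_radius K 0 w \<le> t)"
    "Measurable.pred borel (\<lambda>w :: nat \<Rightarrow> 'a. pair_event K 0 w \<and> pair_radius K 0 w \<le> t)"
proof -
  have [measurable]: "pair_radius K 0 \<in> borel_measurable (borel :: (nat \<Rightarrow> 'a) measure)" by (rule pair_radius_measurable[OF K le0])
  have p: "Measurable.pred borel (\<lambda>w :: nat \<Rightarrow> 'a. pair_radius K 0 w \<le> t)" by measurable
  show "Measurable.pred borel (\<lambda>w :: nat \<Rightarrow> 'a. (wc {..<K} w \<and> wc (second_block K 0) w) \<and> pair_radius K 0 w \<le> t)"
    by (intro pred_intros_logic p borel_measurable_wc lessThan_ne[OF K le0] second_block_props(1,2)[OF K le0])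
  show "Measurable.pred borel (\<lambda>w :: nat \<Rightarrow> 'a. pair_event K 0 w \<and> pair_radius K 0 w \<le> t)"
    by (intro pred_intros_logic p pair_event_measurable[OF K le0])
qed

lemma mass_cb_measurable:
  assumes K: "K \<ge> 1"
  shows "(\<lambda>w. mass (cb {..<K} w)) \<in> borel_measurable (borel :: (nat \<Rightarrow> 'a) measure)"
    "(\<lambda>w. mass (cb (second_block K 0) w)) \<in> borel_measurable (borel :: (nat \<Rightarrow> 'a) measure)"
    "(\<lambda>w. mass (pair_union K 0 w)) \<in> borel_measurable (borel :: (nat \<Rightarrow> 'a) measure)"
  by (intro mass_measurable sets_cb pair_union_sets lessThan_ne[OF K le0] second_block_props(1,2)[OF K le0] K le0)+

text \<open>One identity for both models: \<open>A\<close> and \<open>q\<close> weight the pairs,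
  \<open>B\<close> and \<open>h\<close> the squared mean. Near parts converge separately; far parts
  are put under a single integral, since each alone is too large by a factor of order
  \<open>n\<close>.\<close>

lemma pair_difference:
  assumes K: "K \<ge> 1" and q: "q \<in> borel_measurable borel" "\<And>x. 0 \<le> x \<Longrightarrow> x \<le> 1 \<Longrightarrow> \<bar>q x\<bar> \<le> 1"
    and h: "h \<in> borel_measurable borel" "\<And>x. 0 \<le> x \<Longrightarrow> x \<le> 1 \<Longrightarrow> \<bar>h x\<bar> \<le> 1"
  shows "A * (\<integral>w. (if pair_event K 0 w \<and> pair_radius K 0 w \<le> t then q (mass (pair_union K 0 w)) else 0) \<partial>PiM {..<2 * K} (\<lambda>_. pt))
     - B * (\<integral>w. ball_weight h {..<K} t w \<partial>PiM {..<K} (\<lambda>_. pt))\<^sup>2 =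
     A * (\<integral>w. (if (pair_event K 0 w \<and> near K 0 w) \<and> pair_radius K 0 w \<le> t then q (mass (pair_union K 0 w)) else 0) \<partial>PiM {..<2 * K} (\<lambda>_. pt))
     - B * (\<integral>w. (if near K 0 w \<and> pair_radius K 0 w \<le> t then h (mass (cb {..<K} w)) * h (mass (cb (second_block K 0) w)) else 0) \<partial>PiM {..<2 * K} (\<lambda>_. pt))
     + (\<integral>w. (if far K t w then A * q (mass (cb {..<K} w) + mass (cb (second_block K 0) w)) - B * (h (mass (cb {..<K} w)) * h (mass (cb (second_block K 0) w))) else 0)
         \<partial>PiM {..<2 * K} (\<lambda>_. pt))"
proof -
  let ?P = "PiM {..<2 * K} (\<lambda>_. pt)"
  let ?ma = "\<lambda>w. mass (cb {..<K} w)" and ?mb = "\<lambda>w. mass (cb (second_block K 0) w)" and ?mu = "\<lambda>w. mass (pair_union K 0 w)"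
  note [measurable] = mass_cb_measurable[OF K] q(1) h(1)
  have qm: "(\<lambda>w. q (?mu w)) \<in> borel_measurable borel" by measurable
  have hm: "(\<lambda>w. h (?ma w) * h (?mb w)) \<in> borel_measurable borel" by measurable
  have qb: "\<bar>q (?mu w)\<bar> \<le> 1" for w by (rule q(2)) auto
  have hb: "\<bar>h (?ma w) * h (?mb w)\<bar> \<le> 1" for w
    unfolding abs_mult using h(2)[of "?ma w"] h(2)[of "?mb w"] by (intro mult_le_one) auto
  note s1 = near_split[OF pair_pred(2)[OF K] qm qb K, of "{..<2 * K}" t]
  note s2 = near_split[OF pair_pred(1)[OF K] hm hb K, of "{..<2 * K}" t]
  have e1: "(pair_event K 0 w \<and> pair_radius K 0 w \<le> t) \<and> \<not> near K 0 w \<longleftrightarrow> far K t w" for w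
    using not_near_pair_event[of K 0 w] by (auto simp: far_def pair_event_def)
  have e2: "((wc {..<K} w \<and> wc (second_block K 0) w) \<and> pair_radius K 0 w \<le> t) \<and> near K 0 w \<longleftrightarrow> near K 0 w \<and> pair_radius K 0 w \<le> t" for w
    by (auto simp: near_def)
  have e3: "(pair_event K 0 w \<and> pair_radius K 0 w \<le> t) \<and> near K 0 w \<longleftrightarrow> (pair_event K 0 w \<and> near K 0 w) \<and> pair_radius K 0 w \<le> t" for w
    by blast
  have sq: "(\<integral>w. ball_weight h {..<K} t w \<partial>PiM {..<K} (\<lambda>_. pt))\<^sup>2 =
     (\<integral>w. (if (wc {..<K} w \<and> wc (second_block K 0) w) \<and> pair_radius K 0 w \<le> t then h (?ma w) * h (?mb w) else 0) \<partial>?P)"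
    unfolding ball_weight_pair[symmetric] by (rule pair_product[OF K h, symmetric])
  have fi1: "integrable ?P (\<lambda>w. if far K t w then q (?mu w) else 0)" using s1(3) unfolding e1 .
  have fi2: "integrable ?P (\<lambda>w. if far K t w then h (?ma w) * h (?mb w) else 0)" using s2(3) unfolding far_def[symmetric] .
  have "(\<integral>w. (if far K t w then A * q (?ma w + ?mb w) - B * (h (?ma w) * h (?mb w)) else 0) \<partial>?P) =
     (\<integral>w. A * (if far K t w then q (?mu w) else 0) - B * (if far K t w then h (?ma w) * h (?mb w) else 0) \<partial>?P)"
    by (intro Bochner_Integration.integral_cong) (auto simp: far_mass(1)[OF _ K])
  also have "\<dots> = A * (\<integral>w. (if far K t w then q (?mu w) else 0) \<partial>?P) - B * (\<integral>w. (if far K t w then h (?ma w) * h (?mb w) else 0) \<partial>?P)"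
    using fi1 fi2 by (simp only: Bochner_Integration.integral_diff integrable_mult_right integral_mult_right_zero)
  finally show ?thesis
    unfolding sq s1(1) s2(1) e1 e2 e3 far_def[symmetric] by (simp only: algebra_simps)
qed

lemma pois_limit:
  assumes K: "K = k + 1"
  shows "(\<lambda>n. pois_var f n (crit_num k (r n)) / real n) \<longlonglongrightarrow> sig2_hat K"
proof -
  have K1: "K \<ge> 1" using K by simp
  define N1 where "N1 n = (\<integral>w. (if (pair_event K 0 w \<and> near K 0 w) \<and> pair_radius K 0 w \<le> r n then exp (- (real n * mass (pair_union K 0 w))) else 0) \<partial>PiM {..<2 * K} (\<lambda>_. pt))" for n
  define N2 where "N2 n = (\<integral>w. (if near K 0 w \<and> pair_radius K 0 w \<le> r n then exp (- (real n * mass (cb {..<K} w))) * exp (- (real n * mass (cb (second_block K 0) w))) else 0) \<partial>PiM {..<2 * K} (\<lambda>_. pt))" for n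
  have N1: "(\<lambda>n. real n ^ (2 * K - 1) * N1 n) \<longlonglongrightarrow> near_union_limit K"
    using limit_near1[OF K1 kern_exp] unfolding N1_def near_union_limit_def exp_kernel_def[abs_def] by (simp cong: if_cong)
  have N2: "(\<lambda>n. real n ^ (2 * K - 1) * N2 n) \<longlonglongrightarrow> near_product_limit K"
    using limit_near2[OF K1 kern_exp] unfolding N2_def near_product_limit_def exp_kernel_def[abs_def] by simp
  have diff: "pois_pair K 0 (r n) (real n) - (pois_pair K K (r n) (real n))\<^sup>2 = N1 n - N2 n" for n
  proof -
    let ?h = "\<lambda>x :: real. exp (- (real n * x))"
    have hb: "\<bar>?h x\<bar> \<le> 1" if "0 \<le> x" for x using that by simp
    have hm: "?h \<in> borel_measurable borel" by measurable
    have "pois_pair K K (r n) (real n) = (\<integral>w. ball_weight ?h {..<K} (r n) w \<partial>PiM {..<K} (\<lambda>_. pt))"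
      by (simp add: pois_pair_def ball_weight_def pair_event_self pair_radius_self pair_union_self)
    moreover have "pois_pair K 0 (r n) (real n) = (\<integral>w. (if pair_event K 0 w \<and> pair_radius K 0 w \<le> r n then ?h (mass (pair_union K 0 w)) else 0) \<partial>PiM {..<2 * K} (\<lambda>_. pt))"
      by (simp add: pois_pair_def of_bool_mult_if)
    \<comment> \<open>Poisson emptiness probabilities of disjoint balls multiply exactly, because
      the exponential turns the sum of masses into a product.\<close>
    moreover have "(\<integral>w. (if far K (r n) w then 1 * ?h (mass (cb {..<K} w) + mass (cb (second_block K 0) w)) - 1 * (?h (mass (cb {..<K} w)) * ?h (mass (cb (second_block K 0) w))) else 0)
         \<partial>PiM {..<2 * K} (\<lambda>_. pt)) = 0"
    proof -
      have "1 * ?h (a + b) - 1 * (?h a * ?h b) = 0" for a b by (simp add: exp_add[symmetric] algebra_simps)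
      then show ?thesis by (simp only: if_cancel) simp
    qed
    ultimately show ?thesis
      using pair_difference[OF K1 hm hb hm hb, of 1 "r n" 1] unfolding N1_def N2_def by simp
  qed
  have eq: "pois_var f n (crit_num k (r n)) / real n =
     (\<Sum>j\<in>{1..K}. real n ^ (2 * K - j - 1) * pois_pair K j (r n) (real n) / (fact j * (fact (K - j))\<^sup>2)) +
     (real n ^ (2 * K - 1) * N1 n - real n ^ (2 * K - 1) * N2 n) / (fact K)\<^sup>2" if n: "n > 0" for n
  proof -
    have p: "real n ^ m / real n = real n ^ (m - 1)" if "m \<ge> 1" for m
      using n that by (cases m) auto
    have split: "{..K} = insert 0 {1..K}" by auto
    have "pois_var f n (crit_num k (r n)) = (\<Sum>j\<in>{1..K}. real n ^ (2 * K - j) / (fact j * (fact (K - j))\<^sup>2) * pois_pair K j (r n) (real n)) +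
       real n ^ (2 * K) / (fact K)\<^sup>2 * (pois_pair K 0 (r n) (real n) - (pois_pair K K (r n) (real n))\<^sup>2)"
      unfolding pois_var_eq[OF K] split
      by (simp add: power_mult_distrib power_divide power_mult[symmetric] mult.commute[of K 2] right_diff_distrib)
    then have "pois_var f n (crit_num k (r n)) / real n =
       (\<Sum>j\<in>{1..K}. real n ^ (2 * K - j) / (fact j * (fact (K - j))\<^sup>2) * pois_pair K j (r n) (real n) / real n) +
       (real n ^ (2 * K) / real n) / (fact K)\<^sup>2 * (N1 n - N2 n)"
      unfolding diff by (simp add: add_divide_distrib sum_divide_distrib)
    also have "real n ^ (2 * K) / real n = real n ^ (2 * K - 1)" using K1 by (intro p) simp
    also have "(\<Sum>j\<in>{1..K}. real n ^ (2 * K - j) / (fact j * (fact (K - j))\<^sup>2) * pois_pair K j (r n) (real n) / real n) =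
       (\<Sum>j\<in>{1..K}. real n ^ (2 * K - j - 1) * pois_pair K j (r n) (real n) / (fact j * (fact (K - j))\<^sup>2))"
    proof (rule sum.cong[OF refl])
      fix j assume "j \<in> {1..K}"
      then have "2 * K - j \<ge> 1" using K1 by auto
      have "real n ^ (2 * K - j) / (fact j * (fact (K - j))\<^sup>2) * pois_pair K j (r n) (real n) / real n =
         (real n ^ (2 * K - j) / real n) * pois_pair K j (r n) (real n) / (fact j * (fact (K - j))\<^sup>2)"
        by (simp add: mult.commute)
      then show "real n ^ (2 * K - j) / (fact j * (fact (K - j))\<^sup>2) * pois_pair K j (r n) (real n) / real n =
         real n ^ (2 * K - j - 1) * pois_pair K j (r n) (real n) / (fact j * (fact (K - j))\<^sup>2)"
        unfolding p[OF \<open>2 * K - j \<ge> 1\<close>] .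
    qed
    finally show ?thesis by (simp add: right_diff_distrib diff_divide_distrib)
  qed
  have "(\<lambda>n. (\<Sum>j\<in>{1..K}. real n ^ (2 * K - j - 1) * pois_pair K j (r n) (real n) / (fact j * (fact (K - j))\<^sup>2)) +
     (real n ^ (2 * K - 1) * N1 n - real n ^ (2 * K - 1) * N2 n) / (fact K)\<^sup>2) \<longlonglongrightarrow> sig2_hat K"
    unfolding sig2_hat_def by (intro tendsto_add tendsto_sum tendsto_divide tendsto_const tendsto_diff N1 N2 pois_pair_limit K1) auto
  moreover have "\<forall>\<^sub>F n in sequentially. (\<Sum>j\<in>{1..K}. real n ^ (2 * K - j - 1) * pois_pair K j (r n) (real n) / (fact j * (fact (K - j))\<^sup>2)) +
     (real n ^ (2 * K - 1) * N1 n - real n ^ (2 * K - 1) * N2 n) / (fact K)\<^sup>2 = pois_var f n (crit_num k (r n)) / real n"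
    using eventually_gt_at_top[of 0] by eventually_elim (simp only: eq)
  ultimately show ?thesis by (rule Lim_transform_eventually)
qed

text \<open>On far pairs the binomial discrepancy is \<open>discrepancy\<close> of relative order \<open>1 / n\<close>, and its limit \<open>limit_discrepancy\<close> is a product,
  so that it integrates to minus the square of the mean add-one cost.\<close>
lemma far_limit:
  assumes K: "K \<ge> 1"
  shows "(\<lambda>n. real n ^ (2 * K - 2) * (\<integral>w. (if far K (r n) w then discrepancy K n (real n * mass (cb {..<K} w)) (real n * mass (cb (second_block K 0) w)) else 0)
     \<partial>PiM {..<2 * K} (\<lambda>_. pt))) \<longlonglongrightarrow> - (single_limit K (\<lambda>a b. (real K - a) * exp (- a) * exp (- b)))\<^sup>2"
proof -
  let ?P = "PiM {..<2 * K} (\<lambda>_. pt)"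
  let ?a = "\<lambda>n w. real n * mass (cb {..<K} w)" and ?b = "\<lambda>n w. real n * mass (cb (second_block K 0) w)"
  let ?FD = "\<lambda>n w. if far K (r n) w then discrepancy K n (?a n w) (?b n w) else 0"
    and ?FL = "\<lambda>n w. if far K (r n) w then limit_discrepancy K (?a n w) (?b n w) else 0"
  let ?e = "\<lambda>n x. exp (- (real n * x / 8))" and ?h = "\<lambda>n x. (real K - real n * x) * exp (- (real n * x))"
  let ?Q = "\<lambda>n w. ball_weight (?e n) {..<K} (r n) w * ball_weight (?e n) (second_block K 0) (r n) w"
  note [measurable] = mass_cb_measurable[OF K]
  have farm[measurable]: "Measurable.pred borel (far K t)" for t
    unfolding far_def by (intro pred_intros_logic pair_pred(1)[OF K] near_measurable[OF K le0])
  have pw: "real n ^ (2 * K - 2) = (real n ^ (K - 1))\<^sup>2" for n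
    unfolding power_mult[symmetric] by (rule arg_cong[where f = "power (real n)"]) simp
  define A where "A n = (\<integral>w. ball_weight (?h n) {..<K} (r n) w \<partial>PiM {..<K} (\<lambda>_. pt))" for n
  \<comment> \<open>The integral of the error weight \<open>exp (- n F / 8)\<close> from
    \<open>discrepancy_uniform\<close>; its square will bound the replacement of
    \<open>discrepancy\<close> by its limit.\<close>
  define B where "B n = (\<integral>w. ball_weight (?e n) {..<K} (r n) w \<partial>PiM {..<K} (\<lambda>_. pt))" for n
  have Alim: "(\<lambda>n. real n ^ (K - 1) * A n) \<longlonglongrightarrow> single_limit K (\<lambda>a b. (real K - a) * exp (- a) * exp (- b))"
    unfolding A_def by (rule mean_limit[OF K, where g = "\<lambda>a. (real K - a) * exp (- a)"]) (rule kern_add_one)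
  have Blim: "(\<lambda>n. real n ^ (K - 1) * B n) \<longlonglongrightarrow> single_limit K (\<lambda>a b. exp (- (a / 8)) * exp (- b))"
  proof -
    have "kern (\<lambda>_ a b. exp (- (a / 8)) * exp (- b)) (\<lambda>a b. exp (- (a / 8)) * exp (- b))"
    proof (rule kern_const[of _ "1 / 8" 1])
      fix a b :: real assume "0 \<le> a" "0 \<le> b"
      then show "\<bar>exp (- (a / 8)) * exp (- b)\<bar> \<le> 1 * exp (- (1 / 8) * (a + b))"
        by (simp add: exp_add[symmetric] field_simps)
    qed (auto intro!: continuous_intros)
    from mean_limit[OF K, where g = "\<lambda>a. exp (- (a / 8))", OF this] show ?thesis unfolding B_def .
  qed
  have DnM: "(\<lambda>w. discrepancy K n (?a n w) (?b n w)) \<in> borel_measurable borel" for n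
    unfolding discrepancy_def binom_kernel_def by measurable
  have DlM: "(\<lambda>w. limit_discrepancy K (?a n w) (?b n w)) \<in> borel_measurable borel" for n
    unfolding limit_discrepancy_def by measurable
  have Dlb: "\<bar>limit_discrepancy K (?a n w) (?b n w)\<bar> \<le> 2 * (real K)\<^sup>2 + 64" for n w
  proof -
    have "(2 * (real K)\<^sup>2 + 64) * exp (- ((?a n w + ?b n w) / 4)) \<le> (2 * (real K)\<^sup>2 + 64) * 1" by (intro mult_left_mono) auto
    then show ?thesis using limit_discrepancy_bound[of "?a n w" "?b n w" K] by simp
  qed
  have hm: "(?h n) \<in> borel_measurable borel" for n by measurable
  have hb: "\<bar>(real K - real n * x) * exp (- (real n * x))\<bar> \<le> real K + real n" if "0 \<le> x" "x \<le> 1" for n x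
  proof -
    have "real n * x \<le> real n" "0 \<le> real n * x" using that by (auto simp: mult_left_le)
    then have "\<bar>real K - real n * x\<bar> * exp (- (real n * x)) \<le> (real K + real n) * 1"
      by (intro mult_mono) auto
    then show ?thesis by (simp add: abs_mult)
  qed
  have Asq: "(A n)\<^sup>2 = (\<integral>w. (if (wc {..<K} w \<and> wc (second_block K 0) w) \<and> pair_radius K 0 w \<le> r n then - limit_discrepancy K (?a n w) (?b n w) else 0) \<partial>?P)" for n
  proof -
    have "(A n)\<^sup>2 = (\<integral>w. ball_weight (?h n) {..<K} (r n) w * ball_weight (?h n) (second_block K 0) (r n) w \<partial>?P)"
      unfolding A_def by (rule pair_product[OF K hm hb, symmetric])
    then show ?thesis unfolding ball_weight_pair limit_discrepancy_def minus_minus .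
  qed
  \<comment> \<open>The square of \<open>A n\<close> covers all pairs of balls. The near ones must
    be removed, but they are already convergent at order \<open>n ^ (2 * K - 1)\<close> and hence
    vanish at order \<open>n ^ (2 * K - 2)\<close>.\<close>
  define Nr where "Nr n = (\<integral>w. (if near K 0 w \<and> pair_radius K 0 w \<le> r n then limit_discrepancy K (?a n w) (?b n w) else 0) \<partial>?P)" for n
  have e2: "((wc {..<K} w \<and> wc (second_block K 0) w) \<and> pair_radius K 0 w \<le> t) \<and> near K 0 w \<longleftrightarrow> near K 0 w \<and> pair_radius K 0 w \<le> t" for w t
    by (auto simp: near_def)
  have neg: "(if Q then - x else 0) = - (if Q then x else 0 :: real)" for Q x by simp
  have farDl: "(\<integral>w. ?FL n w \<partial>?P) = - (A n)\<^sup>2 - Nr n" for n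
    using near_split(1)[OF pair_pred(1)[OF K] DlM Dlb K, of "{..<2 * K}" "r n" n]
    unfolding Asq neg Bochner_Integration.integral_minus unfolding e2 far_def[symmetric] Nr_def by linarith
  have Nlim: "(\<lambda>n. real n ^ (2 * K - 2) * Nr n) \<longlonglongrightarrow> 0"
  proof -
    have "(\<lambda>n. real n ^ (2 * K - 1) * Nr n) \<longlonglongrightarrow> limit_moment (2 * K - 0) (near K 0) (pair_radius K 0) (cb {..<K}) (cb (second_block K 0)) (limit_discrepancy K)"
      using limit_near2[OF K kern_limit_discrepancy] unfolding Nr_def .
    from tendsto_mult[OF this lim_1_over_n]
    have "(\<lambda>n. real n ^ (2 * K - 1) * Nr n * (1 / real n)) \<longlonglongrightarrow> 0" by simp
    moreover have "\<forall>\<^sub>F n in sequentially. real n ^ (2 * K - 1) * Nr n * (1 / real n) = real n ^ (2 * K - 2) * Nr n"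
      using eventually_gt_at_top[of 0]
    proof eventually_elim
      case (elim n)
      have "2 * K - 1 = Suc (2 * K - 2)" using K by simp
      then show ?case using elim by simp
    qed
    ultimately show ?thesis by (rule Lim_transform_eventually)
  qed
  have main: "(\<lambda>n. real n ^ (2 * K - 2) * (\<integral>w. ?FL n w \<partial>?P))
      \<longlonglongrightarrow> - (single_limit K (\<lambda>a b. (real K - a) * exp (- a) * exp (- b)))\<^sup>2"
  proof -
    have "(\<lambda>n. - (real n ^ (K - 1) * A n)\<^sup>2 - real n ^ (2 * K - 2) * Nr n) \<longlonglongrightarrow> - (single_limit K (\<lambda>a b. (real K - a) * exp (- a) * exp (- b)))\<^sup>2 - 0"
      by (intro tendsto_diff tendsto_minus tendsto_power Alim Nlim)
    moreover have "- (real n ^ (K - 1) * A n)\<^sup>2 - real n ^ (2 * K - 2) * Nr n =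
       real n ^ (2 * K - 2) * (\<integral>w. ?FL n w \<partial>?P)" for n
      unfolding farDl pw by (simp add: power_mult_distrib algebra_simps)
    ultimately show ?thesis by simp
  qed
  have err: "(\<lambda>n. real n ^ (2 * K - 2) * (\<integral>w. ?FD n w \<partial>?P) -
      real n ^ (2 * K - 2) * (\<integral>w. ?FL n w \<partial>?P)) \<longlonglongrightarrow> 0"
  proof (rule LIMSEQ_I)
    fix e :: real assume e: "e > 0"
    \<comment> \<open>Taking one more than the limit makes \<open>S\<close> positive and an eventual
      strict bound for the normalised \<open>(B n)\<^sup>2\<close>.\<close>
    define S where "S = (single_limit K (\<lambda>a b. exp (- (a / 8)) * exp (- b)))\<^sup>2 + 1"
    have S: "S > 0" by (simp add: S_def add_nonneg_pos)
    define e' where "e' = e / (2 * S)"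
    have e': "e' > 0" using e S by (simp add: e'_def)
    have "(\<lambda>n. (real n ^ (K - 1) * B n)\<^sup>2) \<longlonglongrightarrow> (single_limit K (\<lambda>a b. exp (- (a / 8)) * exp (- b)))\<^sup>2"
      by (intro tendsto_power Blim)
    then have "\<forall>\<^sub>F n in sequentially. (real n ^ (K - 1) * B n)\<^sup>2 < S" by (rule order_tendstoD) (simp add: S_def)
    then have "\<forall>\<^sub>F n in sequentially. norm (real n ^ (2 * K - 2) * (\<integral>w. ?FD n w \<partial>?P) -
      real n ^ (2 * K - 2) * (\<integral>w. ?FL n w \<partial>?P) - 0) < e"
      using discrepancy_uniform[OF e', of K]
    proof eventually_elim
      case (elim n)
      have ab: "?a n w + ?b n w \<le> real n" if "far K (r n) w" for w
        using far_mass(2)[OF that K] by (simp add: distrib_left[symmetric] mult_left_le)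
      have close: "\<bar>discrepancy K n (?a n w) (?b n w) - limit_discrepancy K (?a n w) (?b n w)\<bar> \<le> e' * exp (- ((?a n w + ?b n w) / 8))" if "far K (r n) w" for w
        using elim(2) ab[OF that] by (simp add: zero_le_mult_iff)
      have i1: "integrable ?P (\<lambda>w. ?FL n w)"
        by (rule integrable_PiM_pt[OF borel_PiM_pt, where C = "2 * (real K)\<^sup>2 + 64"]) (use DlM Dlb in auto)
      have i3: "integrable ?P (\<lambda>w. ?FD n w)"
      proof (rule integrable_PiM_pt[OF borel_PiM_pt, where C = "e' + (2 * (real K)\<^sup>2 + 64)"])
        show "(\<lambda>w. ?FD n w) \<in> borel_measurable borel" using DnM by measurable
        show "\<bar>?FD n w\<bar> \<le> e' + (2 * (real K)\<^sup>2 + 64)" for w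
        proof (cases "far K (r n) w")
          case True
          have "e' * exp (- ((?a n w + ?b n w) / 8)) \<le> e' * 1" using e' by (intro mult_left_mono) auto
          then show ?thesis using close[OF True] Dlb[of n w] True by simp
        qed (use e' in simp)
      qed
      have hb8: "\<bar>exp (- (real n * x / 8))\<bar> \<le> 1" if "0 \<le> x" for x using that by simp
      have hm8: "(?e n) \<in> borel_measurable borel" by measurable
      have Bsq: "(B n)\<^sup>2 = (\<integral>w. ?Q n w \<partial>?P)"
        unfolding B_def by (rule pair_product[OF K hm8 hb8, symmetric])
      have i4: "integrable ?P (\<lambda>w. ?Q n w)"
      proof (rule integrable_PiM_pt[where C = 1])
        show "(\<lambda>w. ?Q n w) \<in> borel_measurable ?P"
          by (intro borel_measurable_times borel_PiM_pt ball_weight_measurable hm8 lessThan_ne[OF K le0] second_block_props(1,2)[OF K le0])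
        show "\<bar>?Q n w\<bar> \<le> 1" for w
          unfolding ball_weight_pair by (auto simp: abs_mult intro!: mult_le_one)
      qed
      have "\<bar>(\<integral>w. ?FD n w \<partial>?P) - (\<integral>w. ?FL n w \<partial>?P)\<bar>
         = \<bar>\<integral>w. ?FD n w - ?FL n w \<partial>?P\<bar>"
        using i1 i3 by simp
      also have "\<dots> \<le> (\<integral>w. \<bar>?FD n w - ?FL n w\<bar> \<partial>?P)"
        by (rule integral_abs_bound)
      also have "\<dots> \<le> (\<integral>w. e' * ?Q n w \<partial>?P)"
      proof (rule integral_mono)
        fix w
        show "\<bar>?FD n w - ?FL n w\<bar>
           \<le> e' * ?Q n w"
        proof (cases "far K (r n) w")
          case True
          have "?Q n w = exp (- ((?a n w + ?b n w) / 8))"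
            unfolding ball_weight_pair using True by (simp add: far_def exp_add[symmetric] add_divide_distrib)
          then show ?thesis using close[OF True] True by simp
        next
          case False
          have "0 \<le> ?Q n w"
            by (simp add: ball_weight_def)
          then show ?thesis using False e' by simp
        qed
      qed (use i1 i3 i4 in auto)
      also have "\<dots> = e' * (B n)\<^sup>2" unfolding Bsq by simp
      finally have d: "\<bar>(\<integral>w. ?FD n w \<partial>?P) - (\<integral>w. ?FL n w \<partial>?P)\<bar> \<le> e' * (B n)\<^sup>2" .
      have "\<bar>real n ^ (2 * K - 2) * ((\<integral>w. ?FD n w \<partial>?P) - (\<integral>w. ?FL n w \<partial>?P))\<bar>
          \<le> real n ^ (2 * K - 2) * (e' * (B n)\<^sup>2)"
        unfolding abs_mult using d by (simp add: mult_left_mono)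
      also have "\<dots> = e' * (real n ^ (K - 1) * B n)\<^sup>2" unfolding pw by (simp add: power_mult_distrib)
      also have "\<dots> \<le> e' * S" using elim(1) e' by (intro mult_left_mono) auto
      also have "\<dots> = e / 2" using S by (simp add: e'_def)
      also have "\<dots> < e" using e by simp
      finally show ?case by (simp add: right_diff_distrib)
    qed
    then show "\<exists>N. \<forall>n\<ge>N. norm (real n ^ (2 * K - 2) * (\<integral>w. ?FD n w \<partial>?P) -
      real n ^ (2 * K - 2) * (\<integral>w. ?FL n w \<partial>?P) - 0) < e"
      unfolding eventually_sequentially .
  qed
  from tendsto_add[OF err main] show ?thesis by simp
qed

text \<open>For shared or touching pairs only the limit 1 of the falling factorial ratios matters,
  so these terms agree with the Poisson ones. For far pairs their first-order terms enter through
  \<open>discrepancy\<close>, which yields the additional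
  \<open>- (alpha K)\<^sup>2\<close>.\<close>

lemma binom_limit:
  assumes K: "K = k + 1"
  shows "(\<lambda>n. binom_var f n (crit_num k (r n)) / real n) \<longlonglongrightarrow> sig2 K"
proof -
  have K1: "K \<ge> 1" using K by simp
  define N1 where "N1 n = (\<integral>w. (if (pair_event K 0 w \<and> near K 0 w) \<and> pair_radius K 0 w \<le> r n then (1 - mass (pair_union K 0 w)) ^ (n - 2 * K) else 0) \<partial>PiM {..<2 * K} (\<lambda>_. pt))" for n
  define N2 where "N2 n = (\<integral>w. (if near K 0 w \<and> pair_radius K 0 w \<le> r n then (1 - mass (cb {..<K} w)) ^ (n - K) * (1 - mass (cb (second_block K 0) w)) ^ (n - K) else 0) \<partial>PiM {..<2 * K} (\<lambda>_. pt))" for n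
  define FF where "FF n = (\<integral>w. (if far K (r n) w then discrepancy K n (real n * mass (cb {..<K} w)) (real n * mass (cb (second_block K 0) w)) else 0) \<partial>PiM {..<2 * K} (\<lambda>_. pt))" for n
  have N1: "(\<lambda>n. real n ^ (2 * K - 1) * N1 n) \<longlonglongrightarrow> near_union_limit K"
  proof -
    have "\<forall>\<^sub>F n in sequentially. real n ^ (2 * K - 1) * (\<integral>w. (if (pair_event K 0 w \<and> near K 0 w) \<and> pair_radius K 0 w \<le> r n then binom_kernel (2 * K) n (real n * mass (pair_union K 0 w)) (real n * mass {}) else 0)
      \<partial>PiM {..<2 * K} (\<lambda>_. pt)) = real n ^ (2 * K - 1) * N1 n"
      using eventually_gt_at_top[of 0] by eventually_elim (simp add: N1_def binom_kernel_def cong: if_cong)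
    from Lim_transform_eventually[OF limit_near1[OF K1 kern_binom] this] show ?thesis unfolding near_union_limit_def exp_kernel_def[abs_def] .
  qed
  have N2: "(\<lambda>n. real n ^ (2 * K - 1) * N2 n) \<longlonglongrightarrow> near_product_limit K"
  proof -
    have "\<forall>\<^sub>F n in sequentially. real n ^ (2 * K - 1) * (\<integral>w. (if near K 0 w \<and> pair_radius K 0 w \<le> r n then binom_kernel K n (real n * mass (cb {..<K} w)) (real n * mass (cb (second_block K 0) w)) else 0)
      \<partial>PiM {..<2 * K} (\<lambda>_. pt)) = real n ^ (2 * K - 1) * N2 n"
      using eventually_gt_at_top[of 0] by eventually_elim (simp add: N2_def binom_kernel_def cong: if_cong)
    from Lim_transform_eventually[OF limit_near2[OF K1 kern_binom] this] show ?thesis unfolding near_product_limit_def exp_kernel_def[abs_def] .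
  qed
  have F: "(\<lambda>n. real n ^ (2 * K - 2) * FF n) \<longlonglongrightarrow> - (single_limit K (\<lambda>a b. (real K - a) * exp (- a) * exp (- b)))\<^sup>2"
    unfolding FF_def by (rule far_limit[OF K1])
  have diff: "ffact_ratio (2 * K) n * binom_pair K 0 (r n) n - (ffact_ratio K n)\<^sup>2 * (binom_pair K K (r n) n)\<^sup>2 =
     ffact_ratio (2 * K) n * N1 n - (ffact_ratio K n)\<^sup>2 * N2 n + FF n / real n" if n: "n > 0" for n
  proof -
    let ?q = "\<lambda>x :: real. (1 - x) ^ (n - 2 * K)" and ?h = "\<lambda>x :: real. (1 - x) ^ (n - K)"
    have qb: "\<bar>?q x\<bar> \<le> 1" "\<bar>?h x\<bar> \<le> 1" if "0 \<le> x" "x \<le> 1" for x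
      using that by (auto simp: power_abs intro!: power_le_one)
    have hm: "?q \<in> borel_measurable borel" "?h \<in> borel_measurable borel" by measurable
    have 1: "binom_pair K K (r n) n = (\<integral>w. ball_weight ?h {..<K} (r n) w \<partial>PiM {..<K} (\<lambda>_. pt))"
      by (simp add: binom_pair_def ball_weight_def pair_event_self pair_radius_self pair_union_self)
    have 2: "binom_pair K 0 (r n) n = (\<integral>w. (if pair_event K 0 w \<and> pair_radius K 0 w \<le> r n then ?q (mass (pair_union K 0 w)) else 0) \<partial>PiM {..<2 * K} (\<lambda>_. pt))"
      by (simp add: binom_pair_def of_bool_mult_if)
    have 3: "(\<integral>w. (if far K (r n) w then ffact_ratio (2 * K) n * ?q (mass (cb {..<K} w) + mass (cb (second_block K 0) w)) - (ffact_ratio K n)\<^sup>2 * (?h (mass (cb {..<K} w)) * ?h (mass (cb (second_block K 0) w))) else 0)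
         \<partial>PiM {..<2 * K} (\<lambda>_. pt)) = FF n / real n"
    proof -
      \<comment> \<open>Additivity of mass lets the joint weight depend on \<open>a + b\<close>; the
        factor \<open>1 / real n\<close> lowers the normalising power for far pairs to
        \<open>2 * K - 2\<close>.\<close>
      have "ffact_ratio (2 * K) n * ?q (a + b) - (ffact_ratio K n)\<^sup>2 * (?h a * ?h b) = discrepancy K n (real n * a) (real n * b) * (1 / real n)" for a b
        using n by (simp add: discrepancy_def binom_kernel_def distrib_left[symmetric])
      then have "(\<integral>w. (if far K (r n) w then ffact_ratio (2 * K) n * ?q (mass (cb {..<K} w) + mass (cb (second_block K 0) w)) - (ffact_ratio K n)\<^sup>2 * (?h (mass (cb {..<K} w)) * ?h (mass (cb (second_block K 0) w))) else 0)
         \<partial>PiM {..<2 * K} (\<lambda>_. pt)) = (\<integral>w. (if far K (r n) w then discrepancy K n (real n * mass (cb {..<K} w)) (real n * mass (cb (second_block K 0) w)) else 0) * (1 / real n) \<partial>PiM {..<2 * K} (\<lambda>_. pt))"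
        by (intro Bochner_Integration.integral_cong refl) (simp only: if_distribR split: if_split, simp)
      then show ?thesis unfolding FF_def by (simp only: integral_mult_left_zero) simp
    qed
    show ?thesis
      unfolding 1 2 3[symmetric] N1_def N2_def by (rule pair_difference[OF K1 hm(1) qb(1) hm(2) qb(2)])
  qed
  have eq: "binom_var f n (crit_num k (r n)) / real n =
     (\<Sum>j\<in>{1..K}. ffact_ratio (2 * K - j) n * (real n ^ (2 * K - j - 1) * binom_pair K j (r n) n) / (fact j * (fact (K - j))\<^sup>2)) +
     (ffact_ratio (2 * K) n * (real n ^ (2 * K - 1) * N1 n) - (ffact_ratio K n)\<^sup>2 * (real n ^ (2 * K - 1) * N2 n) + real n ^ (2 * K - 2) * FF n) / (fact K)\<^sup>2" if n: "n > 0" for n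
  proof -
    have p: "ffact n m = ffact_ratio m n * real n ^ (m - 1) * real n" if "m \<ge> 1" for m
    proof -
      have "real n ^ m = real n ^ (m - 1) * real n" using that by (cases m) auto
      moreover have "ffact n m = ffact_ratio m n * real n ^ m" using n by (simp add: ffact_ratio_def)
      ultimately show ?thesis by simp
    qed
    have split: "{..K} = insert 0 {1..K}" by auto
    have fK: "(ffact n K)\<^sup>2 = (ffact_ratio K n)\<^sup>2 * real n ^ (2 * K - 1) * real n"
    proof -
      have "(ffact n K)\<^sup>2 = (ffact_ratio K n)\<^sup>2 * real n ^ (2 * K)" using n by (simp add: ffact_ratio_def power_divide power_mult[symmetric] mult.commute)
      moreover have "real n ^ (2 * K) = real n ^ (2 * K - 1) * real n" using K1 by (cases "2 * K") auto
      ultimately show ?thesis by simp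
    qed
    have "binom_var f n (crit_num k (r n)) = (\<Sum>j\<in>{1..K}. ffact n (2 * K - j) / (fact j * (fact (K - j))\<^sup>2) * binom_pair K j (r n) n) +
       (ffact n (2 * K) * binom_pair K 0 (r n) n - (ffact n K)\<^sup>2 * (binom_pair K K (r n) n)\<^sup>2) / (fact K)\<^sup>2"
      unfolding binom_var_eq binom_second_moment[OF K] binom_mean[OF K] split
      by (simp add: power_mult_distrib power_divide diff_divide_distrib)
    also have "ffact n (2 * K) * binom_pair K 0 (r n) n - (ffact n K)\<^sup>2 * (binom_pair K K (r n) n)\<^sup>2 =
       real n ^ (2 * K - 1) * real n * (ffact_ratio (2 * K) n * binom_pair K 0 (r n) n - (ffact_ratio K n)\<^sup>2 * (binom_pair K K (r n) n)\<^sup>2)"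
      unfolding fK using p[of "2 * K"] K1 by (simp add: algebra_simps)
    also have "\<dots> = real n * (ffact_ratio (2 * K) n * (real n ^ (2 * K - 1) * N1 n) - (ffact_ratio K n)\<^sup>2 * (real n ^ (2 * K - 1) * N2 n) + real n ^ (2 * K - 2) * FF n)"
    proof -
      have "2 * K - 1 = Suc (2 * K - 2)" using K1 by simp
      then have "real n ^ (2 * K - 1) * real n * (FF n / real n) = real n * (real n ^ (2 * K - 2) * FF n)" using n by simp
      then show ?thesis unfolding diff[OF n] by (simp only: distrib_left right_diff_distrib mult_ac)
    qed
    also have "(\<Sum>j\<in>{1..K}. ffact n (2 * K - j) / (fact j * (fact (K - j))\<^sup>2) * binom_pair K j (r n) n) =
       real n * (\<Sum>j\<in>{1..K}. ffact_ratio (2 * K - j) n * (real n ^ (2 * K - j - 1) * binom_pair K j (r n) n) / (fact j * (fact (K - j))\<^sup>2))"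
      unfolding sum_distrib_left
    proof (rule sum.cong[OF refl])
      fix j assume "j \<in> {1..K}"
      then have "2 * K - j \<ge> 1" using K1 by auto
      from p[OF this] show "ffact n (2 * K - j) / (fact j * (fact (K - j))\<^sup>2) * binom_pair K j (r n) n =
         real n * (ffact_ratio (2 * K - j) n * (real n ^ (2 * K - j - 1) * binom_pair K j (r n) n) / (fact j * (fact (K - j))\<^sup>2))"
        by (simp add: mult_ac)
    qed
    finally show ?thesis using n by (simp add: add_divide_distrib)
  qed
  have "(\<lambda>n. (\<Sum>j\<in>{1..K}. ffact_ratio (2 * K - j) n * (real n ^ (2 * K - j - 1) * binom_pair K j (r n) n) / (fact j * (fact (K - j))\<^sup>2)) +
     (ffact_ratio (2 * K) n * (real n ^ (2 * K - 1) * N1 n) - (ffact_ratio K n)\<^sup>2 * (real n ^ (2 * K - 1) * N2 n) + real n ^ (2 * K - 2) * FF n) / (fact K)\<^sup>2) \<longlonglongrightarrow>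
     (\<Sum>j\<in>{1..K}. 1 * pair_limit K j / (fact j * (fact (K - j))\<^sup>2)) +
     (1 * near_union_limit K - 1\<^sup>2 * near_product_limit K + - (single_limit K (\<lambda>a b. (real K - a) * exp (- a) * exp (- b)))\<^sup>2) / (fact K)\<^sup>2"
    by (intro tendsto_add tendsto_sum tendsto_divide tendsto_mult tendsto_power tendsto_const tendsto_diff N1 N2 F binom_pair_limit ffact_ratio_lim K1) auto
  moreover have "(\<Sum>j\<in>{1..K}. 1 * pair_limit K j / (fact j * (fact (K - j))\<^sup>2)) +
     (1 * near_union_limit K - 1\<^sup>2 * near_product_limit K + - (single_limit K (\<lambda>a b. (real K - a) * exp (- a) * exp (- b)))\<^sup>2) / (fact K)\<^sup>2 = sig2 K"
    by (simp add: sig2_def sig2_hat_def alpha_def power_divide diff_divide_distrib add_divide_distrib)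
  moreover have "\<forall>\<^sub>F n in sequentially. (\<Sum>j\<in>{1..K}. ffact_ratio (2 * K - j) n * (real n ^ (2 * K - j - 1) * binom_pair K j (r n) n) / (fact j * (fact (K - j))\<^sup>2)) +
     (ffact_ratio (2 * K) n * (real n ^ (2 * K - 1) * N1 n) - (ffact_ratio K n)\<^sup>2 * (real n ^ (2 * K - 1) * N2 n) + real n ^ (2 * K - 2) * FF n) / (fact K)\<^sup>2 = binom_var f n (crit_num k (r n)) / real n"
    using eventually_gt_at_top[of 0] by eventually_elim (simp only: eq)
  ultimately show ?thesis by (auto intro: Lim_transform_eventually)
qed

end

section \<open>Positivity of the mean add-one cost\<close>

lemma exp_le_quadratic:
  fixes v :: real
  assumes "v \<le> 1"
  shows "exp v \<le> 1 + v + v\<^sup>2"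
proof (cases "0 \<le> v")
  case True
  then show ?thesis using assms by (rule exp_bound)
next
  case False
  define u where "u = - v"
  have u: "u \<ge> 0" using False by (simp add: u_def)
  have p: "0 \<le> 1 - u + u\<^sup>2"
  proof -
    have "1 - u + u\<^sup>2 = (1 - u / 2)\<^sup>2 + 3 / 4 * u\<^sup>2" by (simp add: power2_eq_square algebra_simps)
    then show ?thesis by simp
  qed
  \<comment> \<open>For negative \<open>v\<close> the claim is
    \<open>1 \<le> (1 - u + u\<^sup>2) * exp u\<close>. Multiplied by the quadratic Taylor
    polynomial of \<open>exp u\<close>, the first factor becomes a polynomial with constant term 1
    and nonnegative coefficients.\<close>
  have "1 \<le> 1 + u\<^sup>2 / 2 + u ^ 3 / 2 + u ^ 4 / 2" using u by simp
  also have "\<dots> = (1 - u + u\<^sup>2) * (1 + u + u\<^sup>2 / 2)" by (simp add: power2_eq_square power3_eq_cube power4_eq_xxxx field_simps)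
  also have "\<dots> \<le> (1 - u + u\<^sup>2) * exp u" using exp_lower_Taylor_quadratic[OF u] p by (intro mult_left_mono) auto
  finally have "1 * exp (- u) \<le> (1 - u + u\<^sup>2) * exp u * exp (- u)" by (intro mult_right_mono) auto
  also have "\<dots> = 1 - u + u\<^sup>2" by (simp add: mult.assoc exp_add[symmetric])
  finally show ?thesis by (simp add: u_def)
qed

text \<open>A second-order bound around \<open>h = 0\<close>: from \<open>1 + h \<le> exp h\<close>
  the left side is at most \<open>exp (h * (K - a)) * exp (- a)\<close>, and
  \<open>h * K \<le> 1\<close> keeps the exponent in the range of \<open>exp_le_quadratic\<close>.
  The linear term is the add-one kernel.\<close>

lemma add_one_kernel_le:
  fixes h a :: real
  assumes h: "0 \<le> h" "h * real K \<le> 1" and a: "0 \<le> a"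
  shows "(1 + h) ^ K * exp (- ((1 + h) * a)) \<le> exp (- a) + h * ((real K - a) * exp (- a)) + h\<^sup>2 * ((real K - a)\<^sup>2 * exp (- a))"
proof -
  let ?v = "h * (real K - a)"
  have "(1 + h) ^ K \<le> exp h ^ K" using h by (intro power_mono exp_ge_add_one_self) auto
  also have "\<dots> = exp (real K * h)" by (simp add: exp_of_nat_mult)
  finally have "(1 + h) ^ K * exp (- ((1 + h) * a)) \<le> exp (real K * h) * exp (- ((1 + h) * a))" by (intro mult_right_mono) auto
  also have "\<dots> = exp ?v * exp (- a)" by (simp add: exp_add[symmetric] algebra_simps)
  also have "\<dots> \<le> (1 + ?v + ?v\<^sup>2) * exp (- a)"
  proof (intro mult_right_mono exp_le_quadratic)
    show "?v \<le> 1" using h a by (simp add: right_diff_distrib) (smt (verit) mult_nonneg_nonneg)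
  qed simp
  also have "\<dots> = exp (- a) + h * ((real K - a) * exp (- a)) + h\<^sup>2 * ((real K - a)\<^sup>2 * exp (- a))"
    by (simp only: distrib_right power_mult_distrib mult.assoc mult_1_left)
  finally show ?thesis .
qed

lemma emeasure_open_pos:
  fixes S :: "'a::euclidean_space set"
  assumes "open S" "x \<in> S"
  shows "0 < emeasure lborel S"
proof -
  obtain e where e: "e > 0" "ball x e \<subseteq> S" using assms open_contains_ball by blast
  have "measure lborel (ball x e) > 0" using content_ball_pos[OF e(1)] by simp
  then have "emeasure lborel (ball x e) > 0"
    by (metis emeasure_eq_ennreal_measure emeasure_lborel_ball_finite ennreal_less_zero_iff less_top_ennreal not_less_zero top.not_eq_extremum)
  also have "\<dots> \<le> emeasure lborel S" using e(2) assms(1) by (intro emeasure_mono) auto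
  finally show ?thesis .
qed

lemma norm_cc_le:
  assumes wc: "wc I z" and b: "\<And>i. i \<in> I \<Longrightarrow> norm (z i) \<le> R"
  shows "norm (cc I z) \<le> R"
proof -
  have "cc I z \<in> convex hull (z ` I)" using wc ccenter_in_hull[of "z ` I"] by (simp add: cc_def wc_def)
  also have "\<dots> \<subseteq> cball 0 R" using b by (intro hull_minimal) auto
  finally show ?thesis by simp
qed

context crit_scaling
begin

definition ball_integral :: "nat \<Rightarrow> (real \<Rightarrow> real) \<Rightarrow> (nat \<Rightarrow> 'a) \<Rightarrow> real" where
  "ball_integral K g z = (if wc {..<K} z \<and> W (cr {..<K} z) then (\<integral>x. f x ^ K * g (\<beta> * f x * measure lborel (cb {..<K} z)) \<partial>lborel) else 0)"

lemma limint_self: "limint (2 * K - K) (pair_event K K) (pair_radius K K) (pair_union K K) (\<lambda>_. {}) (\<lambda>a b. g a * exp (- b)) z = ball_integral K g z"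
proof -
  have e: "2 * K - K = K" by simp
  show ?thesis unfolding limint_def ball_integral_def pair_event_self pair_radius_self pair_union_self measure_empty e by simp
qed

lemma integrable_ball_integral:
  assumes K: "K \<ge> 1" and g: "kern (\<lambda>_ a b. g a * exp (- b)) (\<lambda>a b. g a * exp (- b))"
  shows "integrable (PiM {Suc 0..<K} (\<lambda>_. lborel)) (\<lambda>z. ball_integral K g (z(0 := 0)))"
proof -
  have e: "2 * K - K = K" by simp
  show ?thesis using limit_union(2)[OF K K order_refl g] unfolding limint_self unfolding e .
qed

lemma single_limit_eq: "single_limit K (\<lambda>a b. g a * exp (- b)) = \<beta> ^ (K - 1) * (\<integral>z. ball_integral K g (z(0 := 0)) \<partial>PiM {Suc 0..<K} (\<lambda>_. lborel))"
proof -
  have e: "2 * K - K = K" by simp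
  show ?thesis unfolding single_limit_def limit_moment_def limint_self unfolding e ..
qed

lemma integrable_f_power:
  assumes K: "K \<ge> 1" and q[measurable]: "q \<in> borel_measurable borel" and b: "\<And>y. 0 \<le> y \<Longrightarrow> \<bar>q y\<bar> \<le> C" and v: "0 \<le> v"
  shows "integrable lborel (\<lambda>x. f x ^ K * q (\<beta> * f x * v))"
proof (rule Bochner_Integration.integrable_bound)
  show "integrable lborel (\<lambda>x. (f_sup ^ (K - 1) * C) * f x)" using f_int by simp
  show "AE x in lborel. norm (f x ^ K * q (\<beta> * f x * v)) \<le> norm ((f_sup ^ (K - 1) * C) * f x)"
  proof (rule AE_I2)
    fix x
    have q0: "\<bar>q (\<beta> * f x * v)\<bar> \<le> C" using \<beta>_pos f_nonneg v by (intro b) auto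
    then have C: "0 \<le> C" by linarith
    have "f x ^ K = f x * f x ^ (K - 1)" using K by (cases K) auto
    also have "\<dots> \<le> f x * f_sup ^ (K - 1)" using f_nonneg f_le by (intro mult_left_mono power_mono) auto
    finally have "f x ^ K * \<bar>q (\<beta> * f x * v)\<bar> \<le> (f x * f_sup ^ (K - 1)) * C"
      using q0 C f_nonneg f_sup_nonneg by (intro mult_mono) auto
    then show "norm (f x ^ K * q (\<beta> * f x * v)) \<le> norm ((f_sup ^ (K - 1) * C) * f x)"
      using f_nonneg f_sup_nonneg C by (simp add: abs_mult mult_ac)
  qed
qed simp

lemma ball_integral_add_one_le:
  assumes K: "K \<ge> 1" and h: "0 \<le> h" "h * real K \<le> 1"
  shows "ball_integral K (\<lambda>a. (1 + h) ^ K * exp (- ((1 + h) * a))) z \<le>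
    ball_integral K (\<lambda>a. exp (- a)) z + h * ball_integral K (\<lambda>a. (real K - a) * exp (- a)) z + h\<^sup>2 * ball_integral K (\<lambda>a. (real K - a)\<^sup>2 * exp (- a)) z"
proof (cases "wc {..<K} z \<and> W (cr {..<K} z)")
  case True
  let ?v = "measure lborel (cb {..<K} z)"
  have bd: "\<bar>p * exp (- y)\<bar> \<le> C" if "\<bar>p\<bar> \<le> C * exp (y / 4)" "0 \<le> y" for p y C :: real
  proof -
    have C: "0 \<le> C" using that(1) by (metis abs_ge_zero exp_gt_zero order_trans zero_le_mult_iff not_less)
    have "\<bar>p * exp (- y)\<bar> = \<bar>p\<bar> * exp (- y)" by (simp add: abs_mult)
    also have "\<dots> \<le> C * exp (y / 4) * exp (- y)" using that(1) by (intro mult_right_mono) auto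
    also have "\<dots> = C * exp (y / 4 + - y)" by (simp only: exp_add mult.assoc)
    also have "\<dots> \<le> C * 1" using that(2) C by (intro mult_left_mono) auto
    finally show ?thesis by simp
  qed
  have i0: "integrable lborel (\<lambda>x. f x ^ K * exp (- (\<beta> * f x * ?v)))"
    by (rule integrable_f_power[OF K, of "\<lambda>y. exp (- y)" 1]) auto
  have i1: "integrable lborel (\<lambda>x. f x ^ K * ((real K - \<beta> * f x * ?v) * exp (- (\<beta> * f x * ?v))))"
    by (rule integrable_f_power[OF K, of "\<lambda>y. (real K - y) * exp (- y)"]) (use bd[OF add_one_bounds(1)] in auto)
  have i2: "integrable lborel (\<lambda>x. f x ^ K * ((real K - \<beta> * f x * ?v)\<^sup>2 * exp (- (\<beta> * f x * ?v))))"
    by (rule integrable_f_power[OF K, of "\<lambda>y. (real K - y)\<^sup>2 * exp (- y)"]) (use bd[OF add_one_bounds(2)] in auto)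
  have i3: "integrable lborel (\<lambda>x. f x ^ K * ((1 + h) ^ K * exp (- ((1 + h) * (\<beta> * f x * ?v)))))"
    by (rule integrable_f_power[OF K, of "\<lambda>y. (1 + h) ^ K * exp (- ((1 + h) * y))" "(1 + h) ^ K"]) (use h in \<open>auto simp: abs_mult mult_left_le\<close>)
  have "(\<integral>x. f x ^ K * ((1 + h) ^ K * exp (- ((1 + h) * (\<beta> * f x * ?v)))) \<partial>lborel) \<le>
    (\<integral>x. f x ^ K * exp (- (\<beta> * f x * ?v)) + h * (f x ^ K * ((real K - \<beta> * f x * ?v) * exp (- (\<beta> * f x * ?v)))) +
       h\<^sup>2 * (f x ^ K * ((real K - \<beta> * f x * ?v)\<^sup>2 * exp (- (\<beta> * f x * ?v)))) \<partial>lborel)"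
  proof (rule integral_mono)
    fix x
    have "f x ^ K * ((1 + h) ^ K * exp (- ((1 + h) * (\<beta> * f x * ?v)))) \<le>
      f x ^ K * (exp (- (\<beta> * f x * ?v)) + h * ((real K - \<beta> * f x * ?v) * exp (- (\<beta> * f x * ?v))) + h\<^sup>2 * ((real K - \<beta> * f x * ?v)\<^sup>2 * exp (- (\<beta> * f x * ?v))))"
      using \<beta>_pos f_nonneg by (intro mult_left_mono add_one_kernel_le h) auto
    then show "f x ^ K * ((1 + h) ^ K * exp (- ((1 + h) * (\<beta> * f x * ?v)))) \<le>
      f x ^ K * exp (- (\<beta> * f x * ?v)) + h * (f x ^ K * ((real K - \<beta> * f x * ?v) * exp (- (\<beta> * f x * ?v)))) +
       h\<^sup>2 * (f x ^ K * ((real K - \<beta> * f x * ?v)\<^sup>2 * exp (- (\<beta> * f x * ?v))))"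
      by (simp only: distrib_left mult.left_commute)
  qed (intro Bochner_Integration.integrable_add integrable_mult_right i0 i1 i2 i3)+
  also have "\<dots> = (\<integral>x. f x ^ K * exp (- (\<beta> * f x * ?v)) \<partial>lborel) + h * (\<integral>x. f x ^ K * ((real K - \<beta> * f x * ?v) * exp (- (\<beta> * f x * ?v))) \<partial>lborel) +
       h\<^sup>2 * (\<integral>x. f x ^ K * ((real K - \<beta> * f x * ?v)\<^sup>2 * exp (- (\<beta> * f x * ?v))) \<partial>lborel)"
    by (simp only: Bochner_Integration.integral_add Bochner_Integration.integrable_add integrable_mult_right integral_mult_right_zero i0 i1 i2)
  finally show ?thesis using True by (simp add: ball_integral_def)
qed (auto simp: ball_integral_def)

text \<open>Dilating by \<open>e\<close> multiplies the ball volume by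
  \<open>e ^ DIM('a) = 1 + h\<close>, which reproduces the kernel of raised intensity. Only an
  inequality results, because admissibility of the larger simplex implies that of the smaller one
  but not conversely.\<close>

lemma ball_integral_scale:
  assumes K: "K \<ge> 1" and h: "0 \<le> h" and e: "e \<ge> 1" "e ^ DIM('a) = 1 + h" and w: "\<And>i. i < K \<Longrightarrow> w i = e *\<^sub>R z i"
  shows "(1 + h) ^ K * ball_integral K (\<lambda>a. exp (- a)) w \<le> ball_integral K (\<lambda>a. (1 + h) ^ K * exp (- ((1 + h) * a))) z"
proof -
  have e0: "e > 0" using e(1) by simp
  have wi: "\<And>i. i \<in> {..<K} \<Longrightarrow> w i = 0 + e *\<^sub>R z i" using w by simp
  have ww: "wc {..<K} w = wc {..<K} z" "cr {..<K} w = e * cr {..<K} z"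
    by (rule wc_affinity[OF e0 wi], assumption, rule cr_affinity[OF e0 wi], assumption)
  have m: "measure lborel (cb {..<K} w) = (1 + h) * measure lborel (cb {..<K} z)"
    using e0 e(2) by (simp add: cb_eq ww content_cball cr_nonneg power_mult_distrib)
  have T0: "0 \<le> ball_integral K (\<lambda>a. (1 + h) ^ K * exp (- ((1 + h) * a))) z"
    unfolding ball_integral_def using f_nonneg h by auto
  show ?thesis
  proof (cases "wc {..<K} w \<and> W (cr {..<K} w)")
    case True
    have "cr {..<K} z \<le> e * cr {..<K} z" using e(1) cr_nonneg[of "{..<K}" z] mult_right_mono[of 1 e "cr {..<K} z"] by simp
    then have "W (cr {..<K} z)" using True W_mono unfolding ww by blast
    then have "ball_integral K (\<lambda>a. (1 + h) ^ K * exp (- ((1 + h) * a))) z = (\<integral>x. (1 + h) ^ K * (f x ^ K * exp (- (\<beta> * f x * measure lborel (cb {..<K} w)))) \<partial>lborel)"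
      using True unfolding ball_integral_def m ww by (simp add: mult_ac)
    also have "\<dots> = (1 + h) ^ K * ball_integral K (\<lambda>a. exp (- a)) w" using True unfolding ball_integral_def by simp
    finally show ?thesis by simp
  next
    case False
    then have "ball_integral K (\<lambda>a. exp (- a)) w = 0" unfolding ball_integral_def by (rule if_not_P)
    then show ?thesis using T0 by simp
  qed
qed

text \<open>With one vertex fixed at the origin, dilating the other \<open>K - 1\<close> has
  Jacobian \<open>(1 + h) ^ (K - 1)\<close>. Against the factor \<open>(1 + h) ^ K\<close> of the
  kernel this leaves the net gain \<open>1 + h\<close>.\<close>

lemma integral_ball_integral_scale:
  assumes K: "K \<ge> 1" and h: "0 \<le> h"
  shows "(1 + h) * (\<integral>z. ball_integral K (\<lambda>a. exp (- a)) (z(0 := 0)) \<partial>PiM {Suc 0..<K} (\<lambda>_. lborel)) \<le>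
    (\<integral>z. ball_integral K (\<lambda>a. (1 + h) ^ K * exp (- ((1 + h) * a))) (z(0 := 0)) \<partial>PiM {Suc 0..<K} (\<lambda>_. lborel))"
proof -
  let ?J = "{Suc 0..<K}"
  let ?N = "PiM ?J (\<lambda>_. lborel :: 'a measure)"
  let ?g0 = "\<lambda>a. exp (- a) :: real" and ?gh = "\<lambda>a. (1 + h) ^ K * exp (- ((1 + h) * a)) :: real"
  define e where "e = root DIM('a) (1 + h)"
  have e: "e \<ge> 1" "e ^ DIM('a) = 1 + h" "e > 0" using h by (auto simp: e_def real_root_pow_pos)
  have n0: "0 \<le> ball_integral K ?g0 z" "0 \<le> ball_integral K ?gh z" for z unfolding ball_integral_def using f_nonneg h by auto
  have i0: "integrable ?N (\<lambda>z. ball_integral K ?g0 (z(0 := 0)))" by (rule integrable_ball_integral[OF K kern_exp])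
  have ih: "integrable ?N (\<lambda>z. ball_integral K ?gh (z(0 := 0)))" by (rule integrable_ball_integral[OF K kern_dilated[OF h]])
  have m0: "(\<lambda>z. ennreal (ball_integral K ?g0 (z(0 := 0)))) \<in> borel_measurable ?N" using i0 by measurable
  have mh: "(\<lambda>z. ennreal (ball_integral K ?gh (z(0 := 0)))) \<in> borel_measurable ?N" using ih by measurable
  have c: "e ^ (DIM('a) * card ?J) = (1 + h) ^ (K - 1)" using e(2) by (simp add: power_mult)
  have pt: "ball_integral K ?g0 ((\<lambda>i\<in>?J. 0 + e *\<^sub>R z i)(0 := 0)) \<le> 1 / (1 + h) ^ K * ball_integral K ?gh (z(0 := 0))" for z
  proof -
    have "(1 + h) ^ K * ball_integral K ?g0 ((\<lambda>i\<in>?J. 0 + e *\<^sub>R z i)(0 := 0)) \<le> ball_integral K ?gh (z(0 := 0))"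
      by (rule ball_integral_scale[OF K h e(1,2)]) auto
    then show ?thesis using h by (simp add: field_simps)
  qed
  have "ennreal (\<integral>z. ball_integral K ?g0 (z(0 := 0)) \<partial>?N) = (\<integral>\<^sup>+z. ennreal (ball_integral K ?g0 (z(0 := 0))) \<partial>?N)"
    by (rule nn_integral_eq_integral[symmetric, OF i0]) (use n0 in auto)
  also have "\<dots> = ennreal (e ^ (DIM('a) * card ?J)) * (\<integral>\<^sup>+z. ennreal (ball_integral K ?g0 ((\<lambda>i\<in>?J. 0 + e *\<^sub>R z i)(0 := 0))) \<partial>?N)"
    by (rule nn_integral_PiM_lborel_affine[OF _ e(3) m0]) simp
  also have "\<dots> \<le> ennreal ((1 + h) ^ (K - 1)) * (\<integral>\<^sup>+z. ennreal (1 / (1 + h) ^ K) * ennreal (ball_integral K ?gh (z(0 := 0))) \<partial>?N)"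
    unfolding c using pt h n0 by (intro mult_left_mono nn_integral_mono) (auto simp: ennreal_mult[symmetric] intro!: ennreal_leI)
  also have "\<dots> = ennreal ((1 + h) ^ (K - 1)) * (ennreal (1 / (1 + h) ^ K) * ennreal (\<integral>z. ball_integral K ?gh (z(0 := 0)) \<partial>?N))"
    unfolding nn_integral_cmult[OF mh] by (subst nn_integral_eq_integral[OF ih]) (use n0 in auto)
  also have "\<dots> = ennreal ((1 + h) ^ (K - 1) * (1 / (1 + h) ^ K * (\<integral>z. ball_integral K ?gh (z(0 := 0)) \<partial>?N)))"
    using h n0 by (simp add: ennreal_mult[symmetric])
  finally have "(\<integral>z. ball_integral K ?g0 (z(0 := 0)) \<partial>?N) \<le> (1 + h) ^ (K - 1) * (1 / (1 + h) ^ K * (\<integral>z. ball_integral K ?gh (z(0 := 0)) \<partial>?N))"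
    by (rule ennreal_le_iff[THEN iffD1, rotated]) (use h n0 in auto)
  also have "\<dots> = (\<integral>z. ball_integral K ?gh (z(0 := 0)) \<partial>?N) / (1 + h)"
  proof -
    have "(1 + h) ^ K = (1 + h) ^ (K - 1) * (1 + h)" using K by (cases K) auto
    then show ?thesis using h by simp
  qed
  finally show ?thesis using h by (simp add: field_simps)
qed

lemma integral_f_power_pos:
  assumes K: "K \<ge> 1" and v: "0 \<le> v"
  shows "0 < (\<integral>x. f x ^ K * exp (- (\<beta> * f x * v)) \<partial>lborel)"
proof -
  have i: "integrable lborel (\<lambda>x. f x ^ K * exp (- (\<beta> * f x * v)))"
    by (rule integrable_f_power[OF K, of "\<lambda>y. exp (- y)" 1]) (use v in auto)
  have "(\<integral>x. f x ^ K * exp (- (\<beta> * f x * v)) \<partial>lborel) \<noteq> 0"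
  proof
    assume "(\<integral>x. f x ^ K * exp (- (\<beta> * f x * v)) \<partial>lborel) = 0"
    then have "AE x in lborel. f x ^ K * exp (- (\<beta> * f x * v)) = 0"
      by (subst (asm) integral_nonneg_eq_0_iff_AE[OF i]) (use f_nonneg in auto)
    then have "AE x in lborel. f x = 0" by eventually_elim simp
    then have "(\<integral>x. f x \<partial>lborel) = (\<integral>x. 0 \<partial>(lborel :: 'a measure))" by (intro integral_cong_AE) auto
    then show False using f_int(2) by simp
  qed
  moreover have "0 \<le> (\<integral>x. f x ^ K * exp (- (\<beta> * f x * v)) \<partial>lborel)" using f_nonneg by simp
  ultimately show ?thesis by simp
qed

text \<open>A simplex from \<open>wc_exists\<close> is translated to have vertex 0 at the origin and
  shrunk until admissible. Since \<open>wc\<close> is open, a whole box of shapes of positive volume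
  around it has a positive integrand.\<close>

lemma integral_ball_integral_pos:
  assumes k: "1 \<le> k" "k \<le> DIM('a)" and K: "K = k + 1"
  shows "0 < (\<integral>z. ball_integral K (\<lambda>a. exp (- a)) (z(0 := 0)) \<partial>PiM {Suc 0..<K} (\<lambda>_. lborel))"
proof -
  let ?J = "{Suc 0..<K}"
  let ?N = "PiM ?J (\<lambda>_. lborel :: 'a measure)"
  let ?g = "\<lambda>a. exp (- a) :: real"
  have K1: "K \<ge> 1" using K by simp
  have i0: "integrable ?N (\<lambda>z. ball_integral K ?g (z(0 := 0)))" by (rule integrable_ball_integral[OF K1 kern_exp])
  have n0: "0 \<le> ball_integral K ?g z" for z unfolding ball_integral_def using f_nonneg by auto
  obtain \<eta> where \<eta>: "\<eta> > 0" "W \<eta>" using W_small by blast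
  obtain v :: "nat \<Rightarrow> 'a" where v: "wc {..k} v" using wc_exists[OF k] by blast
  \<comment> \<open>A bound exceeding every distance to vertex 0, so that scaling by
    \<open>\<eta> / R\<close> places all vertices strictly within \<open>\<eta>\<close>; the summand
    1 gives strictness and \<open>R > 0\<close>.\<close>
  define R where "R = 1 + (\<Sum>i<K. norm (v i - v 0))"
  have R: "norm (v i - v 0) < R" if "i < K" for i
    unfolding R_def using member_le_sum[of i "{..<K}" "\<lambda>i. norm (v i - v 0)"] that by fastforce
  have R0: "R > 0" unfolding R_def by (simp add: add_pos_nonneg sum_nonneg)
  define u where "u i = (- (\<eta> / R) *\<^sub>R v 0) + (\<eta> / R) *\<^sub>R v i" for i
  have uK: "{..k} = {..<K}" using K by auto
  have wu: "wc {..<K} u"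
    using v unfolding uK by (subst wc_affinity[of "\<eta> / R" _ u "- (\<eta> / R) *\<^sub>R v 0" v]) (use \<eta> R0 in \<open>auto simp: u_def\<close>)
  have u0: "u 0 = 0" by (simp add: u_def)
  have ub: "norm (u i) < \<eta>" if "i < K" for i
  proof -
    have "u i = (\<eta> / R) *\<^sub>R (v i - v 0)" by (simp add: u_def scaleR_diff_right)
    then have "norm (u i) = \<eta> * (norm (v i - v 0) / R)" using \<eta> R0 by simp
    also have "\<dots> < \<eta> * 1" using R[OF that] R0 \<eta> by (intro mult_strict_left_mono) auto
    finally show ?thesis by simp
  qed
  have "open {z :: nat \<Rightarrow> 'a. wc {..<K} z}" by (rule open_wc) (use K in auto)
  then have "openin (product_topology (\<lambda>_. euclidean) UNIV) {z :: nat \<Rightarrow> 'a. wc {..<K} z}" by (simp add: open_fun_def)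
  from product_topology_open_contains_basis[OF this, of u] wu
  obtain X where X: "u \<in> PiE UNIV X" "\<And>i. open (X i)" "PiE UNIV X \<subseteq> {z :: nat \<Rightarrow> 'a. wc {..<K} z}" by auto
  define B where "B = PiE ?J (\<lambda>i. X i \<inter> ball 0 \<eta>)"
  have good: "0 < ball_integral K ?g (z(0 := 0))" if z: "z \<in> B" for z
  proof -
    let ?z = "z(0 := 0)"
    define w where "w i = (if i \<in> ?J then z i else u i)" for i
    have zi: "z i \<in> X i" "norm (z i) < \<eta>" if "i \<in> ?J" for i using PiE_mem[OF z[unfolded B_def] that] by auto
    have "w \<in> PiE UNIV X" using X(1) zi(1) by (auto simp: w_def)
    then have "wc {..<K} w" using X(3) by blast
    moreover have eq: "?z i = w i" if "i \<in> {..<K}" for i using that u0 by (cases "i = 0") (auto simp: w_def)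
    ultimately have wz: "wc {..<K} ?z" using wc_cong[of "{..<K}" ?z w] by blast
    have zb: "norm (?z i) \<le> \<eta>" if "i \<in> {..<K}" for i
    proof (cases "i = 0")
      case False
      then have "i \<in> ?J" using that by auto
      then show ?thesis using zi(2)[of i] False by simp
    qed (use \<eta> in simp)
    \<comment> \<open>Vertex 0 is at the origin, so the radius is the norm of the centre; the centre
      lies in the convex hull of points of norm at most \<open>\<eta>\<close>.\<close>
    have "cr {..<K} ?z = dist (cc {..<K} ?z) (?z 0)" by (rule dist_cc[symmetric, OF wz]) (use K in auto)
    also have "\<dots> = norm (cc {..<K} ?z)" by (simp only: fun_upd_same dist_0_norm dist_norm diff_zero)
    also have "\<dots> \<le> \<eta>" by (rule norm_cc_le[OF wz zb])
    finally have "W (cr {..<K} ?z)" using W_mono[OF \<eta>(2)] by blast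
    then show ?thesis using wz integral_f_power_pos[OF K1, of "measure lborel (cb {..<K} ?z)"] unfolding ball_integral_def by (simp del: fun_upd_apply)
  qed
  have Bs: "B \<in> sets ?N" unfolding B_def by (intro sets_PiM_I_finite) (use X(2) in auto)
  have "emeasure ?N B = (\<Prod>i\<in>?J. emeasure lborel (X i \<inter> ball 0 \<eta>))"
    unfolding B_def by (rule lborel_prod.emeasure_PiM) (use X(2) in auto)
  moreover have "0 < emeasure lborel (X i \<inter> ball 0 \<eta>)" if "i \<in> ?J" for i
    by (rule emeasure_open_pos[of _ "u i"]) (use X ub that in \<open>auto simp: PiE_iff\<close>)
  ultimately have Bpos: "emeasure ?N B \<noteq> 0" by (auto simp: prod_zero_iff less_imp_neq[symmetric])
  have "(\<integral>z. ball_integral K ?g (z(0 := 0)) \<partial>?N) \<noteq> 0"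
  proof
    assume "(\<integral>z. ball_integral K ?g (z(0 := 0)) \<partial>?N) = 0"
    then have "AE z in ?N. ball_integral K ?g (z(0 := 0)) = 0"
      by (subst (asm) integral_nonneg_eq_0_iff_AE[OF i0]) (use n0 in auto)
    then have "AE z in ?N. z \<notin> B" by eventually_elim (metis good less_irrefl)
    then have "B \<in> null_sets ?N" using Bs by (simp add: AE_iff_null_sets)
    then show False using Bpos by auto
  qed
  moreover have "0 \<le> (\<integral>z. ball_integral K ?g (z(0 := 0)) \<partial>?N)" using n0 by (intro Bochner_Integration.integral_nonneg) auto
  ultimately show ?thesis by simp
qed

text \<open>Raising the intensity by the factor \<open>1 + h\<close> amounts to a dilation that only relaxes the constraint \<open>W\<close>, so the mean
  count grows at least by that factor; its derivative at \<open>h = 0\<close> is the mean add-one cost.\<close>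
lemma alpha_pos:
  assumes k: "1 \<le> k" "k \<le> DIM('a)" and K: "K = k + 1"
  shows "alpha K > 0"
proof -
  let ?A = "\<lambda>g. \<integral>z. ball_integral K g (z(0 := 0)) \<partial>PiM {Suc 0..<K} (\<lambda>_. lborel)"
  let ?g0 = "\<lambda>a. exp (- a) :: real" and ?ga = "\<lambda>a. (real K - a) * exp (- a)" and ?gs = "\<lambda>a. (real K - a)\<^sup>2 * exp (- a)"
  let ?gh = "\<lambda>h a. (1 + h) ^ K * exp (- ((1 + h) * a)) :: real"
  have K1: "K \<ge> 1" using K by simp
  note i0 = integrable_ball_integral[OF K1 kern_exp] and ia = integrable_ball_integral[OF K1 kern_add_one] and iq = integrable_ball_integral[OF K1 kern_add_one_sq]
  have pos: "0 < ?A ?g0" by (rule integral_ball_integral_pos[OF k K])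
  have As: "0 \<le> ?A ?gs" unfolding ball_integral_def using f_nonneg by (intro Bochner_Integration.integral_nonneg) auto
  \<comment> \<open>This compares the lower bound \<open>1 + h\<close> on the growth with the
    second-order upper bound; the zeroth-order terms cancel and the rest is divided by
    \<open>h\<close>.\<close>
  have key: "?A ?g0 \<le> ?A ?ga + h * ?A ?gs" if h: "0 < h" "h * real K \<le> 1" for h
  proof -
    have "(1 + h) * ?A ?g0 \<le> ?A (?gh h)" using h by (intro integral_ball_integral_scale K1) simp
    also have "\<dots> \<le> (\<integral>z. ball_integral K ?g0 (z(0 := 0)) + h * ball_integral K ?ga (z(0 := 0)) + h\<^sup>2 * ball_integral K ?gs (z(0 := 0)) \<partial>PiM {Suc 0..<K} (\<lambda>_. lborel))"
    proof (rule integral_mono)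
      show "integrable (PiM {Suc 0..<K} (\<lambda>_. lborel)) (\<lambda>z. ball_integral K (?gh h) (z(0 := 0)))"
        by (rule integrable_ball_integral[OF K1 kern_dilated]) (use h in simp)
      show "ball_integral K (?gh h) (z(0 := 0)) \<le> ball_integral K ?g0 (z(0 := 0)) + h * ball_integral K ?ga (z(0 := 0)) + h\<^sup>2 * ball_integral K ?gs (z(0 := 0))" for z
        by (rule ball_integral_add_one_le[OF K1]) (use h in auto)
    qed (intro Bochner_Integration.integrable_add integrable_mult_right i0 ia iq)
    also have "\<dots> = ?A ?g0 + h * ?A ?ga + h\<^sup>2 * ?A ?gs"
      by (simp only: Bochner_Integration.integral_add Bochner_Integration.integrable_add integrable_mult_right integral_mult_right_zero i0 ia iq)
    finally have "h * ?A ?g0 \<le> h * (?A ?ga + h * ?A ?gs)" by (simp add: algebra_simps power2_eq_square)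
    then show ?thesis using h by simp
  qed
  have "0 < ?A ?ga"
  proof (rule ccontr)
    assume n: "\<not> 0 < ?A ?ga"
    \<comment> \<open>The first bound gives \<open>h * K \<le> 1\<close>; the second makes the
      quadratic error at most half of the positive left side of \<open>key\<close>. The
      \<open>+ 1\<close> avoids division by 0.\<close>
    define h where "h = min (1 / real K) (?A ?g0 / (2 * (?A ?gs + 1)))"
    have h: "0 < h" using K1 pos As by (simp add: h_def)
    have "h \<le> 1 / real K" by (simp add: h_def)
    then have hK: "h * real K \<le> 1" using K1 by (simp add: field_simps)
    have "h \<le> ?A ?g0 / (2 * (?A ?gs + 1))" by (simp add: h_def)
    then have "h * (2 * (?A ?gs + 1)) \<le> ?A ?g0" using As by (simp add: pos_le_divide_eq)
    moreover have "h * ?A ?gs \<le> h * (?A ?gs + 1)" using h by simp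
    ultimately have "2 * (h * ?A ?gs) \<le> ?A ?g0" by (simp add: algebra_simps)
    then show False using key[OF h hK] n pos by linarith
  qed
  then have "0 < single_limit K (\<lambda>a b. ?ga a * exp (- b))" unfolding single_limit_eq using \<beta>_pos by simp
  then show ?thesis by (simp add: alpha_def)
qed

lemma sig2_less: "1 \<le> k \<Longrightarrow> k \<le> DIM('a) \<Longrightarrow> sig2 (k + 1) < sig2_hat (k + 1)"
  using alpha_pos[of k "k + 1"] by (simp add: sig2_def)

end

section \<open>The scaling hypotheses for finite and for infinite limits\<close>

context prob_density
begin

text \<open>Shrink the convex support towards the centre \<open>x\<close> of the ball.\<close>
lemma lower_bounded_ball_mass:
  assumes lb: "lower_bounded f" and cv: "convex (supp f)"
  obtains c D where "c > 0" "D > 0" "\<And>x \<rho>. x \<in> supp f \<Longrightarrow> 0 \<le> \<rho> \<Longrightarrow> \<rho> \<le> D \<Longrightarrow> c * \<rho> ^ DIM('a) \<le> mass (cball x \<rho>)"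
proof -
  let ?S = "supp f"
  define m where "m = (INF x\<in>?S. f x)"
  have m0: "m > 0" and cS: "compact ?S" using lb by (simp_all add: lower_bounded_def m_def)
  have mf: "m \<le> f x" if "x \<in> ?S" for x
    unfolding m_def by (rule cINF_lower[OF _ that]) (use f_nonneg in \<open>auto intro!: bdd_belowI[of _ 0]\<close>)
  have f0: "f x = 0" if "x \<notin> ?S" for x using that closure_subset[of "{x. f x \<noteq> 0}"] unfolding supp_def by auto
  have "?S \<noteq> {}"
  proof
    assume "?S = {}"
    then have "f = (\<lambda>_. 0)" using f0 by auto
    then show False using f_int(2) by simp
  qed
  then have Mf0: "f_sup > 0" using mf f_le m0 by (meson ex_in_conv less_le_trans)
  obtain B where B: "B > 0" "\<And>x. x \<in> ?S \<Longrightarrow> norm x \<le> B" using compact_imp_bounded[OF cS] bounded_pos by blast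
  let ?D = "2 * B" and ?d = "DIM('a)"
  have "(m / f_sup / ?D ^ ?d) * \<rho> ^ ?d \<le> mass (cball x \<rho>)" if x: "x \<in> ?S" and \<rho>: "0 \<le> \<rho>" "\<rho> \<le> ?D" for x \<rho>
  proof (cases "\<rho> = 0")
    case False
    \<comment> \<open>The support has diameter at most \<open>?D\<close>, so contracting it towards
      \<open>x\<close> by this ratio places it in the ball of radius \<open>\<rho>\<close>.\<close>
    define t where "t = \<rho> / ?D"
    have t: "0 < t" "t \<le> 1" using \<rho> B(1) False by (auto simp: t_def)
    have Sb: "?S \<in> sets borel" "bounded ?S" using cS compact_imp_bounded borel_compact by auto
    let ?T = "(\<lambda>y. (1 - t) *\<^sub>R x + t *\<^sub>R y) ` ?S"
    have Tin: "(1 - t) *\<^sub>R x + t *\<^sub>R y \<in> ?S" if "y \<in> ?S" for y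
      using convexD[OF cv x that] t by simp
    have sub: "?T \<subseteq> cball x \<rho>"
    proof
      fix z assume "z \<in> ?T"
      then obtain y where y: "y \<in> ?S" "z = (1 - t) *\<^sub>R x + t *\<^sub>R y" by blast
      have "dist x z = t * dist x y"
      proof -
        have "x - z = t *\<^sub>R (x - y)" by (simp add: y(2) algebra_simps)
        then show ?thesis using t by (simp add: dist_norm)
      qed
      also have "\<dots> \<le> t * ?D"
        using t B(2)[OF x] B(2)[OF y(1)] norm_triangle_ineq4[of x y] by (intro mult_left_mono) (auto simp: dist_norm)
      also have "\<dots> = \<rho>" using B(1) by (simp add: t_def)
      finally show "z \<in> cball x \<rho>" by simp
    qed
    \<comment> \<open>Inside the support the density at the contracted point is at least
      \<open>m\<close>, hence at least \<open>m / f_sup * f y\<close>. The normalisation of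
      \<open>f\<close> then gives a lower bound independent of \<open>x\<close> and
      \<open>t\<close>.\<close>
    have "m / f_sup = (\<integral>y. m / f_sup * f y \<partial>lborel)" using f_int by simp
    also have "\<dots> \<le> (\<integral>y. f ((1 - t) *\<^sub>R x + t *\<^sub>R y) * indicator ?S y \<partial>lborel)"
    proof (rule integral_mono)
      show "integrable lborel (\<lambda>y. m / f_sup * f y)" using f_int by simp
      show "integrable lborel (\<lambda>y. f ((1 - t) *\<^sub>R x + t *\<^sub>R y) * indicator ?S y)" by (rule mass_affine(3)[OF Sb t(1)])
      fix y
      show "m / f_sup * f y \<le> f ((1 - t) *\<^sub>R x + t *\<^sub>R y) * indicator ?S y"
      proof (cases "y \<in> ?S")
        case True
        have "m / f_sup * f y \<le> m / f_sup * f_sup" using m0 Mf0 f_le by (intro mult_left_mono) auto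
        also have "\<dots> = m" using Mf0 by simp
        finally show ?thesis using mf[OF Tin[OF True]] True by simp
      qed (simp add: f0)
    qed
    finally have "t ^ ?d * (m / f_sup) \<le> t ^ ?d * (\<integral>y. f ((1 - t) *\<^sub>R x + t *\<^sub>R y) * indicator ?S y \<partial>lborel)"
      using t by (intro mult_left_mono) auto
    also have "\<dots> = mass ?T" by (rule mass_affine(1)[OF Sb t(1), symmetric])
    also have "\<dots> \<le> mass (cball x \<rho>)" by (intro pt.finite_measure_mono sub) simp
    finally show ?thesis by (simp add: t_def power_divide mult.commute)
  qed (simp add: zero_power)
  then show ?thesis using that[of "m / f_sup / ?D ^ ?d" ?D] m0 Mf0 B(1) by simp
qed

text \<open>With \<open>r\<close> as its own scale the rescaled radius is at most 1, so
  \<open>ball_mass\<close> holds with \<open>c = C = 1\<close> because its left side is at most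
  0.\<close>

lemma crit_scaling_finite:
  assumes r: "\<And>n. 0 < r n" "r \<longlonglongrightarrow> 0" and l: "l > 0" "(\<lambda>n. real n * r n ^ DIM('a)) \<longlonglongrightarrow> l"
  shows "crit_scaling f r r l (\<lambda>t. t \<le> 1)"
proof
  have "1 * (cr I w / r n) - 1 \<le> real n * mass (cb I w)" if "cr I w \<le> r n" for I n and w :: "nat \<Rightarrow> 'a"
  proof -
    have "1 * (cr I w / r n) - 1 \<le> 0" using that r(1)[of n] by simp
    also have "0 \<le> real n * mass (cb I w)" by simp
    finally show ?thesis .
  qed
  then show "\<exists>c C. c > 0 \<and> eventually (\<lambda>n. \<forall>I w. finite I \<longrightarrow> I \<noteq> {} \<longrightarrow> wc I w \<longrightarrow> (\<forall>i\<in>I. f (w i) > 0) \<longrightarrow>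
      cr I w \<le> r n \<longrightarrow> c * (cr I w / r n) - C \<le> real n * mass (cb I w)) sequentially"
    by (intro exI[of _ 1]) auto
  show "eventually (\<lambda>n. (t \<le> r n / r n) = (t \<le> 1)) sequentially" for t
    using r(1) by (simp add: less_imp_neq[symmetric])
  show "\<exists>\<eta>>0. \<eta> \<le> (1 :: real)" by (intro exI[of _ 1]) simp
qed (use r l in auto)

text \<open>The scale is chosen so that \<open>n\<close> times its \<open>d\<close>-th power is
  exactly 1 for \<open>n > 0\<close>; the value at 0 only ensures positivity. As
  \<open>n * r n ^ d\<close> diverges, so does \<open>r n\<close> relative to the scale, and every
  radius constraint eventually disappears.\<close>

lemma crit_scaling_infinite:
  assumes r: "\<And>n. 0 < r n" "r \<longlonglongrightarrow> 0" and l: "filterlim (\<lambda>n. real n * r n ^ DIM('a)) at_top sequentially"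
    and lb: "lower_bounded f" and cv: "convex (supp f)"
  shows "crit_scaling f (\<lambda>n. if n = 0 then 1 else real n powr (- 1 / DIM('a))) r 1 (\<lambda>_. True)"
proof
  let ?s = "\<lambda>n. if n = 0 then 1 else real n powr (- 1 / DIM('a))" and ?d = "DIM('a)"
  show s0: "0 < ?s n" for n by simp
  have sd: "real n * ?s n ^ ?d = 1" if "n > 0" for n
  proof -
    have "(real n powr (- 1 / ?d)) ^ ?d = real n powr (- 1)" using that by (simp add: powr_realpow[symmetric] powr_powr)
    then show ?thesis using that by (simp add: powr_minus)
  qed
  have "(\<lambda>n. real n powr (- 1 / ?d)) \<longlonglongrightarrow> 0" by (rule tendsto_neg_powr[OF _ filterlim_real_sequentially]) simp
  then show "?s \<longlonglongrightarrow> 0"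
    by (rule Lim_transform_eventually) (use eventually_gt_at_top[of 0] in \<open>auto elim: eventually_mono\<close>)
  show "(\<lambda>n. real n * ?s n ^ ?d) \<longlonglongrightarrow> 1"
    by (rule tendsto_eventually) (use eventually_gt_at_top[of 0] sd in \<open>auto elim!: eventually_mono\<close>)
  show "\<forall>\<^sub>F n in sequentially. (t \<le> r n / ?s n) = True" for t
  proof -
    have "\<forall>\<^sub>F n in sequentially. \<bar>t\<bar> ^ ?d < real n * r n ^ ?d"
      using l by (simp add: filterlim_at_top_dense)
    with eventually_gt_at_top[of 0] show ?thesis
    proof eventually_elim
      case (elim n)
      have "(r n / ?s n) ^ ?d = real n * r n ^ ?d" using sd[OF elim(1)] s0[of n] by (simp add: power_divide field_simps)
      then have "\<bar>t\<bar> ^ ?d < (r n / ?s n) ^ ?d" using elim(2) by simp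
      then have "\<bar>t\<bar> < r n / ?s n" by (rule power_less_imp_less_base) (use r(1) s0 in \<open>auto simp: less_imp_le\<close>)
      then show ?case by simp
    qed
  qed
  obtain c D where c: "c > 0" "D > 0" "\<And>x \<rho>. x \<in> supp f \<Longrightarrow> 0 \<le> \<rho> \<Longrightarrow> \<rho> \<le> D \<Longrightarrow> c * \<rho> ^ ?d \<le> mass (cball x \<rho>)"
    using lower_bounded_ball_mass[OF lb cv] by metis
  have "\<forall>\<^sub>F n in sequentially. \<forall>I w. finite I \<longrightarrow> I \<noteq> {} \<longrightarrow> wc I w \<longrightarrow> (\<forall>i\<in>I. f (w i) > 0) \<longrightarrow>
      cr I w \<le> r n \<longrightarrow> c * (cr I w / ?s n) - c \<le> real n * mass (cb I w)"
    using eventually_gt_at_top[of 0] order_tendstoD(2)[OF r(2) c(2)]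
  proof eventually_elim
    case (elim n)
    show ?case
    proof (intro allI impI)
      fix I and w :: "nat \<Rightarrow> 'a" assume w: "wc I w" "\<forall>i\<in>I. f (w i) > 0" "cr I w \<le> r n"
      let ?y = "cr I w / ?s n"
      have y0: "0 \<le> ?y" using s0[of n] cr_nonneg[of I w] by (simp add: less_imp_le)
      \<comment> \<open>The mass bound is of degree \<open>?d\<close> in the rescaled radius; this
        weakens it to the linear growth demanded by \<open>ball_mass\<close>, at the cost of an
        additive constant.\<close>
      have "?y - 1 \<le> ?y ^ ?d"
      proof (cases "?y \<le> 1")
        case False
        then have "?y ^ 1 \<le> ?y ^ ?d" by (intro power_increasing) (auto simp: Suc_leI)
        then show ?thesis by simp
      next
        case True
        have "0 \<le> ?y ^ ?d" using y0 by (rule zero_le_power)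
        then show ?thesis using True by linarith
      qed
      then have "c * ?y - c \<le> c * ?y ^ ?d" using c(1) mult_left_mono[of "?y - 1" "?y ^ ?d" c] by (simp add: right_diff_distrib)
      also have "?y ^ ?d = real n * cr I w ^ ?d" using sd[OF elim(1)] s0[of n] by (simp add: power_divide field_simps)
      also have "c * (real n * cr I w ^ ?d) = real n * (c * cr I w ^ ?d)" by simp
      also have "\<dots> \<le> real n * mass (cball (cc I w) (cr I w))"
      proof (intro mult_left_mono c(3) cr_nonneg)
        \<comment> \<open>The mass estimate holds for balls centred in the support. The centre of a
          well-centred simplex lies in the convex hull of its vertices, and convexity of the support
          brings it there.\<close>
        have "w ` I \<subseteq> supp f" using w(2) closure_subset[of "{x. f x \<noteq> 0}"] by (force simp: supp_def)
        then have "convex hull (w ` I) \<subseteq> supp f" using cv by (rule hull_minimal)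
        moreover have "cc I w \<in> convex hull (w ` I)" using w(1) ccenter_in_hull[of "w ` I"] by (simp add: cc_def wc_def)
        ultimately show "cc I w \<in> supp f" by blast
      qed (use w(3) elim(2) in auto)
      finally show "c * ?y - c \<le> real n * mass (cb I w)" using w(1) by (simp add: cb_eq)
    qed
  qed
  then show "\<exists>c C. c > 0 \<and> eventually (\<lambda>n. \<forall>I w. finite I \<longrightarrow> I \<noteq> {} \<longrightarrow> wc I w \<longrightarrow> (\<forall>i\<in>I. f (w i) > 0) \<longrightarrow>
      cr I w \<le> r n \<longrightarrow> c * (cr I w / ?s n) - C \<le> real n * mass (cb I w)) sequentially"
    using c(1) by blast
  show "\<exists>\<eta>>(0 :: real). True" by (intro exI[of _ 1]) simp
qed auto

end

theorem theorem3p6: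
  fixes f :: "'a::euclidean_space \<Rightarrow> real" and lam :: ereal and k :: nat
  assumes dens: "bounded_prob_density f"
    and lam: "0 < lam"
    and inf_case: "lam = \<infinity> \<longrightarrow> lower_bounded f \<and> convex (supp f)"
    and k: "1 \<le> k" "k \<le> DIM('a)"
  shows "\<exists>\<sigma>2 \<sigma>2_hat :: real. \<sigma>2 < \<sigma>2_hat \<and>
           (\<forall>r :: nat \<Rightarrow> real.
              (\<forall>n. 0 < r n) \<and> r \<longlonglongrightarrow> 0 \<and>
              ((\<lambda>n. ereal (real n * r n ^ DIM('a))) \<longlongrightarrow> lam) sequentially \<longrightarrow>
              ((\<lambda>n. binom_var f n (\<lambda>P. real (crit_count k (r n) P)) / real n) \<longlonglongrightarrow> \<sigma>2) \<and>
              ((\<lambda>n. pois_var f n (\<lambda>P. real (crit_count k (r n) P)) / real n) \<longlonglongrightarrow> \<sigma>2_hat))"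
proof -
  interpret prob_density f by unfold_locales (rule dens)
  define adm where "adm r \<longleftrightarrow> (\<forall>n. 0 < r n) \<and> r \<longlonglongrightarrow> 0 \<and>
    ((\<lambda>n. ereal (real n * r n ^ DIM('a))) \<longlongrightarrow> lam) sequentially" for r :: "nat \<Rightarrow> real"
  \<comment> \<open>The order of quantifiers matters: \<open>\<beta>\<close> and \<open>W\<close>
    depend on \<open>lam\<close> alone, whereas the scale may vary with \<open>r\<close>. Since
    \<open>sig2\<close> and \<open>sig2_hat\<close> are built from \<open>f\<close>,
    \<open>\<beta>\<close> and \<open>W\<close>, the same constants serve every admissible
    sequence.\<close>
  obtain \<beta> W where cs: "\<And>r. adm r \<Longrightarrow> \<exists>s. crit_scaling f s r \<beta> W"
  proof (cases lam)
    case (real l)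
    have "crit_scaling f r r l (\<lambda>t. t \<le> 1)" if "adm r" for r
      by (rule crit_scaling_finite) (use that lam real in \<open>auto simp: adm_def\<close>)
    then show ?thesis using that by blast
  next
    case PInf
    have "crit_scaling f (\<lambda>n. if n = 0 then 1 else real n powr (- 1 / DIM('a))) r 1 (\<lambda>_. True)" if "adm r" for r
    proof (rule crit_scaling_infinite)
      have "((\<lambda>n. ereal (real n * r n ^ DIM('a))) \<longlongrightarrow> \<infinity>) sequentially" using that PInf by (simp add: adm_def)
      then show "filterlim (\<lambda>n. real n * r n ^ DIM('a)) at_top sequentially"
        by (simp add: tendsto_PInfty filterlim_at_top_dense)
    qed (use that inf_case PInf in \<open>auto simp: adm_def\<close>)
    then show ?thesis using that by blast
  qed (use lam in auto)
  show ?thesis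
  \<comment> \<open>The strict inequality is proved inside the locale and so uses one admissible
    sequence; in the other case the convergence claim is vacuous and any two ordered numbers
    do.\<close>
  proof (cases "\<exists>r. adm r")
    case True
    then obtain r0 s0 where "crit_scaling f s0 r0 \<beta> W" using cs by blast
    then have "scaling.sig2 f \<beta> W (k + 1) < scaling.sig2_hat f \<beta> W (k + 1)" using k by (rule crit_scaling.sig2_less)
    moreover have "((\<lambda>n. binom_var f n (crit_num k (r n)) / real n) \<longlonglongrightarrow> scaling.sig2 f \<beta> W (k + 1)) \<and>
        ((\<lambda>n. pois_var f n (crit_num k (r n)) / real n) \<longlonglongrightarrow> scaling.sig2_hat f \<beta> W (k + 1))" if "adm r" for r
      using cs[OF that] crit_scaling.binom_limit[OF _ refl] crit_scaling.pois_limit[OF _ refl] by blast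
    ultimately show ?thesis unfolding adm_def by blast
  next
    case False
    then show ?thesis unfolding adm_def by (intro exI[of _ "0 :: real"] exI[of _ "1 :: real"]) auto
  qed
qed

end
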